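(* Let $s>1$ and assume that $s\mapsto h_s$ (defined for $s>1$) is non-decreasing and satisfies $\log(s)^{1/d}\lesssim h_s\ll s$, meaning that $\delta_s\le h_s$ for all $s>1$ (where $\delta_s\sim\log(s)^{1/d}$ is specified in the context) and $\lim_{s\to\infty} h_s/s=0$. There exist dimensional constants $C_1,C_2>0$ (depending only on $d$), not depending on $s$, such that: 1. (Convergence) There exists a dimensional constant $\sigma\in[1,C_d]$ (depending on the choice of $s\mapsto h_s$) such that $$\lim_{s\to\infty}\frac{\mathbb{E}\left[d_{h_s,\mathcal{X}_s}(0,se_1)\right]}{s}=\sigma\qquad\text{and}\qquad \lim_{s\to\infty}\frac{d_{h_s}(0,se_1)}{s}=\sigma\quad\text{almost surely}.$$ 2. (Concentration) For all $t\ge h_s$ it holds $$\mathbb{P}\left(\left|d_{h_s,\mathcal{X}_s}(0,te_1)-\mathbb{E}\left[d_{h_s,\mathcal{X}_s}(0,te_1)\right]\right|>\lambda\sqrt{\frac{\log(s)^{2/d}}{h_s}\,t}\right)\le C_1\exp(-C_2\lambda)\qquad\text{for all }\lambda\ge 0.$$ 3. (Ratio convergence) For $s>1$ sufficiently large it holds $$\left|\frac{\mathbb{E}\left[d_{h_s,\mathcal{X}_s}(0,se_1)\right]}{\mathbb{E}\left[d_{h_s,\mathcal{X}_s}(0,2se_1)\right]}-\frac12\right|\le C_1\frac{h_s}{s}+C_2\sqrt{\frac{\log(s)^{2/d}}{h_s}}\,\frac{\log(s)}{\sqrt{s}}.$$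
   Context: Let $d\in\mathbb{N}$, let $|\cdot|$ be the Euclidean norm and $e_1=(1,0,\dots,0)\in\mathbb{R}^d$. Let $X$ be a Poisson point process on $\mathbb{R}^d$ with unit intensity. Distances: for a set $P\subset\mathbb{R}^d$ and $x\in\mathbb{R}^d$ let $\pi_P(x)=\{\hat x\in P: |x-\hat x|=\min_{y\in P}|x-y|\}$ be the set of closest points in $P$. For $h>0$ and $x,y\in\mathbb{R}^d$ let $\Pi_{h,P}(x,y)$ be the set of all finite tuples $p=(p_1,\dots,p_m)\in P^m$, $m\in\mathbb{N}$, with $p_1\in\pi_P(x)$, $p_m\in\pi_P(y)$, $|x-p_1|\le h/2$, $|y-p_m|\le h/2$ and $|p_i-p_{i+1}|\le h$ for $1\le i\le m-1$. The length is $L(p)=\sum_{i=1}^{m-1}|p_{i+1}-p_i|$ and $d_{h,P}(x,y)=\inf\{L(p):p\in\Pi_{h,P}(x,y)\}$ (with $\inf\emptyset=+\infty$). Write $d_h:=d_{h,X}$. Constants: $C_d:=2\sqrt d$; $C_d'\ge1$ is a fixed sufficiently large constant depending only on $d$ (at least $C_d+3/2$); $C_d'':=\max\{2C_dC_d',\,4C_d+2\}$; $k>d+1$ is a fixed constant depending only on $d$. Set $\delta_s:=C_d\,(k\log(C_d''s))^{1/d}$ (so $\delta_s\sim\log(s)^{1/d}$). Enriched process: for given $s$, cover $\mathbb{R}^d$ by the closed cubes $\{B_k\}_{k\in\mathbb{N}}$ of a fixed (deterministic) grid with side length $\delta_s/C_d$. For every cube $B_i$ with $B_i\cap X=\emptyset$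 add one point $x_i\in B_i$ (for instance its center) to $X$; the resulting set of points is denoted $\mathcal{X}_s$.
   Formalization: Item 2 is proved for all s ≥ s_0, with s_0 > 1 arbitrary and C_1, C_2 allowed to depend on s_0 as well as d; uniformly over all s > 1 it fails, since log(s) → 0 as s → 1 while δ_s, h_s and the fluctuations of the distance do not vanish. *)

theory Defs
  imports "HOL-Probability.Probability"
begin

(* A Poisson point process of unit intensity: a random locally finite set whose counts on bounded
   Borel sets are Poisson distributed with the volume as parameter, and independent for disjoint sets.
   The Poisson weights are written out because a set of volume 0 (parameter 0, weight 0 ^ 0 = 1
   at n = 0) has to be allowed. *)
definition poisson_point_process ::
    "'a measure \<Rightarrow> ('a \<Rightarrow> (real ^ 'n::finite) set) \<Rightarrow> bool" where
  "poisson_point_process M X \<longleftrightarrow>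
     prob_space M \<and>
     (\<forall>\<omega>\<in>space M. \<forall>B. bounded B \<longrightarrow> finite (X \<omega> \<inter> B)) \<and>
     (\<forall>B. B \<in> sets borel \<and> bounded B \<longrightarrow>
        (\<lambda>\<omega>. card (X \<omega> \<inter> B)) \<in> measurable M (count_space UNIV) \<and>
        (\<forall>n. measure M {\<omega> \<in> space M. card (X \<omega> \<inter> B) = n} =
              measure lborel B ^ n / fact n * exp (- measure lborel B))) \<and>
     (\<forall>(I :: nat set) B. finite I \<and> (\<forall>i\<in>I. B i \<in> sets borel \<and> bounded (B i)) \<and>
        disjoint_family_on B I \<longrightarrow>
        prob_space.indep_vars M (\<lambda>_. count_space UNIV) (\<lambda>i \<omega>. card (X \<omega> \<inter> B i)) I)"

definition closest_points :: "'b::euclidean_space set \<Rightarrow> 'b \<Rightarrow> 'b set" where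
  "closest_points P x = {p \<in> P. \<forall>y\<in>P. norm (x - p) \<le> norm (x - y)}"

definition h_paths :: "real \<Rightarrow> 'b::euclidean_space set \<Rightarrow> 'b \<Rightarrow> 'b \<Rightarrow> 'b list set" where
  "h_paths h P x y =
     {p. p \<noteq> [] \<and> set p \<subseteq> P \<and>
         hd p \<in> closest_points P x \<and> last p \<in> closest_points P y \<and>
         norm (x - hd p) \<le> h / 2 \<and> norm (y - last p) \<le> h / 2 \<and>
         (\<forall>i. Suc i < length p \<longrightarrow> norm (p ! i - p ! Suc i) \<le> h)}"

definition path_length :: "'b::euclidean_space list \<Rightarrow> real" where
  "path_length p = (\<Sum>i<length p - 1. norm (p ! Suc i - p ! i))"

(* Values in ennreal, where the infimum of the empty set is infinity. *)
definition h_dist :: "real \<Rightarrow> 'b::euclidean_space set \<Rightarrow> 'b \<Rightarrow> 'b \<Rightarrow> ennreal" where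
  "h_dist h P x y = (INF p\<in>h_paths h P x y. ennreal (path_length p))"

definition dim_const :: "nat \<Rightarrow> real" where
  "dim_const d = 2 * sqrt (real d)"

(* The constant C_d'' as a function of d and of the constant C' = C_d'. *)
definition dim_const2 :: "nat \<Rightarrow> real \<Rightarrow> real" where
  "dim_const2 d C' = max (2 * dim_const d * C') (4 * dim_const d + 2)"

definition delta_scale :: "nat \<Rightarrow> real \<Rightarrow> real \<Rightarrow> real \<Rightarrow> real" where
  "delta_scale d C' k s = dim_const d * (k * ln (dim_const2 d C' * s)) powr (1 / real d)"

(* The closed cube with index v of the grid with side length a and offset z. *)
definition grid_cube :: "real \<Rightarrow> real ^ 'n \<Rightarrow> int ^ 'n \<Rightarrow> (real ^ 'n::finite) set" where
  "grid_cube a z v = cbox (z + a *\<^sub>R (\<chi> i. real_of_int (v $ i)))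
                          (z + a *\<^sub>R (\<chi> i. real_of_int (v $ i) + 1))"

(* c v is the point that is added in the cube with index v if this cube contains no point of P. *)
definition enrich ::
    "real \<Rightarrow> real ^ 'n \<Rightarrow> (int ^ 'n \<Rightarrow> real ^ 'n) \<Rightarrow> (real ^ 'n::finite) set \<Rightarrow> (real ^ 'n) set" where
  "enrich a z c P = P \<union> {c v |v. grid_cube a z v \<inter> P = {}}"

end

theory Submission
  imports Defs "HOL-Real_Asymp.Real_Asymp"
begin

text \<open>In the enriched process every cube contains a point, so that all distances are finite, and
  resampling the points of one cube increases the distance by at most a multiple of the side
  \<open>\<delta>\<close>. An almost optimal path can be shortened until it has at most of the order of \<open>t / h\<close>
  vertices, hence only that many cubes can increase the distance. Tensorization of the entropy and
  Herbst's argument turn this into exponential concentration at the scale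
  \<open>\<delta> * sqrt (t / h)\<close>.

  Up to an additive constant the expectation depends only on the distance of the end points: with
  probability close to one the process itself meets all relevant cubes, and its law is invariant
  under isometries. By the triangle inequality and the monotonicity of the distance in \<open>h\<close> the
  expectation is therefore subadditive up to an error of order \<open>sqrt s\<close>, which yields the limit
  \<open>\<sigma>\<close>, and concentration with the Borel-Cantelli lemma gives almost sure convergence along the
  integers. In between, monotonicity in \<open>h\<close> sandwiches the distance between the values at the two
  neighbouring integers.

  For the ratio, a path from \<open>0\<close> to a point \<open>w\<close> of norm \<open>2 * s\<close> crosses the spheres of radius
  \<open>s\<close> around both end points, and its two disjoint pieces are paths to those spheres. Concentration
  on a net of polynomial size bounds both pieces from below by the expectation at distance
  \<open>s\<close>, up to a logarithmic factor times the fluctuation scale.\<close>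

subsection \<open>Chains\<close>

text \<open>A given path meets few of the cubes around it, but changing any other cube may lower the
  distance. Only increases are therefore counted, and the entropy inequality has to be one-sided.
  The two tails it yields differ: the upper one is exponential because resampling may raise the
  distance by \<open>jump\<close>, the lower one is Gaussian. The ratio relies on the Gaussian tail:
  a net of polynomial size costs only \<open>sqrt (ln s)\<close>, which \<open>ln s\<close>
  eventually beats. So the constant \<open>C2\<close> of the theorem can be small in the exponent of
  the concentration bound and still serve as a factor in the ratio bound.

  Added points depend on the grid and break the invariance under isometries. The mean of the
  distance in the process itself, truncated at a deterministic level, is free of both defects and
  determined by the law. Hence \<sigma> can be fixed before the probability space, the process and
  the grids. The truncation also reduces the distance to finitely many cubes.

  The scale makes a cube empty with probability at most \<open>s powr (- k)\<close>. As
  \<open>k > d + 1\<close>, the chance of an empty cube in a ball of radius of order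
  \<open>s\<close> is summable over the integers and stays bounded after multiplication by
  \<open>s\<close>.\<close>

lemma norm_diff_via: "norm (a - c) \<le> norm (a - b) + norm (b - c :: 'b::real_normed_vector)"
  using norm_triangle_ineq[of "a - b" "b - c"] by simp

lemma path_length_Nil [simp]: "path_length [] = 0"
  and path_length_single [simp]: "path_length [x] = 0"
  by (simp_all add: path_length_def)

lemma path_length_Cons_Cons [simp]:
  "path_length (x # y # p) = norm (y - x) + path_length (y # p)"
proof -
  have "path_length (x # y # p) = (\<Sum>i<Suc (length p). norm ((x # y # p) ! Suc i - (x # y # p) ! i))"
    by (simp add: path_length_def)
  also have "\<dots> = norm (y - x) + (\<Sum>i<length p. norm ((y # p) ! Suc i - (y # p) ! i))"
    by (subst sum.lessThan_Suc_shift) simp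
  finally show ?thesis by (simp add: path_length_def)
qed

lemma path_length_nonneg [simp]: "0 \<le> path_length p"
  by (simp add: path_length_def sum_nonneg)

lemma path_length_Cons:
  "q \<noteq> [] \<Longrightarrow> path_length (x # q) = norm (hd q - x) + path_length q"
  by (cases q) auto

lemma path_length_append:
  "p \<noteq> [] \<Longrightarrow> q \<noteq> [] \<Longrightarrow>
    path_length (p @ q) = path_length p + norm (hd q - last p) + path_length q"
  by (induction p rule: induct_list012) (auto simp: path_length_Cons)

lemma path_length_map_isometry:
  assumes "\<And>u v. norm (A u - A v) = norm (u - v)"
  shows "path_length (map A p) = path_length p"
  using assms by (induction p rule: induct_list012) auto

lemma norm_le_path_length: "p \<noteq> [] \<Longrightarrow> v \<in> set p \<Longrightarrow> norm (v - hd p) \<le> path_length p"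
proof (induction p rule: induct_list012)
  case (3 x y p)
  show ?case
  proof (cases "v = x")
    case False
    then have "norm (v - y) \<le> path_length (y # p)"
      using 3 by auto
    moreover have "norm (v - x) \<le> norm (v - y) + norm (y - x)"
      by (rule norm_diff_via)
    ultimately show ?thesis by simp
  qed simp
qed auto

abbreviation short_steps :: "real \<Rightarrow> 'b::euclidean_space list \<Rightarrow> bool" where
  "short_steps h \<equiv> successively (\<lambda>u v. norm (u - v) \<le> h)"

lemma short_steps_mono: "short_steps h p \<Longrightarrow> h \<le> h' \<Longrightarrow> short_steps h' p"
  by (induction p rule: induct_list012) auto

lemma short_steps_conv_nth:
  "(\<forall>i. Suc i < length p \<longrightarrow> norm (p ! i - p ! Suc i) \<le> h) \<longleftrightarrow> short_steps h p"
proof (induction p rule: induct_list012)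
  case (3 x y p)
  have "(\<forall>i. Suc i < length (x # y # p) \<longrightarrow> norm ((x # y # p) ! i - (x # y # p) ! Suc i) \<le> h)
    \<longleftrightarrow> norm (x - y) \<le> h \<and> (\<forall>i. Suc i < length (y # p) \<longrightarrow> norm ((y # p) ! i - (y # p) ! Suc i) \<le> h)"
    (is "(\<forall>i. ?Q i) \<longleftrightarrow> ?R")
  proof -
    have "(\<forall>i. ?Q i) \<longleftrightarrow> ?Q 0 \<and> (\<forall>i. ?Q (Suc i))" by (metis not0_implies_Suc)
    then show ?thesis by simp
  qed
  then show ?case using 3 by simp
qed auto

lemma h_paths_iff:
  "p \<in> h_paths h P x y \<longleftrightarrow> p \<noteq> [] \<and> set p \<subseteq> P \<and> hd p \<in> closest_points P x \<and>
     last p \<in> closest_points P y \<and> norm (x - hd p) \<le> h / 2 \<and> norm (y - last p) \<le> h / 2 \<and>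
     short_steps h p"
  unfolding h_paths_def by (simp add: short_steps_conv_nth)

text \<open>Only the end points and a length bound of a chain are kept, so that detours can be
  composed by \<open>conn_trans\<close> without handling lists. Unlike in \<open>h_paths\<close>,
  the ends are arbitrary points of \<open>P\<close>, not closest points of given locations.\<close>

definition conn :: "real \<Rightarrow> 'b::euclidean_space set \<Rightarrow> 'b \<Rightarrow> 'b \<Rightarrow> real \<Rightarrow> bool" where
  "conn h P u v l \<longleftrightarrow> (\<exists>p. p \<noteq> [] \<and> set p \<subseteq> P \<and> hd p = u \<and> last p = v \<and> short_steps h p \<and>
     path_length p \<le> l)"

lemma connI:
  "p \<noteq> [] \<Longrightarrow> set p \<subseteq> P \<Longrightarrow> short_steps h p \<Longrightarrow> path_length p \<le> l \<Longrightarrow> conn h P (hd p) (last p) l"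
  unfolding conn_def by blast

lemma conn_edge: "u \<in> P \<Longrightarrow> v \<in> P \<Longrightarrow> norm (u - v) \<le> h \<Longrightarrow> norm (u - v) \<le> l \<Longrightarrow> conn h P u v l"
  using connI[of "[u, v]" P h l] by (auto simp: norm_minus_commute)

lemma conn_refl: "u \<in> P \<Longrightarrow> 0 \<le> l \<Longrightarrow> conn h P u u l"
  using connI[of "[u]" P h l] by auto

lemma conn_trans:
  assumes "conn h P u v l" "conn h P v w l'" "0 \<le> h"
  shows "conn h P u w (l + l')"
proof -
  obtain p q where p: "p \<noteq> []" "set p \<subseteq> P" "hd p = u" "last p = v" "short_steps h p" "path_length p \<le> l"
    and q: "q \<noteq> []" "set q \<subseteq> P" "hd q = v" "last q = w" "short_steps h q" "path_length q \<le> l'"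
    using assms unfolding conn_def by blast
  have "conn h P (hd (p @ q)) (last (p @ q)) (l + l')"
    using p q assms(3) by (intro connI) (auto simp: successively_append_iff path_length_append)
  then show ?thesis using p q by simp
qed

lemma conn_mono:
  assumes "conn h P u v l" "h \<le> h'" "P \<subseteq> P'" "l \<le> l'"
  shows "conn h' P' u v l'"
proof -
  obtain p where p: "p \<noteq> []" "set p \<subseteq> P" "hd p = u" "last p = v" "short_steps h p" "path_length p \<le> l"
    using assms unfolding conn_def by blast
  have "short_steps h' p"
    using p(5) assms(2) by (rule short_steps_mono)
  then show ?thesis using p assms unfolding conn_def
    by (intro exI[of _ p]) auto
qed

lemma h_dist_leI:
  assumes "u \<in> closest_points P x" "v \<in> closest_points P y" "norm (x - u) \<le> h / 2" "norm (y - v) \<le> h / 2"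
    "conn h P u v l"
  shows "h_dist h P x y \<le> ennreal l"
proof -
  obtain p where "p \<in> h_paths h P x y" "path_length p \<le> l"
    using assms unfolding conn_def h_paths_iff by auto
  then show ?thesis unfolding h_dist_def
    by (metis INF_lower ennreal_leI order_trans)
qed

lemma h_dist_le_path: "p \<in> h_paths h P x y \<Longrightarrow> h_dist h P x y \<le> ennreal (path_length p)"
  unfolding h_dist_def by (rule INF_lower)

lemma h_dist_lessE:
  assumes "h_dist h P x y < ennreal l"
  obtains p where "p \<in> h_paths h P x y" "path_length p < l"
proof -
  obtain p where "p \<in> h_paths h P x y" "ennreal (path_length p) < ennreal l"
    using assms unfolding h_dist_def INF_less_iff by auto
  then show ?thesis using that by (metis ennreal_less_iff path_length_nonneg)
qed

lemma conn_path:
  "p \<in> h_paths h P x y \<Longrightarrow> conn h P (hd p) (last p) (path_length p)"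
  unfolding h_paths_iff by (intro connI) auto

section \<open>Local finiteness, locality and invariance under isometries\<close>

definition lfin :: "'b::euclidean_space set \<Rightarrow> bool" where
  "lfin P \<longleftrightarrow> (\<forall>B. bounded B \<longrightarrow> finite (P \<inter> B))"

lemma closest_points_nonempty:
  fixes x :: "'b::euclidean_space"
  assumes "lfin P" "P \<noteq> {}"
  shows "closest_points P x \<noteq> {}"
proof -
  obtain q where q: "q \<in> P" using assms by blast
  let ?F = "P \<inter> cball x (norm (x - q))"
  have fin: "finite ?F" and ne: "?F \<noteq> {}"
    using assms q by (auto simp: lfin_def dist_norm)
  obtain p where p: "p \<in> ?F" and min: "\<And>y. y \<in> ?F \<Longrightarrow> norm (x - p) \<le> norm (x - y)"
    using arg_min_if_finite(1)[OF fin ne, of "\<lambda>y. norm (x - y)"]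
      arg_min_if_finite(2)[OF fin ne, of "\<lambda>y. norm (x - y)"] by (meson not_le)
  have "norm (x - p) \<le> norm (x - y)" if "y \<in> P" for y
    using min[of y] p that by (force simp: dist_norm)
  then show ?thesis using p by (auto simp: closest_points_def)
qed

text \<open>A path shorter than \<open>l\<close> starts within \<open>h / 2\<close> of
  \<open>x\<close>, hence stays in the ball of radius \<open>R\<close>, and so does every point that
  could compete with its ends as a closest point. The truncation discards the long paths, which may
  leave the ball.\<close>

lemma h_dist_truncated_local_le:
  assumes PP': "P \<inter> cball x R = P' \<inter> cball x R" and R: "l + h + norm (x - y) \<le> R" and "0 \<le> l" "0 \<le> h"
  shows "min (h_dist h P' x y) (ennreal l) \<le> min (h_dist h P x y) (ennreal l)"
proof (cases "h_dist h P x y < ennreal l")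
  case True
  have "h_dist h P' x y \<le> h_dist h P x y"
  proof (rule ccontr)
    assume "\<not> ?thesis"
    then have "h_dist h P x y < min (h_dist h P' x y) (ennreal l)" using True by auto
    then obtain p where p: "p \<in> h_paths h P x y" "ennreal (path_length p) < min (h_dist h P' x y) (ennreal l)"
      unfolding h_dist_def[of h P] INF_less_iff by auto
    then have len: "path_length p < l" by (auto simp: ennreal_less_iff)
    have ball: "v \<in> P \<longleftrightarrow> v \<in> P'" if "norm (x - v) \<le> R" for v
      using PP' that by (auto simp: set_eq_iff dist_norm)
    have sub: "set p \<subseteq> P'"
    proof
      fix v assume v: "v \<in> set p"
      then have "norm (v - hd p) \<le> path_length p"
        using p by (intro norm_le_path_length) (auto simp: h_paths_iff)
      moreover have "norm (x - hd p) \<le> h / 2" using p by (auto simp: h_paths_iff)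
      moreover have "norm (x - v) \<le> norm (x - hd p) + norm (v - hd p)"
        using norm_diff_via[of x v "hd p"] by (simp add: norm_minus_commute)
      ultimately have "norm (x - v) \<le> R" using len R assms by (smt (verit) field_sum_of_halves norm_ge_zero)
      then show "v \<in> P'" using p v ball by (auto simp: h_paths_iff)
    qed
    \<comment> \<open>A competitor \<open>v\<close> further than \<open>h / 2\<close> from
      \<open>w\<close> loses against \<open>q\<close>; a nearer one lies in the ball, where both
      sets agree.\<close>
    have cl: "q \<in> closest_points P' w" if "q \<in> closest_points P w" "norm (w - q) \<le> h / 2"
      "norm (x - w) \<le> norm (x - y)" "q \<in> P'" for q w
    proof -
      have "norm (w - q) \<le> norm (w - v)" if v: "v \<in> P'" for v
      proof (cases "norm (w - v) \<le> h / 2")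
        case True
        have "norm (x - v) \<le> norm (x - w) + norm (w - v)"
          by (rule norm_diff_via)
        then have "norm (x - v) \<le> R"
          using True that R assms \<open>norm (x - w) \<le> _\<close> by (smt (verit) field_sum_of_halves)
        then show ?thesis using v ball \<open>q \<in> closest_points P w\<close> by (auto simp: closest_points_def)
      qed (use \<open>norm (w - q) \<le> h / 2\<close> in auto)
      then show ?thesis using that by (auto simp: closest_points_def)
    qed
    have "hd p \<in> P'" "last p \<in> P'" using p sub by (auto simp: h_paths_iff)
    then have "p \<in> h_paths h P' x y"
      using p sub cl[of "hd p" x] cl[of "last p" y] by (auto simp: h_paths_iff)
    then show False using p(2) h_dist_le_path by (metis min_less_iff_conj not_le)
  qed
  then show ?thesis by (auto simp: min_def)
next
  case False
  then show ?thesis by (simp add: min_def)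
qed

lemma h_dist_truncated_local:
  assumes "P \<inter> cball x R = P' \<inter> cball x R" "l + h + norm (x - y) \<le> R" "0 \<le> l" "0 \<le> h"
  shows "min (h_dist h P x y) (ennreal l) = min (h_dist h P' x y) (ennreal l)"
  using h_dist_truncated_local_le[OF assms] h_dist_truncated_local_le[OF assms(1)[symmetric] assms(2-)]
  by (rule antisym[rotated])

lemma closest_points_isometry:
  assumes A: "\<And>u v. norm (A u - A v) = norm (u - v)"
  shows "closest_points (A ` P) (A x) = A ` closest_points P x"
  by (auto simp: closest_points_def A)

lemma h_dist_isometry:
  assumes A: "\<And>u v. norm (A u - A v) = norm (u - v)"
  shows "h_dist h (A ` P) (A x) (A y) = h_dist h P x y"
proof -
  have inj: "inj A" using A by (metis injI norm_eq_zero right_minus_eq)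
  have "h_paths h (A ` P) (A x) (A y) = map A ` h_paths h P x y"
  proof (intro set_eqI iffI)
    fix q assume q: "q \<in> h_paths h (A ` P) (A x) (A y)"
    then have "set q \<subseteq> range A" by (auto simp: h_paths_iff)
    then obtain p where p: "q = map A p" by (metis ex_map_conv subset_eq image_iff)
    have "p \<in> h_paths h P x y" using q unfolding p h_paths_iff closest_points_isometry[OF A]
      by (auto simp: hd_map last_map A successively_map inj_eq[OF inj] inj_image_subset_iff[OF inj])
    then show "q \<in> map A ` h_paths h P x y" using p by blast
  next
    fix q assume "q \<in> map A ` h_paths h P x y"
    then show "q \<in> h_paths h (A ` P) (A x) (A y)"
      unfolding h_paths_iff closest_points_isometry[OF A]
      by (auto simp: h_paths_iff hd_map last_map A successively_map subset_iff)
  qed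
  then show ?thesis unfolding h_dist_def
    by (simp add: image_image path_length_map_isometry[OF A])
qed

lemma h_dist_mono_h: "h \<le> h' \<Longrightarrow> h_dist h' P x y \<le> h_dist h P x y"
  unfolding h_dist_def
  by (rule INF_superset_mono) (auto simp: h_paths_iff elim: short_steps_mono)

lemma le_h_dist_add:
  assumes "\<And>p. p \<in> h_paths h P x y \<Longrightarrow> b \<le> ennreal (path_length p) + c"
  shows "b \<le> h_dist h P x y + c"
proof (cases "c = top")
  case False
  have "b - c \<le> h_dist h P x y"
    unfolding h_dist_def using assms False by (intro INF_greatest) (simp add: ennreal_minus_le_iff add.commute)
  then show ?thesis using False by (simp add: ennreal_minus_le_iff add.commute)
qed simp

lemma path_length_rev: "path_length (rev p) = path_length p"
proof (induction p)
  case (Cons x p)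
  then show ?case by (cases "p = []")
    (auto simp: path_length_append path_length_Cons last_rev norm_minus_commute)
qed simp

lemma short_steps_rev [simp]: "short_steps h (rev p) = short_steps h p"
  by (simp add: norm_minus_commute)

lemma conn_sym: "conn h P u v l \<Longrightarrow> conn h P v u l"
  unfolding conn_def by (metis hd_rev last_rev path_length_rev rev_is_Nil_conv set_rev short_steps_rev)

subsection \<open>Shortcuts\<close>

text \<open>Peeling off two vertices at a time removes more than \<open>h\<close> of length, so the
  number of vertices beyond two is at most twice the length divided by \<open>h\<close>.\<close>

lemma num_vertices_le:
  fixes p :: "'b::euclidean_space list"
  assumes "\<And>pre a b c post. p = pre @ [a, b, c] @ post \<Longrightarrow> h < norm (b - a) + norm (c - b)" "0 \<le> h"
  shows "h * (real (length p) - 2) \<le> 2 * path_length p"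
  using assms(1)
proof (induction "length p" arbitrary: p rule: less_induct)
  case less
  consider "p = []" | a where "p = [a]" | a b where "p = [a, b]" | a b c q where "p = a # b # c # q"
    by (metis neq_Nil_conv)
  then show ?case
  proof cases
    case (4 a b c q)
    have "h * (real (length (c # q)) - 2) \<le> 2 * path_length (c # q)"
    proof (rule less.hyps)
      fix pre a' b' c' post assume "c # q = pre @ [a', b', c'] @ post"
      then have "p = (a # b # pre) @ [a', b', c'] @ post" using 4 by simp
      then show "h < norm (b' - a') + norm (c' - b')" using less.prems by blast
    qed (use 4 in auto)
    moreover have "h < norm (b - a) + norm (c - b)"
      using less.prems[of "[]" a b c q] 4 by simp
    ultimately show ?thesis using 4 by (simp add: algebra_simps)
  qed (use assms(2) in \<open>auto intro: order_trans[of _ 0]\<close>)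
qed

text \<open>Among the paths no longer than \<open>p\<close> one with the fewest vertices is taken.
  If two consecutive edges had total length at most \<open>h\<close>, the middle vertex could be
  skipped, and the ends of the path would stay the same.\<close>

lemma shortcut:
  fixes P :: "'b::euclidean_space set"
  assumes "p \<in> h_paths h P x y" "0 \<le> h"
  obtains p' where "p' \<in> h_paths h P x y" "path_length p' \<le> path_length p"
    "h * (real (length p') - 2) \<le> 2 * path_length p'"
proof -
  define Q where "Q q \<longleftrightarrow> q \<in> h_paths h P x y \<and> path_length q \<le> path_length p" for q
  define p' where "p' = arg_min length Q"
  have p': "Q p'" and min: "\<And>q. Q q \<Longrightarrow> length p' \<le> length q"
    using arg_min_nat_lemma[of Q p length] assms(1) by (auto simp: Q_def p'_def)
  have "h < norm (b - a) + norm (c - b)" if eq: "p' = pre @ [a, b, c] @ post" for pre a b c post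
  proof (rule ccontr)
    assume le: "\<not> ?thesis"
    let ?q = "pre @ [a, c] @ post"
    have tri: "norm (c - a) \<le> norm (b - a) + norm (c - b)"
      using norm_diff_via[of c a b] by simp
    have "norm (a - c) \<le> h" using tri le by (simp add: norm_minus_commute)
    then have "?q \<in> h_paths h P x y" using p' unfolding Q_def h_paths_iff eq
      by (auto simp: successively_append_iff hd_append split: if_splits)
    moreover have "path_length ?q \<le> path_length p'"
      unfolding eq using tri by (cases "pre = []"; cases post) (auto simp: path_length_append)
    ultimately have "Q ?q" using p' by (auto simp: Q_def)
    from min[OF this] show False by (simp add: eq)
  qed
  then have "h * (real (length p') - 2) \<le> 2 * path_length p'"
    by (rule num_vertices_le[OF _ assms(2)])
  then show ?thesis using that p' unfolding Q_def by blast
qed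

subsection \<open>Cubes\<close>

lemma norm_le_sqrt_card:
  fixes x :: "real ^ 'n::finite"
  assumes "\<And>i. \<bar>x $ i\<bar> \<le> B"
  shows "norm x \<le> sqrt (real CARD('n)) * B"
proof -
  have B: "0 \<le> B" using assms[of undefined] by linarith
  have "(\<Sum>i\<in>UNIV. (x $ i)\<^sup>2) \<le> (\<Sum>i\<in>(UNIV :: 'n set). B\<^sup>2)"
    using assms by (intro sum_mono) (metis abs_le_square_iff abs_of_nonneg B)
  then have "norm x \<le> sqrt (real CARD('n) * B\<^sup>2)"
    unfolding norm_vec_def L2_set_def by simp
  then show ?thesis using B by (simp add: real_sqrt_mult)
qed

lemma finite_vec_box:
  fixes S :: "'n::finite \<Rightarrow> 'b set"
  assumes "\<And>i. finite (S i)" "\<And>i. card (S i) \<le> N"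
  shows "finite {k :: 'b ^ 'n. \<forall>i. k $ i \<in> S i}" "card {k :: 'b ^ 'n. \<forall>i. k $ i \<in> S i} \<le> N ^ CARD('n)"
proof -
  have eq: "{k :: 'b ^ 'n. \<forall>i. k $ i \<in> S i} \<subseteq> vec_lambda ` PiE UNIV S"
  proof
    fix k :: "'b ^ 'n" assume "k \<in> {k. \<forall>i. k $ i \<in> S i}"
    then have "vec_nth k \<in> PiE UNIV S" by auto
    then show "k \<in> vec_lambda ` PiE UNIV S" by (intro image_eqI[of _ _ "vec_nth k"]) auto
  qed
  have fin: "finite (PiE UNIV S)" using assms by (intro finite_PiE) auto
  show "finite {k :: 'b ^ 'n. \<forall>i. k $ i \<in> S i}"
    using eq fin by (meson finite_imageI finite_subset)
  have "card {k :: 'b ^ 'n. \<forall>i. k $ i \<in> S i} \<le> card (PiE UNIV S)"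
    using eq fin by (meson card_image_le card_mono finite_imageI order_trans)
  also have "\<dots> = (\<Prod>i\<in>UNIV. card (S i))" by (simp add: card_PiE)
  also have "\<dots> \<le> (\<Prod>i\<in>(UNIV :: 'n set). N)" using assms by (intro prod_mono) auto
  finally show "card {k :: 'b ^ 'n. \<forall>i. k $ i \<in> S i} \<le> N ^ CARD('n)" by simp
qed

locale cube_grid =
  fixes a :: real and z :: "real ^ 'n::finite"
  assumes a_pos: "0 < a"
begin

abbreviation cube :: "int ^ 'n \<Rightarrow> (real ^ 'n) set" where "cube \<equiv> grid_cube a z"

definition idx :: "real ^ 'n \<Rightarrow> int ^ 'n" where "idx y = (\<chi> i. \<lfloor>(y $ i - z $ i) / a\<rfloor>)"

definition C :: real where "C = 2 * sqrt (real CARD('n))"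

text \<open>Half of \<open>\<delta>\<close> is the diameter of a cube, and \<open>\<delta>\<close>
  bounds the diameter of the union of two touching cubes.\<close>

definition \<delta> :: real where "\<delta> = C * a"

text \<open>The region \<open>U\<close> is the whole space for the enriched process, and a large
  ball for the process itself on the event that no cube there is empty.\<close>

definition hits :: "(real ^ 'n) set \<Rightarrow> (real ^ 'n) set \<Rightarrow> bool" where
  "hits U P \<longleftrightarrow> (\<forall>v. cube v \<inter> U \<noteq> {} \<longrightarrow> cube v \<inter> P \<noteq> {})"

lemma C_ge: "2 \<le> C"
proof -
  have "1 \<le> real CARD('n)" by (simp add: Suc_leI)
  then have "1 \<le> sqrt (real CARD('n))" by simp
  then show ?thesis by (simp add: C_def)
qed

lemma \<delta>_pos: "0 < \<delta>" using C_ge a_pos by (simp add: \<delta>_def)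

lemma cube_iff:
  "y \<in> cube v \<longleftrightarrow> (\<forall>i. z $ i + a * real_of_int (v $ i) \<le> y $ i \<and> y $ i \<le> z $ i + a * (real_of_int (v $ i) + 1))"
  by (auto simp: grid_cube_def mem_box_cart)

lemma mem_cube_idx: "y \<in> cube (idx y)"
  unfolding cube_iff idx_def vec_lambda_beta
proof
  fix i
  define r where "r = (y $ i - z $ i) / a"
  have y: "y $ i = z $ i + a * r" using a_pos by (simp add: r_def)
  have "a * real_of_int \<lfloor>r\<rfloor> \<le> a * r" "a * r \<le> a * (real_of_int \<lfloor>r\<rfloor> + 1)"
    using a_pos by (intro mult_left_mono; linarith)+
  then show "z $ i + a * real_of_int \<lfloor>(y $ i - z $ i) / a\<rfloor> \<le> y $ i \<and>
    y $ i \<le> z $ i + a * (real_of_int \<lfloor>(y $ i - z $ i) / a\<rfloor> + 1)"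
    unfolding r_def[symmetric] y by simp
qed

lemma cube_diam: "u \<in> cube v \<Longrightarrow> w \<in> cube v \<Longrightarrow> norm (u - w) \<le> \<delta> / 2"
proof -
  assume uw: "u \<in> cube v" "w \<in> cube v"
  have "\<bar>(u - w) $ i\<bar> \<le> a" for i
    using uw[unfolded cube_iff] by (simp add: algebra_simps) (smt (verit, best))
  from norm_le_sqrt_card[OF this] show ?thesis by (simp add: \<delta>_def C_def mult.commute)
qed

text \<open>Two closed cubes that contain points at distance at most the side length share a corner.\<close>
lemma adjacent_cubes:
  assumes "norm (y - y') \<le> a" "u \<in> cube (idx y)" "w \<in> cube (idx y')"
  shows "norm (u - w) \<le> \<delta>"
proof -
  have "\<bar>(u - w) $ i\<bar> \<le> 2 * a" for i
  proof -
    have le: "\<bar>(y - y') $ i\<bar> \<le> a" using assms(1) component_le_norm_cart order_trans by blast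
    define r s where "r = (y $ i - z $ i) / a" and "s = (y' $ i - z $ i) / a"
    have "r - s = (y $ i - y' $ i) / a" using a_pos by (simp add: r_def s_def field_simps)
    then have "\<bar>r - s\<bar> \<le> 1" using le a_pos by simp
    then have "\<bar>\<lfloor>r\<rfloor> - \<lfloor>s\<rfloor>\<bar> \<le> 1" by linarith
    then have f: "\<bar>real_of_int \<lfloor>r\<rfloor> - real_of_int \<lfloor>s\<rfloor>\<bar> \<le> 1"
      by (metis of_int_abs of_int_diff of_int_le_1_iff)
    have u: "a * \<lfloor>r\<rfloor> \<le> u $ i - z $ i" "u $ i - z $ i \<le> a * \<lfloor>r\<rfloor> + a"
      and w: "a * \<lfloor>s\<rfloor> \<le> w $ i - z $ i" "w $ i - z $ i \<le> a * \<lfloor>s\<rfloor> + a"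
      using assms(2,3) unfolding cube_iff idx_def r_def s_def by (auto simp: algebra_simps)
    have "\<bar>a * \<lfloor>r\<rfloor> - a * \<lfloor>s\<rfloor>\<bar> = a * \<bar>real_of_int \<lfloor>r\<rfloor> - real_of_int \<lfloor>s\<rfloor>\<bar>"
      using a_pos by (simp add: abs_mult flip: right_diff_distrib)
    also have "\<dots> \<le> a" using f a_pos by simp
    finally show ?thesis using u w by simp
  qed
  from norm_le_sqrt_card[OF this] show ?thesis by (simp add: \<delta>_def C_def)
qed

lemma hits_near:
  assumes "hits U P" "y \<in> U"
  obtains p where "p \<in> P" "p \<in> cube (idx y)" "norm (y - p) \<le> \<delta> / 2"
  using assms mem_cube_idx[of y] cube_diam[of y "idx y"] unfolding hits_def by blast

text \<open>Walking along the segment in steps of at most the side length and choosing a point in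
  each cube on the way gives a chain with steps at most \<open>\<delta>\<close>. The factor
  \<open>C\<close> is the price \<open>\<delta> / a\<close> per unit length; it becomes the upper
  bound for the time constant.\<close>

lemma conn_segment:
  assumes "hits U P" "convex U" "u \<in> P" "w \<in> P" "u \<in> U" "w \<in> U"
  shows "conn \<delta> P u w (C * norm (u - w) + \<delta>)"
proof -
  \<comment> \<open>The summand 1 keeps \<open>m\<close> positive even for \<open>u = w\<close>, so
    that the indices of the two end points differ.\<close>
  define m where "m = nat \<lfloor>norm (u - w) / a\<rfloor> + 1"
  have r0: "0 \<le> norm (u - w) / a" using a_pos by simp
  have m: "norm (u - w) / a \<le> real m" "real m \<le> norm (u - w) / a + 1" "1 \<le> m"
    using r0 unfolding m_def by linarith+
  define y where "y i = u + (real i / real m) *\<^sub>R (w - u)" for i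
  have yU: "y i \<in> U" if "i \<le> m" for i
  proof -
    have "y i = (1 - real i / real m) *\<^sub>R u + (real i / real m) *\<^sub>R w"
      by (simp add: y_def algebra_simps)
    then show ?thesis using assms that m by (auto intro!: convexD)
  qed
  have step: "norm (y i - y (Suc i)) \<le> a" for i
  proof -
    have "y i - y (Suc i) = (1 / real m) *\<^sub>R (u - w)"
      by (simp add: y_def add_divide_distrib algebra_simps)
    then have "norm (y i - y (Suc i)) = norm (u - w) / m" by simp
    also have "\<dots> \<le> a" using m a_pos by (simp add: field_simps)
    finally show ?thesis .
  qed
  have "\<exists>p. p \<in> P \<and> p \<in> cube (idx (y i)) \<and> (i = 0 \<longrightarrow> p = u) \<and> (i = m \<longrightarrow> p = w)" if "i \<le> m" for i
  proof -
    consider "i = 0" | "i = m" "i \<noteq> 0" | "i \<noteq> 0" "i \<noteq> m" by blast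
    then show ?thesis
    proof cases
      case 1
      then have "y i = u" by (simp add: y_def)
      then show ?thesis using 1 m assms mem_cube_idx[of u] by auto
    next
      case 2
      then have "y i = w" using m by (simp add: y_def)
      then show ?thesis using 2 assms mem_cube_idx[of w] by auto
    next
      case 3
      then show ?thesis using hits_near[OF assms(1) yU[OF that]] by metis
    qed
  qed
  then obtain p where p: "\<And>i. i \<le> m \<Longrightarrow> p i \<in> P" "\<And>i. i \<le> m \<Longrightarrow> p i \<in> cube (idx (y i))"
    "p 0 = u" "p m = w" by (metis le0 le_refl)
  have st: "norm (p i - p (Suc i)) \<le> \<delta>" if "Suc i \<le> m" for i
    using adjacent_cubes[OF step p(2) p(2)] that by simp
  have "conn \<delta> P u (p i) (real i * \<delta>)" if "i \<le> m" for i
    using that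
  proof (induction i)
    case 0
    then show ?case using p assms by (auto intro: conn_refl)
  next
    case (Suc i)
    have "conn \<delta> P u (p i) (real i * \<delta>)" using Suc by simp
    then have "conn \<delta> P u (p (Suc i)) (real i * \<delta> + \<delta>)"
      by (rule conn_trans[OF _ conn_edge]) (use Suc.prems p st \<delta>_pos in auto)
    then show ?case by (simp add: algebra_simps)
  qed
  from this[of m] have "conn \<delta> P u w (real m * \<delta>)" using p by simp
  moreover have "real m * \<delta> \<le> C * norm (u - w) + \<delta>"
  proof -
    have "real m * \<delta> \<le> (norm (u - w) / a + 1) * \<delta>" using m \<delta>_pos by (intro mult_right_mono) auto
    also have "\<dots> = C * norm (u - w) + \<delta>" using a_pos by (simp add: \<delta>_def field_simps)
    finally show ?thesis .
  qed
  ultimately show ?thesis by (rule conn_mono[OF _ order_refl subset_refl])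
qed

lemma closest_near:
  assumes "hits U P" "x \<in> U" "u \<in> closest_points P x"
  shows "norm (x - u) \<le> \<delta> / 2"
proof -
  obtain p where "p \<in> P" "norm (x - p) \<le> \<delta> / 2" using hits_near[OF assms(1,2)] by metis
  then show ?thesis using assms(3) unfolding closest_points_def by (auto intro: order_trans)
qed

lemma hits_ex_closest:
  assumes "lfin P" "hits U P" "x \<in> U"
  obtains u where "u \<in> closest_points P x" "u \<in> P" "norm (x - u) \<le> \<delta> / 2"
proof -
  obtain p where "p \<in> P" using hits_near[OF assms(2,3)] by metis
  then obtain u where "u \<in> closest_points P x" using closest_points_nonempty[OF assms(1)] by blast
  then show ?thesis using that closest_near[OF assms(2,3)] by (auto simp: closest_points_def)
qed

lemma conn_ends:
  assumes "hits U P" "convex U" "u \<in> P" "w \<in> P" "norm (x - u) \<le> \<delta> / 2" "norm (y - w) \<le> \<delta> / 2"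
    "cball x (\<delta> / 2) \<subseteq> U" "cball y (\<delta> / 2) \<subseteq> U" "\<delta> \<le> h"
  shows "conn h P u w (C * norm (x - y) + (C + 1) * \<delta>)"
proof -
  have U: "u \<in> U" "w \<in> U" using assms by (auto simp: dist_norm)
  have "norm (u - w) \<le> norm (u - x) + norm (x - y) + norm (y - w)"
    using norm_diff_via[of u w x] norm_diff_via[of x w y] by simp
  then have "norm (u - w) \<le> norm (x - y) + \<delta>" using assms(5,6) by (simp add: norm_minus_commute)
  then have "C * norm (u - w) \<le> C * (norm (x - y) + \<delta>)" using C_ge by (intro mult_left_mono) auto
  then show ?thesis using assms
    by (intro conn_mono[OF conn_segment[OF assms(1-4) U]]) (auto simp: algebra_simps)
qed

lemma h_dist_upper:
  assumes "lfin P" "hits U P" "convex U" "cball x (\<delta> / 2) \<subseteq> U" "cball y (\<delta> / 2) \<subseteq> U" "\<delta> \<le> h"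
  shows "h_dist h P x y \<le> ennreal (C * norm (x - y) + (C + 1) * \<delta>)"
proof -
  have xy: "x \<in> U" "y \<in> U" using assms(4,5) \<delta>_pos by auto
  obtain u where u: "u \<in> closest_points P x" "u \<in> P" "norm (x - u) \<le> \<delta> / 2"
    using hits_ex_closest[OF assms(1,2) xy(1)] .
  obtain w where w: "w \<in> closest_points P y" "w \<in> P" "norm (y - w) \<le> \<delta> / 2"
    using hits_ex_closest[OF assms(1,2) xy(2)] .
  show ?thesis
    using u w assms(6) by (intro h_dist_leI[OF u(1) w(1)] conn_ends[OF assms(2,3)] assms) auto
qed

text \<open>Two step sizes occur because the end point and the scale change together when a real
  scale is compared with a neighbouring integer.\<close>

lemma h_dist_shift_end:
  assumes "lfin P" "hits U P" "convex U" "cball y (\<delta> / 2) \<subseteq> U" "cball y' (\<delta> / 2) \<subseteq> U"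
    "\<delta> \<le> h'" "h \<le> h'"
  shows "h_dist h' P x y' \<le> h_dist h P x y + ennreal (C * norm (y - y') + (C + 1) * \<delta>)"
proof (rule le_h_dist_add)
  fix p assume p: "p \<in> h_paths h P x y"
  have yy: "y \<in> U" "y' \<in> U" using assms(4,5) \<delta>_pos by auto
  obtain w where w: "w \<in> closest_points P y'" "w \<in> P" "norm (y' - w) \<le> \<delta> / 2"
    using hits_ex_closest[OF assms(1,2) yy(2)] .
  have l: "last p \<in> P" "norm (y - last p) \<le> \<delta> / 2" "hd p \<in> closest_points P x" "norm (x - hd p) \<le> h / 2"
    using p closest_near[OF assms(2) yy(1)] by (auto simp: h_paths_iff)
  have "conn h' P (hd p) w (path_length p + (C * norm (y - y') + (C + 1) * \<delta>))"
  proof (rule conn_trans)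
    show "conn h' P (hd p) (last p) (path_length p)"
      using conn_path[OF p] assms(7) by (rule conn_mono) auto
    show "conn h' P (last p) w (C * norm (y - y') + (C + 1) * \<delta>)"
      using w l assms by (intro conn_ends[OF assms(2,3)]) auto
  qed (use \<delta>_pos assms in auto)
  then have "h_dist h' P x y' \<le> ennreal (path_length p + (C * norm (y - y') + (C + 1) * \<delta>))"
    using l w assms by (intro h_dist_leI[of "hd p" P x w]) auto
  also have "\<dots> = ennreal (path_length p) + ennreal (C * norm (y - y') + (C + 1) * \<delta>)"
    using C_ge \<delta>_pos by (intro ennreal_plus) auto
  finally show "h_dist h' P x y' \<le> \<dots>" .
qed

text \<open>The two paths may use different closest points of \<open>y\<close>. Both are within
  \<open>\<delta> / 2\<close> of \<open>y\<close>, so one extra step of length at most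
  \<open>\<delta>\<close> joins them.\<close>

lemma h_dist_triangle:
  assumes "hits U P" "y \<in> U" "\<delta> \<le> h"
  shows "h_dist h P x w \<le> h_dist h P x y + h_dist h P y w + ennreal \<delta>"
proof -
  have "h_dist h P x w \<le> h_dist h P x y + ennreal (path_length q + \<delta>)" if q: "q \<in> h_paths h P y w" for q
  proof (rule le_h_dist_add)
    fix p assume p: "p \<in> h_paths h P x y"
    have l: "last p \<in> P" "norm (y - last p) \<le> \<delta> / 2" "hd q \<in> P" "norm (y - hd q) \<le> \<delta> / 2"
      using p q closest_near[OF assms(1,2)] by (auto simp: h_paths_iff)
    then have "norm (last p - hd q) \<le> \<delta>"
      using norm_diff_via[of "last p" "hd q" y] by (simp add: norm_minus_commute)
    then have "conn h P (last p) (last q) (\<delta> + path_length q)"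
      using l assms \<delta>_pos by (intro conn_trans[OF conn_edge conn_path[OF q]]) auto
    then have "conn h P (hd p) (last q) (path_length p + (\<delta> + path_length q))"
      using assms \<delta>_pos by (intro conn_trans[OF conn_path[OF p]]) auto
    then have "h_dist h P x w \<le> ennreal (path_length p + (\<delta> + path_length q))"
      using p q by (intro h_dist_leI[of "hd p" P x "last q"]) (auto simp: h_paths_iff)
    then show "h_dist h P x w \<le> ennreal (path_length p) + ennreal (path_length q + \<delta>)"
      using \<delta>_pos by (simp add: add.commute flip: ennreal_plus)
  qed
  then have "h_dist h P x w \<le> h_dist h P y w + (h_dist h P x y + ennreal \<delta>)"
    using \<delta>_pos by (intro le_h_dist_add) (simp add: ennreal_plus ac_simps)
  then show ?thesis by (simp add: ac_simps)
qed

lemma cubes_meeting_ball: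
  assumes "0 \<le> R"
  shows "finite {v. cube v \<inter> cball x R \<noteq> {}}"
    "real (card {v. cube v \<inter> cball x R \<noteq> {}}) \<le> (2 * R / a + 2) ^ CARD('n)"
proof -
  define S where "S i = {\<lceil>(x $ i - z $ i - R) / a - 1\<rceil>..\<lfloor>(x $ i - z $ i + R) / a\<rfloor>}" for i
  define N where "N = nat \<lfloor>2 * R / a + 2\<rfloor>"
  have "{v. cube v \<inter> cball x R \<noteq> {}} \<subseteq> {v. \<forall>i. v $ i \<in> S i}"
  proof (rule subsetI, rule CollectI, rule allI)
    fix v i assume "v \<in> {v. cube v \<inter> cball x R \<noteq> {}}"
    then obtain y where y: "y \<in> cube v" "y \<in> cball x R" by blast
    have "\<bar>(x - y) $ i\<bar> \<le> R" using y(2) component_le_norm_cart[of "x - y" i]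
      by (simp add: dist_norm)
    then have "a * (v $ i) \<le> x $ i - z $ i + R" "x $ i - z $ i - R \<le> a * (v $ i) + a"
      using y(1)[unfolded cube_iff, rule_format, of i] by (auto simp: algebra_simps)
    then have "v $ i \<le> (x $ i - z $ i + R) / a" "(x $ i - z $ i - R) / a - 1 \<le> v $ i"
      using a_pos by (simp_all add: field_simps)
    then show "v $ i \<in> S i" unfolding S_def atLeastAtMost_iff le_floor_iff ceiling_le_iff by blast
  qed
  moreover have "card (S i) \<le> N" for i
  proof -
    define r t where "r = (x $ i - z $ i + R) / a" and "t = (x $ i - z $ i - R) / a - 1"
    have "r - t = 2 * R / a + 1"
      using a_pos by (simp add: r_def t_def field_simps)
    then have "real_of_int (\<lfloor>r\<rfloor> + 1 - \<lceil>t\<rceil>) \<le> 2 * R / a + 2" by linarith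
    then have "\<lfloor>r\<rfloor> + 1 - \<lceil>t\<rceil> \<le> \<lfloor>2 * R / a + 2\<rfloor>" unfolding le_floor_iff .
    moreover have "card (S i) = nat (\<lfloor>r\<rfloor> - \<lceil>t\<rceil> + 1)" unfolding S_def r_def t_def by (rule card_atLeastAtMost_int)
    ultimately show ?thesis unfolding N_def by (simp add: nat_mono)
  qed
  moreover have "finite (S i)" for i by (simp add: S_def)
  moreover note b = finite_vec_box[of S N]
  ultimately have b: "finite {v. \<forall>i. v $ i \<in> S i}" "card {v. \<forall>i. v $ i \<in> S i} \<le> N ^ CARD('n)"
    and sub: "{v. cube v \<inter> cball x R \<noteq> {}} \<subseteq> {v. \<forall>i. v $ i \<in> S i}" by blast+
  show "finite {v. cube v \<inter> cball x R \<noteq> {}}"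
    by (rule finite_subset[OF sub b(1)])
  have "card {v. cube v \<inter> cball x R \<noteq> {}} \<le> N ^ CARD('n)"
    using card_mono[OF b(1) sub] b(2) by simp
  then have "real (card {v. cube v \<inter> cball x R \<noteq> {}}) \<le> real N ^ CARD('n)"
    by (metis of_nat_le_iff of_nat_power)
  also have "\<dots> \<le> (2 * R / a + 2) ^ CARD('n)"
  proof (rule power_mono)
    have "0 \<le> 2 * R / a" using assms a_pos by simp
    then show "real N \<le> 2 * R / a + 2" unfolding N_def by linarith
  qed simp
  finally show "real (card {v. cube v \<inter> cball x R \<noteq> {}}) \<le> (2 * R / a + 2) ^ CARD('n)" .
qed

lemma cubes_meeting_bounded: "bounded B \<Longrightarrow> finite {v. cube v \<inter> B \<noteq> {}}"
proof -
  assume "bounded B"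
  then obtain R where R: "B \<subseteq> cball 0 R" "0 \<le> R"
    by (force simp: bounded_pos)
  show ?thesis by (rule finite_subset[OF _ cubes_meeting_ball(1)[OF R(2), of 0]]) (use R in blast)
qed

end

subsection \<open>Changing the points of one cube\<close>

context cube_grid
begin

text \<open>An edge that is up to \<open>\<delta> / 2\<close> too long is split. The intermediate
  point is placed at distance \<open>h - \<delta> / 2\<close> from \<open>u\<close>, so that the
  first step is still at most \<open>h\<close> after moving it to a point of \<open>P\<close>; the
  rest has length at most \<open>3 / 2 * \<delta>\<close> and is bridged by small steps.\<close>

lemma conn_near:
  assumes "hits UNIV P" "u \<in> P" "q \<in> P" "norm (u - q) \<le> h + \<delta> / 2" "\<delta> \<le> h"
  shows "conn h P u q (norm (u - q) + (3 / 2 * C + 1) * \<delta>)"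
proof (cases "norm (u - q) \<le> h")
  case True
  then show ?thesis using assms C_ge \<delta>_pos by (intro conn_edge) auto
next
  case False
  define r where "r = norm (u - q)"
  have r: "h < r" "r \<le> h + \<delta> / 2" "0 < r" using False assms \<delta>_pos by (auto simp: r_def)
  define m where "m = u + ((h - \<delta> / 2) / r) *\<^sub>R (q - u)"
  have "norm (u - m) = \<bar>(h - \<delta> / 2) / r\<bar> * r"
    by (simp add: m_def r_def norm_minus_commute)
  then have um: "norm (u - m) = h - \<delta> / 2" using r assms \<delta>_pos by simp
  have "m - q = (1 - (h - \<delta> / 2) / r) *\<^sub>R (u - q)"
    by (simp add: m_def algebra_simps)
  also have "1 - (h - \<delta> / 2) / r = (r - (h - \<delta> / 2)) / r"
    using r by (simp add: field_simps)
  finally have "m - q = ((r - (h - \<delta> / 2)) / r) *\<^sub>R (u - q)" .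
  then have "norm (m - q) = \<bar>(r - (h - \<delta> / 2)) / r\<bar> * r" by (simp add: r_def)
  then have mq: "norm (m - q) = r - (h - \<delta> / 2)" using r \<delta>_pos by simp
  obtain m' where m': "m' \<in> P" "norm (m - m') \<le> \<delta> / 2"
    using hits_near[OF assms(1), of m] by auto
  have um': "norm (u - m') \<le> h" using norm_diff_via[of u m' m] um m' by simp
  have "norm (m' - q) \<le> 3 / 2 * \<delta>"
    using norm_diff_via[of m' q m] mq m' r by (simp add: norm_minus_commute)
  then have "C * norm (m' - q) \<le> C * (3 / 2 * \<delta>)" using C_ge by (intro mult_left_mono) auto
  then have m'q: "conn h P m' q (3 / 2 * C * \<delta> + \<delta>)"
    using m' assms by (intro conn_mono[OF conn_segment[OF assms(1)]]) auto
  have "conn h P u m' h" using assms m' um' by (intro conn_edge) auto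
  then have "conn h P u q (h + (3 / 2 * C * \<delta> + \<delta>))"
    using m'q by (rule conn_trans) (use assms \<delta>_pos in auto)
  then show ?thesis by (rule conn_mono) (use r in \<open>auto simp: r_def algebra_simps\<close>)
qed

text \<open>The last vertex \<open>b\<close> is replaced by a nearby point \<open>q\<close>, which
  may lengthen the last edge by \<open>\<delta> / 2\<close>, and the start is replaced by
  \<open>q'\<close>, the closest point of \<open>x\<close> in a changed configuration. Both halves
  of a damaged path are repaired in this way, the second one after reversal.\<close>

lemma conn_reroute:
  assumes "hits UNIV P" "set pre \<subseteq> P" "short_steps h (pre @ [b])" "norm (x - hd (pre @ [b])) \<le> \<delta> / 2"
    "q' \<in> P" "norm (x - q') \<le> \<delta> / 2" "q \<in> P" "norm (b - q) \<le> \<delta> / 2" "\<delta> \<le> h"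
  shows "conn h P q' q (path_length (pre @ [b]) + (3 / 2 * C + 5 / 2) * \<delta>)"
proof (cases "pre = []")
  case True
  have "norm (q' - q) \<le> 3 / 2 * \<delta>"
    using norm_diff_via[of q' b x] norm_diff_via[of q' q b] assms True by (simp add: norm_minus_commute)
  then show ?thesis using assms True \<delta>_pos
    by (intro conn_mono[OF conn_near]) (auto simp: algebra_simps)
next
  case False
  have qh: "norm (q' - hd pre) \<le> \<delta>"
    using norm_diff_via[of q' "hd pre" x] assms False by (simp add: norm_minus_commute)
  have hp: "hd pre \<in> P" "last pre \<in> P" using False assms(2) by auto
  have lb: "norm (last pre - b) \<le> h" "short_steps h pre"
    using assms(3) False by (auto simp: successively_append_iff)
  have lq: "norm (last pre - q) \<le> norm (last pre - b) + \<delta> / 2"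
    using norm_diff_via[of "last pre" q b] assms(8) by simp
  have "conn h P q' q (\<delta> + path_length pre + (norm (last pre - q) + (3 / 2 * C + 1) * \<delta>))"
  proof (rule conn_trans[OF conn_trans])
    show "conn h P q' (hd pre) \<delta>" using qh hp assms by (intro conn_edge) auto
    show "conn h P (hd pre) (last pre) (path_length pre)" using False assms lb by (intro connI) auto
    show "conn h P (last pre) q (norm (last pre - q) + (3 / 2 * C + 1) * \<delta>)"
      using lq lb hp assms by (intro conn_near) auto
  qed (use assms \<delta>_pos in auto)
  then show ?thesis
    by (rule conn_mono) (use lq False in \<open>auto simp: path_length_append algebra_simps norm_minus_commute\<close>)
qed

text \<open>A configuration is recorded cube by cube, so that changing one cube is a function
  update. The pieces may overlap in the faces of the closed cubes.\<close>

definition cells :: "(int ^ 'n \<Rightarrow> (real ^ 'n) set) \<Rightarrow> bool" where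
  "cells Y \<longleftrightarrow> (\<forall>v. Y v \<noteq> {} \<and> finite (Y v) \<and> Y v \<subseteq> cube v)"

lemma cells_hits: "cells Y \<Longrightarrow> hits U (\<Union>v. Y v)"
  unfolding cells_def hits_def by blast

lemma cells_lfin: "cells Y \<Longrightarrow> lfin (\<Union>v. Y v)"
  unfolding lfin_def
proof safe
  fix B :: "(real ^ 'n) set" assume Y: "cells Y" and B: "bounded B"
  have "(\<Union>v. Y v) \<inter> B \<subseteq> (\<Union>v\<in>{v. cube v \<inter> B \<noteq> {}}. Y v)" using Y by (fastforce simp: cells_def)
  moreover have "finite (\<Union>v\<in>{v. cube v \<inter> B \<noteq> {}}. Y v)"
    using Y cubes_meeting_bounded[OF B] by (auto simp: cells_def)
  ultimately show "finite ((\<Union>v. Y v) \<inter> B)" by (rule finite_subset)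
qed

text \<open>A path may lose many vertices, but all of them lie in cube \<open>k\<close>. It is
  followed up to the first lost vertex, crosses the cube through one new point \<open>q\<close>, and
  goes on after the last lost vertex; whatever lies in between is discarded. Each half contributes
  half of \<open>(3 * C + 5) * \<delta>\<close>.\<close>

lemma h_dist_replace:
  assumes "cells Y" "cells Y'" "\<And>v. v \<noteq> k \<Longrightarrow> Y' v = Y v" "\<delta> \<le> h"
  shows "h_dist h (\<Union>v. Y' v) x y \<le> h_dist h (\<Union>v. Y v) x y + ennreal ((3 * C + 5) * \<delta>)"
proof (rule le_h_dist_add)
  let ?P = "\<Union>v. Y v" and ?P' = "\<Union>v. Y' v"
  fix p assume p: "p \<in> h_paths h ?P x y"
  note hit = cells_hits[OF assms(2), of UNIV]
  note h0 = \<delta>_pos assms(4)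
  have ends: "norm (x - hd p) \<le> \<delta> / 2" "norm (y - last p) \<le> \<delta> / 2"
    using p closest_near[OF cells_hits[OF assms(1), of UNIV]] by (auto simp: h_paths_iff)
  obtain q' where q': "q' \<in> closest_points ?P' x" "q' \<in> ?P'" "norm (x - q') \<le> \<delta> / 2"
    using hits_ex_closest[OF cells_lfin[OF assms(2)] hit UNIV_I] .
  obtain r' where r': "r' \<in> closest_points ?P' y" "r' \<in> ?P'" "norm (y - r') \<le> \<delta> / 2"
    using hits_ex_closest[OF cells_lfin[OF assms(2)] hit UNIV_I] .
  have "conn h ?P' q' r' (path_length p + (3 * C + 5) * \<delta>)"
  proof (cases "set p \<subseteq> ?P'")
    \<comment> \<open>No vertex is lost, but the closest points of \<open>x\<close> and
      \<open>y\<close> may have changed, so both ends are reattached.\<close>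
    case True
    have "p \<noteq> []" using p by (simp add: h_paths_iff)
    then have p': "hd p \<in> ?P'" "last p \<in> ?P'" using True hd_in_set last_in_set by blast+
    have e: "norm (q' - hd p) \<le> \<delta>" "norm (last p - r') \<le> \<delta>"
      using norm_diff_via[of q' "hd p" x] norm_diff_via[of "last p" r' y] ends q' r'
      by (simp_all add: norm_minus_commute)
    have "conn h ?P' q' r' (\<delta> + path_length p + \<delta>)"
    proof (rule conn_trans[OF conn_trans])
      show "conn h ?P' q' (hd p) \<delta>" "conn h ?P' (last p) r' \<delta>"
        using e p' q' r' assms(4) by (auto intro!: conn_edge)
      show "conn h ?P' (hd p) (last p) (path_length p)"
        using p True by (intro connI) (auto simp: h_paths_iff)
    qed (use h0 in auto)
    then show ?thesis
      by (rule conn_mono) (use C_ge \<delta>_pos in \<open>auto simp: algebra_simps\<close>)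
  next
    case False
    then have "\<exists>b\<in>set p. b \<notin> ?P'" by blast
    then obtain pre b rest where p1: "p = pre @ b # rest" "b \<notin> ?P'" "\<forall>v\<in>set pre. \<not> v \<notin> ?P'"
      by (rule split_list_first_propE)
    have "\<exists>b'\<in>set (b # rest). b' \<notin> ?P'" using p1 by auto
    then obtain mid b' suf where p2: "b # rest = mid @ b' # suf" "b' \<notin> ?P'" "\<forall>v\<in>set suf. \<not> v \<notin> ?P'"
      by (rule split_list_last_propE)
    have bk: "w \<in> cube k" if "w \<in> set p" "w \<notin> ?P'" for w
    proof -
      have "set p \<subseteq> ?P" using p by (simp add: h_paths_iff)
      then have "w \<in> ?P" using that by blast
      then obtain v where "w \<in> Y v" by blast
      then have "v = k" using that(2) assms(3)[of v] by blast
      then show ?thesis using \<open>w \<in> Y v\<close> assms(1) by (auto simp: cells_def)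
    qed
    obtain q where q: "q \<in> Y' k" using assms(2) unfolding cells_def by blast
    then have q2: "q \<in> ?P'" "q \<in> cube k" using assms(2) unfolding cells_def by blast+
    have bq: "norm (b - q) \<le> \<delta> / 2" "norm (b' - q) \<le> \<delta> / 2"
      using bk[of b] bk[of b'] p1 p2 q2 by (metis cube_diam Un_iff list.set_intros(1) set_append)+
    have ss: "short_steps h p" using p by (simp add: h_paths_iff)
    have ss1: "short_steps h (pre @ [b])"
      using ss p1(1) by (auto simp: successively_append_iff)
    have ss2': "short_steps h (b' # suf)"
      using ss p1(1) p2(1) by (auto simp: successively_append_iff)
    have revs: "rev suf @ [b'] = rev (b' # suf)" by simp
    have ss2: "short_steps h (rev suf @ [b'])" unfolding revs short_steps_rev by (rule ss2')
    have hd1: "hd (pre @ [b]) = hd p" using p1(1) by (cases pre) auto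
    have "last (b # rest) = last (b' # suf)" using p2(1) by (metis last_appendR list.discI)
    then have hd2: "hd (rev suf @ [b']) = last p"
      unfolding revs hd_rev using p1(1) by simp
    have A: "conn h ?P' q' q (path_length (pre @ [b]) + (3 / 2 * C + 5 / 2) * \<delta>)"
      by (rule conn_reroute[OF hit _ ss1 _ q'(2,3) q2(1) bq(1) assms(4)])
        (use p1(3) ends hd1 in auto)
    have "conn h ?P' r' q (path_length (rev suf @ [b']) + (3 / 2 * C + 5 / 2) * \<delta>)"
      by (rule conn_reroute[OF hit _ ss2 _ r'(2,3) q2(1) bq(2) assms(4)])
        (use p2(3) ends hd2 in auto)
    then have B: "conn h ?P' q r' (path_length (b' # suf) + (3 / 2 * C + 5 / 2) * \<delta>)"
      unfolding revs path_length_rev by (rule conn_sym)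
    have "path_length p = path_length (pre @ [b]) + path_length (b # rest)"
      using p1(1) by (cases "pre = []") (auto simp: path_length_append)
    moreover have "path_length (b' # suf) \<le> path_length (b # rest)"
      unfolding p2(1) by (cases "mid = []") (auto simp: path_length_append)
    ultimately have "path_length (pre @ [b]) + (3 / 2 * C + 5 / 2) * \<delta> +
        (path_length (b' # suf) + (3 / 2 * C + 5 / 2) * \<delta>) \<le> path_length p + (3 * C + 5) * \<delta>"
      by (simp add: algebra_simps)
    then show ?thesis using h0 by (intro conn_mono[OF conn_trans[OF A B]]) auto
  qed
  then have "h_dist h ?P' x y \<le> ennreal (path_length p + (3 * C + 5) * \<delta>)"
    using q' r' assms(4) by (intro h_dist_leI[OF q'(1) r'(1)]) auto
  also have "\<dots> = ennreal (path_length p) + ennreal ((3 * C + 5) * \<delta>)"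
    using C_ge \<delta>_pos by (intro ennreal_plus) auto
  finally show "h_dist h ?P' x y \<le> \<dots>" .
qed

text \<open>The old closest point is within \<open>\<delta> / 2\<close> of \<open>x\<close>, whereas
  every point of the changed cube is further away.\<close>

lemma closest_points_unaffected:
  assumes "cells Y" "cells Y'" "\<And>v. v \<noteq> k \<Longrightarrow> Y' v = Y v" "cube k \<inter> cball x (\<delta> / 2) = {}"
    "q \<in> closest_points (\<Union>v. Y v) x" "q \<in> (\<Union>v. Y' v)"
  shows "q \<in> closest_points (\<Union>v. Y' v) x"
proof -
  have q: "norm (x - q) \<le> \<delta> / 2"
    using closest_near[OF cells_hits[OF assms(1), of UNIV]] assms(5) by auto
  have "norm (x - q) \<le> norm (x - w)" if w: "w \<in> Y' v" for w v
  proof (cases "v = k")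
    case True
    then have "w \<in> cube k" using w assms(2) by (auto simp: cells_def)
    then have "w \<notin> cball x (\<delta> / 2)" using assms(4) by blast
    then show ?thesis using q by (simp add: dist_norm)
  next
    case False
    then show ?thesis using w assms(3,5) by (auto simp: closest_points_def)
  qed
  then show ?thesis using assms(6) by (auto simp: closest_points_def)
qed

text \<open>Only the cubes that contain a vertex of an almost optimal path, or that are close to an end
  point, can increase the distance when their points are changed.\<close>
lemma card_increasing_cubes:
  assumes Y: "cells Y" and A: "\<And>k. k \<in> V \<Longrightarrow> cells (Y(k := A k))" and "finite V" "\<delta> \<le> h"
    and l: "h_dist h (\<Union>v. Y v) x y \<le> ennreal l" "0 \<le> l"
  shows "real (card {k \<in> V. h_dist h (\<Union>v. Y v) x y < h_dist h (\<Union>v. (Y(k := A k)) v) x y})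
    \<le> 2 * (C + 2) ^ CARD('n) + 2 * l / h + 4"
proof -
  let ?P = "\<Union>v. Y v"
  let ?D = "\<lambda>k. h_dist h (\<Union>v. (Y(k := A k)) v) x y"
  let ?N = "\<lambda>x. {v. cube v \<inter> cball x (\<delta> / 2) \<noteq> {}}"
  define W where "W = {k \<in> V. h_dist h ?P x y < ?D k}"
  have finW: "finite W" using assms(3) by (simp add: W_def)
  have h: "0 < h" using \<delta>_pos assms(4) by simp
  \<comment> \<open>The infimum need not be attained, so a path is taken strictly below all the
    finitely many increased distances at once. The entry \<open>l + h\<close> keeps its length under
    control.\<close>
  define m where "m = Min (insert (ennreal (l + h)) (?D ` W))"
  have lh: "ennreal l < ennreal (l + h)" using l(2) h by (simp add: ennreal_less_iff)
  have "h_dist h ?P x y < m"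
    unfolding m_def using finW l lh by (subst Min_gr_iff) (auto simp: W_def)
  then obtain p where p: "p \<in> h_paths h ?P x y" "ennreal (path_length p) < m"
    unfolding h_dist_def[of h ?P] INF_less_iff by auto
  obtain p' where p': "p' \<in> h_paths h ?P x y" "path_length p' \<le> path_length p"
    "h * (real (length p') - 2) \<le> 2 * path_length p'"
    using shortcut[OF p(1)] h by (metis less_imp_le)
  have pm: "ennreal (path_length p') < m" using p' p(2) by (meson ennreal_leI le_less_trans)
  have m1: "m \<le> ennreal (l + h)" "\<And>k. k \<in> W \<Longrightarrow> m \<le> ?D k"
    unfolding m_def using finW by auto
  have "ennreal (path_length p') < ennreal (l + h)" using pm m1 by simp
  then have pl: "path_length p' < l + h" by (simp add: ennreal_less_iff)
  have "\<forall>w\<in>set p'. \<exists>v. w \<in> Y v" using p' by (auto simp: h_paths_iff)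
  \<comment> \<open>The vertex \<open>w\<close> survives a change of any cube other than
    \<open>f w\<close>, even if it lies on a face and belongs to several pieces; so one cube per
    vertex suffices.\<close>
  then obtain f where f: "\<And>w. w \<in> set p' \<Longrightarrow> w \<in> Y (f w)" by metis
  have sub: "W \<subseteq> ?N x \<union> ?N y \<union> f ` set p'"
  proof
    fix k assume k: "k \<in> W"
    show "k \<in> ?N x \<union> ?N y \<union> f ` set p'"
    proof (rule ccontr)
      assume n: "k \<notin> ?N x \<union> ?N y \<union> f ` set p'"
      let ?Y' = "Y(k := A k)"
      have Y': "cells ?Y'" "\<And>v. v \<noteq> k \<Longrightarrow> ?Y' v = Y v" using k A by (auto simp: W_def)
      have s: "set p' \<subseteq> (\<Union>v. ?Y' v)"
      proof
        fix w assume w: "w \<in> set p'"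
        then have "f w \<noteq> k" using n by blast
        then have "w \<in> ?Y' (f w)" using f[OF w] by simp
        then show "w \<in> (\<Union>v. ?Y' v)" by blast
      qed
      have "p' \<noteq> []" using p' by (simp add: h_paths_iff)
      then have e: "hd p' \<in> (\<Union>v. ?Y' v)" "last p' \<in> (\<Union>v. ?Y' v)"
        using s hd_in_set last_in_set by blast+
      have "p' \<in> h_paths h (\<Union>v. ?Y' v) x y"
        unfolding h_paths_iff
        using p'(1)[unfolded h_paths_iff] s n
          closest_points_unaffected[OF Y Y' _ _ e(1), where x = x] closest_points_unaffected[OF Y Y' _ _ e(2), where x = y]
        by auto
      then have "?D k \<le> ennreal (path_length p')" by (rule h_dist_le_path)
      then show False using pm m1(2)[OF k] by simp
    qed
  qed
  have \<delta>a: "2 * (\<delta> / 2) / a + 2 = C + 2" using a_pos by (simp add: \<delta>_def)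
  have N: "finite (?N w)" "real (card (?N w)) \<le> (C + 2) ^ CARD('n)" for w
    using cubes_meeting_ball[of "\<delta> / 2" w] \<delta>_pos \<delta>a by auto
  have "card W \<le> card (?N x \<union> ?N y \<union> f ` set p')"
    using sub N by (intro card_mono) auto
  also have "\<dots> \<le> card (?N x) + card (?N y) + card (f ` set p')"
    by (meson card_Un_le add_le_mono1 order_trans)
  also have "card (f ` set p') \<le> length p'" by (meson List.finite_set card_image_le card_length order_trans)
  finally have "real (card W) \<le> real (card (?N x)) + real (card (?N y)) + real (length p')"
    by (simp flip: of_nat_add)
  moreover have "real (length p') \<le> 2 * l / h + 4"
  proof -
    have "h * (real (length p') - 2) \<le> 2 * (l + h)" using p'(3) pl by simp
    then show ?thesis using h by (simp add: field_simps)
  qed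
  ultimately show ?thesis using N(2)[of x] N(2)[of y] unfolding W_def by linarith
qed

end

subsection \<open>Measurability on the space of configurations\<close>

text \<open>Counts on bounded Borel sets are what the definition of a Poisson process makes
  measurable. The sigma-algebra they generate is rich enough for the distance.\<close>

definition cfg :: "'b::euclidean_space set measure" where
  "cfg = sigma {P. lfin P} {{P. lfin P \<and> card (P \<inter> B) = n} |B n. B \<in> sets borel \<and> bounded B}"

lemma space_cfg: "space cfg = {P. lfin P}"
  unfolding cfg_def by (rule space_measure_of) auto

lemma sets_cfg: "sets cfg = sigma_sets {P. lfin P} {{P. lfin P \<and> card (P \<inter> B) = n} |B n. B \<in> sets borel \<and> bounded B}"
  unfolding cfg_def by (rule sets_measure_of) auto

lemma measurable_card [measurable (raw)]:
  assumes "B \<in> sets borel" "bounded B" and [measurable]: "f \<in> measurable M cfg"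
  shows "(\<lambda>x. card (f x \<inter> B)) \<in> measurable M (count_space UNIV)"
proof -
  have "(\<lambda>P. card (P \<inter> B)) \<in> measurable cfg (count_space UNIV)"
  proof (subst measurable_count_space_eq2_countable, safe)
    fix n
    have "(\<lambda>P. card (P \<inter> B)) -` {n} \<inter> space cfg = {P. lfin P \<and> card (P \<inter> B) = n}"
      by (auto simp: space_cfg)
    also have "\<dots> \<in> sets cfg" unfolding sets_cfg using assms by (intro sigma_sets.Basic) blast
    finally show "(\<lambda>P. card (P \<inter> B)) -` {n} \<inter> space cfg \<in> sets cfg" .
  qed auto
  from measurable_compose[OF assms(3) this] show ?thesis .
qed

lemma measurable_cfgI:
  assumes "\<And>x. x \<in> space M \<Longrightarrow> lfin (f x)"
    and "\<And>B. B \<in> sets borel \<Longrightarrow> bounded B \<Longrightarrow> (\<lambda>x. card (f x \<inter> B)) \<in> measurable M (count_space UNIV)"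
  shows "f \<in> measurable M cfg"
  unfolding cfg_def
proof (rule measurable_measure_of)
  fix A assume "A \<in> {{P. lfin P \<and> card (P \<inter> B) = n} |B n. B \<in> sets borel \<and> bounded (B :: 'b set)}"
  then obtain B n where A: "A = {P. lfin P \<and> card (P \<inter> B) = n}" "B \<in> sets borel" "bounded B" by blast
  have "f -` A \<inter> space M = (\<lambda>x. card (f x \<inter> B)) -` {n} \<inter> space M"
    using assms(1) by (auto simp: A(1))
  then show "f -` A \<inter> space M \<in> sets M" using assms(2)[OF A(2,3)] by (auto intro: measurable_sets)
qed (use assms in auto)

lemma measurable_cfg_Int [measurable (raw)]:
  fixes B :: "'b::euclidean_space set"
  assumes "B \<in> sets borel" and [measurable]: "f \<in> measurable M cfg"
  shows "(\<lambda>x. f x \<inter> B) \<in> measurable M cfg"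
proof (rule measurable_cfgI)
  show "lfin (f x \<inter> B)" if "x \<in> space M" for x
    using measurable_space[OF assms(2) that]
    by (auto simp: lfin_def space_cfg Int_assoc intro: finite_subset[of _ "f x \<inter> _"])
next
  fix B' :: "'b set" assume B': "B' \<in> sets borel" "bounded B'"
  have "(\<lambda>x. card (f x \<inter> (B \<inter> B'))) \<in> measurable M (count_space UNIV)"
    using B' assms by (intro measurable_card) auto
  then show "(\<lambda>x. card (f x \<inter> B \<inter> B')) \<in> measurable M (count_space UNIV)"
    by (simp add: Int_assoc)
qed

text \<open>A countable family of bounded open sets isolates all the points of a configuration, which
  therefore has a measurable enumeration.\<close>
definition iso_set :: "nat \<Rightarrow> 'b::euclidean_space set" where
  "iso_set = (SOME f. (\<forall>n. open (f n) \<and> bounded (f n)) \<and>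
     (\<forall>x S. open S \<and> x \<in> S \<longrightarrow> (\<exists>n. x \<in> f n \<and> f n \<subseteq> S)))"

lemma iso_set:
  shows "open (iso_set n :: 'b::euclidean_space set)" "bounded (iso_set n :: 'b set)"
    and "open S \<Longrightarrow> x \<in> S \<Longrightarrow> \<exists>n. (x :: 'b) \<in> iso_set n \<and> iso_set n \<subseteq> S"
proof -
  let ?Q = "\<lambda>f. (\<forall>n. open (f n) \<and> bounded (f n)) \<and>
     (\<forall>x S. open S \<and> x \<in> S \<longrightarrow> (\<exists>n. x \<in> f n \<and> f n \<subseteq> (S :: 'b set)))"
  obtain U :: "'b set set" where U: "countable U" "topological_basis U"
    using ex_countable_basis by blast
  define W where "W = (\<lambda>(u, m :: nat). u \<inter> ball 0 (real m)) ` (U \<times> UNIV)"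
  have "U \<noteq> {}" using topological_basisE[OF U(2) open_UNIV UNIV_I] by blast
  then have ne: "W \<noteq> {}" by (auto simp: W_def)
  have cW: "countable W" unfolding W_def using U by (intro countable_image countable_SIGMA) auto
  have "?Q (from_nat_into W)"
  proof (intro conjI allI impI)
    fix n
    have "from_nat_into W n \<in> W" using ne by (rule from_nat_into)
    then obtain u m where um: "from_nat_into W n = u \<inter> ball 0 (real m)" "u \<in> U" by (auto simp: W_def)
    then show "open (from_nat_into W n)" "bounded (from_nat_into W n)"
      using topological_basis_open[OF U(2) um(2)]
      by (auto intro!: open_Int bounded_subset[OF bounded_ball])
  next
    fix x :: 'b and S assume S: "open S \<and> x \<in> S"
    then obtain u where u: "u \<in> U" "x \<in> u" "u \<subseteq> S" using U(2) by (meson topological_basisE)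
    obtain m :: nat where "norm x < real m" using reals_Archimedean2 by blast
    then have "u \<inter> ball 0 (real m) \<in> W" "x \<in> u \<inter> ball 0 (real m)" using u by (auto simp: W_def)
    then show "\<exists>n. x \<in> from_nat_into W n \<and> from_nat_into W n \<subseteq> S"
      using u(3) from_nat_into_surj[OF cW] by (metis Int_subset_iff inf.coboundedI1)
  qed
  then have "?Q iso_set" unfolding iso_set_def by (rule someI[where P = ?Q])
  then show "open (iso_set n :: 'b::euclidean_space set)" "bounded (iso_set n :: 'b set)"
    and "open S \<Longrightarrow> x \<in> S \<Longrightarrow> \<exists>n. (x :: 'b) \<in> iso_set n \<and> iso_set n \<subseteq> S" by blast+
qed

definition isolated :: "nat \<Rightarrow> 'b::euclidean_space set \<Rightarrow> bool" where
  "isolated n P \<longleftrightarrow> card (P \<inter> iso_set n) = 1"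

text \<open>The value 0 is a placeholder guarded by \<open>isolated\<close>. A point is listed once
  for every set that isolates it.\<close>

definition pt :: "nat \<Rightarrow> 'b::euclidean_space set \<Rightarrow> 'b" where
  "pt n P = (if isolated n P then the_elem (P \<inter> iso_set n) else 0)"

lemma isolated_pt: "isolated n P \<Longrightarrow> P \<inter> iso_set n = {pt n P}"
  by (metis isolated_def pt_def card_1_singletonE the_elem_eq)

lemma lfin_points:
  assumes "lfin P"
  shows "p \<in> P \<longleftrightarrow> (\<exists>n. isolated n P \<and> p = pt n P)"
proof
  assume p: "p \<in> P"
  have "finite (P \<inter> ball p 1 - {p})" using assms by (auto simp: lfin_def)
  then have "open (ball p 1 - (P \<inter> ball p 1 - {p}))" by (intro open_Diff finite_imp_closed) auto
  then obtain n where n: "p \<in> iso_set n" "iso_set n \<subseteq> ball p 1 - (P \<inter> ball p 1 - {p})"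
    using iso_set(3)[of _ p] by (metis DiffI Diff_iff centre_in_ball singletonI zero_less_one)
  then have "P \<inter> iso_set n = {p}" using p by blast
  then show "\<exists>n. isolated n P \<and> p = pt n P"
    by (intro exI[of _ n]) (simp add: isolated_def pt_def)
next
  assume "\<exists>n. isolated n P \<and> p = pt n P"
  then show "p \<in> P" using isolated_pt by blast
qed

lemma measurable_isolated [measurable]: "Measurable.pred cfg (isolated n)"
proof -
  have [measurable]: "(\<lambda>P. card (P \<inter> iso_set n)) \<in> measurable cfg (count_space UNIV)"
    using iso_set(1,2)[of n] by (intro measurable_card measurable_ident_sets borel_open) auto
  show ?thesis unfolding isolated_def by measurable
qed

text \<open>Where \<open>isolated n\<close> holds, membership of the point in \<open>A\<close> is a
  statement about the count on a bounded Borel set.\<close>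

lemma measurable_pt [measurable]: "(pt n :: 'b::euclidean_space set \<Rightarrow> 'b) \<in> borel_measurable cfg"
proof (rule measurableI)
  fix A :: "'b set" assume A[measurable]: "A \<in> sets borel"
  have b: "iso_set n \<inter> A \<in> sets borel" "bounded (iso_set n \<inter> A)"
    using iso_set(1,2)[of n] by (auto intro: bounded_subset borel_open)
  have "pt n P \<in> A \<longleftrightarrow> (if isolated n P then card (P \<inter> (iso_set n \<inter> A)) = 1 else 0 \<in> A)" for P
  proof (cases "isolated n P")
    case True
    have "P \<inter> (iso_set n \<inter> A) = {pt n P} \<inter> A" using isolated_pt[OF True] by blast
    then show ?thesis using True by (cases "pt n P \<in> A") auto
  qed (simp add: pt_def)
  then have "pt n -` A \<inter> space cfg =
    {P \<in> space cfg. if isolated n P then card (P \<inter> (iso_set n \<inter> A)) = 1 else 0 \<in> A}" by auto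
  also have "\<dots> \<in> sets cfg"
    using measurable_card[OF b measurable_ident_sets[OF refl]] by measurable
  finally show "pt n -` A \<inter> space cfg \<in> sets cfg" .
qed simp

text \<open>With the points enumerated by \<open>pt\<close>, the infimum over paths becomes one over
  the countably many lists of indices, and being a closest point becomes a countable
  conjunction.\<close>

lemma measurable_h_dist_cfg:
  fixes x y :: "'b::euclidean_space"
  shows "(\<lambda>P. h_dist h P x y) \<in> borel_measurable cfg"
proof -
  define len where "len ns P = (\<Sum>i<length ns - 1. norm (pt (ns ! Suc i) P - pt (ns ! i) P :: 'b))" for ns P
  define near where "near x n P \<longleftrightarrow> norm (x - pt n P) \<le> h / 2 \<and>
    (\<forall>m. isolated m P \<longrightarrow> norm (x - pt n P) \<le> norm (x - pt m P :: 'b))" for x n P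
  define ok where "ok ns P \<longleftrightarrow> ns \<noteq> [] \<and> (\<forall>n\<in>set ns. isolated n P) \<and> near x (hd ns) P \<and> near y (last ns) P \<and>
    (\<forall>i<length ns - 1. norm (pt (ns ! i) P - pt (ns ! Suc i) P :: 'b) \<le> h)" for ns P
  have [measurable]: "len ns \<in> borel_measurable cfg" "Measurable.pred cfg (near x n)"
    "Measurable.pred cfg (near y n)" for ns n
    unfolding len_def near_def by measurable
  have [measurable]: "Measurable.pred cfg (ok ns)" for ns
    unfolding ok_def by measurable
  have eq: "h_dist h P x y = (INF ns. if ok ns P then ennreal (len ns P) else top)" if "P \<in> space cfg" for P
  proof -
    have P: "lfin P" using that by (simp add: space_cfg)
    note mem = lfin_points[OF P]
    have cl: "pt n P \<in> closest_points P w \<and> norm (w - pt n P) \<le> h / 2 \<longleftrightarrow> near w n P" if "isolated n P" for n w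
    proof -
      have "(\<forall>y\<in>P. norm (w - pt n P) \<le> norm (w - y)) \<longleftrightarrow>
        (\<forall>m. isolated m P \<longrightarrow> norm (w - pt n P) \<le> norm (w - pt m P))" using mem by metis
      moreover have "pt n P \<in> P" using that mem by blast
      ultimately show ?thesis unfolding closest_points_def near_def by auto
    qed
    have ok: "ok ns P \<longleftrightarrow> (\<forall>n\<in>set ns. isolated n P) \<and> map (\<lambda>n. pt n P) ns \<in> h_paths h P x y" for ns
    proof (cases "ns \<noteq> [] \<and> (\<forall>n\<in>set ns. isolated n P)")
      case True
      then have "isolated (hd ns) P" "isolated (last ns) P" by auto
      moreover have "set (map (\<lambda>n. pt n P) ns) \<subseteq> P" using True mem by force
      ultimately show ?thesis using True cl[of "hd ns" x] cl[of "last ns" y]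
        unfolding ok_def h_paths_def by (auto simp: hd_map last_map less_diff_conv)
    qed (auto simp: ok_def h_paths_def)
    have len: "path_length (map (\<lambda>n. pt n P) ns) = len ns P" for ns
      unfolding path_length_def len_def by (auto intro!: sum.cong)
    show ?thesis
    proof (rule antisym)
      show "h_dist h P x y \<le> (INF ns. if ok ns P then ennreal (len ns P) else top)"
        using ok h_dist_le_path by (intro INF_greatest) (auto simp: len[symmetric])
      show "(INF ns. if ok ns P then ennreal (len ns P) else top) \<le> h_dist h P x y"
        unfolding h_dist_def
      proof (rule INF_greatest)
        fix p assume p: "p \<in> h_paths h P x y"
        have "\<forall>u\<in>set p. \<exists>n. isolated n P \<and> u = pt n P" using p by (auto simp: h_paths_def mem)
        then obtain g where g: "\<And>u. u \<in> set p \<Longrightarrow> isolated (g u) P" "\<And>u. u \<in> set p \<Longrightarrow> u = pt (g u) P"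
          by metis
        have "map (\<lambda>n. pt n P) (map g p) = p" using g(2) by (simp add: map_idI)
        then have "ok (map g p) P" "len (map g p) P = path_length p"
          using p g(1) by (auto simp: ok len[symmetric])
        then show "(INF ns. if ok ns P then ennreal (len ns P) else top) \<le> ennreal (path_length p)"
          by (intro INF_lower2[of "map g p"]) auto
      qed
    qed
  qed
  show ?thesis
    by (subst measurable_cong[OF eq], assumption, intro borel_measurable_INF) (auto, measurable)
qed

lemma measurable_h_dist [measurable (raw)]:
  "f \<in> measurable M cfg \<Longrightarrow> (\<lambda>\<omega>. h_dist h (f \<omega>) x y) \<in> borel_measurable M"
  using measurable_compose[OF _ measurable_h_dist_cfg] .

text \<open>Only the finitely many candidates in \<open>B\<close> matter, so the count on
  \<open>B\<close> is determined by the set \<open>W\<close> of those whose region is empty,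
  together with a count of \<open>P\<close>. The added points are removed from \<open>B\<close>
  before \<open>P\<close> is counted, since \<open>P\<close> may already contain some of
  them.\<close>

lemma measurable_fill:
  fixes Q :: "'i \<Rightarrow> 'b::euclidean_space set"
  assumes Q: "\<And>v. Q v \<in> sets borel" "\<And>v. bounded (Q v)" and c: "\<And>B. bounded B \<Longrightarrow> finite {v. c v \<in> B}"
  shows "(\<lambda>P. P \<union> {c v |v. Q v \<inter> P = {}}) \<in> measurable cfg cfg"
proof (rule measurable_cfgI)
  fix P :: "'b set" assume "P \<in> space cfg"
  then have P: "lfin P" by (simp add: space_cfg)
  have "finite ({c v |v. Q v \<inter> P = {}} \<inter> B)" if "bounded B" for B
    by (rule finite_subset[of _ "c ` {v. c v \<in> B}"]) (use c[OF that] in auto)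
  then show "lfin (P \<union> {c v |v. Q v \<inter> P = {}})"
    using P by (auto simp: lfin_def Int_Un_distrib2)
next
  fix B :: "'b set" assume B: "B \<in> sets borel" "bounded B"
  define V where "V = {v. c v \<in> B}"
  have V: "finite V" unfolding V_def using c B by blast
  let ?E = "\<lambda>P. P \<union> {c v |v. Q v \<inter> P = {}}"
  define S where "S W n = {P \<in> space cfg. (\<forall>v\<in>V. card (P \<inter> Q v) = 0 \<longleftrightarrow> v \<in> W) \<and>
     card (P \<inter> (B - c ` W)) + card (c ` W) = n}" for W n
  have cnt: "card (?E P \<inter> B) = card (P \<inter> (B - c ` W)) + card (c ` W)"
    if "P \<in> space cfg" "W = {v \<in> V. Q v \<inter> P = {}}" for P W
  proof -
    have "?E P \<inter> B = (P \<inter> (B - c ` W)) \<union> c ` W" using that by (auto simp: V_def)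
    moreover have "finite (P \<inter> (B - c ` W))" using that B by (auto simp: space_cfg lfin_def intro: bounded_subset)
    moreover have "finite (c ` W)" using V that by auto
    ultimately show ?thesis by (simp add: card_Un_disjoint disjoint_iff)
  qed
  have zero: "card (P \<inter> Q v) = 0 \<longleftrightarrow> Q v \<inter> P = {}" if "P \<in> space cfg" for P v
    using that Q(2)[of v] by (auto simp: space_cfg lfin_def)
  have "S W n \<in> sets cfg" if "W \<subseteq> V" for W n
  proof -
    have "finite W" using that V by (rule finite_subset)
    then have "c ` W \<in> sets borel" by (intro borel_closed finite_imp_closed finite_imageI)
    then have BW: "B - c ` W \<in> sets borel" "bounded (B - c ` W)"
      using B by (auto intro: bounded_subset)
    note [measurable] = measurable_card[OF BW measurable_ident_sets[OF refl]]
      measurable_card[OF Q measurable_ident_sets[OF refl]]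
    show ?thesis unfolding S_def using V by measurable
  qed
  moreover have "{P \<in> space cfg. card (?E P \<inter> B) = n} = (\<Union>W\<in>Pow V. S W n)" for n
  proof (intro set_eqI iffI)
    fix P assume "P \<in> {P \<in> space cfg. card (?E P \<inter> B) = n}"
    then show "P \<in> (\<Union>W\<in>Pow V. S W n)"
      using cnt[of P "{v \<in> V. Q v \<inter> P = {}}"] zero[of P]
      by (intro UN_I[of "{v \<in> V. Q v \<inter> P = {}}"]) (auto simp: S_def)
  next
    fix P assume "P \<in> (\<Union>W\<in>Pow V. S W n)"
    then obtain W where W: "W \<subseteq> V" "P \<in> S W n" by blast
    then have "W = {v \<in> V. Q v \<inter> P = {}}" using zero[of P] unfolding S_def by blast
    then show "P \<in> {P \<in> space cfg. card (?E P \<inter> B) = n}"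
      using cnt[of P W] W by (auto simp: S_def)
  qed
  ultimately have "{P \<in> space cfg. card (?E P \<inter> B) = n} \<in> sets cfg" for n
    using V by (auto intro!: sets.finite_UN)
  then show "(\<lambda>P. card (?E P \<inter> B)) \<in> measurable cfg (count_space UNIV)"
    by (subst measurable_count_space_eq2_countable) (auto simp: vimage_def Int_def conj_commute)
qed

subsection \<open>The law of a Poisson point process\<close>

text \<open>Conditions on a single count are not stable under intersection, so finitely many counts
  are constrained at once.\<close>

definition count_events :: "'b::euclidean_space set set set" where
  "count_events = {{P. lfin P \<and> (\<forall>B\<in>F. card (P \<inter> B) \<in> S B)} |F S.
     finite F \<and> (\<forall>B\<in>F. B \<in> sets borel \<and> bounded B)}"

lemma Int_stable_count_events: "Int_stable (count_events :: 'b::euclidean_space set set set)"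
proof (rule Int_stableI)
  fix a b :: "'b set set" assume "a \<in> count_events" "b \<in> count_events"
  then obtain F S G T where a: "a = {P. lfin P \<and> (\<forall>B\<in>F. card (P \<inter> B) \<in> S B)}" "finite F"
      "\<forall>B\<in>F. B \<in> sets borel \<and> bounded B"
    and b: "b = {P. lfin P \<and> (\<forall>B\<in>G. card (P \<inter> B) \<in> T B)}" "finite G"
      "\<forall>B\<in>G. B \<in> sets borel \<and> bounded B"
    unfolding count_events_def by blast
  define R where "R B = (if B \<in> F then S B else UNIV) \<inter> (if B \<in> G then T B else UNIV)" for B
  have "a \<inter> b = {P. lfin P \<and> (\<forall>B\<in>F \<union> G. card (P \<inter> B) \<in> R B)}"
    unfolding a(1) b(1) R_def by auto
  moreover have "finite (F \<union> G)" "\<forall>B\<in>F \<union> G. B \<in> sets borel \<and> bounded B" using a b by auto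
  ultimately show "a \<inter> b \<in> count_events"
    unfolding count_events_def by (intro CollectI exI[of _ "F \<union> G"] exI[of _ R] conjI)
qed

lemma space_in_count_events: "{P. lfin P} \<in> count_events"
  unfolding count_events_def by (rule CollectI, intro exI[of _ "{}"]) auto

lemma count_events_closed: "count_events \<subseteq> Pow {P. lfin P}"
  unfolding count_events_def by auto

lemma sets_cfg_count_events: "sets (cfg :: 'b::euclidean_space set measure) = sigma_sets {P. lfin P} count_events"
  unfolding sets_cfg
proof (rule sigma_sets_eqI)
  fix a assume "a \<in> {{P. lfin P \<and> card (P \<inter> B) = n} |B n. B \<in> sets borel \<and> bounded (B :: 'b set)}"
  then obtain B n where a: "a = {P. lfin P \<and> card (P \<inter> B) = n}" "B \<in> sets borel" "bounded B" by blast
  then have "a = {P. lfin P \<and> (\<forall>B\<in>{B}. card (P \<inter> B) \<in> {n})}" by auto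
  then have "a \<in> count_events" unfolding count_events_def
    using a by (intro CollectI exI[of _ "{B}"] exI[of _ "\<lambda>_. {n}"]) auto
  then show "a \<in> sigma_sets {P. lfin P} count_events" by (rule sigma_sets.Basic)
next
  fix a :: "'b set set" assume "a \<in> count_events"
  then obtain F S where a: "a = {P. lfin P \<and> (\<forall>B\<in>F. card (P \<inter> B) \<in> S B)}" "finite F"
      "\<forall>B\<in>F. B \<in> sets borel \<and> bounded B"
    unfolding count_events_def by blast
  have [measurable]: "(\<lambda>P. card (P \<inter> B)) \<in> measurable cfg (count_space UNIV)" if "B \<in> F" for B
    using a that by (intro measurable_card measurable_ident_sets) auto
  have "{P \<in> space cfg. \<forall>B\<in>F. card (P \<inter> B) \<in> S B} \<in> sets cfg"
    using a(2) by measurable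
  then show "a \<in> sigma_sets {P. lfin P} {{P. lfin P \<and> card (P \<inter> B) = n} |B n. B \<in> sets borel \<and> bounded B}"
    unfolding sets_cfg[symmetric] a(1) by (simp add: space_cfg)
qed

text \<open>Counts on finitely many sets are read off the counts on the atoms of the generated algebra,
  to which the independence assumption applies.\<close>
definition atom :: "'b set set \<Rightarrow> 'b set set \<Rightarrow> 'b set" where
  "atom F J = \<Inter>J - \<Union>(F - J)"

text \<open>The empty index is left out because its atom would be the complement of the union of
  \<open>F\<close>, which is not bounded when the sets of \<open>F\<close> are.\<close>

definition nonempty_subsets :: "'b set \<Rightarrow> 'b set set" where
  "nonempty_subsets F = Pow F - {{}}"

lemma finite_nonempty_subsets [simp]: "finite F \<Longrightarrow> finite (nonempty_subsets F)"
  by (simp add: nonempty_subsets_def)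

lemma atom_borel:
  fixes F :: "'b::euclidean_space set set"
  assumes "finite F" "\<And>B. B \<in> F \<Longrightarrow> B \<in> sets borel \<and> bounded B" "J \<in> nonempty_subsets F"
  shows "atom F J \<in> sets borel" "bounded (atom F J)"
proof -
  have J: "J \<subseteq> F" "J \<noteq> {}" "finite J" using assms finite_subset by (auto simp: nonempty_subsets_def)
  have "(\<Inter>B\<in>J. B) \<in> sets borel"
    using J assms(2) by (intro sets.finite_INT) auto
  then have "\<Inter>J \<in> sets borel" by simp
  moreover have "\<Union>(F - J) \<in> sets borel"
    using assms(1,2) by (intro sets.finite_Union) auto
  ultimately show "atom F J \<in> sets borel" unfolding atom_def by (rule sets.Diff)
  obtain B where B: "B \<in> J" using J by blast
  then have "bounded B" using assms(2) J(1) by blast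
  moreover have "atom F J \<subseteq> B" using B by (auto simp: atom_def)
  ultimately show "bounded (atom F J)" by (rule bounded_subset)
qed

lemma disjoint_atoms: "disjoint_family_on (atom F) (nonempty_subsets F)"
  unfolding disjoint_family_on_def
proof (intro ballI impI)
  fix J K assume JK: "J \<in> nonempty_subsets F" "K \<in> nonempty_subsets F" "J \<noteq> K"
  then obtain B where "B \<in> F" "(B \<in> J) \<noteq> (B \<in> K)" by (auto simp: nonempty_subsets_def)
  then show "atom F J \<inter> atom F K = {}" unfolding atom_def by blast
qed

lemma card_atoms:
  assumes "lfin P" "finite F" "\<And>B. B \<in> F \<Longrightarrow> bounded B" "B \<in> F"
  shows "card (P \<inter> B) = (\<Sum>J\<in>{J \<in> nonempty_subsets F. B \<in> J}. card (P \<inter> atom F J))"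
proof -
  have "P \<inter> B = (\<Union>J\<in>{J \<in> nonempty_subsets F. B \<in> J}. P \<inter> atom F J)"
  proof (intro set_eqI iffI)
    fix x assume "x \<in> P \<inter> B"
    then have "{B' \<in> F. x \<in> B'} \<in> {J \<in> nonempty_subsets F. B \<in> J}" "x \<in> P \<inter> atom F {B' \<in> F. x \<in> B'}"
      using assms(4) by (auto simp: nonempty_subsets_def atom_def)
    then show "x \<in> (\<Union>J\<in>{J \<in> nonempty_subsets F. B \<in> J}. P \<inter> atom F J)" by blast
  qed (auto simp: atom_def)
  moreover have "finite (P \<inter> atom F J)" if "J \<in> {J \<in> nonempty_subsets F. B \<in> J}" for J
  proof -
    have "atom F J \<subseteq> B" using that by (auto simp: atom_def)
    then show ?thesis using assms by (metis bounded_subset lfin_def)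
  qed
  moreover have "(P \<inter> atom F J) \<inter> (P \<inter> atom F K) = {}"
    if "J \<in> {J \<in> nonempty_subsets F. B \<in> J}" "K \<in> {J \<in> nonempty_subsets F. B \<in> J}" "J \<noteq> K" for J K
    using disjoint_atoms[of F] that by (auto simp: disjoint_family_on_def)
  ultimately show ?thesis using assms(2)
    by (simp only:) (intro card_UN_disjoint; auto)
qed

text \<open>The independence in the definition of a Poisson process is stated for index sets of
  natural numbers; this transports it to arbitrary finite index sets.\<close>

lemma (in prob_space) indep_vars_reindex:
  assumes "inj_on f I" "indep_vars M' X (f ` I)"
  shows "indep_vars (\<lambda>i. M' (f i)) (\<lambda>i. X (f i)) I"
  unfolding indep_vars_def2
proof (intro conjI ballI indep_setsI)
  fix i assume "i \<in> I"
  then show rv: "random_variable (M' (f i)) (X (f i))"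
    using assms(2) unfolding indep_vars_def2 by blast
  then show "{X (f i) -` A \<inter> space M |A. A \<in> sets (M' (f i))} \<subseteq> events"
    by (auto intro: measurable_sets)
next
  fix A J assume J: "J \<noteq> {}" "J \<subseteq> I" "finite J"
    and A: "\<forall>j\<in>J. A j \<in> {X (f j) -` A \<inter> space M |A. A \<in> sets (M' (f j))}"
  have inj: "inj_on f J" using assms(1) J(2) by (rule inj_on_subset)
  define A' where "A' j = A (the_inv_into J f j)" for j
  have A': "A' (f j) = A j" if "j \<in> J" for j using inj that by (simp add: A'_def the_inv_into_f_f)
  have "indep_sets (\<lambda>i. {X i -` A \<inter> space M |A. A \<in> sets (M' i)}) (f ` I)"
    using assms(2) unfolding indep_vars_def2 by blast
  then have "prob (\<Inter>j\<in>f ` J. A' j) = (\<Prod>j\<in>f ` J. prob (A' j))"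
    by (rule indep_setsD) (use J A A' in auto)
  then show "prob (\<Inter>j\<in>J. A j) = (\<Prod>j\<in>J. prob (A j))"
    using A' by (simp add: prod.reindex[OF inj])
qed

locale poisson =
  fixes M :: "'a measure" and X :: "'a \<Rightarrow> (real ^ 'n::finite) set"
  assumes ppp: "poisson_point_process M X"
begin

sublocale prob_space M using ppp by (simp add: poisson_point_process_def)

lemma lfin_X: "\<omega> \<in> space M \<Longrightarrow> lfin (X \<omega>)"
  using ppp by (simp add: poisson_point_process_def lfin_def)

lemma X_measurable [measurable]: "X \<in> measurable M cfg"
  using ppp lfin_X by (intro measurable_cfgI) (auto simp: poisson_point_process_def)

lemma prob_count:
  "B \<in> sets borel \<Longrightarrow> bounded B \<Longrightarrow>
    prob {\<omega> \<in> space M. card (X \<omega> \<inter> B) = n} = measure lborel B ^ n / fact n * exp (- measure lborel B)"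
  using ppp by (simp add: poisson_point_process_def)

lemma indep_counts:
  fixes I :: "'i set"
  assumes "finite I" "\<And>i. i \<in> I \<Longrightarrow> B i \<in> sets borel" "\<And>i. i \<in> I \<Longrightarrow> bounded (B i)" "disjoint_family_on B I"
  shows "indep_vars (\<lambda>_. count_space UNIV) (\<lambda>i \<omega>. card (X \<omega> \<inter> B i)) I"
proof -
  obtain f :: "'i \<Rightarrow> nat" where f: "inj_on f I"
    using finite_imp_inj_to_nat_seg[OF assms(1)] by blast
  define B' where "B' j = B (inv_into I f j)" for j
  have B': "B' (f i) = B i" if "i \<in> I" for i using f that by (simp add: B'_def)
  have "disjoint_family_on B' (f ` I)"
    unfolding disjoint_family_on_def
  proof safe
    fix i j x assume "i \<in> I" "j \<in> I" "f i \<noteq> f j" "x \<in> B' (f i)" "x \<in> B' (f j)"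
    moreover from this have "B i \<inter> B j = {}"
      using assms(4) unfolding disjoint_family_on_def by metis
    ultimately show "x \<in> {}" using B' by blast
  qed
  then have "indep_vars (\<lambda>_. count_space UNIV) (\<lambda>i \<omega>. card (X \<omega> \<inter> B' i)) (f ` I)"
    using ppp assms B' unfolding poisson_point_process_def by auto
  from indep_vars_reindex[OF f this] show ?thesis
    by (rule indep_vars_cong[THEN iffD1, rotated -1]) (auto simp: B')
qed

lemma distr_counts:
  assumes "finite I" "\<And>i. i \<in> I \<Longrightarrow> B i \<in> sets borel" "\<And>i. i \<in> I \<Longrightarrow> bounded (B i)" "disjoint_family_on B I"
    "I \<noteq> {}"
  shows "distr M (PiM I (\<lambda>_. count_space UNIV)) (\<lambda>\<omega>. \<lambda>i\<in>I. card (X \<omega> \<inter> B i)) =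
    PiM I (\<lambda>i. distr M (count_space UNIV) (\<lambda>\<omega>. card (X \<omega> \<inter> B i)))"
proof (subst indep_vars_iff_distr_eq_PiM'[symmetric])
  show "indep_vars (\<lambda>_. count_space UNIV) (\<lambda>i \<omega>. card (X \<omega> \<inter> B i)) I"
    using assms by (intro indep_counts)
  show "(\<lambda>\<omega>. card (X \<omega> \<inter> B i)) \<in> measurable M (count_space UNIV)" if "i \<in> I" for i
    using assms that by measurable
qed (use assms in auto)

end

lemma distr_count_unique:
  fixes X :: "'a \<Rightarrow> (real ^ 'n::finite) set" and X' :: "'b \<Rightarrow> (real ^ 'n) set"
  assumes "poisson M X" "poisson M' X'" and B: "B \<in> sets borel" "bounded B"
  shows "distr M (count_space UNIV) (\<lambda>\<omega>. card (X \<omega> \<inter> B)) =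
    distr M' (count_space UNIV) (\<lambda>\<omega>. card (X' \<omega> \<inter> B))"
proof -
  interpret P: poisson M X by fact
  interpret P': poisson M' X' by fact
  note [measurable] = measurable_card[OF B]
  show ?thesis
  proof (rule measure_eqI_countable[of _ UNIV])
    fix n :: nat
    have v: "(\<lambda>\<omega>. card (X \<omega> \<inter> B)) -` {n} \<inter> space M = {\<omega> \<in> space M. card (X \<omega> \<inter> B) = n}"
      "(\<lambda>\<omega>. card (X' \<omega> \<inter> B)) -` {n} \<inter> space M' = {\<omega> \<in> space M'. card (X' \<omega> \<inter> B) = n}" by auto
    show "emeasure (distr M (count_space UNIV) (\<lambda>\<omega>. card (X \<omega> \<inter> B))) {n} =
        emeasure (distr M' (count_space UNIV) (\<lambda>\<omega>. card (X' \<omega> \<inter> B))) {n}"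
      using P.prob_count[OF B, of n] P'.prob_count[OF B, of n]
      by (simp add: emeasure_distr v P.emeasure_eq_measure P'.emeasure_eq_measure)
  qed auto
qed

text \<open>The counts on disjoint atoms are independent with prescribed distributions, so their
  joint law is a fixed product measure. Counts on arbitrary bounded Borel sets are sums over atoms,
  and the events they describe form an intersection-stable generator.\<close>

theorem poisson_law_unique:
  fixes X :: "'a \<Rightarrow> (real ^ 'n::finite) set" and X' :: "'b \<Rightarrow> (real ^ 'n) set"
  assumes PX: "poisson M X" "poisson M' X'"
  shows "distr M cfg X = distr M' cfg X'"
proof -
  interpret P: poisson M X by fact
  interpret P': poisson M' X' by fact
  interpret D: prob_space "distr M cfg X" by (rule P.prob_space_distr) measurable
  have eq: "emeasure (distr M cfg X) A = emeasure (distr M' cfg X') A" if A: "A \<in> count_events" for A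
  proof -
    obtain F S where F: "A = {P. lfin P \<and> (\<forall>B\<in>F. card (P \<inter> B) \<in> S B)}" "finite F"
      "\<forall>B\<in>F. B \<in> sets borel \<and> bounded B"
      using A unfolding count_events_def by blast
    let ?J = "nonempty_subsets F"
    show ?thesis
    proof (cases "F = {}")
      \<comment> \<open>Without constraints the event is the whole space; the product form of the
        joint law is available for nonempty index sets.\<close>
      case True
      have "X -` {P. lfin P} \<inter> space M = space M" "X' -` {P. lfin P} \<inter> space M' = space M'"
        using P.lfin_X P'.lfin_X by auto
      then have "emeasure M (X -` {P. lfin P} \<inter> space M) = 1"
        "emeasure M' (X' -` {P. lfin P} \<inter> space M') = 1"
        using P.emeasure_space_1 P'.emeasure_space_1 by simp_all
      moreover have "{P. lfin P} \<in> sets (cfg :: (real ^ 'n) set measure)"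
        unfolding sets_cfg_count_events using space_in_count_events by (rule sigma_sets.Basic)
      ultimately show ?thesis using True F(1) by (simp add: emeasure_distr)
    next
      case False
      then have ne: "?J \<noteq> {}" by (auto simp: nonempty_subsets_def)
      have at: "atom F J \<in> sets borel" "bounded (atom F J)" if "J \<in> ?J" for J
        using atom_borel[OF F(2) _ that] F(3) by auto
      define T where "T = {k \<in> space (PiM ?J (\<lambda>_. count_space (UNIV :: nat set))).
        \<forall>B\<in>F. (\<Sum>J\<in>{J \<in> ?J. B \<in> J}. k J) \<in> S B}"
      have [measurable]: "T \<in> sets (PiM ?J (\<lambda>_. count_space (UNIV :: nat set)))"
        unfolding T_def using F(2) by measurable
      have *: "emeasure (distr N cfg Z) A =
          emeasure (PiM ?J (\<lambda>J. distr N (count_space UNIV) (\<lambda>\<omega>. card (Z \<omega> \<inter> atom F J)))) T"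
        if "poisson N Z" for N :: "'z measure" and Z :: "'z \<Rightarrow> (real ^ 'n) set"
      proof -
        interpret Z: poisson N Z by fact
        have [measurable]: "(\<lambda>\<omega>. card (Z \<omega> \<inter> atom F J)) \<in> measurable N (count_space UNIV)"
          if "J \<in> ?J" for J by (intro measurable_card at that) measurable
        have "A \<in> sets cfg" unfolding sets_cfg_count_events using A by (rule sigma_sets.Basic)
        then have "emeasure (distr N cfg Z) A = emeasure N (Z -` A \<inter> space N)"
          by (simp add: emeasure_distr)
        also have "Z -` A \<inter> space N = (\<lambda>\<omega>. \<lambda>J\<in>?J. card (Z \<omega> \<inter> atom F J)) -` T \<inter> space N"
        proof (intro set_eqI iffI)
          fix \<omega>
          assume w: "\<omega> \<in> Z -` A \<inter> space N"
          then have "(\<Sum>J\<in>{J \<in> ?J. B \<in> J}. card (Z \<omega> \<inter> atom F J)) \<in> S B" if "B \<in> F" for B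
            using card_atoms[OF Z.lfin_X F(2), of \<omega> B] F that by auto
          then show "\<omega> \<in> (\<lambda>\<omega>. \<lambda>J\<in>?J. card (Z \<omega> \<inter> atom F J)) -` T \<inter> space N"
            using w by (auto simp: T_def space_PiM)
        next
          fix \<omega>
          assume w: "\<omega> \<in> (\<lambda>\<omega>. \<lambda>J\<in>?J. card (Z \<omega> \<inter> atom F J)) -` T \<inter> space N"
          then have "card (Z \<omega> \<inter> B) \<in> S B" if "B \<in> F" for B
            using card_atoms[OF Z.lfin_X F(2), of \<omega> B] F that by (auto simp: T_def)
          then show "\<omega> \<in> Z -` A \<inter> space N" using w Z.lfin_X by (auto simp: F(1))
        qed
        also have "emeasure N \<dots> = emeasure (distr N (PiM ?J (\<lambda>_. count_space UNIV)) (\<lambda>\<omega>. \<lambda>J\<in>?J. card (Z \<omega> \<inter> atom F J))) T"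
          by (rule emeasure_distr[symmetric]) measurable
        also have "distr N (PiM ?J (\<lambda>_. count_space UNIV)) (\<lambda>\<omega>. \<lambda>J\<in>?J. card (Z \<omega> \<inter> atom F J)) =
            PiM ?J (\<lambda>J. distr N (count_space UNIV) (\<lambda>\<omega>. card (Z \<omega> \<inter> atom F J)))"
          using at F disjoint_atoms ne by (intro Z.distr_counts) auto
        finally show ?thesis .
      qed
      have "PiM ?J (\<lambda>J. distr M (count_space UNIV) (\<lambda>\<omega>. card (X \<omega> \<inter> atom F J))) =
        PiM ?J (\<lambda>J. distr M' (count_space UNIV) (\<lambda>\<omega>. card (X' \<omega> \<inter> atom F J)))"
        using at F by (intro PiM_cong refl distr_count_unique PX) auto
      then show ?thesis by (simp add: *[OF PX(1)] *[OF PX(2)])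
    qed
  qed
  show ?thesis
  proof (rule measure_eqI_generator_eq[OF Int_stable_count_events count_events_closed eq])
    show "range (\<lambda>_::nat. {P. lfin P}) \<subseteq> (count_events :: (real ^ 'n) set set set)"
      using space_in_count_events by auto
  qed (auto simp: sets_cfg_count_events)
qed

section \<open>Invariance of the volume under orthogonal maps\<close>

lemma nn_integral_lborel_reflect:
  fixes g :: "'b::euclidean_space \<Rightarrow> ennreal"
  assumes [measurable]: "g \<in> borel_measurable borel" and c: "\<bar>c\<bar> = 1"
  shows "(\<integral>\<^sup>+x. g (t + c *\<^sub>R x) \<partial>lborel) = (\<integral>\<^sup>+x. g x \<partial>lborel)"
proof -
  have "c \<noteq> 0" using c by auto
  from arg_cong[OF lborel_affine[OF this, of t], of "\<lambda>N. integral\<^sup>N N g"] show ?thesis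
    using c by (simp add: nn_integral_density nn_integral_distr)
qed

text \<open>Uniqueness of the translation invariant measure by Fubini's theorem: both sides multiplied by
  the volume of a ball are the volume of \<open>{(x, y). f x \<in> A \<and> f x + y \<in> ball 0 1}\<close>.\<close>
lemma emeasure_lborel_orthogonal_vimage:
  fixes f :: "'b::euclidean_space \<Rightarrow> 'b"
  assumes f: "orthogonal_transformation f" and [measurable]: "A \<in> sets borel"
  shows "emeasure lborel (f -` A) = emeasure lborel A"
proof -
  have lin: "linear f" using f by (rule orthogonal_transformation_linear)
  have [measurable]: "f \<in> borel_measurable borel"
    using lin by (intro borel_measurable_continuous_onI linear_continuous_on) (simp add: linear_conv_bounded_linear)
  have vm: "f -` S \<in> sets borel" if "S \<in> sets borel" for S
    using measurable_sets[of f borel borel S] that by simp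
  have ind: "indicator S (f x) = (indicator (f -` S) x :: ennreal)" for S x
    by (simp add: indicator_def)
  let ?B = "ball (0 :: 'b) 1"
  have [measurable]: "?B \<in> sets borel" by simp
  have B: "f -` ?B = ?B" using f by (auto simp: orthogonal_transformation_norm)
  define I where "I = (\<integral>\<^sup>+y. (\<integral>\<^sup>+x. indicator A (f x) * indicator ?B (f x + y) \<partial>lborel) \<partial>lborel)"
  have I1: "I = emeasure lborel (f -` A) * emeasure lborel ?B"
  proof -
    have "I = (\<integral>\<^sup>+x. (\<integral>\<^sup>+y. indicator A (f x) * indicator ?B (f x + 1 *\<^sub>R y) \<partial>lborel) \<partial>lborel)"
      unfolding I_def scaleR_one by (rule lborel_pair.Fubini') measurable
    also have "\<dots> = (\<integral>\<^sup>+x. indicator A (f x) * emeasure lborel ?B \<partial>lborel)"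
      by (subst nn_integral_cmult, measurable) (subst nn_integral_lborel_reflect, auto)
    also have "\<dots> = (\<integral>\<^sup>+x. indicator (f -` A) x \<partial>lborel) * emeasure lborel ?B"
      unfolding ind using vm by (intro nn_integral_multc) auto
    finally show ?thesis using vm by simp
  qed
  have I2: "I = emeasure lborel A * emeasure lborel ?B"
  proof -
    have "(\<integral>\<^sup>+x. indicator A (f x) * indicator ?B (f x + y) \<partial>lborel) =
      (\<integral>\<^sup>+x. indicator A (f x + (-1) *\<^sub>R y) * indicator ?B (f x) \<partial>lborel)" for y :: 'b
    proof -
      \<comment> \<open>Translating \<open>x\<close> by the preimage of \<open>y\<close> moves the
        shift from the ball to \<open>A\<close>. Afterwards the integral over \<open>y\<close> gives
        the volume of a reflected translate of \<open>A\<close>, and the integral over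
        \<open>x\<close> gives the volume of the ball.\<close>
      obtain w where w: "f w = y" using orthogonal_transformation_surj[OF f] by (metis surjD)
      define g :: "'b \<Rightarrow> ennreal" where "g x = indicator A (f x) * indicator ?B (f x + y)" for x
      have [measurable]: "g \<in> borel_measurable borel" unfolding g_def by measurable
      have "(\<integral>\<^sup>+x. g x \<partial>lborel) = (\<integral>\<^sup>+x. g (- w + 1 *\<^sub>R x) \<partial>lborel)"
        by (rule nn_integral_lborel_reflect[symmetric]) auto
      also have "\<dots> = (\<integral>\<^sup>+x. indicator A (f x + (-1) *\<^sub>R y) * indicator ?B (f x) \<partial>lborel)"
        by (simp add: g_def linear_diff[OF lin] w)
      finally show ?thesis by (simp add: g_def)
    qed
    then have "I = (\<integral>\<^sup>+y. (\<integral>\<^sup>+x. indicator A (f x + (-1) *\<^sub>R y) * indicator ?B (f x) \<partial>lborel) \<partial>lborel)"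
      by (simp add: I_def)
    also have "\<dots> = (\<integral>\<^sup>+x. (\<integral>\<^sup>+y. indicator A (f x + (-1) *\<^sub>R y) * indicator ?B (f x) \<partial>lborel) \<partial>lborel)"
      by (rule lborel_pair.Fubini') measurable
    also have "\<dots> = (\<integral>\<^sup>+x. emeasure lborel A * indicator ?B (f x) \<partial>lborel)"
      by (subst nn_integral_multc, measurable) (subst nn_integral_lborel_reflect, auto)
    also have "\<dots> = emeasure lborel A * (\<integral>\<^sup>+x. indicator (f -` ?B) x \<partial>lborel)"
      unfolding ind using vm by (intro nn_integral_cmult) auto
    finally show ?thesis unfolding B by simp
  qed
  have "emeasure lborel ?B \<noteq> 0" "emeasure lborel ?B \<noteq> top"
    using emeasure_lborel_ball_finite[of 0 1] content_ball_pos[of 1 "0 :: 'b"]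
    by (auto simp: measure_def)
  then show ?thesis using I1 I2 by (metis ennreal_mult_cancel_left mult.commute)
qed

context poisson
begin

text \<open>It suffices to test events given by finitely many counts. Intersecting the atoms for
  each \<open>v\<close> with the region \<open>Q v\<close> yields one finite disjoint family for all
  \<open>v\<close>; its counts are independent and can be grouped by \<open>v\<close>.\<close>

theorem indep_restrictions:
  fixes Q :: "'v \<Rightarrow> (real ^ 'n) set"
  assumes "finite V" "\<And>v. v \<in> V \<Longrightarrow> Q v \<in> sets borel" "\<And>v. v \<in> V \<Longrightarrow> bounded (Q v)"
    "disjoint_family_on Q V" "V \<noteq> {}"
  shows "indep_vars (\<lambda>_. cfg) (\<lambda>v \<omega>. X \<omega> \<inter> Q v) V"
proof (subst indep_vars_finite[where E = "\<lambda>_. count_events"])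
  show "\<forall>A\<in>\<Pi> v\<in>V. count_events. prob (\<Inter>v\<in>V. (\<lambda>\<omega>. X \<omega> \<inter> Q v) -` A v \<inter> space M) =
     (\<Prod>v\<in>V. prob ((\<lambda>\<omega>. X \<omega> \<inter> Q v) -` A v \<inter> space M))"
  proof
    fix A :: "'v \<Rightarrow> (real ^ 'n) set set" assume "A \<in> (\<Pi> v\<in>V. count_events)"
    then have "\<forall>v\<in>V. \<exists>F S. A v = {P. lfin P \<and> (\<forall>B\<in>F. card (P \<inter> B) \<in> S B)} \<and> finite F \<and>
      (\<forall>B\<in>F. B \<in> sets borel \<and> bounded B)"
      unfolding count_events_def by (fastforce simp: Pi_iff)
    from bchoice[OF this] obtain F where
      "\<forall>v\<in>V. \<exists>S. A v = {P. lfin P \<and> (\<forall>B\<in>F v. card (P \<inter> B) \<in> S B)} \<and> finite (F v) \<and>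
      (\<forall>B\<in>F v. B \<in> sets borel \<and> bounded B)" ..
    from bchoice[OF this] obtain S where
      "\<forall>v\<in>V. A v = {P. lfin P \<and> (\<forall>B\<in>F v. card (P \<inter> B) \<in> S v B)} \<and> finite (F v) \<and>
      (\<forall>B\<in>F v. B \<in> sets borel \<and> bounded B)" ..
    then have F: "\<And>v. v \<in> V \<Longrightarrow> A v = {P. lfin P \<and> (\<forall>B\<in>F v. card (P \<inter> B) \<in> S v B)}"
      "\<And>v. v \<in> V \<Longrightarrow> finite (F v)" "\<And>v B. v \<in> V \<Longrightarrow> B \<in> F v \<Longrightarrow> B \<in> sets borel \<and> bounded B"
      by blast+
    define K where "K v = {v} \<times> nonempty_subsets (F v)" for v
    define cl where "cl p = atom (F (fst p)) (snd p) \<inter> Q (fst p)" for p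
    define Y where "Y p \<omega> = card (X \<omega> \<inter> cl p)" for p \<omega>
    have cl: "cl p \<in> sets borel \<and> bounded (cl p)" if "p \<in> (\<Union>v\<in>V. K v)" for p
    proof -
      obtain v J where p: "p = (v, J)" "v \<in> V" "J \<in> nonempty_subsets (F v)" using \<open>p \<in> _\<close> by (auto simp: K_def)
      show ?thesis using atom_borel[OF F(2)[OF p(2)] F(3)[OF p(2)] p(3)] p assms(2)[of v]
        by (auto simp: cl_def intro: bounded_subset)
    qed
    have dj: "disjoint_family_on cl (\<Union>v\<in>V. K v)"
      unfolding disjoint_family_on_def
    proof (intro ballI impI)
      fix p q assume "p \<in> (\<Union>v\<in>V. K v)" "q \<in> (\<Union>v\<in>V. K v)" "p \<noteq> q"
      then obtain v J w L where pq: "p = (v, J)" "q = (w, L)" "v \<in> V" "w \<in> V" "(v, J) \<noteq> (w, L)"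
        "J \<in> nonempty_subsets (F v)" "L \<in> nonempty_subsets (F w)"
        unfolding K_def by blast
      show "cl p \<inter> cl q = {}"
      proof (cases "v = w")
        case True
        then have "atom (F v) J \<inter> atom (F v) L = {}"
          using pq disjoint_atoms[of "F v", unfolded disjoint_family_on_def] by blast
        then show ?thesis using True unfolding cl_def pq by auto
      next
        case False
        then have "Q v \<inter> Q w = {}" using assms(4) pq unfolding disjoint_family_on_def by blast
        then show ?thesis unfolding cl_def pq by auto
      qed
    qed
    have fin: "finite (\<Union>v\<in>V. K v)" using assms(1) F(2) by (auto simp: K_def)
    have ind: "indep_vars (\<lambda>_. count_space UNIV) Y (\<Union>v\<in>V. K v)"
      unfolding Y_def using fin cl dj by (intro indep_counts) auto
    have ind2: "indep_vars (\<lambda>v. PiM (K v) (\<lambda>_. count_space UNIV)) (\<lambda>v \<omega>. restrict (\<lambda>p. Y p \<omega>) (K v)) V"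
      by (rule indep_vars_restrict[OF ind]) (auto simp: disjoint_family_on_def K_def)
    define T where "T v = {k \<in> space (PiM (K v) (\<lambda>_. count_space (UNIV :: nat set))).
        \<forall>B\<in>F v. (\<Sum>J\<in>{J \<in> nonempty_subsets (F v). B \<in> J}. k (v, J)) \<in> S v B}" for v
    have T: "T v \<in> sets (PiM (K v) (\<lambda>_. count_space UNIV))" if "v \<in> V" for v
    proof -
      have [measurable]: "(\<lambda>k. k (v, J)) \<in> measurable (PiM (K v) (\<lambda>_. count_space (UNIV :: nat set))) (count_space UNIV)"
        if "J \<in> nonempty_subsets (F v)" for J
        using that by (intro measurable_component_singleton) (auto simp: K_def)
      show ?thesis unfolding T_def using F(2)[OF that] by measurable
    qed
    have eq: "(\<lambda>\<omega>. X \<omega> \<inter> Q v) -` A v \<inter> space M = (\<lambda>\<omega>. restrict (\<lambda>p. Y p \<omega>) (K v)) -` T v \<inter> space M"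
      if v: "v \<in> V" for v
    proof -
      have lf: "lfin (X \<omega> \<inter> Q v)" if "\<omega> \<in> space M" for \<omega>
        using lfin_X[OF that] by (auto simp: lfin_def Int_assoc intro: finite_subset[of _ "X \<omega> \<inter> _"])
      have *: "card (X \<omega> \<inter> Q v \<inter> B) = (\<Sum>J\<in>{J \<in> nonempty_subsets (F v). B \<in> J}. Y (v, J) \<omega>)"
        if "\<omega> \<in> space M" "B \<in> F v" for \<omega> B
        using card_atoms[OF lf[OF that(1)] F(2)[OF v], of B] F(3)[OF v] that
        by (simp add: Y_def cl_def Int_ac)
      have "restrict (\<lambda>p. Y p \<omega>) (K v) \<in> T v \<longleftrightarrow>
        (\<forall>B\<in>F v. (\<Sum>J\<in>{J \<in> nonempty_subsets (F v). B \<in> J}. Y (v, J) \<omega>) \<in> S v B)" for \<omega>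
        by (auto simp: T_def space_PiM K_def intro!: sum.cong)
      then show ?thesis using * lf by (auto simp: F(1)[OF v])
    qed
    have "prob (\<Inter>v\<in>V. (\<lambda>\<omega>. X \<omega> \<inter> Q v) -` A v \<inter> space M) =
        prob (\<Inter>v\<in>V. (\<lambda>\<omega>. restrict (\<lambda>p. Y p \<omega>) (K v)) -` T v \<inter> space M)"
      using eq by (intro arg_cong[where f = prob] INF_cong) auto
    also have "\<dots> = (\<Prod>v\<in>V. prob ((\<lambda>\<omega>. restrict (\<lambda>p. Y p \<omega>) (K v)) -` T v \<inter> space M))"
      using assms T by (intro indep_varsD_finite[OF ind2]) auto
    also have "\<dots> = (\<Prod>v\<in>V. prob ((\<lambda>\<omega>. X \<omega> \<inter> Q v) -` A v \<inter> space M))"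
      using eq by (intro prod.cong) auto
    finally show "prob (\<Inter>v\<in>V. (\<lambda>\<omega>. X \<omega> \<inter> Q v) -` A v \<inter> space M) =
     (\<Prod>v\<in>V. prob ((\<lambda>\<omega>. X \<omega> \<inter> Q v) -` A v \<inter> space M))" .
  qed
next
  show "Int_stable count_events" by (rule Int_stable_count_events)
next
  fix v assume "v \<in> V"
  then show "(\<lambda>\<omega>. X \<omega> \<inter> Q v) \<in> measurable M cfg" using assms(2) by measurable
next
  show "count_events \<subseteq> Pow (space cfg)" unfolding space_cfg by (rule count_events_closed)
qed (use assms in \<open>auto simp: space_cfg sets_cfg_count_events space_in_count_events\<close>)

text \<open>Counting image points in \<open>B\<close> is counting points in the preimage of
  \<open>B\<close>, which is again bounded and Borel and has the same volume.\<close>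

lemma isometric_image:
  fixes f :: "real ^ 'n \<Rightarrow> real ^ 'n"
  assumes "orthogonal_transformation f"
  shows "poisson M (\<lambda>\<omega>. (\<lambda>u. f u + b) ` X \<omega>)"
proof
  define A where "A u = f u + b" for u
  have lin: "linear f" using assms by (rule orthogonal_transformation_linear)
  have nrm: "norm (A u - A v) = norm (u - v)" for u v
    using assms by (simp add: A_def orthogonal_transformation_norm flip: linear_diff[OF lin])
  have inj: "inj A" using nrm by (metis injI norm_eq_zero right_minus_eq)
  have cont: "continuous_on UNIV A" unfolding A_def
    by (intro continuous_intros linear_continuous_on linear_conv_bounded_linear[THEN iffD1] lin)
  have surj: "A ` (A -` B) = B" for B
  proof -
    have "surj f" using assms by (rule orthogonal_transformation_surj)
    then have "surj A" unfolding A_def surj_def by (metis diff_add_cancel)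
    then show ?thesis by (simp add: surj_image_vimage_eq)
  qed
  have cnt: "card (A ` P \<inter> B) = card (P \<inter> A -` B)" for P B
  proof -
    have "A ` P \<inter> B = A ` (P \<inter> A -` B)" by auto
    then show ?thesis using inj by (simp add: card_image inj_on_subset)
  qed
  have vm: "A -` B \<in> sets borel \<and> bounded (A -` B) \<and> measure lborel (A -` B) = measure lborel B"
    if B: "B \<in> sets borel" "bounded B" for B
  proof (intro conjI)
    have "A \<in> borel_measurable borel" using cont by (rule borel_measurable_continuous_onI)
    then show m: "A -` B \<in> sets borel" using B measurable_sets[of A borel borel B] by simp
    obtain R where R: "\<And>w. w \<in> B \<Longrightarrow> norm w \<le> R" using B(2) by (auto simp: bounded_iff)
    have "norm u \<le> R + norm (A 0)" if "A u \<in> B" for u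
      using nrm[of u 0] norm_triangle_ineq4[of "A u" "A 0"] R[OF that] by simp
    then show bd: "bounded (A -` B)" by (auto simp: bounded_iff)
    have [measurable]: "B \<in> sets borel" by fact
    define B' where "B' = (\<lambda>u. b + 1 *\<^sub>R u) -` B"
    have "(\<lambda>u. b + 1 *\<^sub>R u) \<in> borel_measurable borel" by measurable
    then have [measurable]: "B' \<in> sets borel" unfolding B'_def by (rule measurable_sets_borel) fact
    have "A -` B = f -` B'" by (auto simp: A_def B'_def add.commute)
    then have "emeasure lborel (A -` B) = emeasure lborel B'"
      using assms by (simp add: emeasure_lborel_orthogonal_vimage)
    also have "\<dots> = (\<integral>\<^sup>+u. indicator B' u \<partial>lborel)" by simp
    also have "\<dots> = (\<integral>\<^sup>+u. indicator B (b + 1 *\<^sub>R u) \<partial>lborel)"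
      by (intro nn_integral_cong) (simp add: B'_def indicator_def)
    also have "\<dots> = emeasure lborel B" by (subst nn_integral_lborel_reflect) auto
    finally show "measure lborel (A -` B) = measure lborel B" by (simp add: measure_def)
  qed
  show "poisson_point_process M (\<lambda>\<omega>. (\<lambda>u. f u + b) ` X \<omega>)"
    unfolding poisson_point_process_def A_def[symmetric]
  proof (intro conjI ballI allI impI)
    show "prob_space M" by (rule prob_space_axioms)
    show "finite (A ` X \<omega> \<inter> B)" if w: "\<omega> \<in> space M" and bd: "bounded B" for \<omega> B
    proof -
      obtain R where R: "\<And>w. w \<in> B \<Longrightarrow> norm w \<le> R" using bd by (auto simp: bounded_iff)
      have "norm u \<le> R + norm (A 0)" if "A u \<in> B" for u
        using nrm[of u 0] norm_triangle_ineq4[of "A u" "A 0"] R[OF that] by simp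
      then have "bounded (A -` B)" by (auto simp: bounded_iff)
      moreover have "A ` X \<omega> \<inter> B = A ` (X \<omega> \<inter> A -` B)" by auto
      ultimately show ?thesis using lfin_X[OF w] by (simp add: lfin_def)
    qed
  next
    fix B :: "(real ^ 'n) set" assume B: "B \<in> sets borel \<and> bounded B"
    show "(\<lambda>\<omega>. card (A ` X \<omega> \<inter> B)) \<in> measurable M (count_space UNIV)"
    proof -
      have v: "A -` B \<in> sets borel" "bounded (A -` B)" using vm B by blast+
      show ?thesis unfolding cnt by (intro measurable_card v) measurable
    qed
    show "prob {\<omega> \<in> space M. card (A ` X \<omega> \<inter> B) = n} = measure lborel B ^ n / fact n * exp (- measure lborel B)" for n
      unfolding cnt using vm B prob_count[of "A -` B" n] by simp
  next
    fix I :: "nat set" and B :: "nat \<Rightarrow> (real ^ 'n) set"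
    assume "finite I \<and> (\<forall>i\<in>I. B i \<in> sets borel \<and> bounded (B i)) \<and> disjoint_family_on B I"
    then have I: "finite I" "\<And>i. i \<in> I \<Longrightarrow> B i \<in> sets borel" "\<And>i. i \<in> I \<Longrightarrow> bounded (B i)"
      "disjoint_family_on B I" by auto
    have "disjoint_family_on (\<lambda>i. A -` B i) I"
      using I(4) unfolding disjoint_family_on_def by (metis vimage_Int vimage_empty)
    then show "indep_vars (\<lambda>_. count_space UNIV) (\<lambda>i \<omega>. card (A ` X \<omega> \<inter> B i)) I"
      unfolding cnt using vm I by (intro indep_counts) blast+
  qed
qed

end

subsection \<open>The entropy method\<close>

text \<open>A class closed under all the operations used below, which settles integrability and the
  hypotheses of Fubini's theorem at once.\<close>

definition bdd_mble :: "'a measure \<Rightarrow> ('a \<Rightarrow> real) \<Rightarrow> bool" where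
  "bdd_mble M f \<longleftrightarrow> f \<in> borel_measurable M \<and> (\<exists>B. \<forall>x\<in>space M. \<bar>f x\<bar> \<le> B)"

lemma bdd_mbleI: "f \<in> borel_measurable M \<Longrightarrow> (\<And>x. x \<in> space M \<Longrightarrow> \<bar>f x\<bar> \<le> B) \<Longrightarrow> bdd_mble M f"
  unfolding bdd_mble_def by blast

lemma (in prob_space) bdd_mble_integrable: "bdd_mble M f \<Longrightarrow> integrable M f"
  unfolding bdd_mble_def by (auto intro!: integrable_const_bound AE_I2)

lemma bdd_mble_const: "bdd_mble M (\<lambda>_. c)"
  by (rule bdd_mbleI[of _ _ "\<bar>c\<bar>"]) auto

lemma bdd_mble_mult: "bdd_mble M f \<Longrightarrow> bdd_mble M g \<Longrightarrow> bdd_mble M (\<lambda>x. f x * g x)"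
proof -
  assume fg: "bdd_mble M f" "bdd_mble M g"
  then obtain A B where "\<And>x. x \<in> space M \<Longrightarrow> \<bar>f x\<bar> \<le> A" "\<And>x. x \<in> space M \<Longrightarrow> \<bar>g x\<bar> \<le> B"
    unfolding bdd_mble_def by blast
  then show ?thesis using fg
    by (intro bdd_mbleI[of _ _ "A * B"]) (auto simp: bdd_mble_def abs_mult intro!: mult_mono' )
qed

lemma bdd_mble_add: "bdd_mble M f \<Longrightarrow> bdd_mble M g \<Longrightarrow> bdd_mble M (\<lambda>x. f x + g x)"
proof -
  assume fg: "bdd_mble M f" "bdd_mble M g"
  then obtain A B where "\<And>x. x \<in> space M \<Longrightarrow> \<bar>f x\<bar> \<le> A" "\<And>x. x \<in> space M \<Longrightarrow> \<bar>g x\<bar> \<le> B"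
    unfolding bdd_mble_def by blast
  then show ?thesis using fg
    by (intro bdd_mbleI[of _ _ "A + B"]) (auto simp: bdd_mble_def intro: order_trans[OF abs_triangle_ineq] add_mono)
qed

lemma bdd_mble_diff: "bdd_mble M f \<Longrightarrow> bdd_mble M g \<Longrightarrow> bdd_mble M (\<lambda>x. f x - g x)"
  using bdd_mble_add[OF _ bdd_mble_mult[OF bdd_mble_const[of _ "-1"]], of M f g] by simp

lemma bdd_mble_continuous:
  assumes f: "bdd_mble M f" and g: "continuous_on UNIV (g :: real \<Rightarrow> real)"
  shows "bdd_mble M (\<lambda>x. g (f x))"
proof -
  obtain B where B: "\<And>x. x \<in> space M \<Longrightarrow> \<bar>f x\<bar> \<le> B" using f unfolding bdd_mble_def by blast
  have "continuous_on {-B..B} g" using g by (rule continuous_on_subset) auto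
  then have "bounded (g ` {-B..B})" by (intro compact_imp_bounded compact_continuous_image) auto
  then obtain D where D: "\<forall>y\<in>{-B..B}. \<bar>g y\<bar> \<le> D" by (auto simp: bounded_iff)
  have "\<bar>g (f x)\<bar> \<le> D" if "x \<in> space M" for x
    using B[OF that] by (intro D[rule_format]) auto
  moreover have "(\<lambda>x. g (f x)) \<in> borel_measurable M"
    by (rule measurable_compose[OF _ borel_measurable_continuous_onI[OF g]]) (use f in \<open>simp add: bdd_mble_def\<close>)
  ultimately show ?thesis by (rule bdd_mbleI[rotated])
qed

lemma bdd_mble_ln:
  assumes "f \<in> borel_measurable M" "\<And>x. x \<in> space M \<Longrightarrow> \<alpha> \<le> f x" "\<And>x. x \<in> space M \<Longrightarrow> f x \<le> \<beta>" "0 < \<alpha>"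
  shows "bdd_mble M (\<lambda>x. ln (f x))"
proof (rule bdd_mbleI)
  fix x assume x: "x \<in> space M"
  then have "ln \<alpha> \<le> ln (f x)" "ln (f x) \<le> ln \<beta>"
    using assms(2)[OF x] assms(3)[OF x] assms(4) by auto
  then show "\<bar>ln (f x)\<bar> \<le> \<bar>ln \<alpha>\<bar> + \<bar>ln \<beta>\<bar>" by linarith
qed (use assms(1) in measurable)

lemma bdd_mble_compose: "bdd_mble N f \<Longrightarrow> g \<in> measurable M N \<Longrightarrow> bdd_mble M (\<lambda>x. f (g x))"
  unfolding bdd_mble_def by (metis measurable_compose measurable_space)

lemma (in prob_space) integral_bounds:
  fixes f :: "'a \<Rightarrow> real"
  assumes "f \<in> borel_measurable M" "\<And>x. x \<in> space M \<Longrightarrow> \<alpha> \<le> f x" "\<And>x. x \<in> space M \<Longrightarrow> f x \<le> \<beta>"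
  shows "\<alpha> \<le> (\<integral>x. f x \<partial>M)" "(\<integral>x. f x \<partial>M) \<le> \<beta>"
proof -
  have "integrable M f"
    using assms(2,3) by (intro bdd_mble_integrable bdd_mbleI[of _ _ "\<bar>\<alpha>\<bar> + \<bar>\<beta>\<bar>"] assms(1)) force
  then show "\<alpha> \<le> (\<integral>x. f x \<partial>M)" "(\<integral>x. f x \<partial>M) \<le> \<beta>"
    using assms by (auto intro!: integral_ge_const integral_le_const)
qed

lemma (in prob_space) bdd_mble_integral:
  assumes "bdd_mble (N \<Otimes>\<^sub>M M) (\<lambda>(x, y). f x y)"
  shows "bdd_mble N (\<lambda>x. \<integral>y. f x y \<partial>M)"
proof -
  have m: "(\<lambda>(x, y). f x y) \<in> borel_measurable (N \<Otimes>\<^sub>M M)" using assms by (simp add: bdd_mble_def)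
  obtain B where B: "\<And>x y. x \<in> space N \<Longrightarrow> y \<in> space M \<Longrightarrow> \<bar>f x y\<bar> \<le> B"
    using assms unfolding bdd_mble_def space_pair_measure by auto
  show ?thesis
  proof (rule bdd_mbleI)
    show "(\<lambda>x. \<integral>y. f x y \<partial>M) \<in> borel_measurable N" using m by (rule borel_measurable_lebesgue_integral)
    fix x assume x: "x \<in> space N"
    have "f x \<in> borel_measurable M" using measurable_Pair2[OF m x] by simp
    then show "\<bar>\<integral>y. f x y \<partial>M\<bar> \<le> B"
      using integral_bounds[of "f x" "-B" B] B[OF x] by (simp add: abs_le_iff minus_le_iff)
  qed
qed

lemma Fubini_bdd:
  assumes "prob_space M" "prob_space N" "bdd_mble (M \<Otimes>\<^sub>M N) (\<lambda>(x, y). f x y)"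
  shows "(\<integral>x. (\<integral>y. f x y \<partial>N) \<partial>M) = (\<integral>y. (\<integral>x. f x y \<partial>M) \<partial>N)"
proof -
  interpret M: prob_space M by fact
  interpret N: prob_space N by fact
  interpret P: pair_prob_space M N ..
  show ?thesis using P.bdd_mble_integrable[OF assms(3)] by (rule P.Fubini_integral[symmetric])
qed

text \<open>One direction of the variational formula for the entropy. It follows from
  \<open>ln u \<le> u - 1\<close> with \<open>u = g * Ef / (f * Eg)\<close>: multiplied by
  \<open>f\<close>, the right side integrates to zero.\<close>

lemma (in prob_space) gibbs:
  fixes f :: "'a \<Rightarrow> real"
  assumes f: "f \<in> borel_measurable M" "\<And>x. x \<in> space M \<Longrightarrow> \<alpha> \<le> f x" "\<And>x. x \<in> space M \<Longrightarrow> f x \<le> \<beta>"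
    and g: "g \<in> borel_measurable M" "\<And>x. x \<in> space M \<Longrightarrow> \<alpha> \<le> g x" "\<And>x. x \<in> space M \<Longrightarrow> g x \<le> \<beta>"
    and \<alpha>: "0 < \<alpha>"
  shows "(\<integral>x. f x * (ln (g x) - ln (\<integral>x. g x \<partial>M)) \<partial>M) \<le>
    (\<integral>x. f x * ln (f x) \<partial>M) - (\<integral>x. f x \<partial>M) * ln (\<integral>x. f x \<partial>M)"
proof -
  define Ef Eg where "Ef = (\<integral>x. f x \<partial>M)" and "Eg = (\<integral>x. g x \<partial>M)"
  have pos: "0 < Ef" "0 < Eg" using integral_bounds(1)[OF f] integral_bounds(1)[OF g] \<alpha>
    unfolding Ef_def Eg_def by linarith+
  have bf: "bdd_mble M f" and bg: "bdd_mble M g"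
    using f(2,3) g(2,3) by (auto intro!: bdd_mbleI[of _ _ "\<bar>\<alpha>\<bar> + \<bar>\<beta>\<bar>"] f(1) g(1)) force+
  note b = bdd_mble_ln[OF f \<alpha>] bdd_mble_ln[OF g \<alpha>] bf bg
  have "f x * (ln (g x) - ln Eg) \<le> f x * ln (f x) - f x * ln Ef + (Ef / Eg * g x - f x)"
    if x: "x \<in> space M" for x
  proof -
    have fg: "0 < f x" "0 < g x" using f(2)[OF x] g(2)[OF x] \<alpha> by auto
    have "ln (g x * Ef / (f x * Eg)) \<le> g x * Ef / (f x * Eg) - 1"
      using fg pos by (intro ln_le_minus_one) auto
    then have "f x * ln (g x * Ef / (f x * Eg)) \<le> f x * (g x * Ef / (f x * Eg) - 1)"
      using fg by (intro mult_left_mono) auto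
    also have "f x * (g x * Ef / (f x * Eg) - 1) = Ef / Eg * g x - f x"
      using fg pos by (simp add: field_simps)
    also have "ln (g x * Ef / (f x * Eg)) = ln (g x) + ln Ef - ln (f x) - ln Eg"
      using fg pos by (simp add: ln_div ln_mult)
    finally show ?thesis by (simp add: algebra_simps)
  qed
  then have "(\<integral>x. f x * (ln (g x) - ln Eg) \<partial>M) \<le>
    (\<integral>x. f x * ln (f x) - f x * ln Ef + (Ef / Eg * g x - f x) \<partial>M)"
    using b by (intro integral_mono bdd_mble_integrable bdd_mble_add bdd_mble_diff bdd_mble_mult bdd_mble_const)
  also have "\<dots> = (\<integral>x. f x * ln (f x) \<partial>M) - Ef * ln Ef + (Ef / Eg * Eg - Ef)"
    using b by (simp add: bdd_mble_integrable bdd_mble_mult bdd_mble_const bdd_mble_diff bdd_mble_add Ef_def Eg_def)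
  finally show ?thesis using pos by (simp add: Ef_def Eg_def)
qed

lemma (in prob_space) jensen_ln:
  fixes f :: "'a \<Rightarrow> real"
  assumes f: "f \<in> borel_measurable M" "\<And>x. x \<in> space M \<Longrightarrow> \<alpha> \<le> f x" "\<And>x. x \<in> space M \<Longrightarrow> f x \<le> \<beta>"
    and \<alpha>: "0 < \<alpha>"
  shows "(\<integral>x. ln (f x) \<partial>M) \<le> ln (\<integral>x. f x \<partial>M)"
proof -
  define E where "E = (\<integral>x. f x \<partial>M)"
  have E: "0 < E" using integral_bounds(1)[OF f] \<alpha> unfolding E_def by linarith
  have bf: "bdd_mble M f" using f(2,3) by (auto intro!: bdd_mbleI[of _ _ "\<bar>\<alpha>\<bar> + \<bar>\<beta>\<bar>"] f(1)) force
  have "(\<integral>x. ln (f x) \<partial>M) \<le> (\<integral>x. ln E + (1 / E * f x - 1) \<partial>M)"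
  proof (intro integral_mono bdd_mble_integrable bdd_mble_add bdd_mble_diff bdd_mble_mult bdd_mble_const bf bdd_mble_ln[OF f \<alpha>])
    fix x assume "x \<in> space M"
    then have "0 < f x" using f(2)[of x] \<alpha> by simp
    then show "ln (f x) \<le> ln E + (1 / E * f x - 1)"
      using ln_le_minus_one[of "f x / E"] E by (simp add: ln_div)
  qed
  also have "\<dots> = ln E"
    using bf E by (simp add: bdd_mble_integrable bdd_mble_mult bdd_mble_const bdd_mble_diff E_def prob_space)
  finally show ?thesis by (simp add: E_def)
qed

section \<open>Product measures and tensorization of the entropy\<close>

locale prob_family =
  fixes N :: "'i \<Rightarrow> 'c measure"
  assumes prob_N: "\<And>i. prob_space (N i)"
begin

sublocale product_sigma_finite N
  by (intro product_sigma_finite.intro prob_space_imp_sigma_finite prob_N)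

lemma prob_Pi: "prob_space (PiM I N)" by (rule prob_space_PiM) (rule prob_N)

lemma integral_insert:
  assumes "finite I" "i \<notin> I" "bdd_mble (PiM (insert i I) N) f"
  shows "(\<integral>x. f x \<partial>PiM (insert i I) N) = (\<integral>x. (\<integral>y. f (x(i := y)) \<partial>N i) \<partial>PiM I N)"
proof -
  interpret prob_space "PiM (insert i I) N" by (rule prob_Pi)
  show ?thesis using assms by (intro product_integral_insert bdd_mble_integrable)
qed

lemma fun_upd_mble:
  "i \<in> I \<Longrightarrow> (\<lambda>(x, y). x(i := y)) \<in> measurable (PiM I N \<Otimes>\<^sub>M N i) (PiM I N)"
proof -
  assume "i \<in> I"
  then have "insert i I = I" by auto
  then show ?thesis unfolding case_prod_unfold
    using measurable_fun_upd[where I = I and J = I and i = i and f = fst and h = snd and M = N and N = "PiM I N \<Otimes>\<^sub>M N i"]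
    by simp
qed

lemma fun_upd_insert_mble:
  "(\<lambda>(x, y). x(i := y)) \<in> measurable (PiM I N \<Otimes>\<^sub>M N i) (PiM (insert i I) N)"
  by (rule measurable_add_dim)

lemma fun_upd_space: "x \<in> space (PiM I N) \<Longrightarrow> y \<in> space (N i) \<Longrightarrow> x(i := y) \<in> space (PiM (insert i I) N)"
  by (auto simp: space_PiM PiE_iff extensional_def)

text \<open>In one coordinate the entropy is at most the integral of
  \<open>f * (ln f - ln f')\<close>, where \<open>f'\<close> is \<open>f\<close> at an independent
  copy, by Jensen's inequality. In the induction the entropy splits into the mean entropy in the new
  coordinate and the entropy of the marginal \<open>g\<close>. The Gibbs inequality bounds the
  latter by the mean entropy of the slices, to which the induction hypothesis applies.\<close>

theorem entropy_tensorization: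
  fixes f :: "('i \<Rightarrow> 'c) \<Rightarrow> real"
  assumes "finite I" "f \<in> borel_measurable (PiM I N)"
    "\<And>x. x \<in> space (PiM I N) \<Longrightarrow> \<alpha> \<le> f x" "\<And>x. x \<in> space (PiM I N) \<Longrightarrow> f x \<le> \<beta>" "0 < \<alpha>"
  shows "(\<integral>x. f x * ln (f x) \<partial>PiM I N) - (\<integral>x. f x \<partial>PiM I N) * ln (\<integral>x. f x \<partial>PiM I N) \<le>
    (\<Sum>i\<in>I. \<integral>x. (\<integral>y. f x * (ln (f x) - ln (f (x(i := y)))) \<partial>N i) \<partial>PiM I N)"
  using assms(1-4)
proof (induction I arbitrary: f rule: finite_induct)
  case empty
  interpret prob_space "PiM {} N" by (rule prob_Pi)
  define u where "u = f (\<lambda>_. undefined)"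
  have "f x = u" if "x \<in> space (PiM {} N)" for x using that by (simp add: space_PiM u_def)
  then have "(\<integral>x. f x * ln (f x) \<partial>PiM {} N) = u * ln u" "(\<integral>x. f x \<partial>PiM {} N) = u"
    by (simp_all add: prob_space cong: Bochner_Integration.integral_cong)
  then show ?case by simp
next
  case (insert i I)
  let ?\<Pi> = "PiM I N" and ?\<Pi>' = "PiM (insert i I) N"
  interpret P: prob_space ?\<Pi> by (rule prob_Pi)
  interpret P': prob_space ?\<Pi>' by (rule prob_Pi)
  interpret Ni: prob_space "N i" by (rule prob_N)
  note f = insert.prems
  define h where "h x y = f (x(i := y))" for x y
  have hm: "(\<lambda>(x, y). h x y) \<in> borel_measurable (?\<Pi> \<Otimes>\<^sub>M N i)"
    unfolding h_def case_prod_unfold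
    by (rule measurable_compose[OF fun_upd_insert_mble f(1), unfolded case_prod_unfold])
  have h1: "h x \<in> borel_measurable (N i)" if "x \<in> space ?\<Pi>" for x
    using measurable_Pair2[OF hm that] by simp
  have h2: "(\<lambda>x. h x y) \<in> borel_measurable ?\<Pi>" if "y \<in> space (N i)" for y
    using measurable_Pair1[OF hm that] by simp
  have hb: "\<alpha> \<le> h x y" "h x y \<le> \<beta>" if "x \<in> space ?\<Pi>" "y \<in> space (N i)" for x y
    using f(2,3) fun_upd_space[OF that] unfolding h_def by auto
  have bh: "bdd_mble (?\<Pi> \<Otimes>\<^sub>M N i) (\<lambda>(x, y). h x y)"
    using hb by (intro bdd_mbleI[of _ _ "\<bar>\<alpha>\<bar> + \<bar>\<beta>\<bar>"] hm) (force simp: space_pair_measure)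
  have blh: "bdd_mble (?\<Pi> \<Otimes>\<^sub>M N i) (\<lambda>(x, y). ln (h x y))"
    using bdd_mble_ln[OF hm, of \<alpha> \<beta>] hb assms(5) by (auto simp: space_pair_measure case_prod_unfold)
  have bhl: "bdd_mble (?\<Pi> \<Otimes>\<^sub>M N i) (\<lambda>(x, y). h x y * ln (h x y))"
    using bdd_mble_mult[OF bh blh] by (simp add: case_prod_unfold)
  have bf: "bdd_mble ?\<Pi>' f"
    using f(2,3) by (intro bdd_mbleI[of _ _ "\<bar>\<alpha>\<bar> + \<bar>\<beta>\<bar>"] f(1)) force
  have bfl: "bdd_mble ?\<Pi>' (\<lambda>x. f x * ln (f x))"
    by (rule bdd_mble_mult[OF bf bdd_mble_ln[OF f assms(5)]])
  define g where "g x = (\<integral>y. h x y \<partial>N i)" for x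
  have gm: "g \<in> borel_measurable ?\<Pi>" unfolding g_def using Ni.bdd_mble_integral[OF bh] by (simp add: bdd_mble_def)
  have gb: "\<alpha> \<le> g x" "g x \<le> \<beta>" if "x \<in> space ?\<Pi>" for x
    using Ni.integral_bounds[OF h1[OF that] hb[OF that]] unfolding g_def by auto
  have bg: "bdd_mble ?\<Pi> g" unfolding g_def by (rule Ni.bdd_mble_integral[OF bh])
  have bgl: "bdd_mble ?\<Pi> (\<lambda>x. g x * ln (g x))"
    by (rule bdd_mble_mult[OF bg bdd_mble_ln[OF gm gb assms(5)]])
  have bhl': "bdd_mble ?\<Pi> (\<lambda>x. \<integral>y. h x y * ln (h x y) \<partial>N i)"
    by (rule Ni.bdd_mble_integral[OF bhl])
  have Ef: "(\<integral>x. f x \<partial>?\<Pi>') = (\<integral>x. g x \<partial>?\<Pi>)"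
    using integral_insert[OF insert.hyps bf] by (simp add: g_def h_def)
  have Efl: "(\<integral>x. f x * ln (f x) \<partial>?\<Pi>') = (\<integral>x. (\<integral>y. h x y * ln (h x y) \<partial>N i) \<partial>?\<Pi>)"
    using integral_insert[OF insert.hyps bfl] by (simp add: h_def)
  define D where "D j x = (\<integral>y. f x * (ln (f x) - ln (f (x(j := y)))) \<partial>N j)" for j x
  have bD0: "bdd_mble (?\<Pi>' \<Otimes>\<^sub>M N j) (\<lambda>(x, y). f x * (ln (f x) - ln (f (x(j := y)))))" if "j \<in> insert i I" for j
    unfolding case_prod_unfold
    by (intro bdd_mble_mult bdd_mble_diff bdd_mble_compose[OF bf measurable_fst]
        bdd_mble_compose[OF bdd_mble_ln[OF f assms(5)] measurable_fst]
        bdd_mble_compose[OF bdd_mble_ln[OF f assms(5)] fun_upd_mble[OF that], unfolded case_prod_unfold])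
  have bD: "bdd_mble ?\<Pi>' (D j)" if "j \<in> insert i I" for j
  proof -
    interpret Nj: prob_space "N j" by (rule prob_N)
    show ?thesis unfolding D_def by (rule Nj.bdd_mble_integral[OF bD0[OF that]])
  qed
  have bD': "bdd_mble (?\<Pi> \<Otimes>\<^sub>M N i) (\<lambda>(x, y). D j (x(i := y)))" if "j \<in> insert i I" for j
    unfolding case_prod_unfold
    by (rule bdd_mble_compose[OF bD[OF that] fun_upd_insert_mble, unfolded case_prod_unfold])
  have ID: "(\<integral>x. D j x \<partial>?\<Pi>') = (\<integral>x. (\<integral>y. D j (x(i := y)) \<partial>N i) \<partial>?\<Pi>)" if "j \<in> insert i I" for j
    by (rule integral_insert[OF insert.hyps bD[OF that]])
  have A: "(\<integral>x. (\<integral>y. h x y * ln (h x y) \<partial>N i) - g x * ln (g x) \<partial>?\<Pi>) \<le> (\<integral>x. D i x \<partial>?\<Pi>')"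
    unfolding ID[OF insertI1]
  proof (intro integral_mono P.bdd_mble_integrable bdd_mble_diff bhl' bgl Ni.bdd_mble_integral bD' insertI1)
    fix x assume x: "x \<in> space ?\<Pi>"
    note hx = h1[OF x] hb[OF x]
    have bhx: "bdd_mble (N i) (h x)"
      using hx(2,3) by (intro bdd_mbleI[of _ _ "\<bar>\<alpha>\<bar> + \<bar>\<beta>\<bar>"] hx(1)) force
    have blx: "bdd_mble (N i) (\<lambda>y. ln (h x y))" by (rule bdd_mble_ln[OF hx assms(5)])
    note ii = Ni.bdd_mble_integrable[OF bhx] Ni.bdd_mble_integrable[OF blx]
      Ni.bdd_mble_integrable[OF bdd_mble_mult[OF bhx blx]]
    have "D i (x(i := y)) = h x y * ln (h x y) - h x y * (\<integral>y. ln (h x y) \<partial>N i)" for y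
    proof -
      have "D i (x(i := y)) = (\<integral>y'. h x y * ln (h x y) - h x y * ln (h x y') \<partial>N i)"
        unfolding D_def h_def by (simp add: algebra_simps)
      also have "\<dots> = h x y * ln (h x y) - h x y * (\<integral>y. ln (h x y) \<partial>N i)"
        using ii by (simp add: Ni.prob_space)
      finally show ?thesis .
    qed
    then have "(\<integral>y. D i (x(i := y)) \<partial>N i) = (\<integral>y. h x y * ln (h x y) \<partial>N i) - g x * (\<integral>y. ln (h x y) \<partial>N i)"
      using ii by (simp add: g_def)
    moreover have "g x * (\<integral>y. ln (h x y) \<partial>N i) \<le> g x * ln (g x)"
      using Ni.jensen_ln[OF hx assms(5)] gb[OF x] assms(5) by (intro mult_left_mono) (auto simp: g_def)
    ultimately show "(\<integral>y. h x y * ln (h x y) \<partial>N i) - g x * ln (g x) \<le> (\<integral>y. D i (x(i := y)) \<partial>N i)"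
      by simp
  qed
  define Eg where "Eg = (\<integral>x. g x \<partial>?\<Pi>)"
  have bgl': "bdd_mble ?\<Pi> (\<lambda>x. ln (g x) - ln Eg)"
    by (intro bdd_mble_diff bdd_mble_const bdd_mble_ln[OF gm gb assms(5)])
  have bB: "bdd_mble (?\<Pi> \<Otimes>\<^sub>M N i) (\<lambda>(x, y). h x y * (ln (g x) - ln Eg))"
    using bdd_mble_mult[OF bh bdd_mble_compose[OF bgl' measurable_fst]] by (simp add: case_prod_unfold)
  have bBs: "bdd_mble (N i \<Otimes>\<^sub>M ?\<Pi>) (\<lambda>(y, x). h x y * (ln (g x) - ln Eg))"
    using bdd_mble_compose[OF bB measurable_pair_swap'] by (simp add: case_prod_unfold del: fun_upd_apply)
  have bDs: "bdd_mble (N i \<Otimes>\<^sub>M ?\<Pi>) (\<lambda>(y, x). D j (x(i := y)))" if "j \<in> insert i I" for j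
    using bdd_mble_compose[OF bD'[OF that] measurable_pair_swap', unfolded case_prod_unfold fst_conv snd_conv]
    unfolding case_prod_unfold .
  have B: "(\<integral>x. g x * ln (g x) \<partial>?\<Pi>) - Eg * ln Eg \<le> (\<Sum>j\<in>I. \<integral>x. D j x \<partial>?\<Pi>')"
  proof -
    have "(\<integral>x. g x * ln (g x) \<partial>?\<Pi>) - Eg * ln Eg = (\<integral>x. g x * (ln (g x) - ln Eg) \<partial>?\<Pi>)"
      using P.bdd_mble_integrable[OF bg] P.bdd_mble_integrable[OF bgl]
      by (simp add: right_diff_distrib Eg_def)
    also have "\<dots> = (\<integral>x. (\<integral>y. h x y * (ln (g x) - ln Eg) \<partial>N i) \<partial>?\<Pi>)"
      by (simp add: g_def)
    also have "\<dots> = (\<integral>y. (\<integral>x. h x y * (ln (g x) - ln Eg) \<partial>?\<Pi>) \<partial>N i)"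
      by (rule Fubini_bdd[OF P.prob_space_axioms Ni.prob_space_axioms bB])
    also have "\<dots> \<le> (\<integral>y. (\<Sum>j\<in>I. \<integral>x. D j (x(i := y)) \<partial>?\<Pi>) \<partial>N i)"
    proof (intro integral_mono)
      show "integrable (N i) (\<lambda>y. \<integral>x. h x y * (ln (g x) - ln Eg) \<partial>?\<Pi>)"
        by (intro Ni.bdd_mble_integrable P.bdd_mble_integral bBs)
      show "integrable (N i) (\<lambda>y. \<Sum>j\<in>I. \<integral>x. D j (x(i := y)) \<partial>?\<Pi>)"
        by (intro Bochner_Integration.integrable_sum Ni.bdd_mble_integrable P.bdd_mble_integral bDs) auto
      fix y assume y: "y \<in> space (N i)"
      have "(\<integral>x. h x y * (ln (g x) - ln Eg) \<partial>?\<Pi>) \<le>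
        (\<integral>x. h x y * ln (h x y) \<partial>?\<Pi>) - (\<integral>x. h x y \<partial>?\<Pi>) * ln (\<integral>x. h x y \<partial>?\<Pi>)"
        unfolding Eg_def using hb y gb by (intro P.gibbs[of _ \<alpha> \<beta>] h2 gm assms(5)) auto
      also have "\<dots> \<le> (\<Sum>j\<in>I. \<integral>x. (\<integral>y'. h x y * (ln (h x y) - ln (h (x(j := y')) y)) \<partial>N j) \<partial>?\<Pi>)"
        using hb y by (intro insert.IH h2) auto
      also have "\<dots> = (\<Sum>j\<in>I. \<integral>x. D j (x(i := y)) \<partial>?\<Pi>)"
      proof (rule sum.cong[OF refl])
        fix j assume "j \<in> I"
        then have "j \<noteq> i" using insert.hyps by auto
        then show "(\<integral>x. (\<integral>y'. h x y * (ln (h x y) - ln (h (x(j := y')) y)) \<partial>N j) \<partial>?\<Pi>) = (\<integral>x. D j (x(i := y)) \<partial>?\<Pi>)"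
          unfolding D_def h_def by (simp add: fun_upd_twist)
      qed
      finally show "(\<integral>x. h x y * (ln (g x) - ln Eg) \<partial>?\<Pi>) \<le> (\<Sum>j\<in>I. \<integral>x. D j (x(i := y)) \<partial>?\<Pi>)" .
    qed
    also have "\<dots> = (\<Sum>j\<in>I. \<integral>y. (\<integral>x. D j (x(i := y)) \<partial>?\<Pi>) \<partial>N i)"
      by (intro Bochner_Integration.integral_sum Ni.bdd_mble_integrable P.bdd_mble_integral bDs) auto
    also have "\<dots> = (\<Sum>j\<in>I. \<integral>x. D j x \<partial>?\<Pi>')"
      using Fubini_bdd[OF P.prob_space_axioms Ni.prob_space_axioms bD'] ID
      by (intro sum.cong refl) simp
    finally show ?thesis .
  qed
  have "(\<integral>x. f x * ln (f x) \<partial>?\<Pi>') - (\<integral>x. f x \<partial>?\<Pi>') * ln (\<integral>x. f x \<partial>?\<Pi>') =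
    (\<integral>x. (\<integral>y. h x y * ln (h x y) \<partial>N i) - g x * ln (g x) \<partial>?\<Pi>) + ((\<integral>x. g x * ln (g x) \<partial>?\<Pi>) - Eg * ln Eg)"
    unfolding Ef Efl Eg_def using P.bdd_mble_integrable[OF bhl'] P.bdd_mble_integrable[OF bgl] by simp
  also have "\<dots> \<le> (\<Sum>j\<in>insert i I. \<integral>x. D j x \<partial>?\<Pi>')"
    using A B insert.hyps by simp
  finally show ?case unfolding D_def .
qed

end

section \<open>From entropy bounds to moment generating functions\<close>

lemma exp_remainder: "\<bar>exp s - 1 - s\<bar> \<le> s\<^sup>2 * exp \<bar>s\<bar>" for s :: real
proof -
  have 1: "0 \<le> exp s - 1 - s" using exp_ge_add_one_self[of s] by linarith
  have "1 - s \<le> exp (- s)" using exp_ge_add_one_self[of "- s"] by simp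
  then have "(1 - s) * exp s \<le> exp (- s) * exp s" by (intro mult_right_mono) auto
  then have 2: "exp s - 1 \<le> s * exp s" by (simp add: algebra_simps flip: exp_add)
  have 3: "s * (exp s - 1) \<le> s\<^sup>2 * exp \<bar>s\<bar>"
  proof (cases "0 \<le> s")
    case True
    then have "s * (exp s - 1) \<le> s * (s * exp s)" using 2 by (intro mult_left_mono) auto
    then show ?thesis using True by (simp add: power2_eq_square mult.assoc)
  next
    case False
    have "s \<le> exp s - 1" using exp_ge_add_one_self[of s] by linarith
    then have "s * (exp s - 1) \<le> s * s" using False by (intro mult_left_mono_neg) auto
    also have "\<dots> \<le> s\<^sup>2 * exp \<bar>s\<bar>"
      using mult_left_mono[of 1 "exp \<bar>s\<bar>" "s\<^sup>2"] by (simp add: power2_eq_square)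
    finally show ?thesis .
  qed
  have "exp s - 1 - s \<le> s * (exp s - 1)" using 2 by (simp add: algebra_simps)
  then show ?thesis using 1 3 by linarith
qed

lemma DERIV_quadratic_bound:
  fixes H :: "real \<Rightarrow> real"
  assumes "\<And>\<eta>. \<bar>\<eta>\<bar> \<le> 1 \<Longrightarrow> \<bar>H (t + \<eta>) - H t - \<eta> * D\<bar> \<le> K * \<eta>\<^sup>2"
  shows "(H has_real_derivative D) (at t)"
  unfolding DERIV_def
proof -
  have "((\<lambda>\<eta>. (H (t + \<eta>) - H t) / \<eta> - D) \<longlongrightarrow> 0) (at 0)"
  proof (rule Lim_null_comparison)
    have "\<forall>\<^sub>F \<eta> in at 0. \<eta> \<noteq> (0 :: real) \<and> \<bar>\<eta>\<bar> \<le> 1"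
      unfolding eventually_at by (intro exI[of _ 1]) auto
    then show "\<forall>\<^sub>F \<eta> in at 0. norm ((H (t + \<eta>) - H t) / \<eta> - D) \<le> K * \<bar>\<eta>\<bar>"
    proof eventually_elim
      case (elim \<eta>)
      have "(H (t + \<eta>) - H t) / \<eta> - D = (H (t + \<eta>) - H t - \<eta> * D) / \<eta>"
        using elim by (simp add: diff_divide_distrib)
      then have "norm ((H (t + \<eta>) - H t) / \<eta> - D) = \<bar>H (t + \<eta>) - H t - \<eta> * D\<bar> / \<bar>\<eta>\<bar>" by simp
      also have "\<dots> \<le> K * \<eta>\<^sup>2 / \<bar>\<eta>\<bar>" using assms elim by (intro divide_right_mono) auto
      also have "\<dots> = K * \<bar>\<eta>\<bar>" using elim by (simp add: power2_eq_square abs_if)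
      finally show ?case .
    qed
    show "((\<lambda>\<eta>. K * \<bar>\<eta>\<bar>) \<longlongrightarrow> 0) (at 0)" by (auto intro!: tendsto_eq_intros)
  qed
  from tendsto_add[OF this tendsto_const[of D]]
  show "(\<lambda>\<eta>. (H (t + \<eta>) - H t) / \<eta>) \<midarrow>0\<rightarrow> D" by simp
qed

context prob_space
begin

lemma mgf_DERIV:
  assumes "bdd_mble M G"
  shows "((\<lambda>t. \<integral>x. exp (t * G x) \<partial>M) has_real_derivative (\<integral>x. G x * exp (t * G x) \<partial>M)) (at t)"
proof -
  obtain B where B: "\<And>x. x \<in> space M \<Longrightarrow> \<bar>G x\<bar> \<le> B" using assms unfolding bdd_mble_def by blast
  have be: "bdd_mble M (\<lambda>x. exp (t * G x))" for t
    by (rule bdd_mble_continuous[OF assms]) (intro continuous_intros)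
  have bge: "bdd_mble M (\<lambda>x. G x * exp (t * G x))" for t
    by (rule bdd_mble_mult[OF assms be])
  note i = bdd_mble_integrable[OF be] bdd_mble_integrable[OF bge]
  show ?thesis
  proof (rule DERIV_quadratic_bound)
    fix \<eta> :: real assume \<eta>: "\<bar>\<eta>\<bar> \<le> 1"
    have "\<bar>(\<integral>x. exp ((t + \<eta>) * G x) \<partial>M) - (\<integral>x. exp (t * G x) \<partial>M) - \<eta> * (\<integral>x. G x * exp (t * G x) \<partial>M)\<bar>
      = \<bar>\<integral>x. exp ((t + \<eta>) * G x) - exp (t * G x) - \<eta> * (G x * exp (t * G x)) \<partial>M\<bar>"
      using i by simp
    also have "\<dots> \<le> (\<integral>x. \<bar>exp ((t + \<eta>) * G x) - exp (t * G x) - \<eta> * (G x * exp (t * G x))\<bar> \<partial>M)"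
      by (rule integral_abs_bound)
    also have "\<dots> \<le> (\<integral>x. exp (\<bar>t\<bar> * B) * (B\<^sup>2 * exp B) * \<eta>\<^sup>2 \<partial>M)"
    proof (rule integral_mono)
      show "integrable M (\<lambda>x. \<bar>exp ((t + \<eta>) * G x) - exp (t * G x) - \<eta> * (G x * exp (t * G x))\<bar>)"
        using i by (intro integrable_abs Bochner_Integration.integrable_diff integrable_mult_right) auto
      fix x assume x: "x \<in> space M"
      have e: "exp ((t + \<eta>) * G x) - exp (t * G x) - \<eta> * (G x * exp (t * G x)) =
        exp (t * G x) * (exp (\<eta> * G x) - 1 - \<eta> * G x)" by (simp add: distrib_right exp_add algebra_simps)
      have B0: "0 \<le> B" using B[OF x] by linarith
      have "\<bar>\<eta> * G x\<bar> \<le> 1 * B" unfolding abs_mult using \<eta> B[OF x] by (intro mult_mono) auto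
      then have "exp \<bar>\<eta> * G x\<bar> \<le> exp B" by simp
      moreover have "(G x)\<^sup>2 \<le> B\<^sup>2" using B[OF x] B0 by (metis abs_le_square_iff abs_of_nonneg)
      ultimately have "(\<eta> * G x)\<^sup>2 * exp \<bar>\<eta> * G x\<bar> \<le> (\<eta>\<^sup>2 * B\<^sup>2) * exp B"
        unfolding power_mult_distrib by (intro mult_mono) auto
      then have r: "\<bar>exp (\<eta> * G x) - 1 - \<eta> * G x\<bar> \<le> B\<^sup>2 * exp B * \<eta>\<^sup>2"
        using exp_remainder[of "\<eta> * G x"] by (simp add: mult_ac)
      have "t * G x \<le> \<bar>t * G x\<bar>" by simp
      also have "\<dots> \<le> \<bar>t\<bar> * B" unfolding abs_mult using B[OF x] by (intro mult_left_mono) auto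
      finally have "exp (t * G x) \<le> exp (\<bar>t\<bar> * B)" by simp
      then show "\<bar>exp ((t + \<eta>) * G x) - exp (t * G x) - \<eta> * (G x * exp (t * G x))\<bar> \<le>
        exp (\<bar>t\<bar> * B) * (B\<^sup>2 * exp B) * \<eta>\<^sup>2"
        unfolding e abs_mult using r by (auto simp: mult.assoc intro!: mult_mono)
    qed simp
    also have "\<dots> = exp (\<bar>t\<bar> * B) * (B\<^sup>2 * exp B) * \<eta>\<^sup>2" by (simp add: prob_space)
    finally show "\<bar>(\<integral>x. exp ((t + \<eta>) * G x) \<partial>M) - (\<integral>x. exp (t * G x) \<partial>M) - \<eta> * (\<integral>x. G x * exp (t * G x) \<partial>M)\<bar>
      \<le> exp (\<bar>t\<bar> * B) * (B\<^sup>2 * exp B) * \<eta>\<^sup>2" .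
  qed
qed

text \<open>Herbst's argument: the entropy bound says that \<open>ln H(t) / t - \<kappa> t\<close> is non-increasing, where \<open>H\<close> is the
  moment generating function, and the limit at \<open>0\<close> is the expectation.\<close>
lemma herbst:
  assumes G: "bdd_mble M G" and \<tau>: "0 < \<tau>"
    and ent: "\<And>t. 0 < t \<Longrightarrow> t \<le> \<tau> \<Longrightarrow>
      t * (\<integral>x. G x * exp (t * G x) \<partial>M) - (\<integral>x. exp (t * G x) \<partial>M) * ln (\<integral>x. exp (t * G x) \<partial>M)
        \<le> \<kappa> * t\<^sup>2 * (\<integral>x. exp (t * G x) \<partial>M)"
  shows "(\<integral>x. exp (\<tau> * G x) \<partial>M) \<le> exp (\<tau> * (\<integral>x. G x \<partial>M) + \<kappa> * \<tau>\<^sup>2)"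
proof -
  define H D where "H t = (\<integral>x. exp (t * G x) \<partial>M)" and "D t = (\<integral>x. G x * exp (t * G x) \<partial>M)" for t
  have HD: "(H has_real_derivative D t) (at t)" for t
    unfolding H_def[abs_def] D_def by (rule mgf_DERIV[OF G])
  have be: "bdd_mble M (\<lambda>x. exp (t * G x))" for t
    by (rule bdd_mble_continuous[OF G]) (intro continuous_intros)
  have Hpos: "0 < H t" for t
  proof -
    obtain B where B: "\<And>x. x \<in> space M \<Longrightarrow> \<bar>G x\<bar> \<le> B" using G unfolding bdd_mble_def by blast
    have "exp (- (\<bar>t\<bar> * B)) \<le> H t" unfolding H_def
    proof (rule integral_ge_const[OF bdd_mble_integrable[OF be]], rule AE_I2)
      fix x assume "x \<in> space M"
      then have "\<bar>t * G x\<bar> \<le> \<bar>t\<bar> * B" unfolding abs_mult using B by (intro mult_left_mono) auto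
      then show "exp (- (\<bar>t\<bar> * B)) \<le> exp (t * G x)" by (simp add: abs_le_iff minus_le_iff)
    qed
    then show ?thesis by (meson exp_gt_zero less_le_trans)
  qed
  have lnD: "((\<lambda>t. ln (H t)) has_real_derivative D t / H t) (at t)" for t
    using DERIV_chain2[OF DERIV_ln_divide[OF Hpos] HD, of t] by simp
  have H0: "H 0 = 1" "D 0 = (\<integral>x. G x \<partial>M)" by (simp_all add: H_def D_def prob_space)
  define u where "u t = ln (H t) / t - \<kappa> * t" for t
  have lim: "(u \<longlongrightarrow> D 0) (at_right 0)"
  proof -
    have "((\<lambda>h. (ln (H (0 + h)) - ln (H 0)) / h) \<longlongrightarrow> D 0 / H 0) (at 0)"
      using lnD[of 0] unfolding DERIV_def .
    then have "((\<lambda>h. ln (H h) / h) \<longlongrightarrow> D 0) (at 0)" by (simp add: H0)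
    then have "(u \<longlongrightarrow> D 0 - \<kappa> * 0) (at 0)" unfolding u_def[abs_def] by (intro tendsto_intros)
    then show ?thesis by (auto intro: filterlim_mono at_le)
  qed
  have mono: "u \<tau> \<le> u t" if t: "0 < t" "t \<le> \<tau>" for t
  proof (rule DERIV_nonpos_imp_nonincreasing[OF t(2)])
    fix s assume s: "t \<le> s" "s \<le> \<tau>"
    then have s0: "0 < s" using t by simp
    have "(u has_real_derivative ((D s / H s) * s - ln (H s) * 1) / (s * s) - \<kappa>) (at s)"
      unfolding u_def[abs_def] using s0
      by (intro DERIV_cong[OF DERIV_diff[OF DERIV_divide[OF lnD DERIV_ident] DERIV_cmult[OF DERIV_ident]]]) auto
    moreover have "((D s / H s) * s - ln (H s) * 1) / (s * s) - \<kappa> \<le> 0"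
    proof -
      have "s * D s - H s * ln (H s) \<le> \<kappa> * s\<^sup>2 * H s" using ent[OF s0 s(2)] by (simp add: H_def D_def)
      then have "(s * D s - H s * ln (H s)) / H s \<le> \<kappa> * s\<^sup>2" using Hpos[of s] by (simp add: pos_divide_le_eq)
      then have "(D s / H s) * s - ln (H s) \<le> \<kappa> * s\<^sup>2" using Hpos[of s] by (simp add: diff_divide_distrib mult.commute)
      then show ?thesis using s0 by (simp add: pos_divide_le_eq power2_eq_square)
    qed
    ultimately show "\<exists>y. (u has_real_derivative y) (at s) \<and> y \<le> 0" by blast
  qed
  have "u \<tau> \<le> D 0"
  proof (rule tendsto_lowerbound[OF lim])
    show "\<forall>\<^sub>F t in at_right 0. u \<tau> \<le> u t"
      using eventually_at_right_real[OF \<tau>] by eventually_elim (use mono in auto)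
  qed simp
  then have "ln (H \<tau>) / \<tau> \<le> D 0 + \<kappa> * \<tau>" by (simp add: u_def)
  then have "ln (H \<tau>) \<le> \<tau> * D 0 + \<kappa> * \<tau>\<^sup>2" using \<tau>
    by (simp add: pos_divide_le_eq power2_eq_square algebra_simps)
  then have "exp (ln (H \<tau>)) \<le> exp (\<tau> * D 0 + \<kappa> * \<tau>\<^sup>2)" by simp
  then show ?thesis using Hpos[of \<tau>] by (simp add: H_def[symmetric] H0(2))
qed

end

text \<open>The exponential on the right is taken at the smaller value \<open>u\<close>, so that
  later only increases of the function count. For positive \<open>\<theta>\<close> passing from
  \<open>w\<close> down to \<open>u\<close> costs a factor \<open>exp (\<theta> * b)\<close>; for
  negative \<open>\<theta>\<close> it costs nothing, hence \<open>max 0 \<theta>\<close>.\<close>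

lemma exp_diff_bound:
  fixes u w \<theta> b :: real
  assumes "u \<le> w" "w \<le> u + b"
  shows "\<theta> * (exp (\<theta> * w) - exp (\<theta> * u)) * (w - u) \<le> \<theta>\<^sup>2 * exp (max 0 \<theta> * b) * exp (\<theta> * u) * (w - u)\<^sup>2"
proof -
  have key: "\<theta> * (exp (\<theta> * w) - exp (\<theta> * u)) \<le> \<theta>\<^sup>2 * exp (max 0 \<theta> * b) * exp (\<theta> * u) * (w - u)"
  proof (cases "0 \<le> \<theta>")
    case True
    have "1 - \<theta> * (w - u) \<le> exp (- (\<theta> * (w - u)))" using exp_ge_add_one_self[of "- (\<theta> * (w - u))"] by simp
    then have "(1 - \<theta> * (w - u)) * exp (\<theta> * w) \<le> exp (- (\<theta> * (w - u))) * exp (\<theta> * w)"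
      by (intro mult_right_mono) auto
    also have "\<dots> = exp (\<theta> * u)" by (simp add: algebra_simps flip: exp_add)
    finally have "exp (\<theta> * w) - exp (\<theta> * u) \<le> \<theta> * (w - u) * exp (\<theta> * w)" by (simp add: algebra_simps)
    also have "\<dots> \<le> \<theta> * (w - u) * (exp (\<theta> * b) * exp (\<theta> * u))"
    proof -
      have "\<theta> * w \<le> \<theta> * b + \<theta> * u" using mult_left_mono[OF assms(2) True] by (simp add: algebra_simps)
      then have "exp (\<theta> * w) \<le> exp (\<theta> * b) * exp (\<theta> * u)" by (simp flip: exp_add)
      then show ?thesis using True assms by (intro mult_left_mono) auto
    qed
    finally have "\<theta> * (exp (\<theta> * w) - exp (\<theta> * u)) \<le> \<theta> * (\<theta> * (w - u) * (exp (\<theta> * b) * exp (\<theta> * u)))"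
      using True by (intro mult_left_mono) auto
    then show ?thesis using True by (simp add: power2_eq_square max_def mult_ac)
  next
    case False
    have "1 + \<theta> * (w - u) \<le> exp (\<theta> * (w - u))" by (rule exp_ge_add_one_self)
    then have "(1 + \<theta> * (w - u)) * exp (\<theta> * u) \<le> exp (\<theta> * (w - u)) * exp (\<theta> * u)"
      by (intro mult_right_mono) auto
    also have "\<dots> = exp (\<theta> * w)" by (simp add: algebra_simps flip: exp_add)
    finally have "\<theta> * (w - u) * exp (\<theta> * u) \<le> exp (\<theta> * w) - exp (\<theta> * u)" by (simp add: algebra_simps)
    then have "\<theta> * (exp (\<theta> * w) - exp (\<theta> * u)) \<le> \<theta> * (\<theta> * (w - u) * exp (\<theta> * u))"
      using False by (intro mult_left_mono_neg) auto
    then show ?thesis using False by (simp add: power2_eq_square max_def mult_ac)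
  qed
  show ?thesis using mult_right_mono[OF key, of "w - u"] assms by (simp add: power2_eq_square mult_ac)
qed

section \<open>Resampling one coordinate\<close>

context prob_family
begin

text \<open>Given the other coordinates, the value at \<open>i\<close> and its replacement are
  independent with the same law, so they may be exchanged.\<close>

lemma integral_resample_swap:
  fixes F :: "('i \<Rightarrow> 'c) \<Rightarrow> real" and \<phi> :: "real \<Rightarrow> real \<Rightarrow> real"
  assumes "finite I" "i \<in> I" and F: "bdd_mble (PiM I N) F" and \<phi>: "continuous_on UNIV (\<lambda>(u, w). \<phi> u w)"
  shows "(\<integral>x. (\<integral>y. \<phi> (F x) (F (x(i := y))) \<partial>N i) \<partial>PiM I N) =
    (\<integral>x. (\<integral>y. \<phi> (F (x(i := y))) (F x) \<partial>N i) \<partial>PiM I N)"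
proof -
  interpret Ni: prob_space "N i" by (rule prob_N)
  define J where "J = I - {i}"
  have J: "finite J" "i \<notin> J" "insert i J = I" using assms by (auto simp: J_def)
  interpret PJ: prob_space "PiM J N" by (rule prob_Pi)
  interpret PI: prob_space "PiM I N" by (rule prob_Pi)
  obtain B where B: "\<And>x. x \<in> space (PiM I N) \<Longrightarrow> \<bar>F x\<bar> \<le> B" using F unfolding bdd_mble_def by blast
  have "bounded ((\<lambda>(u, w). \<phi> u w) ` ({-B..B} \<times> {-B..B}))"
    using \<phi> by (intro compact_imp_bounded compact_continuous_image compact_Times) (auto intro: continuous_on_subset)
  then obtain D where D: "\<forall>u\<in>{-B..B}. \<forall>w\<in>{-B..B}. \<bar>\<phi> u w\<bar> \<le> D" by (auto simp: bounded_iff)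
  have \<phi>m: "(\<lambda>x. \<phi> (f x) (g x)) \<in> borel_measurable M"
    if "f \<in> borel_measurable M" "g \<in> borel_measurable M" for f g and M :: "'z measure"
    using measurable_compose[OF borel_measurable_Pair[OF that] borel_measurable_continuous_onI[OF \<phi>]] by simp
  have bdd: "bdd_mble M (\<lambda>x. \<phi> (F (f x)) (F (g x)))"
    if "f \<in> measurable M (PiM I N)" "g \<in> measurable M (PiM I N)" for f g and M :: "'z measure"
  proof (rule bdd_mbleI)
    show "(\<lambda>x. \<phi> (F (f x)) (F (g x))) \<in> borel_measurable M"
      using F that by (intro \<phi>m) (auto simp: bdd_mble_def intro: measurable_compose)
    fix x assume "x \<in> space M"
    then have "f x \<in> space (PiM I N)" "g x \<in> space (PiM I N)" using that by (auto dest: measurable_space)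
    from B[OF this(1)] B[OF this(2)] show "\<bar>\<phi> (F (f x)) (F (g x))\<bar> \<le> D"
      by (intro D[rule_format]) auto
  qed
  have id: "(\<lambda>p. fst p) \<in> measurable (PiM I N \<Otimes>\<^sub>M N i) (PiM I N)" by simp
  have up: "(\<lambda>p. (fst p)(i := snd p)) \<in> measurable (PiM I N \<Otimes>\<^sub>M N i) (PiM I N)"
    using fun_upd_mble[OF assms(2)] unfolding case_prod_unfold .
  have *: "(\<integral>x. (\<integral>y. \<psi> (F x) (F (x(i := y))) \<partial>N i) \<partial>PiM I N) =
      (\<integral>x. (\<integral>y'. (\<integral>y. \<psi> (F (x(i := y'))) (F (x(i := y))) \<partial>N i) \<partial>N i) \<partial>PiM J N)"
    if "bdd_mble (PiM I N \<Otimes>\<^sub>M N i) (\<lambda>(x, y). \<psi> (F x) (F (x(i := y))))" for \<psi> :: "real \<Rightarrow> real \<Rightarrow> real"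
    using integral_insert[OF J(1,2), of "\<lambda>x. \<integral>y. \<psi> (F x) (F (x(i := y))) \<partial>N i"]
      Ni.bdd_mble_integral[OF that] unfolding J(3) by simp
  have "(\<integral>x. (\<integral>y. \<phi> (F x) (F (x(i := y))) \<partial>N i) \<partial>PiM I N) =
      (\<integral>x. (\<integral>y'. (\<integral>y. \<phi> (F (x(i := y'))) (F (x(i := y))) \<partial>N i) \<partial>N i) \<partial>PiM J N)"
    by (rule *) (unfold case_prod_unfold, rule bdd[OF id up])
  also have "\<dots> = (\<integral>x. (\<integral>y'. (\<integral>y. \<phi> (F (x(i := y))) (F (x(i := y'))) \<partial>N i) \<partial>N i) \<partial>PiM J N)"
  proof (rule Bochner_Integration.integral_cong[OF refl])
    fix x assume x: "x \<in> space (PiM J N)"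
    have "(\<lambda>y. x(i := y)) \<in> measurable (N i) (PiM I N)"
      using measurable_Pair2[OF fun_upd_insert_mble[of i J] x] by (simp add: J(3))
    then have "bdd_mble (N i \<Otimes>\<^sub>M N i) (\<lambda>p. \<phi> (F (x(i := fst p))) (F (x(i := snd p))))"
      by (intro bdd measurable_compose[OF measurable_fst] measurable_compose[OF measurable_snd])
    then have "bdd_mble (N i \<Otimes>\<^sub>M N i) (\<lambda>(y', y). \<phi> (F (x(i := y'))) (F (x(i := y))))"
      unfolding case_prod_unfold .
    then show "(\<integral>y'. (\<integral>y. \<phi> (F (x(i := y'))) (F (x(i := y))) \<partial>N i) \<partial>N i) =
      (\<integral>y'. (\<integral>y. \<phi> (F (x(i := y))) (F (x(i := y'))) \<partial>N i) \<partial>N i)"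
      by (rule Fubini_bdd[OF prob_N prob_N])
  qed
  also have "\<dots> = (\<integral>x. (\<integral>y. \<phi> (F (x(i := y))) (F x) \<partial>N i) \<partial>PiM I N)"
    by (rule *[symmetric]) (unfold case_prod_unfold, rule bdd[OF up id])
  finally show ?thesis .
qed

text \<open>Allows the separate copies of the coordinates to be replaced by one independent copy of
  the whole vector, so that the sum over all coordinates can be bounded pointwise.\<close>

lemma integral_component:
  assumes "i \<in> I" "g \<in> borel_measurable (N i)"
  shows "(\<integral>y. g y \<partial>N i) = (\<integral>x. (g (x i) :: real) \<partial>PiM I N)"
proof -
  have "(\<integral>y. g y \<partial>N i) = (\<integral>y. g y \<partial>distr (PiM I N) (N i) (\<lambda>x. x i))"
    by (subst distr_PiM_component[OF prob_N assms(1)]) simp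
  also have "\<dots> = (\<integral>x. g (x i) \<partial>PiM I N)"
    using assms by (intro integral_distr) auto
  finally show ?thesis .
qed

text \<open>Tensorization gives a sum of terms in the original and the resampled value. Exchanging
  the two symmetrises each term, \<open>exp_diff_bound\<close> applies to the ordered pair, and
  exchanging back leaves only positive increments relative to \<open>F x\<close>, whose squares sum
  to at most \<open>K\<close>.\<close>

theorem resampling_entropy:
  fixes F :: "('i \<Rightarrow> 'c) \<Rightarrow> real"
  assumes I: "finite I" and F: "bdd_mble (PiM I N) F"
    and b: "\<And>x y i. x \<in> space (PiM I N) \<Longrightarrow> i \<in> I \<Longrightarrow> y \<in> space (N i) \<Longrightarrow> F (x(i := y)) \<le> F x + b"
    and K: "\<And>x x'. x \<in> space (PiM I N) \<Longrightarrow> x' \<in> space (PiM I N) \<Longrightarrow>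
      (\<Sum>i\<in>I. (max 0 (F (x(i := x' i)) - F x))\<^sup>2) \<le> K"
  shows "\<theta> * (\<integral>x. F x * exp (\<theta> * F x) \<partial>PiM I N) -
      (\<integral>x. exp (\<theta> * F x) \<partial>PiM I N) * ln (\<integral>x. exp (\<theta> * F x) \<partial>PiM I N)
    \<le> \<theta>\<^sup>2 * exp (max 0 \<theta> * b) * K * (\<integral>x. exp (\<theta> * F x) \<partial>PiM I N)"
proof -
  let ?\<Pi> = "PiM I N"
  interpret P: prob_space ?\<Pi> by (rule prob_Pi)
  obtain B where B: "\<And>x. x \<in> space ?\<Pi> \<Longrightarrow> \<bar>F x\<bar> \<le> B" using F unfolding bdd_mble_def by blast
  define f where "f x = exp (\<theta> * F x)" for x
  have bf: "bdd_mble ?\<Pi> f" unfolding f_def by (rule bdd_mble_continuous[OF F]) (intro continuous_intros)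
  have fm: "f \<in> borel_measurable ?\<Pi>" using bf by (simp add: bdd_mble_def)
  have fb: "exp (- (\<bar>\<theta>\<bar> * B)) \<le> f x" "f x \<le> exp (\<bar>\<theta>\<bar> * B)" if "x \<in> space ?\<Pi>" for x
  proof -
    have "\<bar>\<theta> * F x\<bar> \<le> \<bar>\<theta>\<bar> * B" unfolding abs_mult using B[OF that] by (intro mult_left_mono) auto
    then show "exp (- (\<bar>\<theta>\<bar> * B)) \<le> f x" "f x \<le> exp (\<bar>\<theta>\<bar> * B)"
      unfolding f_def by (auto simp: abs_le_iff minus_le_iff)
  qed
  define c where "c = \<theta>\<^sup>2 * exp (max 0 \<theta> * b)"
  \<comment> \<open>The term \<open>\<phi>\<close> comes from tensorization, and
    \<open>\<xi>\<close> is its one-sided majorant: the inequality between them holds after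
    symmetrisation in \<open>u\<close> and \<open>w\<close>.\<close>
  define \<phi> \<xi> where "\<phi> u w = \<theta> * exp (\<theta> * u) * (u - w)"
    and "\<xi> u w = c * exp (\<theta> * u) * (max 0 (w - u))\<^sup>2" for u w :: real
  have c\<phi>: "continuous_on UNIV (\<lambda>(u, w). \<phi> u w)" "continuous_on UNIV (\<lambda>(u, w). \<xi> u w)"
    "continuous_on UNIV (\<lambda>(u, w). \<phi> w u)" "continuous_on UNIV (\<lambda>(u, w). \<xi> w u)"
    unfolding \<phi>_def \<xi>_def case_prod_unfold by (intro continuous_intros)+
  have c0: "0 \<le> c" by (simp add: c_def)
  have pw: "\<phi> u w + \<phi> w u \<le> \<xi> u w + \<xi> w u" if "w \<le> u + b" "u \<le> w + b" for u w
  proof (cases "u \<le> w")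
    case True
    then show ?thesis using exp_diff_bound[OF True that(1), of \<theta>]
      by (simp add: \<phi>_def \<xi>_def c_def max_def algebra_simps)
  next
    case False
    then show ?thesis using exp_diff_bound[of w u b \<theta>] that
      by (simp add: \<phi>_def \<xi>_def c_def max_def algebra_simps)
  qed
  have bdd: "bdd_mble (?\<Pi> \<Otimes>\<^sub>M N i) (\<lambda>(x, y). \<psi> (F x) (F (x(i := y))))"
    if i: "i \<in> I" and \<psi>: "continuous_on UNIV (\<lambda>(u, w). \<psi> u w)" for i and \<psi> :: "real \<Rightarrow> real \<Rightarrow> real"
  proof -
    have up: "(\<lambda>p. (fst p)(i := snd p)) \<in> measurable (?\<Pi> \<Otimes>\<^sub>M N i) ?\<Pi>"
      using fun_upd_mble[OF i] unfolding case_prod_unfold .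
    have "bounded ((\<lambda>(u, w). \<psi> u w) ` ({-B..B} \<times> {-B..B}))"
      using \<psi> by (intro compact_imp_bounded compact_continuous_image compact_Times) (auto intro: continuous_on_subset)
    then obtain D where D: "\<forall>u\<in>{-B..B}. \<forall>w\<in>{-B..B}. \<bar>\<psi> u w\<bar> \<le> D" by (auto simp: bounded_iff)
    have Fm: "F \<in> borel_measurable ?\<Pi>" using F by (simp add: bdd_mble_def)
    show ?thesis unfolding case_prod_unfold
    proof (rule bdd_mbleI)
      show "(\<lambda>p. \<psi> (F (fst p)) (F ((fst p)(i := snd p)))) \<in> borel_measurable (?\<Pi> \<Otimes>\<^sub>M N i)"
        using measurable_compose[OF borel_measurable_Pair[OF measurable_compose[OF measurable_fst Fm]
              measurable_compose[OF up Fm]] borel_measurable_continuous_onI[OF \<psi>]] by (simp del: fun_upd_apply)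
      fix p assume p: "p \<in> space (?\<Pi> \<Otimes>\<^sub>M N i)"
      have "fst p \<in> space ?\<Pi>" "(fst p)(i := snd p) \<in> space ?\<Pi>"
        using p measurable_space[OF up p] by (auto simp: space_pair_measure)
      from B[OF this(1)] B[OF this(2)] show "\<bar>\<psi> (F (fst p)) (F ((fst p)(i := snd p)))\<bar> \<le> D"
        by (intro D[rule_format]) auto
    qed
  qed
  have int: "integrable (N i) (\<lambda>y. \<psi> (F x) (F (x(i := y))))"
      "(\<lambda>y. \<psi> (F x) (F (x(i := y)))) \<in> borel_measurable (N i)"
      "integrable ?\<Pi> (\<lambda>x. \<integral>y. \<psi> (F x) (F (x(i := y))) \<partial>N i)"
    if i: "i \<in> I" and \<psi>: "continuous_on UNIV (\<lambda>(u, w). \<psi> u w)" and x: "x \<in> space ?\<Pi>"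
    for i x and \<psi> :: "real \<Rightarrow> real \<Rightarrow> real"
  proof -
    interpret Ni: prob_space "N i" by (rule prob_N)
    note bd = bdd[OF i \<psi>]
    have "(\<lambda>(x, y). \<psi> (F x) (F (x(i := y)))) \<circ> Pair x = (\<lambda>y. \<psi> (F x) (F (x(i := y))))" by auto
    then have bN: "bdd_mble (N i) (\<lambda>y. \<psi> (F x) (F (x(i := y))))"
      using bdd_mble_compose[OF bd measurable_Pair1'[OF x]] by (simp add: comp_def del: fun_upd_apply)
    then show "integrable (N i) (\<lambda>y. \<psi> (F x) (F (x(i := y))))"
      "(\<lambda>y. \<psi> (F x) (F (x(i := y)))) \<in> borel_measurable (N i)"
      using Ni.bdd_mble_integrable[OF bN] by (simp_all add: bdd_mble_def del: fun_upd_apply)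
    show "integrable ?\<Pi> (\<lambda>x. \<integral>y. \<psi> (F x) (F (x(i := y))) \<partial>N i)"
      by (intro P.bdd_mble_integrable Ni.bdd_mble_integral bd)
  qed
  have upsp: "x(i := y) \<in> space ?\<Pi>" if "x \<in> space ?\<Pi>" "i \<in> I" "y \<in> space (N i)" for x i y
    using fun_upd_space[OF that(1,3)] that(2) by (simp add: insert_absorb)
  have summand: "(\<integral>x. (\<integral>y. \<phi> (F x) (F (x(i := y))) \<partial>N i) \<partial>?\<Pi>) \<le> (\<integral>x. (\<integral>y. \<xi> (F x) (F (x(i := y))) \<partial>N i) \<partial>?\<Pi>)"
    if i: "i \<in> I" for i
  proof -
    obtain x0 where x0: "x0 \<in> space ?\<Pi>" using P.not_empty by blast
    note ic = int[OF i c\<phi>(1)] int[OF i c\<phi>(2)] int[OF i c\<phi>(3)] int[OF i c\<phi>(4)]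
    note ic0 = ic[OF x0]
    have "2 * (\<integral>x. (\<integral>y. \<phi> (F x) (F (x(i := y))) \<partial>N i) \<partial>?\<Pi>) =
      (\<integral>x. (\<integral>y. \<phi> (F x) (F (x(i := y))) \<partial>N i) + (\<integral>y. \<phi> (F (x(i := y))) (F x) \<partial>N i) \<partial>?\<Pi>)"
      using integral_resample_swap[OF I i F c\<phi>(1)] ic0 by simp
    also have "\<dots> \<le> (\<integral>x. (\<integral>y. \<xi> (F x) (F (x(i := y))) \<partial>N i) + (\<integral>y. \<xi> (F (x(i := y))) (F x) \<partial>N i) \<partial>?\<Pi>)"
    proof (intro integral_mono Bochner_Integration.integrable_add ic0)
      fix x assume x: "x \<in> space ?\<Pi>"
      have "(\<integral>y. \<phi> (F x) (F (x(i := y))) + \<phi> (F (x(i := y))) (F x) \<partial>N i) \<le>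
        (\<integral>y. \<xi> (F x) (F (x(i := y))) + \<xi> (F (x(i := y))) (F x) \<partial>N i)"
      proof (intro integral_mono Bochner_Integration.integrable_add ic[OF x])
        fix y assume y: "y \<in> space (N i)"
        have xi: "x i \<in> space (N i)" using x i by (auto simp: space_PiM)
        have "F ((x(i := y))(i := x i)) \<le> F (x(i := y)) + b" by (rule b[OF upsp[OF x i y] i xi])
        then have "F x \<le> F (x(i := y)) + b" by simp
        then show "\<phi> (F x) (F (x(i := y))) + \<phi> (F (x(i := y))) (F x) \<le> \<xi> (F x) (F (x(i := y))) + \<xi> (F (x(i := y))) (F x)"
          by (intro pw b[OF x i y])
      qed
      then show "(\<integral>y. \<phi> (F x) (F (x(i := y))) \<partial>N i) + (\<integral>y. \<phi> (F (x(i := y))) (F x) \<partial>N i) \<le>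
        (\<integral>y. \<xi> (F x) (F (x(i := y))) \<partial>N i) + (\<integral>y. \<xi> (F (x(i := y))) (F x) \<partial>N i)"
        using ic[OF x] by simp
    qed
    also have "\<dots> = 2 * (\<integral>x. (\<integral>y. \<xi> (F x) (F (x(i := y))) \<partial>N i) \<partial>?\<Pi>)"
      using integral_resample_swap[OF I i F c\<phi>(2)] ic0 by simp
    finally show ?thesis by simp
  qed
  have sum_le: "(\<Sum>i\<in>I. \<integral>x. (\<integral>y. \<xi> (F x) (F (x(i := y))) \<partial>N i) \<partial>?\<Pi>) \<le> (\<integral>x. c * K * f x \<partial>?\<Pi>)"
  proof -
    obtain x0 where x0: "x0 \<in> space ?\<Pi>" using P.not_empty by blast
    have "(\<Sum>i\<in>I. \<integral>x. (\<integral>y. \<xi> (F x) (F (x(i := y))) \<partial>N i) \<partial>?\<Pi>) =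
      (\<integral>x. (\<Sum>i\<in>I. \<integral>y. \<xi> (F x) (F (x(i := y))) \<partial>N i) \<partial>?\<Pi>)"
      using int(3)[OF _ c\<phi>(2) x0] by (intro Bochner_Integration.integral_sum[symmetric]) auto
    also have "\<dots> \<le> (\<integral>x. c * K * f x \<partial>?\<Pi>)"
    proof (intro integral_mono Bochner_Integration.integrable_sum int(3)[OF _ c\<phi>(2) x0])
      show "integrable ?\<Pi> (\<lambda>x. c * K * f x)" using P.bdd_mble_integrable[OF bf] by simp
      fix x assume x: "x \<in> space ?\<Pi>"
      have ii: "integrable ?\<Pi> (\<lambda>x'. \<xi> (F x) (F (x(i := x' i))))" if "i \<in> I" for i
      proof -
        have d: "distr ?\<Pi> (N i) (\<lambda>x. x i) = N i" by (rule distr_PiM_component[OF prob_N that])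
        show ?thesis using int(1)[OF that c\<phi>(2) x] that
          by (subst (asm) d[symmetric], subst (asm) integrable_distr_eq)
            (auto intro: int(2)[OF that c\<phi>(2) x])
      qed
      have "(\<Sum>i\<in>I. \<integral>y. \<xi> (F x) (F (x(i := y))) \<partial>N i) = (\<Sum>i\<in>I. \<integral>x'. \<xi> (F x) (F (x(i := x' i))) \<partial>?\<Pi>)"
        by (intro sum.cong refl integral_component int(2)[OF _ c\<phi>(2) x])
      also have "\<dots> = (\<integral>x'. (\<Sum>i\<in>I. \<xi> (F x) (F (x(i := x' i)))) \<partial>?\<Pi>)"
        using ii by (intro Bochner_Integration.integral_sum[symmetric]) auto
      also have "\<dots> \<le> (\<integral>x'. c * K * f x \<partial>?\<Pi>)"
      proof (intro integral_mono Bochner_Integration.integrable_sum ii)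
        fix x' assume x': "x' \<in> space ?\<Pi>"
        have "(\<Sum>i\<in>I. \<xi> (F x) (F (x(i := x' i)))) = c * f x * (\<Sum>i\<in>I. (max 0 (F (x(i := x' i)) - F x))\<^sup>2)"
          unfolding \<xi>_def f_def sum_distrib_left ..
        also have "\<dots> \<le> c * f x * K" using K[OF x x'] c0 by (intro mult_left_mono) (auto simp: f_def)
        finally show "(\<Sum>i\<in>I. \<xi> (F x) (F (x(i := x' i)))) \<le> c * K * f x" by (simp add: mult_ac)
      qed auto
      also have "\<dots> = c * K * f x" by (simp add: P.prob_space)
      finally show "(\<Sum>i\<in>I. \<integral>y. \<xi> (F x) (F (x(i := y))) \<partial>N i) \<le> c * K * f x" .
    qed
    finally show ?thesis .
  qed
  have "(\<integral>x. f x * ln (f x) \<partial>?\<Pi>) - (\<integral>x. f x \<partial>?\<Pi>) * ln (\<integral>x. f x \<partial>?\<Pi>) \<le>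
    (\<Sum>i\<in>I. \<integral>x. (\<integral>y. f x * (ln (f x) - ln (f (x(i := y)))) \<partial>N i) \<partial>?\<Pi>)"
    by (rule entropy_tensorization[OF I fm fb]) auto
  also have "\<dots> = (\<Sum>i\<in>I. \<integral>x. (\<integral>y. \<phi> (F x) (F (x(i := y))) \<partial>N i) \<partial>?\<Pi>)"
    by (simp add: f_def \<phi>_def algebra_simps del: fun_upd_apply)
  also have "\<dots> \<le> (\<Sum>i\<in>I. \<integral>x. (\<integral>y. \<xi> (F x) (F (x(i := y))) \<partial>N i) \<partial>?\<Pi>)"
    by (rule sum_mono[OF summand])
  also note sum_le
  finally have "(\<integral>x. f x * ln (f x) \<partial>?\<Pi>) - (\<integral>x. f x \<partial>?\<Pi>) * ln (\<integral>x. f x \<partial>?\<Pi>) \<le> (\<integral>x. c * K * f x \<partial>?\<Pi>)" .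
  moreover have "(\<integral>x. f x * ln (f x) \<partial>?\<Pi>) = \<theta> * (\<integral>x. F x * exp (\<theta> * F x) \<partial>?\<Pi>)"
    unfolding f_def ln_exp by (simp add: mult_ac flip: integral_mult_right_zero)
  ultimately show ?thesis by (simp add: f_def c_def)
qed

end

context prob_family
begin

text \<open>The restriction on \<open>\<theta>\<close> in the first part keeps
  \<open>exp (\<theta> * b)\<close> below 3. For negative exponents this factor is 1, so the second
  part holds for all positive \<open>\<theta>\<close> and yields a Gaussian tail.\<close>

theorem resampling_mgf:
  fixes F :: "('i \<Rightarrow> 'c) \<Rightarrow> real"
  assumes I: "finite I" and F: "bdd_mble (PiM I N) F" and "0 < b"
    and b: "\<And>x y i. x \<in> space (PiM I N) \<Longrightarrow> i \<in> I \<Longrightarrow> y \<in> space (N i) \<Longrightarrow> F (x(i := y)) \<le> F x + b"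
    and K: "\<And>x x'. x \<in> space (PiM I N) \<Longrightarrow> x' \<in> space (PiM I N) \<Longrightarrow>
      (\<Sum>i\<in>I. (max 0 (F (x(i := x' i)) - F x))\<^sup>2) \<le> K" and K0: "0 \<le> K"
  shows "0 < \<theta> \<Longrightarrow> \<theta> \<le> 1 / b \<Longrightarrow>
      (\<integral>x. exp (\<theta> * F x) \<partial>PiM I N) \<le> exp (\<theta> * (\<integral>x. F x \<partial>PiM I N) + 3 * K * \<theta>\<^sup>2)"
    and "0 < \<theta> \<Longrightarrow> (\<integral>x. exp (- \<theta> * F x) \<partial>PiM I N) \<le> exp (- \<theta> * (\<integral>x. F x \<partial>PiM I N) + K * \<theta>\<^sup>2)"
proof -
  interpret P: prob_space "PiM I N" by (rule prob_Pi)
  note ent = resampling_entropy[OF I F b K]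
  have H: "0 \<le> (\<integral>x. exp (t * F x) \<partial>PiM I N)" for t by (rule Bochner_Integration.integral_nonneg) simp
  {
    assume \<theta>: "0 < \<theta>" "\<theta> \<le> 1 / b"
    show "(\<integral>x. exp (\<theta> * F x) \<partial>PiM I N) \<le> exp (\<theta> * (\<integral>x. F x \<partial>PiM I N) + 3 * K * \<theta>\<^sup>2)"
    proof (rule P.herbst[OF F \<theta>(1)])
      fix t assume t: "0 < t" "t \<le> \<theta>"
      have "t * b \<le> \<theta> * b" "\<theta> * b \<le> 1"
        using t(2) \<theta>(2) assms(3) by (auto simp: pos_le_divide_eq intro: mult_right_mono)
      then have "t * b \<le> 1" by linarith
      then have "exp (max 0 t * b) \<le> exp 1" using t(1) by (simp add: max_def)
      then have "exp (max 0 t * b) \<le> 3" using exp_le by linarith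
      then have "exp (max 0 t * b) * (t\<^sup>2 * K * (\<integral>x. exp (t * F x) \<partial>PiM I N)) \<le>
        3 * (t\<^sup>2 * K * (\<integral>x. exp (t * F x) \<partial>PiM I N))"
        using H[of t] K0 by (intro mult_right_mono mult_nonneg_nonneg) auto
      then have le: "t\<^sup>2 * exp (max 0 t * b) * K * (\<integral>x. exp (t * F x) \<partial>PiM I N) \<le>
        3 * K * t\<^sup>2 * (\<integral>x. exp (t * F x) \<partial>PiM I N)" by (simp only: mult_ac)
      show "t * (\<integral>x. F x * exp (t * F x) \<partial>PiM I N) -
        (\<integral>x. exp (t * F x) \<partial>PiM I N) * ln (\<integral>x. exp (t * F x) \<partial>PiM I N)
        \<le> 3 * K * t\<^sup>2 * (\<integral>x. exp (t * F x) \<partial>PiM I N)"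
        by (rule order_trans[OF ent[of t] le])
    qed
  }
  {
    assume \<theta>: "0 < \<theta>"
    have F': "bdd_mble (PiM I N) (\<lambda>x. - F x)" using bdd_mble_mult[OF bdd_mble_const[of _ "-1"] F] by simp
    have "(\<integral>x. exp (\<theta> * - F x) \<partial>PiM I N) \<le> exp (\<theta> * (\<integral>x. - F x \<partial>PiM I N) + K * \<theta>\<^sup>2)"
    proof (rule P.herbst[OF F' \<theta>])
      fix t assume t: "0 < t" "t \<le> \<theta>"
      show "t * (\<integral>x. - F x * exp (t * - F x) \<partial>PiM I N) -
        (\<integral>x. exp (t * - F x) \<partial>PiM I N) * ln (\<integral>x. exp (t * - F x) \<partial>PiM I N)
        \<le> K * t\<^sup>2 * (\<integral>x. exp (t * - F x) \<partial>PiM I N)"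
      proof -
        define D H where "D = (\<integral>x. F x * exp (- t * F x) \<partial>PiM I N)" and "H = (\<integral>x. exp (- t * F x) \<partial>PiM I N)"
        have e: "(\<lambda>x. exp (t * - F x)) = (\<lambda>x. exp (- t * F x))"
          "(\<lambda>x. - F x * exp (t * - F x)) = (\<lambda>x. - (F x * exp (- t * F x)))" by auto
        have "max 0 (- t) = 0" using t(1) by simp
        then have "(- t)\<^sup>2 * exp (max 0 (- t) * b) * K * H = t\<^sup>2 * K * H" by simp
        moreover have "- t * D - H * ln H \<le> (- t)\<^sup>2 * exp (max 0 (- t) * b) * K * H"
          unfolding D_def H_def by (rule ent)
        ultimately have "- t * D - H * ln H \<le> t\<^sup>2 * K * H" by linarith
        moreover have "t * - D = - t * D" "K * t\<^sup>2 * H = t\<^sup>2 * K * H" by simp_all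
        ultimately have "t * - D - H * ln H \<le> K * t\<^sup>2 * H" by linarith
        then show ?thesis unfolding e Bochner_Integration.integral_minus D_def H_def .
      qed
    qed
    then show "(\<integral>x. exp (- \<theta> * F x) \<partial>PiM I N) \<le> exp (- \<theta> * (\<integral>x. F x \<partial>PiM I N) + K * \<theta>\<^sup>2)" by simp
  }
qed

end

subsection \<open>Concentration of the distance in the enriched process\<close>

context cube_grid
begin

text \<open>The half-open cubes, unlike the closed cubes, partition the space.\<close>
definition hcube :: "int ^ 'n \<Rightarrow> (real ^ 'n) set" where "hcube v = {y. idx y = v}"

lemma hcube_subset: "hcube v \<subseteq> cube v"
  using mem_cube_idx by (auto simp: hcube_def)

lemma hcube_iff:
  "y \<in> hcube v \<longleftrightarrow> (\<forall>i. z $ i + a * real_of_int (v $ i) \<le> y $ i \<and> y $ i < z $ i + a * (real_of_int (v $ i) + 1))"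
proof -
  have "\<lfloor>(y $ i - z $ i) / a\<rfloor> = v $ i \<longleftrightarrow>
    z $ i + a * real_of_int (v $ i) \<le> y $ i \<and> y $ i < z $ i + a * (real_of_int (v $ i) + 1)" for i
    unfolding floor_eq_iff using a_pos
    by (simp add: pos_le_divide_eq pos_divide_less_eq algebra_simps)
  then show ?thesis by (simp add: hcube_def idx_def vec_eq_iff)
qed

lemma cube_borel [measurable]: "cube v \<in> sets borel" and cube_bounded: "bounded (cube v)"
  by (auto simp: grid_cube_def)

lemma hcube_borel [measurable]: "hcube v \<in> sets borel"
proof -
  have "hcube v = {y \<in> space borel. \<forall>i. z $ i + a * real_of_int (v $ i) \<le> y $ i \<and> y $ i < z $ i + a * (real_of_int (v $ i) + 1)}"
    using hcube_iff by auto
  also have "\<dots> \<in> sets borel" by measurable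
  finally show ?thesis .
qed

lemma hcube_bounded: "bounded (hcube v)"
  using cube_bounded hcube_subset by (rule bounded_subset)

lemma disjoint_hcube: "disjoint_family_on hcube V"
  by (auto simp: disjoint_family_on_def hcube_def)

lemma emeasure_cube_diff: "emeasure lborel (cube v - hcube v) = 0"
proof -
  let ?l = "z + a *\<^sub>R (\<chi> i. real_of_int (v $ i))" and ?u = "z + a *\<^sub>R (\<chi> i. real_of_int (v $ i) + 1)"
  have "box ?l ?u \<subseteq> hcube v" by (auto simp: hcube_iff mem_box_cart less_imp_le)
  then have "cube v - hcube v \<subseteq> cbox ?l ?u - box ?l ?u" by (auto simp: grid_cube_def)
  then have "emeasure lborel (cube v - hcube v) \<le> emeasure lborel (cbox ?l ?u - box ?l ?u)"
    by (intro emeasure_mono) auto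
  also have "\<dots> = emeasure lborel (cbox ?l ?u) - emeasure lborel (box ?l ?u)"
    by (intro emeasure_Diff) (auto simp: box_subset_cbox emeasure_lborel_box_eq)
  also have "\<dots> = 0" by (simp add: emeasure_lborel_box_eq emeasure_lborel_cbox_eq)
  finally show ?thesis by simp
qed

lemma finite_centres:
  assumes c: "\<And>v. c v \<in> cube v" and B: "bounded B"
  shows "finite {v. c v \<in> B}"
  by (rule finite_subset[OF _ cubes_meeting_bounded[OF B]]) (use c in blast)

lemma enrich_measurable:
  assumes "\<And>v. c v \<in> cube v"
  shows "enrich a z c \<in> measurable cfg cfg"
  using measurable_fill[of cube c, OF cube_borel cube_bounded finite_centres[OF assms]]
  unfolding enrich_def[abs_def] by simp

lemma enrich_hits: "(\<And>v. c v \<in> cube v) \<Longrightarrow> hits U (enrich a z c P)"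
  unfolding hits_def enrich_def by blast

text \<open>A deterministic bound for the enriched distance of two points at Euclidean distance
  \<open>r\<close>. It serves as the truncation level that makes the distance local.\<close>

definition ell :: "real \<Rightarrow> real" where "ell r = C * r + (C + 1) * \<delta>"

lemma ell_nonneg: "0 \<le> r \<Longrightarrow> 0 \<le> ell r"
  using C_ge \<delta>_pos by (simp add: ell_def)

lemma h_dist_le_ell:
  "lfin P \<Longrightarrow> hits UNIV P \<Longrightarrow> \<delta> \<le> h \<Longrightarrow> h_dist h P x y \<le> ennreal (ell (norm (x - y)))"
  unfolding ell_def by (rule h_dist_upper[of P UNIV]) auto

text \<open>The cost of changing the points of one cube, from \<open>h_dist_replace\<close>.\<close>

definition jump :: real where "jump = (3 * C + 5) * \<delta>"

lemma jump_pos: "0 < jump" using C_ge \<delta>_pos by (simp add: jump_def)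

text \<open>Rebuilds the enriched configuration from independent pieces indexed by a finite set
  \<open>V\<close>. The pieces are cut to the half-open cubes once more because on the product space
  they are arbitrary configurations; outside \<open>V\<close> only the points \<open>c v\<close> are
  placed.\<close>

definition fill_cells :: "(int ^ 'n \<Rightarrow> real ^ 'n) \<Rightarrow> (int ^ 'n) set \<Rightarrow> (int ^ 'n \<Rightarrow> (real ^ 'n) set) \<Rightarrow> int ^ 'n \<Rightarrow> (real ^ 'n) set" where
  "fill_cells c V \<xi> v = (if v \<in> V \<and> \<xi> v \<inter> hcube v \<noteq> {} then \<xi> v \<inter> hcube v else {c v})"

lemma cells_fill_cells:
  assumes "\<And>v. c v \<in> cube v" "\<And>v. v \<in> V \<Longrightarrow> lfin (\<xi> v)"
  shows "cells (fill_cells c V \<xi>)"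
  unfolding cells_def
proof (rule allI)
  fix v
  show "fill_cells c V \<xi> v \<noteq> {} \<and> finite (fill_cells c V \<xi> v) \<and> fill_cells c V \<xi> v \<subseteq> cube v"
    using assms(1)[of v] assms(2)[of v] hcube_subset[of v] hcube_bounded[of v]
    by (cases "v \<in> V") (auto simp: fill_cells_def lfin_def)
qed

lemma fill_cells_upd: "v \<noteq> k \<Longrightarrow> fill_cells c V (\<xi>(k := \<eta>)) v = fill_cells c V \<xi> v"
  by (simp add: fill_cells_def)

lemma fill_cells_upd_eq: "fill_cells c V (\<xi>(k := \<eta>)) = (fill_cells c V \<xi>)(k := fill_cells c V (\<xi>(k := \<eta>)) k)"
  by (auto simp: fun_eq_iff fill_cells_def)

lemma fill_cells_measurable:
  assumes c: "\<And>v. c v \<in> cube v" and V: "finite V"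
  shows "(\<lambda>\<xi>. \<Union>v. fill_cells c V \<xi> v) \<in> measurable (PiM V (\<lambda>_. cfg)) cfg"
proof -
  let ?U = "\<lambda>\<xi> :: int ^ 'n \<Rightarrow> (real ^ 'n) set. \<Union>v\<in>V. \<xi> v \<inter> hcube v"
  have U: "?U \<in> measurable (PiM V (\<lambda>_. cfg)) cfg"
  proof (rule measurable_cfgI)
    fix \<xi> assume "\<xi> \<in> space (PiM V (\<lambda>_. cfg :: (real ^ 'n) set measure))"
    then have "\<And>v. v \<in> V \<Longrightarrow> lfin (\<xi> v)" by (auto simp: space_PiM space_cfg)
    then have "finite (\<Union>v\<in>V. \<xi> v \<inter> B)" if "bounded B" for B
      using that by (intro finite_UN_I V) (auto simp: lfin_def)
    moreover have "?U \<xi> \<inter> B \<subseteq> (\<Union>v\<in>V. \<xi> v \<inter> B)" for B by auto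
    ultimately show "lfin (?U \<xi>)" unfolding lfin_def by (meson finite_subset)
  next
    fix B :: "(real ^ 'n) set" assume B: "B \<in> sets borel" "bounded B"
    have "card (?U \<xi> \<inter> B) = (\<Sum>v\<in>V. card (\<xi> v \<inter> (hcube v \<inter> B)))"
      if "\<xi> \<in> space (PiM V (\<lambda>_. cfg))" for \<xi>
    proof -
      have "\<And>v. v \<in> V \<Longrightarrow> lfin (\<xi> v)" using that by (auto simp: space_PiM space_cfg)
      then have "\<And>v. v \<in> V \<Longrightarrow> finite (\<xi> v \<inter> (hcube v \<inter> B))"
        using B(2) unfolding lfin_def by (metis bounded_Int inf_commute)
      moreover have "?U \<xi> \<inter> B = (\<Union>v\<in>V. \<xi> v \<inter> (hcube v \<inter> B))" by auto
      ultimately show ?thesis using V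
        by (simp only:) (intro card_UN_disjoint; auto simp: hcube_def)
    qed
    moreover have "(\<lambda>\<xi>. \<Sum>v\<in>V. card (\<xi> v \<inter> (hcube v \<inter> B))) \<in> measurable (PiM V (\<lambda>_. cfg)) (count_space UNIV)"
    proof -
      have "(\<lambda>\<xi>. card (\<xi> v \<inter> (hcube v \<inter> B))) \<in> measurable (PiM V (\<lambda>_. cfg)) (count_space UNIV)" if "v \<in> V" for v
        using B that by (intro measurable_card measurable_component_singleton) auto
      then show ?thesis by measurable
    qed
    ultimately show "(\<lambda>\<xi>. card (?U \<xi> \<inter> B)) \<in> measurable (PiM V (\<lambda>_. cfg)) (count_space UNIV)"
      by (simp cong: measurable_cong)
  qed
  have "(\<Union>v. fill_cells c V \<xi> v) = ?U \<xi> \<union> {c v |v. hcube v \<inter> ?U \<xi> = {}}" for \<xi>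
  proof -
    have "hcube v \<inter> ?U \<xi> = {} \<longleftrightarrow> \<not> (v \<in> V \<and> \<xi> v \<inter> hcube v \<noteq> {})" for v
      by (auto simp: hcube_def)
    then show ?thesis by (auto simp: fill_cells_def split: if_splits)
  qed
  then show ?thesis
    using measurable_compose[OF U measurable_fill[of hcube c, OF hcube_borel hcube_bounded finite_centres[OF c]]]
    by simp
qed

text \<open>The variance factor of the concentration inequality is proportional to the number of vertices of
  a geodesic times the square of the cost of a detour around one cube.\<close>
definition vf :: "real \<Rightarrow> real \<Rightarrow> real" where
  "vf h r = (3 * C + 5)\<^sup>2 * (2 * (C + 2) ^ CARD('n) + 4 * C + 6) * \<delta>\<^sup>2 * r / h"

text \<open>Makes \<open>\<theta> = 1 / sqrt K\<close> admissible in the upper tail. It relies on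
  the end points being at distance at least \<open>h\<close>.\<close>

lemma vf_ge_jump:
  assumes "\<delta> \<le> h" "h \<le> r"
  shows "jump\<^sup>2 \<le> vf h r"
proof -
  have "0 < h" using assms \<delta>_pos by linarith
  have "1 \<le> 2 * (C + 2) ^ CARD('n) + 4 * C + 6" using C_ge zero_le_power[of "C + 2" "CARD('n)"] by simp
  moreover have "1 \<le> r / h" using assms \<open>0 < h\<close> by simp
  ultimately have "1 * 1 \<le> (2 * (C + 2) ^ CARD('n) + 4 * C + 6) * (r / h)" by (intro mult_mono) auto
  then have "jump\<^sup>2 * 1 \<le> jump\<^sup>2 * ((2 * (C + 2) ^ CARD('n) + 4 * C + 6) * (r / h))"
    by (intro mult_left_mono) auto
  then show ?thesis by (simp add: vf_def jump_def power_mult_distrib mult_ac)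
qed

text \<open>Provides the hypotheses of \<open>resampling_mgf\<close>. The bounds hold for every
  family of locally finite sets and not just almost surely, as the entropy method on the product
  space demands.\<close>

lemma resampling_bounds:
  assumes c: "\<And>v. c v \<in> cube v" and V: "finite V" and h: "\<delta> \<le> h" and r: "h \<le> norm (x - y)"
  defines "F \<equiv> \<lambda>\<xi>. enn2real (h_dist h (\<Union>v. fill_cells c V \<xi> v) x y)"
  assumes \<xi>: "\<And>v. v \<in> V \<Longrightarrow> lfin (\<xi> v)"
  shows "h_dist h (\<Union>v. fill_cells c V \<xi> v) x y = ennreal (F \<xi>)" "0 \<le> F \<xi>" "F \<xi> \<le> ell (norm (x - y))"
    and "k \<in> V \<Longrightarrow> lfin \<eta> \<Longrightarrow> F (\<xi>(k := \<eta>)) \<le> F \<xi> + jump"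
    and "(\<And>v. v \<in> V \<Longrightarrow> lfin (\<xi>' v)) \<Longrightarrow> (\<Sum>k\<in>V. (max 0 (F (\<xi>(k := \<xi>' k)) - F \<xi>))\<^sup>2) \<le> vf h (norm (x - y))"
proof -
  let ?r = "norm (x - y)" and ?D = "\<lambda>\<xi>. h_dist h (\<Union>v. fill_cells c V \<xi> v) x y"
  have h0: "0 < h" using h \<delta>_pos by linarith
  have le: "?D \<zeta> \<le> ennreal (ell ?r)" if "\<And>v. v \<in> V \<Longrightarrow> lfin (\<zeta> v)" for \<zeta>
  proof -
    have cc: "cells (fill_cells c V \<zeta>)" by (rule cells_fill_cells[OF c that])
    show ?thesis by (rule h_dist_le_ell[OF cells_lfin[OF cc] cells_hits[OF cc] h])
  qed
  have eq: "?D \<zeta> = ennreal (F \<zeta>)" if "\<And>v. v \<in> V \<Longrightarrow> lfin (\<zeta> v)" for \<zeta>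
    using le_less_trans[OF le[OF that] ennreal_less_top] by (simp add: F_def)
  have F0: "0 \<le> F \<zeta>" for \<zeta> by (simp add: F_def)
  show "?D \<xi> = ennreal (F \<xi>)" "0 \<le> F \<xi>" using eq[OF \<xi>] F0 by auto
  show "F \<xi> \<le> ell ?r" using le[OF \<xi>] eq[OF \<xi>] ell_nonneg[of ?r] by simp
  have upd: "lfin ((\<xi>(k := \<eta>)) v)" if "lfin \<eta>" "v \<in> V" for k \<eta> v
    using \<xi> that by simp
  have J: "F (\<xi>(k := \<eta>)) \<le> F \<xi> + jump" if k: "k \<in> V" and \<eta>: "lfin \<eta>" for k \<eta>
  proof -
    have "?D (\<xi>(k := \<eta>)) \<le> ?D \<xi> + ennreal ((3 * C + 5) * \<delta>)"
      by (rule h_dist_replace[OF cells_fill_cells[OF c \<xi>] cells_fill_cells[OF c upd[OF \<eta>]] fill_cells_upd h])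
    moreover have "?D (\<xi>(k := \<eta>)) = ennreal (F (\<xi>(k := \<eta>)))" by (rule eq, rule upd[OF \<eta>])
    moreover have "?D \<xi> = ennreal (F \<xi>)" by (rule eq[OF \<xi>])
    moreover have "ennreal (F \<xi>) + ennreal ((3 * C + 5) * \<delta>) = ennreal (F \<xi> + jump)"
      using F0 jump_pos by (simp add: jump_def ennreal_plus)
    ultimately have "ennreal (F (\<xi>(k := \<eta>))) \<le> ennreal (F \<xi> + jump)" by (simp only:)
    then show ?thesis using F0[of \<xi>] jump_pos by (subst (asm) ennreal_le_iff) auto
  qed
  show "k \<in> V \<Longrightarrow> lfin \<eta> \<Longrightarrow> F (\<xi>(k := \<eta>)) \<le> F \<xi> + jump" by (rule J)
  show "(\<Sum>k\<in>V. (max 0 (F (\<xi>(k := \<xi>' k)) - F \<xi>))\<^sup>2) \<le> vf h ?r" if \<xi>': "\<And>v. v \<in> V \<Longrightarrow> lfin (\<xi>' v)"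
  proof -
    define W where "W = {k \<in> V. F \<xi> < F (\<xi>(k := \<xi>' k))}"
    have W: "finite W" "W \<subseteq> V" using V by (auto simp: W_def)
    define A where "A k = fill_cells c V (\<xi>(k := \<xi>' k)) k" for k
    have Aeq: "fill_cells c V (\<xi>(k := \<xi>' k)) = (fill_cells c V \<xi>)(k := A k)" for k
      unfolding A_def by (rule fill_cells_upd_eq)
    have "real (card {k \<in> V. h_dist h (\<Union>v. fill_cells c V \<xi> v) x y <
        h_dist h (\<Union>v. ((fill_cells c V \<xi>)(k := A k)) v) x y}) \<le> 2 * (C + 2) ^ CARD('n) + 2 * ell ?r / h + 4"
    proof (rule card_increasing_cubes[OF cells_fill_cells[OF c \<xi>] _ V h le[OF \<xi>] ell_nonneg])
      fix k assume "k \<in> V"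
      then show "cells ((fill_cells c V \<xi>)(k := A k))"
        unfolding Aeq[symmetric] using \<xi>' upd by (intro cells_fill_cells c) auto
    qed auto
    also have "{k \<in> V. h_dist h (\<Union>v. fill_cells c V \<xi> v) x y <
        h_dist h (\<Union>v. ((fill_cells c V \<xi>)(k := A k)) v) x y} = W"
    proof -
      have "?D \<xi> < ?D (\<xi>(k := \<xi>' k)) \<longleftrightarrow> F \<xi> < F (\<xi>(k := \<xi>' k))" if "k \<in> V" for k
      proof -
        have e1: "?D (\<xi>(k := \<xi>' k)) = ennreal (F (\<xi>(k := \<xi>' k)))" by (rule eq, rule upd[OF \<xi>'[OF that]])
        have e2: "?D \<xi> = ennreal (F \<xi>)" by (rule eq[OF \<xi>])
        show ?thesis unfolding e1 e2 by (rule ennreal_less_iff[OF F0])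
      qed
      then show ?thesis unfolding W_def Aeq[symmetric] by blast
    qed
    finally have cW: "real (card W) \<le> 2 * (C + 2) ^ CARD('n) + 2 * ell ?r / h + 4" .
    \<comment> \<open>Since \<open>\<delta> \<le> h \<le> ?r\<close>, the additive terms are
      absorbed and the number of cubes is bounded by a multiple of \<open>?r / h\<close>.\<close>
    have "ell ?r \<le> (2 * C + 1) * ?r"
      using h r C_ge mult_left_mono[of \<delta> ?r "C + 1"] by (simp add: ell_def algebra_simps)
    then have "2 * ell ?r / h \<le> 2 * ((2 * C + 1) * ?r) / h" using h0 by (intro divide_right_mono) auto
    moreover have "(2 * (C + 2) ^ CARD('n) + 4) * 1 \<le> (2 * (C + 2) ^ CARD('n) + 4) * (?r / h)"
      using r h0 C_ge by (intro mult_left_mono) auto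
    ultimately have "real (card W) \<le> (2 * (C + 2) ^ CARD('n) + 4 * C + 6) * (?r / h)"
      using cW by (simp add: algebra_simps add_divide_distrib)
    then have "real (card W) * jump\<^sup>2 \<le> (2 * (C + 2) ^ CARD('n) + 4 * C + 6) * (?r / h) * jump\<^sup>2"
      by (rule mult_right_mono) auto
    then have cW': "real (card W) * jump\<^sup>2 \<le> vf h ?r"
      by (simp add: vf_def jump_def power_mult_distrib mult_ac)
    have "(\<Sum>k\<in>V. (max 0 (F (\<xi>(k := \<xi>' k)) - F \<xi>))\<^sup>2) = (\<Sum>k\<in>W. (max 0 (F (\<xi>(k := \<xi>' k)) - F \<xi>))\<^sup>2)"
      using V by (intro sum.mono_neutral_right) (auto simp: W_def max_def)
    also have "\<dots> \<le> (\<Sum>k\<in>W. jump\<^sup>2)"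
    proof (rule sum_mono)
      fix k assume "k \<in> W"
      then have "F (\<xi>(k := \<xi>' k)) - F \<xi> \<le> jump" using J[of k "\<xi>' k"] W \<xi>' by force
      then show "(max 0 (F (\<xi>(k := \<xi>' k)) - F \<xi>))\<^sup>2 \<le> jump\<^sup>2" using jump_pos by (intro power_mono) auto
    qed
    also have "\<dots> \<le> vf h ?r" using cW' by simp
    finally show ?thesis .
  qed
qed

end

section \<open>The enriched distance as a function of independent cubes\<close>

locale poisson_grid = cube_grid a z + poisson M X
  for a :: real and z :: "real ^ 'n::finite" and M :: "'a measure" and X :: "'a \<Rightarrow> (real ^ 'n) set" +
  fixes c :: "int ^ 'n \<Rightarrow> real ^ 'n"
  assumes c_in: "\<And>v. c v \<in> grid_cube a z v"
begin

abbreviation Xe :: "'a \<Rightarrow> (real ^ 'n) set" where "Xe \<omega> \<equiv> enrich a z c (X \<omega>)"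

definition dist_e :: "real \<Rightarrow> real ^ 'n \<Rightarrow> real ^ 'n \<Rightarrow> 'a \<Rightarrow> real" where
  "dist_e h x y \<omega> = enn2real (h_dist h (Xe \<omega>) x y)"

lemma Xe_measurable [measurable]: "Xe \<in> measurable M cfg"
  using measurable_compose[OF X_measurable enrich_measurable[OF c_in]] .

lemma dist_e_measurable [measurable]: "dist_e h x y \<in> borel_measurable M"
  unfolding dist_e_def by measurable

lemma Xe_lfin: "\<omega> \<in> space M \<Longrightarrow> lfin (Xe \<omega>)"
  using measurable_space[OF Xe_measurable] by (simp add: space_cfg)

lemma Xe_hits: "hits U (Xe \<omega>)"
  by (rule enrich_hits[OF c_in])

lemma h_dist_Xe_le: "\<omega> \<in> space M \<Longrightarrow> \<delta> \<le> h \<Longrightarrow> h_dist h (Xe \<omega>) x y \<le> ennreal (ell (norm (x - y)))"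
  by (rule h_dist_le_ell[OF Xe_lfin Xe_hits])

lemma h_dist_Xe: "\<omega> \<in> space M \<Longrightarrow> \<delta> \<le> h \<Longrightarrow> h_dist h (Xe \<omega>) x y = ennreal (dist_e h x y \<omega>)"
  using le_less_trans[OF h_dist_Xe_le ennreal_less_top, of \<omega> h x y] by (simp add: dist_e_def)

lemma dist_e_nonneg: "0 \<le> dist_e h x y \<omega>"
  by (simp add: dist_e_def)

lemma dist_e_le: "\<omega> \<in> space M \<Longrightarrow> \<delta> \<le> h \<Longrightarrow> dist_e h x y \<omega> \<le> ell (norm (x - y))"
  using h_dist_Xe_le[of \<omega> h x y] h_dist_Xe[of \<omega> h x y] ell_nonneg[of "norm (x - y)"] by simp

lemma bdd_dist_e: "\<delta> \<le> h \<Longrightarrow> bdd_mble M (dist_e h x y)"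
  using dist_e_le dist_e_nonneg by (intro bdd_mbleI[of _ _ "ell (norm (x - y))"]) auto

text \<open>Reconciles the closed cubes of the enrichment, which overlap in their faces, with the
  half-open cubes, whose contents are independent: the difference has volume 0.\<close>

lemma AE_no_boundary_points: "AE \<omega> in M. \<forall>v. X \<omega> \<inter> cube v = X \<omega> \<inter> hcube v"
proof (rule AE_all_countable[THEN iffD2], rule allI)
  fix v
  let ?B = "cube v - hcube v"
  have B: "?B \<in> sets borel" "bounded ?B" using cube_bounded by (auto intro: bounded_subset)
  have "measure lborel ?B = 0" using emeasure_cube_diff by (simp add: measure_def)
  then have "prob {\<omega> \<in> space M. card (X \<omega> \<inter> ?B) = 0} = 1" using prob_count[OF B, of 0] by simp
  moreover have "{\<omega> \<in> space M. card (X \<omega> \<inter> ?B) = 0} \<in> events"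
    using measurable_card[OF B X_measurable] by measurable
  ultimately have "AE \<omega> in M. \<omega> \<in> {\<omega> \<in> space M. card (X \<omega> \<inter> ?B) = 0}"
    by (simp only: prob_eq_1)
  then show "AE \<omega> in M. X \<omega> \<inter> cube v = X \<omega> \<inter> hcube v"
  proof eventually_elim
    case (elim \<omega>)
    then have "finite (X \<omega> \<inter> ?B)" using lfin_X B by (auto simp: lfin_def)
    then have "X \<omega> \<inter> ?B = {}" using elim by simp
    then show ?case using hcube_subset[of v] by blast
  qed
qed

end

context poisson_grid
begin

text \<open>The bound \<open>ell\<close> confines the distance to the cubes that meet one ball. The
  restrictions of the process to these half-open cubes are independent, so their joint law is a
  product measure, and the resampling bound applies there.\<close>

lemma mgf_dist_e:
  assumes h: "\<delta> \<le> h" and r: "h \<le> norm (x - y)"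
  defines "D \<equiv> dist_e h x y" and "K \<equiv> vf h (norm (x - y))"
  shows "0 < \<theta> \<Longrightarrow> \<theta> \<le> 1 / jump \<Longrightarrow> (\<integral>\<omega>. exp (\<theta> * D \<omega>) \<partial>M) \<le> exp (\<theta> * (\<integral>\<omega>. D \<omega> \<partial>M) + 3 * K * \<theta>\<^sup>2)"
    and "0 < \<theta> \<Longrightarrow> (\<integral>\<omega>. exp (- \<theta> * D \<omega>) \<partial>M) \<le> exp (- \<theta> * (\<integral>\<omega>. D \<omega> \<partial>M) + K * \<theta>\<^sup>2)"
proof -
  let ?r = "norm (x - y)"
  define R where "R = ell ?r + h + ?r"
  have h0: "0 < h" using h \<delta>_pos by linarith
  have R0: "0 \<le> R" using ell_nonneg[of ?r] h0 by (simp add: R_def)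
  define V where "V = {v. cube v \<inter> cball x R \<noteq> {}}"
  have V: "finite V" unfolding V_def by (rule cubes_meeting_ball(1)[OF R0])
  have "idx x \<in> V" unfolding V_def using mem_cube_idx[of x] R0 by auto
  then have Vne: "V \<noteq> {}" by blast
  define N where "N v = distr M cfg (\<lambda>\<omega>. X \<omega> \<inter> hcube v)" for v
  have rv: "(\<lambda>\<omega>. X \<omega> \<inter> hcube v) \<in> measurable M cfg" for v
    by (rule measurable_cfg_Int[OF hcube_borel X_measurable])
  interpret N: prob_family N
    by (rule prob_family.intro) (unfold N_def, rule prob_space_distr[OF rv])
  define \<Phi> where "\<Phi> \<omega> = (\<lambda>v\<in>V. X \<omega> \<inter> hcube v)" for \<omega>
  have law: "distr M (PiM V (\<lambda>_. cfg)) \<Phi> = PiM V N"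
    unfolding \<Phi>_def N_def
    by (rule indep_vars_iff_distr_eq_PiM'[OF Vne rv, THEN iffD1,
          OF indep_restrictions[OF V hcube_borel hcube_bounded disjoint_hcube Vne]])
  have \<Phi>m: "\<Phi> \<in> measurable M (PiM V (\<lambda>_. cfg))"
    unfolding \<Phi>_def by (rule measurable_restrict[OF rv])
  define F where "F \<xi> = enn2real (h_dist h (\<Union>v. fill_cells c V \<xi> v) x y)" for \<xi>
  note rb = resampling_bounds[where c = c, OF c_in V h r, folded F_def]
  have sp: "lfin (\<xi> v)" if "\<xi> \<in> space (PiM V N)" "v \<in> V" for \<xi> v
    using that by (auto simp: space_PiM N_def space_cfg)
  have spN: "space (N v) = {P. lfin P}" for v by (simp add: N_def space_cfg)
  have setsN: "sets (PiM V N) = sets (PiM V (\<lambda>_. cfg))" by (rule sets_PiM_cong) (auto simp: N_def)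
  have Fm: "F \<in> borel_measurable (PiM V (\<lambda>_. cfg))"
    unfolding F_def
    by (intro borel_measurable_enn2real measurable_h_dist fill_cells_measurable c_in V)
  have bF: "bdd_mble (PiM V N) F"
  proof (rule bdd_mbleI)
    show "F \<in> borel_measurable (PiM V N)" using Fm unfolding measurable_cong_sets[OF setsN refl] .
    fix \<xi> assume "\<xi> \<in> space (PiM V N)"
    then have l: "lfin (\<xi> v)" if "v \<in> V" for v using sp that by blast
    have "0 \<le> F \<xi>" "F \<xi> \<le> ell ?r" using rb(2,3)[where \<xi> = \<xi>, OF l] by blast+
    then show "\<bar>F \<xi>\<bar> \<le> ell ?r" by simp
  qed
  \<comment> \<open>The rebuilt configuration agrees with the enriched one in the ball of radius
    \<open>R\<close>. Further out they may differ, but both distances are below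
    \<open>ell ?r\<close> and do not see it.\<close>
  have FD: "AE \<omega> in M. F (\<Phi> \<omega>) = D \<omega>"
    using AE_no_boundary_points AE_space
  proof eventually_elim
    case (elim \<omega>)
    let ?P = "\<Union>v. fill_cells c V (\<Phi> \<omega>) v"
    have lf: "lfin (\<Phi> \<omega> v)" if "v \<in> V" for v
      using measurable_space[OF \<Phi>m elim(2)] that by (auto simp: space_PiM space_cfg)
    have em: "cube v \<inter> X \<omega> = {} \<longleftrightarrow> X \<omega> \<inter> hcube v = {}" for v
    proof -
      have "cube v \<inter> X \<omega> = X \<omega> \<inter> hcube v" using elim(1) by blast
      then show ?thesis by simp
    qed
    have "?P \<inter> cball x R = Xe \<omega> \<inter> cball x R"
    proof (intro set_eqI iffI)
      fix u assume u: "u \<in> ?P \<inter> cball x R"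
      then obtain v where v: "u \<in> fill_cells c V (\<Phi> \<omega>) v" by blast
      show "u \<in> Xe \<omega> \<inter> cball x R"
      proof (cases "v \<in> V")
        case True
        then show ?thesis using u v em[of v] by (auto simp: fill_cells_def \<Phi>_def enrich_def split: if_splits)
      next
        case False
        then have "u = c v" using v by (simp add: fill_cells_def)
        then have "v \<in> V" using u c_in[of v] by (auto simp: V_def)
        then show ?thesis using False by blast
      qed
    next
      fix u assume u: "u \<in> Xe \<omega> \<inter> cball x R"
      then consider "u \<in> X \<omega>" | v where "u = c v" "cube v \<inter> X \<omega> = {}" by (auto simp: enrich_def)
      then show "u \<in> ?P \<inter> cball x R"
      proof cases
        case 1
        have "idx u \<in> V" using u mem_cube_idx[of u] by (auto simp: V_def)
        then have "u \<in> fill_cells c V (\<Phi> \<omega>) (idx u)" using 1 by (auto simp: fill_cells_def \<Phi>_def hcube_def)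
        then show ?thesis using u by blast
      next
        case 2
        then have "u \<in> fill_cells c V (\<Phi> \<omega>) v" using em[of v] by (auto simp: fill_cells_def \<Phi>_def)
        then show ?thesis using u by blast
      qed
    qed
    then have "min (h_dist h ?P x y) (ennreal (ell ?r)) = min (h_dist h (Xe \<omega>) x y) (ennreal (ell ?r))"
      by (rule h_dist_truncated_local) (use h0 ell_nonneg[of ?r] in \<open>auto simp: R_def\<close>)
    moreover have "h_dist h ?P x y \<le> ennreal (ell ?r)"
    proof -
      have cc: "cells (fill_cells c V (\<Phi> \<omega>))" by (rule cells_fill_cells[OF c_in lf])
      show ?thesis by (rule h_dist_le_ell[OF cells_lfin[OF cc] cells_hits[OF cc] h])
    qed
    moreover note h_dist_Xe_le[OF elim(2) h, of x y]
    ultimately show ?case by (simp add: F_def D_def dist_e_def min_absorb1)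
  qed
  have int: "(\<integral>\<xi>. g (F \<xi>) \<partial>PiM V N) = (\<integral>\<omega>. g (D \<omega>) \<partial>M)"
    if "g \<in> borel_measurable borel" for g :: "real \<Rightarrow> real"
  proof -
    have "(\<integral>\<xi>. g (F \<xi>) \<partial>PiM V N) = (\<integral>\<omega>. g (F (\<Phi> \<omega>)) \<partial>M)"
      unfolding law[symmetric] using measurable_compose[OF Fm that] by (intro integral_distr \<Phi>m)
    also have "\<dots> = (\<integral>\<omega>. g (D \<omega>) \<partial>M)"
    proof (rule integral_cong_AE)
      show "(\<lambda>\<omega>. g (F (\<Phi> \<omega>))) \<in> borel_measurable M"
        using measurable_compose[OF \<Phi>m measurable_compose[OF Fm that]] .
      show "(\<lambda>\<omega>. g (D \<omega>)) \<in> borel_measurable M" unfolding D_def using that by measurable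
      show "AE \<omega> in M. g (F (\<Phi> \<omega>)) = g (D \<omega>)" using FD by eventually_elim simp
    qed
    finally show ?thesis .
  qed
  have K0: "0 \<le> K" using vf_ge_jump[OF h r] unfolding K_def by (meson order_trans zero_le_power2)
  have b: "F (\<xi>(i := \<eta>)) \<le> F \<xi> + jump" if "\<xi> \<in> space (PiM V N)" "i \<in> V" "\<eta> \<in> space (N i)" for \<xi> \<eta> i
    by (rule rb(4)[where \<xi> = \<xi>]) (use that sp in \<open>auto simp: spN\<close>)
  have Ks: "(\<Sum>i\<in>V. (max 0 (F (\<xi>(i := \<xi>' i)) - F \<xi>))\<^sup>2) \<le> K"
    if "\<xi> \<in> space (PiM V N)" "\<xi>' \<in> space (PiM V N)" for \<xi> \<xi>'
    unfolding K_def by (rule rb(5)[where \<xi> = \<xi> and \<xi>' = \<xi>']) (use that sp in auto)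
  have id: "(\<integral>\<xi>. F \<xi> \<partial>PiM V N) = (\<integral>\<omega>. D \<omega> \<partial>M)" using int[of "\<lambda>t. t"] by simp
  have e: "(\<integral>\<xi>. exp (\<theta> * F \<xi>) \<partial>PiM V N) = (\<integral>\<omega>. exp (\<theta> * D \<omega>) \<partial>M)" for \<theta>
    by (rule int) measurable
  show "(\<integral>\<omega>. exp (\<theta> * D \<omega>) \<partial>M) \<le> exp (\<theta> * (\<integral>\<omega>. D \<omega> \<partial>M) + 3 * K * \<theta>\<^sup>2)"
    if "0 < \<theta>" "\<theta> \<le> 1 / jump"
    unfolding e[symmetric] id[symmetric]
    by (rule N.resampling_mgf(1)[where b = jump]) (use V bF jump_pos b Ks K0 that in blast)+
  show "(\<integral>\<omega>. exp (- \<theta> * D \<omega>) \<partial>M) \<le> exp (- \<theta> * (\<integral>\<omega>. D \<omega> \<partial>M) + K * \<theta>\<^sup>2)"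
    if "0 < \<theta>"
    unfolding e[symmetric] id[symmetric]
    by (rule N.resampling_mgf(2)[where b = jump]) (use V bF jump_pos b Ks K0 that in blast)+
qed

section \<open>Tail bounds\<close>

lemma (in prob_space) chernoff:
  assumes "bdd_mble M D" "(\<integral>\<omega>. exp (\<theta> * D \<omega>) \<partial>M) \<le> exp (\<theta> * E + A)"
  shows "prob {\<omega> \<in> space M. t \<le> \<theta> * (D \<omega> - E)} \<le> exp (A - t)"
proof -
  have be: "bdd_mble M (\<lambda>\<omega>. exp (\<theta> * D \<omega>))"
    by (rule bdd_mble_continuous[OF assms(1)]) (intro continuous_intros)
  have "{\<omega> \<in> space M. t \<le> \<theta> * (D \<omega> - E)} = {\<omega> \<in> space M. exp (\<theta> * E + t) \<le> exp (\<theta> * D \<omega>)}"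
    by (auto simp: algebra_simps)
  also have "prob \<dots> \<le> (\<integral>\<omega>. exp (\<theta> * D \<omega>) \<partial>M) / exp (\<theta> * E + t)"
    by (rule integral_Markov_inequality_measure[OF bdd_mble_integrable[OF be], where A = "{}"]) auto
  also have "\<dots> \<le> exp (\<theta> * E + A) / exp (\<theta> * E + t)" using assms(2) by (intro divide_right_mono) auto
  also have "\<dots> = exp (A - t)" by (simp flip: exp_diff)
  finally show ?thesis .
qed

theorem upper_tail:
  assumes h: "\<delta> \<le> h" and r: "h \<le> norm (x - y)" and l: "0 \<le> l"
  defines "D \<equiv> dist_e h x y" and "K \<equiv> vf h (norm (x - y))"
  shows "prob {\<omega> \<in> space M. l * sqrt K \<le> D \<omega> - (\<integral>\<omega>. D \<omega> \<partial>M)} \<le> exp (3 - l)"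
proof -
  have jK: "jump \<le> sqrt K" using vf_ge_jump[OF h r] jump_pos unfolding K_def by (simp add: real_le_rsqrt)
  then have sK: "0 < sqrt K" using jump_pos by linarith
  then have K: "0 < K" by simp
  \<comment> \<open>With this choice the quadratic term equals 3, whence the bound
    \<open>exp (3 - l)\<close>.\<close>
  define \<theta> where "\<theta> = 1 / sqrt K"
  have \<theta>: "0 < \<theta>" "\<theta> \<le> 1 / jump" using sK jK jump_pos by (auto simp: \<theta>_def intro: divide_left_mono)
  have e: "3 * K * \<theta>\<^sup>2 = 3" using K by (simp add: \<theta>_def power_divide)
  have "(\<integral>\<omega>. exp (\<theta> * D \<omega>) \<partial>M) \<le> exp (\<theta> * (\<integral>\<omega>. D \<omega> \<partial>M) + 3)"
    using mgf_dist_e(1)[OF h r \<theta>, folded D_def K_def, unfolded e] .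
  from chernoff[OF _ this, of l] bdd_dist_e[OF h]
  have "prob {\<omega> \<in> space M. l \<le> \<theta> * (D \<omega> - (\<integral>\<omega>. D \<omega> \<partial>M))} \<le> exp (3 - l)" by (simp add: D_def)
  also have "{\<omega> \<in> space M. l \<le> \<theta> * (D \<omega> - (\<integral>\<omega>. D \<omega> \<partial>M))} = {\<omega> \<in> space M. l * sqrt K \<le> D \<omega> - (\<integral>\<omega>. D \<omega> \<partial>M)}"
    using sK by (auto simp: \<theta>_def pos_le_divide_eq)
  finally show ?thesis .
qed

theorem lower_tail:
  assumes h: "\<delta> \<le> h" and r: "h \<le> norm (x - y)" and l: "0 \<le> l"
  defines "D \<equiv> dist_e h x y" and "K \<equiv> vf h (norm (x - y))"
  shows "prob {\<omega> \<in> space M. l * sqrt K \<le> (\<integral>\<omega>. D \<omega> \<partial>M) - D \<omega>} \<le> exp (- l\<^sup>2 / 4)"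
proof (cases "l = 0")
  case False
  have jK: "jump \<le> sqrt K" using vf_ge_jump[OF h r] jump_pos unfolding K_def by (simp add: real_le_rsqrt)
  then have sK: "0 < sqrt K" using jump_pos by linarith
  then have K: "0 < K" by simp
  \<comment> \<open>The minimiser of \<open>K * \<theta>\<^sup>2 - l * sqrt K * \<theta>\<close>. As
    \<open>\<theta>\<close> may be arbitrarily large here, the tail is Gaussian for all
    \<open>l\<close>.\<close>
  define \<theta> where "\<theta> = l / (2 * sqrt K)"
  have \<theta>: "0 < \<theta>" using sK l False by (simp add: \<theta>_def)
  have e: "K * \<theta>\<^sup>2 = l\<^sup>2 / 4" using K by (simp add: \<theta>_def power_divide power_mult_distrib)
  have "(\<integral>\<omega>. exp (- \<theta> * D \<omega>) \<partial>M) \<le> exp (- \<theta> * (\<integral>\<omega>. D \<omega> \<partial>M) + l\<^sup>2 / 4)"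
    using mgf_dist_e(2)[OF h r \<theta>, folded D_def K_def, unfolded e] .
  from chernoff[OF _ this, of "l\<^sup>2 / 2"] bdd_dist_e[OF h]
  have "prob {\<omega> \<in> space M. l\<^sup>2 / 2 \<le> - \<theta> * (D \<omega> - (\<integral>\<omega>. D \<omega> \<partial>M))} \<le> exp (l\<^sup>2 / 4 - l\<^sup>2 / 2)" by (simp add: D_def)
  also have "{\<omega> \<in> space M. l\<^sup>2 / 2 \<le> - \<theta> * (D \<omega> - (\<integral>\<omega>. D \<omega> \<partial>M))} =
      {\<omega> \<in> space M. l * sqrt K \<le> (\<integral>\<omega>. D \<omega> \<partial>M) - D \<omega>}"
  proof -
    have "l\<^sup>2 / 2 \<le> - \<theta> * (u - e) \<longleftrightarrow> l * sqrt K \<le> e - u" for u e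
    proof -
      have "l\<^sup>2 / 2 = \<theta> * (l * sqrt K)" using sK by (simp add: \<theta>_def power2_eq_square)
      moreover have "- \<theta> * (u - e) = \<theta> * (e - u)" by (simp add: algebra_simps)
      ultimately show ?thesis using \<theta> by simp
    qed
    then show ?thesis by simp
  qed
  finally show ?thesis by (simp add: field_simps)
qed simp

end

subsection \<open>Scales\<close>

locale scales =
  fixes C' k :: real and d :: nat
  assumes d_pos: "1 \<le> d" and C': "dim_const d + 3 / 2 \<le> C'" and k: "real d + 1 < k"
begin

definition Cd :: real where "Cd = dim_const d"

definition \<delta>s :: "real \<Rightarrow> real" where "\<delta>s s = delta_scale d C' k s"

definition side :: "real \<Rightarrow> real" where "side s = \<delta>s s / Cd"

definition C2 :: real where "C2 = dim_const2 d C'"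

lemma Cd_ge: "2 \<le> Cd"
proof -
  have "1 \<le> sqrt (real d)" using d_pos by simp
  then show ?thesis by (simp add: Cd_def dim_const_def)
qed

lemma C2_ge: "10 \<le> C2"
  using Cd_ge unfolding C2_def dim_const2_def Cd_def by linarith

lemma C2_pos: "0 < C2" using C2_ge by simp

lemma ln_C2_gt: "2 < ln C2"
proof -
  have "exp 2 = exp 1 * exp (1 :: real)" by (simp flip: exp_add)
  also have "\<dots> \<le> 3 * 3" using exp_le by (intro mult_mono) auto
  finally have "exp 2 < C2" using C2_ge by simp
  then show ?thesis using C2_pos by (metis exp_ln exp_less_cancel_iff)
qed

lemma ln_scaled: "1 < s \<Longrightarrow> ln (C2 * s) = ln C2 + ln s"
  using C2_pos by (simp add: ln_mult)

lemma ln_pos: "1 < s \<Longrightarrow> 2 < ln (C2 * s)"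
  using ln_C2_gt by (simp add: ln_scaled) (smt (verit) ln_gt_zero)

lemma side_eq: "side s = (k * ln (C2 * s)) powr (1 / real d)"
  using Cd_ge by (simp add: side_def \<delta>s_def delta_scale_def Cd_def C2_def)

lemma \<delta>s_eq: "\<delta>s s = Cd * side s"
  using Cd_ge by (simp add: side_def)

lemma k_ln_ge: "1 < s \<Longrightarrow> 1 \<le> k * ln (C2 * s)"
  using mult_mono[of 1 k 1 "ln (C2 * s)"] ln_pos[of s] k by simp

lemma side_ge: "1 < s \<Longrightarrow> 1 \<le> side s"
  unfolding side_eq using k_ln_ge[of s] by (intro ge_one_powr_ge_zero) auto

lemma \<delta>s_ge: "1 < s \<Longrightarrow> 2 \<le> \<delta>s s"
  unfolding \<delta>s_eq using mult_mono[OF Cd_ge side_ge, of s] Cd_ge by simp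

lemma side_mono: "1 < s \<Longrightarrow> s \<le> t \<Longrightarrow> side s \<le> side t"
proof -
  assume s: "1 < s" "s \<le> t"
  have "ln (C2 * s) \<le> ln (C2 * t)" using s C2_pos by simp
  then have "k * ln (C2 * s) \<le> k * ln (C2 * t)" using k by (intro mult_left_mono) auto
  then show ?thesis unfolding side_eq using k_ln_ge[OF s(1)] by (intro powr_mono2) auto
qed

lemma \<delta>s_mono: "1 < s \<Longrightarrow> s \<le> t \<Longrightarrow> \<delta>s s \<le> \<delta>s t"
  unfolding \<delta>s_eq using side_mono Cd_ge by (intro mult_left_mono) auto

lemma side_power: "1 < s \<Longrightarrow> side s ^ d = k * ln (C2 * s)"
proof -
  assume s: "1 < s"
  have "side s ^ d = side s powr real d" using side_ge[OF s] by (intro powr_realpow[symmetric]) auto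
  also have "\<dots> = (k * ln (C2 * s)) powr (1 / real d * real d)" unfolding side_eq by (rule powr_powr)
  finally show ?thesis using k_ln_ge[OF s] d_pos by simp
qed

text \<open>The scale is chosen so that a cube has volume \<open>k * ln (C2 * s)\<close>; it is then
  empty with probability \<open>(C2 * s) powr (- k)\<close>.\<close>

lemma empty_cube_bound: "1 < s \<Longrightarrow> exp (- (side s ^ d)) \<le> s powr (- k)"
proof -
  assume s: "1 < s"
  have "exp (- (side s ^ d)) = (C2 * s) powr (- k)"
    unfolding side_power[OF s] using s C2_pos by (simp add: powr_def)
  also have "\<dots> \<le> s powr (- k)" using s C2_ge k by (intro powr_mono2') auto
  finally show ?thesis .
qed

text \<open>A crude bound of \<open>\<delta>s s\<close> by a multiple of \<open>sqrt s\<close>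
  suffices for the error in the subadditivity and for the almost sure limit.\<close>

definition Bsqrt :: real where "Bsqrt = Cd * k * (2 * sqrt C2)"

lemma ln_le_2sqrt: "0 < x \<Longrightarrow> ln x \<le> 2 * sqrt x" for x :: real
proof -
  assume x: "0 < x"
  have "ln (sqrt x) \<le> sqrt x - 1" using x by (intro ln_le_minus_one) auto
  then show ?thesis using x by (simp add: ln_sqrt)
qed

lemma \<delta>s_le_sqrt: "1 < s \<Longrightarrow> \<delta>s s \<le> Bsqrt * sqrt s"
proof -
  assume s: "1 < s"
  have "side s \<le> (k * ln (C2 * s)) powr 1"
    unfolding side_eq using k_ln_ge[OF s] d_pos by (intro powr_mono) (auto simp: divide_le_eq)
  also have "\<dots> = k * ln (C2 * s)" using k_ln_ge[OF s] by simp
  also have "\<dots> \<le> k * (2 * sqrt (C2 * s))"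
    using ln_le_2sqrt[of "C2 * s"] s C2_pos k by (intro mult_left_mono) auto
  finally have "Cd * side s \<le> Cd * (k * (2 * sqrt (C2 * s)))" using Cd_ge by (intro mult_left_mono) auto
  then show ?thesis unfolding \<delta>s_eq Bsqrt_def by (simp add: real_sqrt_mult mult_ac)
qed

lemma Bsqrt_pos: "0 < Bsqrt" using Cd_ge k C2_pos by (simp add: Bsqrt_def)

text \<open>The constant in the comparison of \<open>(\<delta>s s)\<^sup>2\<close> with
  \<open>ln s powr (2 / real d)\<close> for \<open>s \<ge> s0\<close>. It grows without bound as
  \<open>s0\<close> approaches 1, where the logarithm vanishes but \<open>\<delta>s\<close> does
  not.\<close>

definition Blog :: "real \<Rightarrow> real" where
  "Blog s0 = Cd\<^sup>2 * (k * (ln C2 / ln s0 + 1)) powr (2 / real d)"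

lemma Blog_pos: "1 < s0 \<Longrightarrow> 0 < Blog s0"
proof -
  assume s0: "1 < s0"
  have "0 < ln C2 / ln s0 + 1" using ln_C2_gt s0 by (intro add_pos_pos divide_pos_pos) auto
  then show ?thesis unfolding Blog_def using Cd_ge k by (intro mult_pos_pos) auto
qed

lemma \<delta>s_square_le: "1 < s0 \<Longrightarrow> s0 \<le> s \<Longrightarrow> (\<delta>s s)\<^sup>2 \<le> Blog s0 * ln s powr (2 / real d)"
proof -
  assume s: "1 < s0" "s0 \<le> s"
  then have s1: "1 < s" by simp
  have l0: "0 < ln s0" "ln s0 \<le> ln s" using s by auto
  have "ln C2 * ln s0 \<le> ln C2 * ln s" using l0 ln_C2_gt by (intro mult_left_mono) auto
  then have "ln C2 \<le> ln C2 / ln s0 * ln s" using l0 by (simp add: field_simps)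
  then have "ln (C2 * s) \<le> (ln C2 / ln s0 + 1) * ln s" unfolding ln_scaled[OF s1] by (simp add: algebra_simps)
  then have le: "k * ln (C2 * s) \<le> k * (ln C2 / ln s0 + 1) * ln s"
    using k by (simp add: mult.assoc)
  have "(side s)\<^sup>2 = (k * ln (C2 * s)) powr (2 / real d)"
    unfolding side_eq using k_ln_ge[OF s1] by (simp add: power2_eq_square flip: powr_add)
  also have "\<dots> \<le> (k * (ln C2 / ln s0 + 1) * ln s) powr (2 / real d)"
    using le k_ln_ge[OF s1] by (intro powr_mono2) auto
  also have "\<dots> = (k * (ln C2 / ln s0 + 1)) powr (2 / real d) * ln s powr (2 / real d)"
    by (rule powr_mult)
  finally have "Cd\<^sup>2 * (side s)\<^sup>2 \<le> Cd\<^sup>2 * ((k * (ln C2 / ln s0 + 1)) powr (2 / real d) * ln s powr (2 / real d))"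
    by (intro mult_left_mono) auto
  then show ?thesis unfolding \<delta>s_eq Blog_def by (simp add: power_mult_distrib mult_ac)
qed

definition ells :: "real \<Rightarrow> real \<Rightarrow> real" where "ells s r = Cd * r + (Cd + 1) * \<delta>s s"

text \<open>If the cubes have side at least 1 and \<open>s > 1\<close>, a ball of radius
  \<open>7 * Cd * s\<close> meets at most \<open>(16 * Cd * s) ^ d\<close> of them.\<close>

definition bad_const :: real where "bad_const = (16 * Cd) ^ d"

text \<open>The truncation level is at most \<open>4 * Cd * s\<close>, and an empty cube nearby has
  probability at most \<open>bad_const * s powr (d - k)\<close>. The product is at most
  \<open>c0\<close> because \<open>k > d + 1\<close>.\<close>

definition c0 :: real where "c0 = 4 * Cd * bad_const"

lemma c0_pos: "0 < c0"
  using Cd_ge by (simp add: bad_const_def c0_def)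

definition kap :: real where
  "kap = (3 * Cd + 5)\<^sup>2 * (2 * (Cd + 2) ^ d + 4 * Cd + 6)"

lemma kap_pos: "0 < kap"
proof -
  have "0 < (3 * Cd + 5)\<^sup>2" using Cd_ge by auto
  moreover have "0 < 2 * (Cd + 2) ^ d + 4 * Cd + 6"
    using Cd_ge zero_le_power[of "Cd + 2" "d"] by linarith
  ultimately show ?thesis unfolding kap_def by (rule mult_pos_pos)
qed

text \<open>Collects, with room to spare, the error terms of \<open>ratio_bound\<close> that are
  multiples of \<open>h s\<close>; additive constants are absorbed through
  \<open>h s \<ge> 2\<close>.\<close>

definition c3 :: real where "c3 = 8 * c0 + 4 * (2 * Cd + 1) + 2 * (3 * Cd + 1) + 1"

lemma c3_pos: "0 < c3" using c0_pos Cd_ge by (simp add: c3_def)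

end

subsection \<open>Empty cubes are rare\<close>

text \<open>Bounded and local, hence integrable for the process itself, whose distance may be
  infinite. Its mean involves no grid.\<close>

definition trunc_dist :: "real \<Rightarrow> real \<Rightarrow> 'b::euclidean_space set \<Rightarrow> 'b \<Rightarrow> 'b \<Rightarrow> real" where
  "trunc_dist h l P x y = enn2real (min (h_dist h P x y) (ennreal l))"

lemma trunc_dist_bounds: "0 \<le> trunc_dist h l P x y" "0 \<le> l \<Longrightarrow> trunc_dist h l P x y \<le> l"
proof -
  assume l: "0 \<le> l"
  have "enn2real (min (h_dist h P x y) (ennreal l)) \<le> enn2real (ennreal l)"
    by (intro enn2real_mono) auto
  then show "trunc_dist h l P x y \<le> l" using l by (simp add: trunc_dist_def)
qed (simp add: trunc_dist_def)

lemma ennreal_trunc_dist: "ennreal (trunc_dist h l P x y) = min (h_dist h P x y) (ennreal l)"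
  unfolding trunc_dist_def by (intro ennreal_enn2real) (auto simp: min_less_iff_disj)

lemma trunc_dist_measurable [measurable (raw)]:
  "f \<in> measurable M cfg \<Longrightarrow> (\<lambda>\<omega>. trunc_dist h l (f \<omega>) x y) \<in> borel_measurable M"
  unfolding trunc_dist_def by measurable

text \<open>A larger step size can only decrease the distance, so the growth is at most that of the
  truncation level.\<close>

lemma trunc_dist_mono:
  assumes "h \<le> h'" "0 \<le> l" "l \<le> l'"
  shows "trunc_dist h' l' P x y \<le> trunc_dist h l P x y + (l' - l)"
proof -
  have "min (h_dist h' P x y) (ennreal l') \<le> min (h_dist h P x y) (ennreal l) + ennreal (l' - l)"
  proof (cases "h_dist h P x y \<le> ennreal l")
    case True
    then have "h_dist h' P x y \<le> min (h_dist h P x y) (ennreal l)" using h_dist_mono_h[OF assms(1)] by auto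
    then have "min (h_dist h' P x y) (ennreal l') \<le> min (h_dist h P x y) (ennreal l)" by (rule min.coboundedI1)
    then show ?thesis by (rule add_increasing2[OF zero_le])
  next
    case False
    then have "min (h_dist h P x y) (ennreal l) = ennreal l" by (simp add: min_def)
    moreover have "ennreal l' = ennreal l + ennreal (l' - l)" using assms by (simp flip: ennreal_plus)
    ultimately show ?thesis by simp
  qed
  then have "ennreal (trunc_dist h' l' P x y) \<le> ennreal (trunc_dist h l P x y) + ennreal (l' - l)"
    unfolding ennreal_trunc_dist .
  also have "\<dots> = ennreal (trunc_dist h l P x y + (l' - l))"
    using assms trunc_dist_bounds(1) by (intro ennreal_plus[symmetric]) auto
  finally have "ennreal (trunc_dist h' l' P x y) \<le> ennreal (trunc_dist h l P x y + (l' - l))" .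
  then show ?thesis using assms trunc_dist_bounds(1)[of h l P x y] by (subst (asm) ennreal_le_iff) auto
qed

text \<open>An isometry carries one pair of points to the other, and the image process has the same
  law. Two different processes are allowed, so that the time constant does not depend on the
  probability space.\<close>

lemma mean_trunc_dist_unique:
  fixes X :: "'a \<Rightarrow> (real ^ 'n::finite) set" and X' :: "'b \<Rightarrow> (real ^ 'n) set"
  assumes P: "poisson M X" "poisson M' X'" and r: "norm (x - y) = norm (x' - y')"
  shows "(\<integral>\<omega>. trunc_dist h l (X \<omega>) x y \<partial>M) = (\<integral>\<omega>. trunc_dist h l (X' \<omega>) x' y' \<partial>M')"
proof -
  interpret P: poisson M X by fact
  interpret P': poisson M' X' by fact
  have "norm (y - x) = norm (y' - x')" using r by (simp add: norm_minus_commute)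
  then obtain f where f: "orthogonal_transformation f" "f (y - x) = y' - x'"
    using orthogonal_transformation_exists[of "y - x" "y' - x'"] by blast
  define A where "A u = f u + (x' - f x)" for u
  have lin: "linear f" using f(1) by (rule orthogonal_transformation_linear)
  have A: "norm (A u - A v) = norm (u - v)" for u v
    using f(1) by (simp add: A_def orthogonal_transformation_norm flip: linear_diff[OF lin])
  have Ax: "A x = x'" "A y = y'" using f(2) by (simp_all add: A_def linear_diff[OF lin] algebra_simps)
  have PA: "poisson M (\<lambda>\<omega>. A ` X \<omega>)" unfolding A_def by (rule P.isometric_image[OF f(1)])
  interpret PA: poisson M "\<lambda>\<omega>. A ` X \<omega>" by fact
  let ?g = "\<lambda>P. trunc_dist h l P x' y'"
  have gm: "?g \<in> borel_measurable cfg" by measurable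
  have "(\<integral>\<omega>. trunc_dist h l (X \<omega>) x y \<partial>M) = (\<integral>\<omega>. ?g (A ` X \<omega>) \<partial>M)"
    unfolding trunc_dist_def using h_dist_isometry[OF A, of h _ x y] by (simp add: Ax)
  also have "\<dots> = (\<integral>P. ?g P \<partial>distr M cfg (\<lambda>\<omega>. A ` X \<omega>))"
    by (rule integral_distr[symmetric, OF PA.X_measurable gm])
  also have "\<dots> = (\<integral>P. ?g P \<partial>distr M' cfg X')"
    by (simp only: poisson_law_unique[OF PA P(2)])
  also have "\<dots> = (\<integral>\<omega>. ?g (X' \<omega>) \<partial>M')" by (rule integral_distr[OF P'.X_measurable gm])
  finally show ?thesis .
qed

context poisson_grid
begin

definition bad :: "real \<Rightarrow> 'a set" where
  "bad R = {\<omega> \<in> space M. \<exists>v\<in>{v. cube v \<inter> cball 0 R \<noteq> {}}. card (X \<omega> \<inter> cube v) = 0}"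

lemma card_cube_measurable: "(\<lambda>\<omega>. card (X \<omega> \<inter> cube v)) \<in> measurable M (count_space UNIV)"
  by (rule measurable_card[OF cube_borel cube_bounded X_measurable])

lemma bad_events: "0 \<le> R \<Longrightarrow> bad R \<in> events"
proof -
  assume R: "0 \<le> R"
  note [measurable] = card_cube_measurable
  show ?thesis unfolding bad_def using cubes_meeting_ball(1)[OF R] by measurable
qed

lemma measure_cube: "measure lborel (cube v) = a ^ CARD('n)"
proof -
  have "z + a *\<^sub>R (\<chi> i. real_of_int (v $ i)) \<in> cube v" using a_pos by (simp add: cube_iff algebra_simps)
  then have "cube v \<noteq> {}" by blast
  then show ?thesis unfolding grid_cube_def by (subst content_cbox_cart) (auto simp: algebra_simps)
qed

lemma prob_bad: "0 \<le> R \<Longrightarrow> prob (bad R) \<le> (2 * R / a + 2) ^ CARD('n) * exp (- (a ^ CARD('n)))"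
proof -
  assume R: "0 \<le> R"
  let ?V = "{v. cube v \<inter> cball 0 R \<noteq> {}}"
  note V = cubes_meeting_ball[OF R, of 0]
  have "bad R = (\<Union>v\<in>?V. {\<omega> \<in> space M. card (X \<omega> \<inter> cube v) = 0})" by (auto simp: bad_def)
  also have "prob \<dots> \<le> (\<Sum>v\<in>?V. prob {\<omega> \<in> space M. card (X \<omega> \<inter> cube v) = 0})"
    using card_cube_measurable V(1) by (intro finite_measure_subadditive_finite) auto
  also have "\<dots> = (\<Sum>v\<in>?V. exp (- (a ^ CARD('n))))"
    using prob_count[OF cube_borel cube_bounded, of _ 0] by (simp add: measure_cube)
  also have "\<dots> = real (card ?V) * exp (- (a ^ CARD('n)))" by simp
  also have "\<dots> \<le> (2 * R / a + 2) ^ CARD('n) * exp (- (a ^ CARD('n)))"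
    using V(2) by (intro mult_right_mono) auto
  finally show ?thesis .
qed

lemma good_hits:
  assumes "\<omega> \<in> space M" "\<omega> \<notin> bad R"
  shows "hits (cball 0 R) (X \<omega>)"
  unfolding hits_def
proof (intro allI impI notI)
  fix v assume "cube v \<inter> cball 0 R \<noteq> {}" "cube v \<inter> X \<omega> = {}"
  then have "card (X \<omega> \<inter> cube v) = 0" "v \<in> {v. cube v \<inter> cball 0 R \<noteq> {}}" by (auto simp: Int_commute)
  then show False using assms unfolding bad_def by blast
qed

lemma good_Xe:
  assumes "\<omega> \<in> space M" "\<omega> \<notin> bad R"
  shows "Xe \<omega> \<inter> cball 0 R = X \<omega> \<inter> cball 0 R"
  using good_hits[OF assms] c_in unfolding hits_def enrich_def by blast

text \<open>Without empty cubes in the ball both processes coincide there. The deterministic upper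
  bound then also holds for the process itself, so the truncation is inactive for both.\<close>

lemma good_dist:
  assumes \<omega>: "\<omega> \<in> space M" "\<omega> \<notin> bad R" and h: "\<delta> \<le> h"
    and R: "ell (norm (x - y)) + h + norm (x - y) + norm x \<le> R"
  shows "dist_e h x y \<omega> = trunc_dist h (ell (norm (x - y))) (X \<omega>) x y"
    "h_dist h (X \<omega>) x y = ennreal (dist_e h x y \<omega>)"
proof -
  let ?r = "norm (x - y)"
  let ?R' = "ell ?r + h + ?r"
  have h0: "0 \<le> h" using h \<delta>_pos by linarith
  have sub: "cball x ?R' \<subseteq> cball 0 R"
  proof
    fix u assume "u \<in> cball x ?R'"
    then have "norm (x - u) \<le> ?R'" by (simp add: dist_norm)
    then show "u \<in> cball 0 R" using R norm_triangle_ineq4[of x "x - u"] by simp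
  qed
  have "Xe \<omega> \<inter> cball x ?R' = X \<omega> \<inter> cball x ?R'" using good_Xe[OF \<omega>] sub by blast
  then have eq: "min (h_dist h (Xe \<omega>) x y) (ennreal (ell ?r)) = min (h_dist h (X \<omega>) x y) (ennreal (ell ?r))"
    by (rule h_dist_truncated_local) (use h0 ell_nonneg[of ?r] in auto)
  have le: "h_dist h (Xe \<omega>) x y \<le> ennreal (ell ?r)" by (rule h_dist_Xe_le[OF \<omega>(1) h])
  show "dist_e h x y \<omega> = trunc_dist h (ell ?r) (X \<omega>) x y"
    unfolding dist_e_def trunc_dist_def eq[symmetric] using le by (simp add: min_absorb1)
  have \<delta>le: "\<delta> / 2 \<le> ?R'" using h \<delta>_pos ell_nonneg[of ?r] norm_ge_zero[of "x - y"] by linarith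
  have "cball x (\<delta> / 2) \<subseteq> cball x ?R'" using \<delta>le by auto
  then have bx: "cball x (\<delta> / 2) \<subseteq> cball 0 R" using sub by blast
  have "cball y (\<delta> / 2) \<subseteq> cball x ?R'"
  proof
    fix u assume "u \<in> cball y (\<delta> / 2)"
    then have "dist x u \<le> ?r + \<delta> / 2" using dist_triangle[of x u y] by (simp add: dist_norm)
    then show "u \<in> cball x ?R'" using h \<delta>_pos ell_nonneg[of ?r] by simp
  qed
  then have "cball y (\<delta> / 2) \<subseteq> cball 0 R" using sub by blast
  then have "h_dist h (X \<omega>) x y \<le> ennreal (ell ?r)"
    unfolding ell_def using bx h by (intro h_dist_upper[OF lfin_X[OF \<omega>(1)] good_hits[OF \<omega>]]) auto
  then show "h_dist h (X \<omega>) x y = ennreal (dist_e h x y \<omega>)"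
    using eq le h_dist_Xe[OF \<omega>(1) h] by (simp add: min_absorb1)
qed

lemma mean_dist_e_trunc:
  assumes h: "\<delta> \<le> h" and R: "ell (norm (x - y)) + h + norm (x - y) + norm x \<le> R"
  shows "\<bar>(\<integral>\<omega>. dist_e h x y \<omega> \<partial>M) - (\<integral>\<omega>. trunc_dist h (ell (norm (x - y))) (X \<omega>) x y \<partial>M)\<bar>
    \<le> ell (norm (x - y)) * prob (bad R)"
proof -
  let ?l = "ell (norm (x - y))"
  have l: "0 \<le> ?l" by (rule ell_nonneg) simp
  have h0: "0 \<le> h" using h \<delta>_pos by linarith
  have R0: "0 \<le> R" using R l h0 norm_ge_zero[of "x - y"] norm_ge_zero[of x] by linarith
  note [measurable] = bad_events[OF R0]
  have bT: "bdd_mble M (\<lambda>\<omega>. trunc_dist h ?l (X \<omega>) x y)"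
  proof (rule bdd_mbleI)
    show "(\<lambda>\<omega>. trunc_dist h ?l (X \<omega>) x y) \<in> borel_measurable M" by measurable
    show "\<bar>trunc_dist h ?l (X \<omega>) x y\<bar> \<le> ?l" for \<omega>
      using trunc_dist_bounds(1)[of h ?l "X \<omega>" x y] trunc_dist_bounds(2)[OF l, of h "X \<omega>" x y] by simp
  qed
  note int = bdd_mble_integrable[OF bdd_dist_e[OF h, of x y]] bdd_mble_integrable[OF bT]
  have "\<bar>(\<integral>\<omega>. dist_e h x y \<omega> \<partial>M) - (\<integral>\<omega>. trunc_dist h ?l (X \<omega>) x y \<partial>M)\<bar> =
      \<bar>\<integral>\<omega>. dist_e h x y \<omega> - trunc_dist h ?l (X \<omega>) x y \<partial>M\<bar>" using int by simp
  also have "\<dots> \<le> (\<integral>\<omega>. \<bar>dist_e h x y \<omega> - trunc_dist h ?l (X \<omega>) x y\<bar> \<partial>M)" by (rule integral_abs_bound)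
  also have "\<dots> \<le> (\<integral>\<omega>. ?l * indicator (bad R) \<omega> \<partial>M)"
  proof (rule integral_mono)
    show "integrable M (\<lambda>\<omega>. \<bar>dist_e h x y \<omega> - trunc_dist h ?l (X \<omega>) x y\<bar>)" using int by simp
    show "integrable M (\<lambda>\<omega>. ?l * indicator (bad R) \<omega>)"
      using bad_events[OF R0] by (intro integrable_mult_right integrable_real_indicator) (auto simp: emeasure_eq_measure)
    fix \<omega> assume \<omega>: "\<omega> \<in> space M"
    show "\<bar>dist_e h x y \<omega> - trunc_dist h ?l (X \<omega>) x y\<bar> \<le> ?l * indicator (bad R) \<omega>"
    proof (cases "\<omega> \<in> bad R")
      case True
      then show ?thesis
        using dist_e_le[OF \<omega> h, of x y] dist_e_nonneg[of h x y \<omega>] trunc_dist_bounds(1)[of h ?l "X \<omega>" x y]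
          trunc_dist_bounds(2)[OF l, of h "X \<omega>" x y] by simp
    qed (use good_dist(1)[OF \<omega> _ h R] in simp)
  qed
  also have "\<dots> = ?l * prob (bad R)" using bad_events[OF R0] by simp
  finally show ?thesis .
qed

end

subsection \<open>Almost subadditive functions\<close>

text \<open>When a number is split into parts of between one and two thirds of it, the sum of the
  roots exceeds the root of the sum by at least a third. Hence the correction
  \<open>3 * B * sqrt\<close> gains the error \<open>B * sqrt\<close> at every split.\<close>

lemma sqrt_thirds:
  assumes "1 / 3 \<le> p" "p \<le> 2 / 3"
  shows "4 / 3 \<le> sqrt p + sqrt (1 - p)"
proof -
  have pq: "2 / 9 \<le> p * (1 - p)"
  proof -
    have "0 \<le> (p - 1 / 3) * (2 / 3 - p)" using assms by (intro mult_nonneg_nonneg) auto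
    also have "(p - 1 / 3) * (2 / 3 - p) = p * (1 - p) - 2 / 9" by (simp add: field_simps)
    finally show ?thesis by simp
  qed
  have "(4 / 9 :: real)\<^sup>2 \<le> 2 / 9" by (simp add: power2_eq_square)
  then have "4 / 9 \<le> sqrt (p * (1 - p))" using pq by (intro real_le_rsqrt) linarith
  moreover have "(sqrt p + sqrt (1 - p))\<^sup>2 = 1 + 2 * sqrt (p * (1 - p))"
    using assms by (simp add: power2_sum real_sqrt_mult)
  ultimately have "(4 / 3)\<^sup>2 \<le> (sqrt p + sqrt (1 - p))\<^sup>2" by (simp add: power2_eq_square)
  then show ?thesis by (rule power2_le_imp_le) (use assms in auto)
qed

text \<open>Almost subadditivity is assumed only from \<open>S\<close> on, because
  \<open>h s \<le> s\<close> is known for large scales only.\<close>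

context
  fixes f :: "real \<Rightarrow> real" and B A S :: real
  assumes sub: "\<And>u v. S \<le> u \<Longrightarrow> S \<le> v \<Longrightarrow> f (u + v) \<le> f u + f v + B * sqrt (u + v)"
    and f0: "\<And>t. S \<le> t \<Longrightarrow> 0 \<le> f t" and fA: "\<And>t. S \<le> t \<Longrightarrow> f t \<le> A * t" and B: "0 \<le> B" and S: "1 \<le> S"
begin

lemma multiple_ge: "S \<le> s \<Longrightarrow> 1 \<le> q \<Longrightarrow> S \<le> real q * s"
proof -
  assume s: "S \<le> s" and q: "1 \<le> q"
  have "1 * s \<le> real q * s" using s S q by (intro mult_right_mono) auto
  then show ?thesis using s by simp
qed

text \<open>The correction \<open>3 * B * sqrt\<close> turns almost subadditivity into subadditivity for summands of
  comparable size, so that the multiple \<open>q * s\<close> is reached by successive halving.\<close>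
lemma halving:
  assumes s: "S \<le> s" and q: "1 \<le> q"
  shows "f (real q * s) \<le> real q * (f s + 3 * B * sqrt s) - 3 * B * sqrt (real q * s)"
  using q
proof (induction q rule: less_induct)
  case (less q)
  show ?case
  proof (cases "q = 1")
    case False
    then have q2: "2 \<le> q" using less.prems by simp
    \<comment> \<open>The integer halves of \<open>q \<ge> 2\<close> lie between a third and two
      thirds of \<open>q\<close>, the extreme case being \<open>q = 3\<close>.\<close>
    define m n where "m = q div 2" and "n = q - q div 2"
    have mn: "1 \<le> m" "1 \<le> n" "m < q" "n < q" "m + n = q" "3 * m \<ge> q" "3 * n \<ge> q" "3 * m \<le> 2 * q"
      using q2 unfolding m_def n_def by linarith+
    have s0: "0 < s" using s S by simp
    have ge: "S \<le> real m * s" "S \<le> real n * s"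
      using multiple_ge[OF s] mn by auto
    have q': "real q * s = real m * s + real n * s" using mn(5) by (simp flip: distrib_right of_nat_add)
    define p where "p = real m / real q"
    have p: "1 / 3 \<le> p" "p \<le> 2 / 3" using mn q2 by (auto simp: p_def field_simps)
    have "p * real q = real m" "real n = real q - real m" using q2 by (simp_all add: p_def flip: mn(5))
    then have np: "real n = (1 - p) * real q" "real m = p * real q" by (simp_all add: left_diff_distrib)
    have "sqrt (real m * s) + sqrt (real n * s) = (sqrt p + sqrt (1 - p)) * sqrt (real q * s)"
      unfolding np real_sqrt_mult by (simp add: algebra_simps)
    also have "\<dots> \<ge> 4 / 3 * sqrt (real q * s)" using sqrt_thirds[OF p] s0 by (intro mult_right_mono) auto
    finally have "3 * B * (4 / 3 * sqrt (real q * s)) \<le> 3 * B * (sqrt (real m * s) + sqrt (real n * s))"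
      using B by (intro mult_left_mono) auto
    moreover have "f (real q * s) \<le> f (real m * s) + f (real n * s) + B * sqrt (real q * s)"
      unfolding q' by (rule sub[OF ge])
    moreover note less.IH[OF mn(3,1)] less.IH[OF mn(4,2)]
    moreover have "real q * (f s + 3 * B * sqrt s) = real m * (f s + 3 * B * sqrt s) + real n * (f s + 3 * B * sqrt s)"
      using mn(5) by (simp flip: distrib_right of_nat_add)
    ultimately show ?thesis by (simp add: algebra_simps)
  qed simp
qed

lemma fekete_bound:
  assumes s: "S \<le> s" and t: "2 * s \<le> t"
  shows "f t / t \<le> (f s + 3 * B * sqrt s) / s + 2 * A * s / t + B / sqrt t"
proof -
  have s0: "0 < s" and t0: "0 < t" using s t S by auto
  \<comment> \<open>One less than the integer quotient, so that the remainder is at least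
    \<open>s\<close> and almost subadditivity applies to it as well.\<close>
  define q where "q = nat \<lfloor>t / s\<rfloor> - 1"
  have ts: "2 \<le> t / s" using t s0 by (simp add: field_simps)
  then have fl: "2 \<le> \<lfloor>t / s\<rfloor>" by (simp add: le_floor_iff)
  then have q1: "1 \<le> q" and rq: "real q = real_of_int \<lfloor>t / s\<rfloor> - 1" unfolding q_def by linarith+
  have "real q + 1 \<le> t / s" "t / s < real q + 2" unfolding rq by linarith+
  then have r: "s \<le> t - real q * s" "t - real q * s \<le> 2 * s" using s0 by (simp_all add: field_simps)
  have ge: "S \<le> real q * s" by (rule multiple_ge[OF s q1])
  have "f t \<le> f (real q * s) + f (t - real q * s) + B * sqrt t"
    using sub[OF ge, of "t - real q * s"] r(1) s by simp
  moreover have "f (real q * s) \<le> real q * (f s + 3 * B * sqrt s)"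
    using halving[OF s q1] B s0 by (smt (verit) mult_nonneg_nonneg of_nat_0_le_iff real_sqrt_ge_zero)
  moreover have "f (t - real q * s) \<le> 2 * A * s"
  proof -
    have "0 \<le> A" using fA[OF s] f0[OF s] s0 by (smt (verit) mult_neg_pos)
    then have "A * (t - real q * s) \<le> A * (2 * s)" using r by (intro mult_left_mono) auto
    then show ?thesis using fA[of "t - real q * s"] r s by simp
  qed
  ultimately have "f t \<le> real q * (f s + 3 * B * sqrt s) + 2 * A * s + B * sqrt t" by linarith
  then have "f t / t \<le> (real q * (f s + 3 * B * sqrt s) + 2 * A * s + B * sqrt t) / t"
    using t0 by (intro divide_right_mono) auto
  also have "\<dots> = real q * (f s + 3 * B * sqrt s) / t + 2 * A * s / t + B * (sqrt t / t)"
    by (simp add: add_divide_distrib)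
  also have "sqrt t / t = 1 / sqrt t" using t0 by (simp add: real_div_sqrt field_simps)
  also have "real q * (f s + 3 * B * sqrt s) / t \<le> (f s + 3 * B * sqrt s) / s"
  proof -
    have "real q * s \<le> t" using r s0 by simp
    then have "real q / t \<le> 1 / s" using s0 t0 by (simp add: field_simps)
    then have "(f s + 3 * B * sqrt s) * (real q / t) \<le> (f s + 3 * B * sqrt s) * (1 / s)"
      using f0[OF s] B s0 by (intro mult_left_mono) auto
    then show ?thesis by (simp add: mult.commute)
  qed
  finally show ?thesis by simp
qed

lemma almost_subadditive_limit: "\<exists>\<sigma>. ((\<lambda>t. f t / t) \<longlongrightarrow> \<sigma>) at_top"
proof -
  \<comment> \<open>The limit is the infimum of the corrected quotient; the correction tends to 0
    and does not change the limit.\<close>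
  define g where "g s = (f s + 3 * B * sqrt s) / s" for s
  have g0: "0 \<le> g s" if "S \<le> s" for s using f0[OF that] B S that by (auto simp: g_def)
  define \<sigma> where "\<sigma> = (INF s\<in>{S..}. g s)"
  have bb: "bdd_below (g ` {S..})" using g0 by (intro bdd_belowI[of _ 0]) auto
  have \<sigma>: "\<sigma> \<le> g s" if "S \<le> s" for s unfolding \<sigma>_def using that bb by (intro cINF_lower) auto
  have lim0: "((\<lambda>t. 3 * B / sqrt t) \<longlongrightarrow> 0) at_top" "((\<lambda>t. 2 * A * s / t + B / sqrt t) \<longlongrightarrow> 0) at_top" for s
    by real_asymp+
  have "((\<lambda>t. f t / t) \<longlongrightarrow> \<sigma>) at_top"
  proof (rule tendstoI)
    fix e :: real assume e: "0 < e"
    have "\<exists>s\<in>{S..}. g s < \<sigma> + e / 2"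
      using cINF_less_iff[OF _ bb, of "\<sigma> + e / 2"] e unfolding \<sigma>_def by auto
    then obtain s where s: "S \<le> s" "g s < \<sigma> + e / 2" by auto
    have e2: "0 < e / 2" using e by simp
    have "\<forall>\<^sub>F t in at_top. 3 * B / sqrt t < e" using order_tendstoD(2)[OF lim0(1) e] .
    moreover have "\<forall>\<^sub>F t in at_top. 2 * A * s / t + B / sqrt t < e / 2"
      by (rule order_tendstoD(2)[OF lim0(2) e2])
    moreover have "\<forall>\<^sub>F t in at_top. max S (2 * s) \<le> t" by (rule eventually_ge_at_top)
    ultimately show "\<forall>\<^sub>F t in at_top. dist (f t / t) \<sigma> < e"
    proof eventually_elim
      case (elim t)
      have t: "S \<le> t" "2 * s \<le> t" "0 < t" using elim(3) S by auto
      have "g t = f t / t + 3 * B * (sqrt t / t)" by (simp add: g_def add_divide_distrib)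
      also have "sqrt t / t = 1 / sqrt t" using t by (simp add: real_div_sqrt field_simps)
      finally have "\<sigma> - 3 * B / sqrt t \<le> f t / t" using \<sigma>[OF t(1)] by simp
      moreover have "f t / t < \<sigma> + e" using fekete_bound[OF s(1) t(2)] s(2)[unfolded g_def] elim(2) by linarith
      ultimately show ?case using elim(1) by (simp add: dist_real_def abs_less_iff)
    qed
  qed
  then show ?thesis by blast
qed

end

subsection \<open>The time constant\<close>

text \<open>Statements about the process itself mention no grid. For them the grid with offset 0,
  with the lower corners as added points, serves as an auxiliary enrichment.\<close>

definition corner :: "real \<Rightarrow> int ^ 'n \<Rightarrow> real ^ 'n" where
  "corner a v = (\<chi> i. a * real_of_int (v $ i))"

lemma corner_in_cube: "0 < a \<Longrightarrow> corner a v \<in> grid_cube a 0 v"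
  by (auto simp: corner_def grid_cube_def mem_box_cart algebra_simps)

context poisson_grid
begin

lemma dist_e_triangle:
  assumes "\<omega> \<in> space M" "\<delta> \<le> h"
  shows "dist_e h x w \<omega> \<le> dist_e h x y \<omega> + dist_e h y w \<omega> + \<delta>"
proof -
  have "ennreal (dist_e h x w \<omega>) \<le> ennreal (dist_e h x y \<omega>) + ennreal (dist_e h y w \<omega>) + ennreal \<delta>"
    using h_dist_triangle[OF Xe_hits[of UNIV \<omega>] UNIV_I assms(2), of x w y] by (simp add: h_dist_Xe[OF assms])
  also have "\<dots> = ennreal (dist_e h x y \<omega> + dist_e h y w \<omega> + \<delta>)"
    using dist_e_nonneg \<delta>_pos by (simp add: ennreal_plus)
  finally show ?thesis using dist_e_nonneg[of h x y \<omega>] dist_e_nonneg[of h y w \<omega>] \<delta>_pos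
    by (subst (asm) ennreal_le_iff) auto
qed

lemma dist_e_lower:
  assumes "\<omega> \<in> space M" "\<delta> \<le> h"
  shows "norm (x - y) - h \<le> dist_e h x y \<omega>"
proof (rule ccontr)
  assume "\<not> ?thesis"
  then have "h_dist h (Xe \<omega>) x y < ennreal (norm (x - y) - h)"
    using dist_e_nonneg[of h x y \<omega>] by (simp add: h_dist_Xe[OF assms] ennreal_less_iff)
  then obtain p where p: "p \<in> h_paths h (Xe \<omega>) x y" "path_length p < norm (x - y) - h" by (rule h_dist_lessE)
  have "norm (last p - hd p) \<le> path_length p" using p(1) by (intro norm_le_path_length) (auto simp: h_paths_iff)
  moreover have "norm (x - hd p) \<le> h / 2" "norm (y - last p) \<le> h / 2" using p(1) by (auto simp: h_paths_iff)
  moreover have "norm (x - y) \<le> norm (x - hd p) + norm (last p - hd p) + norm (y - last p)"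
    using norm_diff_via[of x y "hd p"] norm_diff_via[of "hd p" y "last p"] by (simp add: norm_minus_commute)
  ultimately show False using p(2) by linarith
qed

end

locale fpp = scales C' k "CARD('n::finite)" + poisson M X
  for C' k and M :: "'a measure" and X :: "'a \<Rightarrow> (real ^ 'n) set" +
  fixes h :: "real \<Rightarrow> real"
  assumes h_mono: "mono_on {1<..} h" and h_ge: "\<And>s. 1 < s \<Longrightarrow> \<delta>s s \<le> h s"
    and h_lim: "((\<lambda>s. h s / s) \<longlongrightarrow> 0) at_top"
begin

lemma h_le: "1 < s \<Longrightarrow> s \<le> t \<Longrightarrow> h s \<le> h t"
  using h_mono by (auto simp: mono_on_def)

lemma h_ge_2: "1 < s \<Longrightarrow> 2 \<le> h s"
  using h_ge \<delta>s_ge by (meson order_trans)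

lemma eventually_h_le: "\<forall>\<^sub>F s in at_top. h s \<le> s"
proof -
  have "\<forall>\<^sub>F s in at_top. h s / s < 1" using order_tendstoD(2)[OF h_lim] by simp
  then show ?thesis using eventually_gt_at_top[of 0]
    by eventually_elim (simp add: pos_divide_less_eq)
qed

lemma ex_large: "\<exists>S\<ge>2. \<forall>s\<ge>S. h s \<le> s"
  using eventually_h_le unfolding eventually_at_top_linorder by (metis max.bounded_iff max.cobounded1)

lemma grid:
  assumes "1 < s" "\<And>v. c v \<in> grid_cube (side s) z v"
  shows "poisson_grid (side s) z M X c"
  using side_ge[OF assms(1)] assms(2) by unfold_locales auto

lemma grid_corner: "1 < s \<Longrightarrow> poisson_grid (side s) 0 M X (corner (side s))"
  using side_ge[of s] by (intro grid corner_in_cube) auto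

text \<open>A radius that contains all short paths between points considered at scale \<open>s\<close>.\<close>
definition rad :: "real \<Rightarrow> real" where "rad s = 7 * Cd * s"

lemma prob_bad_rad:
  assumes s: "1 < s" and c: "\<And>v. c v \<in> grid_cube (side s) z v"
  shows "prob (poisson_grid.bad (side s) z M X (rad s)) \<le> bad_const * s powr (real CARD('n) - k)"
proof -
  interpret G: poisson_grid "side s" z M X c by (rule grid[OF s c])
  have r0: "0 \<le> rad s" using Cd_ge s by (simp add: rad_def)
  have s1: "1 \<le> side s" by (rule side_ge[OF s])
  have "2 * rad s / side s \<le> 2 * rad s / 1" using s1 r0 by (intro divide_left_mono) auto
  also have "2 * rad s / 1 + 2 \<le> 16 * Cd * s"
  proof -
    have "1 \<le> s * Cd" using mult_mono[of 1 s 1 Cd] Cd_ge s by simp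
    then show ?thesis by (simp add: rad_def mult_ac)
  qed
  finally have le: "2 * rad s / side s + 2 \<le> 16 * Cd * s" by simp
  have "prob (G.bad (rad s)) \<le> (2 * rad s / side s + 2) ^ CARD('n) * exp (- (side s ^ CARD('n)))"
    by (rule G.prob_bad[OF r0])
  also have "\<dots> \<le> (16 * Cd * s) ^ CARD('n) * s powr (- k)"
    using le r0 s1 empty_cube_bound[OF s] Cd_ge s by (intro mult_mono power_mono) auto
  also have "\<dots> = bad_const * (s powr real CARD('n) * s powr (- k))"
    using s by (simp add: bad_const_def power_mult_distrib powr_realpow)
  also have "s powr real CARD('n) * s powr (- k) = s powr (real CARD('n) - k)" by (simp flip: powr_add)
  finally show ?thesis .
qed

text \<open>The direction is immaterial by isometry invariance, so the arbitrary coordinate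
  \<open>undefined\<close> is used. Scale and distance are separate arguments because one scale must
  serve pieces of different lengths.\<close>

definition tau :: "real \<Rightarrow> real \<Rightarrow> real" where
  "tau s r = (\<integral>\<omega>. trunc_dist (h s) (ells s r) (X \<omega>) 0 (r *\<^sub>R axis undefined 1) \<partial>M)"

definition f :: "real \<Rightarrow> real" where "f s = tau s s"

lemma tau_eq: "(\<integral>\<omega>. trunc_dist (h s) (ells s (norm (x - y))) (X \<omega>) x y \<partial>M) = tau s (norm (x - y))"
  unfolding tau_def by (rule mean_trunc_dist_unique) (unfold_locales, auto)

text \<open>The bounds \<open>3 * s\<close> and \<open>2 * s\<close> cover all pairs of the ratio
  argument: two centres at distance \<open>2 * s\<close> and the points of the spheres of radius
  \<open>s\<close> around them.\<close>

lemma mean_dist_tau: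
  assumes s: "1 < s" "h s \<le> s" and c: "\<And>v. c v \<in> grid_cube (side s) z v"
    and xy: "norm x \<le> 3 * s" "norm (x - y) \<le> 2 * s"
  shows "\<bar>(\<integral>\<omega>. poisson_grid.dist_e (side s) z X c (h s) x y \<omega> \<partial>M) - tau s (norm (x - y))\<bar> \<le> c0"
proof -
  interpret G: poisson_grid "side s" z M X c by (rule grid[OF s(1) c])
  have GC: "G.C = Cd" by (simp add: G.C_def Cd_def dim_const_def)
  have G\<delta>: "G.\<delta> = \<delta>s s" by (simp add: G.\<delta>_def GC \<delta>s_eq)
  have Gell: "G.ell r = ells s r" for r by (simp add: G.ell_def ells_def GC G\<delta>)
  have \<delta>h: "\<delta>s s \<le> s" using h_ge[OF s(1)] s(2) by simp
  have ell_le: "ells s (norm (x - y)) \<le> (3 * Cd + 1) * s"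
  proof -
    have "Cd * norm (x - y) \<le> Cd * (2 * s)" "(Cd + 1) * \<delta>s s \<le> (Cd + 1) * s"
      using Cd_ge xy(2) \<delta>h by (auto intro: mult_left_mono)
    then show ?thesis by (simp add: ells_def algebra_simps)
  qed
  have "(3 * Cd + 7) * s \<le> (7 * Cd) * s" "(3 * Cd + 1) * s \<le> (4 * Cd) * s"
    using Cd_ge s by (auto intro: mult_right_mono)
  moreover have "(3 * Cd + 7) * s = (3 * Cd + 1) * s + 6 * s" by (simp add: algebra_simps)
  ultimately have R: "G.ell (norm (x - y)) + h s + norm (x - y) + norm x \<le> rad s" and ell_le': "G.ell (norm (x - y)) \<le> 4 * Cd * s"
    unfolding Gell rad_def using ell_le s xy by linarith+
  have "\<bar>(\<integral>\<omega>. G.dist_e (h s) x y \<omega> \<partial>M) - (\<integral>\<omega>. trunc_dist (h s) (G.ell (norm (x - y))) (X \<omega>) x y \<partial>M)\<bar>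
      \<le> G.ell (norm (x - y)) * prob (G.bad (rad s))"
    by (rule G.mean_dist_e_trunc[OF _ R]) (use h_ge[OF s(1)] G\<delta> in simp)
  also have "\<dots> \<le> (4 * Cd * s) * (bad_const * s powr (real CARD('n) - k))"
  proof (rule mult_mono)
    show "G.ell (norm (x - y)) \<le> 4 * Cd * s" by (rule ell_le')
    show "prob (G.bad (rad s)) \<le> bad_const * s powr (real CARD('n) - k)" by (rule prob_bad_rad[OF s(1) c])
  qed (use Cd_ge s in auto)
  also have "\<dots> = c0 * (s powr 1 * s powr (real CARD('n) - k))" using s by (simp add: c0_def)
  also have "s powr 1 * s powr (real CARD('n) - k) = s powr (1 + real CARD('n) - k)"
    unfolding powr_add[symmetric] by (simp add: algebra_simps)
  also have "c0 * s powr (1 + real CARD('n) - k) \<le> c0 * s powr 0"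
    using c0_pos s k by (intro mult_left_mono powr_mono) auto
  finally show ?thesis using s by (simp add: Gell tau_eq)
qed

definition Bf :: real where "Bf = (Cd + 2) * Bsqrt + 3 * c0"

lemma Bf_pos: "0 < Bf" using Cd_ge Bsqrt_pos c0_pos by (simp add: Bf_def add_pos_pos)

lemma ells_nonneg: "1 < s \<Longrightarrow> 0 \<le> r \<Longrightarrow> 0 \<le> ells s r"
  using Cd_ge \<delta>s_ge[of s] by (simp add: ells_def)

lemma bdd_trunc: "0 \<le> l \<Longrightarrow> bdd_mble M (\<lambda>\<omega>. trunc_dist h' l (X \<omega>) x y)"
  by (rule bdd_mbleI[of _ _ l]) (measurable, simp add: abs_of_nonneg[OF trunc_dist_bounds(1)] trunc_dist_bounds(2))

lemma f_bounds: "1 < s \<Longrightarrow> 0 \<le> f s" "1 < s \<Longrightarrow> f s \<le> ells s s"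
proof -
  assume s: "1 < s"
  have l: "0 \<le> ells s s" using s by (intro ells_nonneg) auto
  show "0 \<le> f s" unfolding f_def tau_def by (rule Bochner_Integration.integral_nonneg) (rule trunc_dist_bounds)
  show "f s \<le> ells s s" unfolding f_def tau_def
    by (rule integral_bounds(2)[where \<alpha> = 0]) (measurable, auto intro: trunc_dist_bounds(1) trunc_dist_bounds(2)[OF l])
qed

text \<open>Subadditivity at scale \<open>u + v\<close> treats both pieces with the larger step
  size; this brings them back to their own scales. Monotonicity in \<open>h\<close> has the
  favourable sign, so only the truncation level contributes an error.\<close>

lemma tau_mono:
  assumes "1 < s" "s \<le> t" "0 \<le> r"
  shows "tau t r \<le> tau s r + (Cd + 1) * \<delta>s t"
proof -
  have l: "0 \<le> ells s r" "ells s r \<le> ells t r"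
    using ells_nonneg[OF assms(1,3)] \<delta>s_mono[OF assms(1,2)] Cd_ge by (auto simp: ells_def intro: mult_left_mono)
  have "tau t r \<le> (\<integral>\<omega>. trunc_dist (h s) (ells s r) (X \<omega>) 0 (r *\<^sub>R axis undefined 1) + (ells t r - ells s r) \<partial>M)"
    unfolding tau_def using l h_le[OF assms(1,2)]
    by (intro integral_mono trunc_dist_mono bdd_mble_integrable bdd_mble_add bdd_mble_const bdd_trunc) auto
  also have "\<dots> = tau s r + (ells t r - ells s r)"
    using bdd_mble_integrable[OF bdd_trunc[OF l(1)]] by (simp add: tau_def prob_space)
  also have "ells t r - ells s r \<le> (Cd + 1) * \<delta>s t"
    using \<delta>s_ge[OF assms(1)] Cd_ge by (simp add: ells_def algebra_simps)
  finally show ?thesis by simp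
qed

lemma f_almost_subadditive:
  assumes S: "2 \<le> S" "\<And>s. S \<le> s \<Longrightarrow> h s \<le> s" and uv: "S \<le> u" "S \<le> v"
  shows "f (u + v) \<le> f u + f v + (2 * Bf) * sqrt (u + v)"
proof -
  define t where "t = u + v"
  have t: "1 < t" "h t \<le> t" "1 < u" "1 < v" "u \<le> t" "v \<le> t" using S uv by (auto simp: t_def)
  let ?c = "corner (side t) :: int ^ 'n \<Rightarrow> real ^ 'n"
  interpret G: poisson_grid "side t" 0 M X ?c by (rule grid_corner[OF t(1)])
  have c: "?c v \<in> grid_cube (side t) 0 v" for v by (rule G.c_in)
  have GC: "G.C = Cd" by (simp add: G.C_def Cd_def dim_const_def)
  have G\<delta>: "G.\<delta> = \<delta>s t" by (simp add: G.\<delta>_def GC \<delta>s_eq)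
  have \<delta>h: "G.\<delta> \<le> h t" using h_ge[OF t(1)] by (simp add: G\<delta>)
  define e :: "real ^ 'n" where "e = axis undefined 1"
  have ne: "norm e = 1" by (simp add: e_def)
  have n: "norm (0 - t *\<^sub>R e) = t" "norm (0 - u *\<^sub>R e) = u" "norm (u *\<^sub>R e - t *\<^sub>R e) = v"
    "norm (u *\<^sub>R e) = u"
    using t ne by (auto simp: t_def simp flip: scaleR_diff_left)
  have 1: "\<bar>(\<integral>\<omega>. G.dist_e (h t) 0 (t *\<^sub>R e) \<omega> \<partial>M) - tau t t\<bar> \<le> c0"
    using mean_dist_tau[OF t(1,2) c, of 0 "t *\<^sub>R e"] t unfolding n by simp
  have 2: "\<bar>(\<integral>\<omega>. G.dist_e (h t) 0 (u *\<^sub>R e) \<omega> \<partial>M) - tau t u\<bar> \<le> c0"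
    using mean_dist_tau[OF t(1,2) c, of 0 "u *\<^sub>R e"] t unfolding n by simp
  have 3: "\<bar>(\<integral>\<omega>. G.dist_e (h t) (u *\<^sub>R e) (t *\<^sub>R e) \<omega> \<partial>M) - tau t v\<bar> \<le> c0"
    using mean_dist_tau[OF t(1,2) c, of "u *\<^sub>R e" "t *\<^sub>R e"] t unfolding n by simp
  have tri: "G.dist_e (h t) 0 (t *\<^sub>R e) \<omega> \<le> G.dist_e (h t) 0 (u *\<^sub>R e) \<omega> + G.dist_e (h t) (u *\<^sub>R e) (t *\<^sub>R e) \<omega> + \<delta>s t"
    if \<omega>: "\<omega> \<in> space M" for \<omega>
    by (rule G.dist_e_triangle[OF \<omega> \<delta>h, unfolded G\<delta>])
  note int = G.bdd_dist_e[OF \<delta>h]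
  have "(\<integral>\<omega>. G.dist_e (h t) 0 (t *\<^sub>R e) \<omega> \<partial>M) \<le>
    (\<integral>\<omega>. G.dist_e (h t) 0 (u *\<^sub>R e) \<omega> + G.dist_e (h t) (u *\<^sub>R e) (t *\<^sub>R e) \<omega> + \<delta>s t \<partial>M)"
    by (intro integral_mono bdd_mble_integrable bdd_mble_add bdd_mble_const int tri)
  also have "\<dots> = (\<integral>\<omega>. G.dist_e (h t) 0 (u *\<^sub>R e) \<omega> \<partial>M) + (\<integral>\<omega>. G.dist_e (h t) (u *\<^sub>R e) (t *\<^sub>R e) \<omega> \<partial>M) + \<delta>s t"
    using bdd_mble_integrable[OF int] by (simp add: prob_space)
  finally have "tau t t \<le> tau t u + tau t v + \<delta>s t + 3 * c0" using 1 2 3 by linarith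
  moreover have "tau t u \<le> tau u u + (Cd + 1) * \<delta>s t" "tau t v \<le> tau v v + (Cd + 1) * \<delta>s t"
    using t by (auto intro!: tau_mono)
  ultimately have "f t \<le> f u + f v + ((2 * Cd + 3) * \<delta>s t + 3 * c0)"
    by (simp add: f_def algebra_simps)
  also have "(2 * Cd + 3) * \<delta>s t + 3 * c0 \<le> (2 * Cd + 3) * (Bsqrt * sqrt t) + 3 * c0 * sqrt t"
  proof -
    have "1 \<le> sqrt t" using t by simp
    then have "3 * c0 * 1 \<le> 3 * c0 * sqrt t" using c0_pos by (intro mult_left_mono) auto
    moreover have "(2 * Cd + 3) * \<delta>s t \<le> (2 * Cd + 3) * (Bsqrt * sqrt t)"
      using \<delta>s_le_sqrt[OF t(1)] Cd_ge by (intro mult_left_mono) auto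
    ultimately show ?thesis by simp
  qed
  also have "\<dots> = ((2 * Cd + 3) * Bsqrt + 3 * c0) * sqrt t" by (simp add: algebra_simps)
  also have "\<dots> \<le> (2 * Bf) * sqrt t"
    using Cd_ge Bsqrt_pos c0_pos t by (intro mult_right_mono) (auto simp: Bf_def algebra_simps)
  finally show ?thesis by (simp add: t_def)
qed

lemma f_lower:
  assumes s: "1 < s" "h s \<le> s"
  shows "s - h s - c0 \<le> f s"
proof -
  let ?c = "corner (side s) :: int ^ 'n \<Rightarrow> real ^ 'n"
  interpret G: poisson_grid "side s" 0 M X ?c by (rule grid_corner[OF s(1)])
  have c: "?c v \<in> grid_cube (side s) 0 v" for v by (rule G.c_in)
  have GC: "G.C = Cd" by (simp add: G.C_def Cd_def dim_const_def)
  have G\<delta>: "G.\<delta> = \<delta>s s" by (simp add: G.\<delta>_def GC \<delta>s_eq)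
  have \<delta>h: "G.\<delta> \<le> h s" using h_ge[OF s(1)] by (simp add: G\<delta>)
  define e :: "real ^ 'n" where "e = axis undefined 1"
  have n: "norm (0 - s *\<^sub>R e) = s" using s by (simp add: e_def)
  have 1: "\<bar>(\<integral>\<omega>. G.dist_e (h s) 0 (s *\<^sub>R e) \<omega> \<partial>M) - tau s s\<bar> \<le> c0"
    using mean_dist_tau[OF s c, of 0 "s *\<^sub>R e"] s unfolding n by simp
  have "(\<integral>\<omega>. s - h s \<partial>M) \<le> (\<integral>\<omega>. G.dist_e (h s) 0 (s *\<^sub>R e) \<omega> \<partial>M)"
    using G.dist_e_lower[OF _ \<delta>h, of _ 0 "s *\<^sub>R e"] n
    by (intro integral_mono bdd_mble_integrable bdd_mble_const G.bdd_dist_e[OF \<delta>h]) auto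
  then show ?thesis using 1 by (simp add: prob_space f_def)
qed

lemma time_constant: "\<exists>\<sigma>. 1 \<le> \<sigma> \<and> \<sigma> \<le> Cd \<and> ((\<lambda>s. f s / s) \<longlongrightarrow> \<sigma>) at_top"
proof -
  obtain S where S: "2 \<le> S" "\<And>s. S \<le> s \<Longrightarrow> h s \<le> s" using ex_large by blast
  have ub: "f t \<le> Cd * t + (Cd + 1) * (Bsqrt * sqrt t)" if "S \<le> t" for t
  proof -
    have t: "1 < t" using that S by simp
    have "(Cd + 1) * \<delta>s t \<le> (Cd + 1) * (Bsqrt * sqrt t)"
      using \<delta>s_le_sqrt[OF t] Cd_ge by (intro mult_left_mono) auto
    then show ?thesis using f_bounds(2)[OF t] by (simp add: ells_def)
  qed
  have "\<exists>\<sigma>. ((\<lambda>t. f t / t) \<longlongrightarrow> \<sigma>) at_top"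
  proof (rule almost_subadditive_limit[where S = S and B = "2 * Bf" and A = "Cd + (Cd + 1) * Bsqrt"])
    show "f (u + v) \<le> f u + f v + (2 * Bf) * sqrt (u + v)" if "S \<le> u" "S \<le> v" for u v
      by (rule f_almost_subadditive[OF S that])
    show "0 \<le> f t" if "S \<le> t" for t using that S by (intro f_bounds) auto
    show "f t \<le> (Cd + (Cd + 1) * Bsqrt) * t" if "S \<le> t" for t
    proof -
      have t1: "1 \<le> t" using that S by simp
      then have "sqrt t \<le> t" using real_sqrt_le_mono[of t "t * t"] by simp
      then have "(Cd + 1) * (Bsqrt * sqrt t) \<le> (Cd + 1) * (Bsqrt * t)"
        using Cd_ge Bsqrt_pos by (intro mult_left_mono) auto
      then show ?thesis using ub[OF that] by (simp add: algebra_simps)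
    qed
  qed (use Bf_pos S in auto)
  then obtain \<sigma> where \<sigma>: "((\<lambda>t. f t / t) \<longlongrightarrow> \<sigma>) at_top" by blast
  have "\<sigma> \<le> Cd"
  proof (rule tendsto_le[OF _ _ \<sigma>])
    show "((\<lambda>t. Cd + (Cd + 1) * Bsqrt * (1 / sqrt t)) \<longlongrightarrow> Cd) at_top" by real_asymp
    show "\<forall>\<^sub>F t in at_top. f t / t \<le> Cd + (Cd + 1) * Bsqrt * (1 / sqrt t)"
      using eventually_ge_at_top[of S]
    proof eventually_elim
      case (elim t)
      have t: "0 < t" using elim S by simp
      have "f t / t \<le> (Cd * t + (Cd + 1) * (Bsqrt * sqrt t)) / t" using ub[OF elim] t by (intro divide_right_mono) auto
      also have "\<dots> = Cd + (Cd + 1) * Bsqrt * (sqrt t / t)" using t by (simp add: add_divide_distrib)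
      also have "sqrt t / t = 1 / sqrt t" using t by (simp add: real_div_sqrt field_simps)
      finally show ?case .
    qed
  qed simp
  moreover have "1 \<le> \<sigma>"
  proof (rule tendsto_le[OF _ \<sigma>])
    have "((\<lambda>t. 1 - h t / t - c0 / t) \<longlongrightarrow> 1 - 0 - 0) at_top"
      by (intro tendsto_intros h_lim) real_asymp
    then show "((\<lambda>t. 1 - h t / t - c0 / t) \<longlongrightarrow> 1) at_top" by simp
    show "\<forall>\<^sub>F t in at_top. 1 - h t / t - c0 / t \<le> f t / t"
      using eventually_ge_at_top[of S]
    proof eventually_elim
      case (elim t)
      have t: "1 < t" using elim S by simp
      have "(t - h t - c0) / t \<le> f t / t"
        using f_lower[OF t S(2)[OF elim]] t by (intro divide_right_mono) auto
      then show ?case using t by (simp add: diff_divide_distrib)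
    qed
  qed simp
  ultimately show ?thesis using \<sigma> by blast
qed

end

context poisson_grid
begin

theorem two_sided_tail:
  assumes h: "\<delta> \<le> h" and r: "h \<le> norm (x - y)" and l: "0 \<le> l"
  defines "D \<equiv> dist_e h x y" and "K \<equiv> vf h (norm (x - y))"
  shows "prob {\<omega> \<in> space M. l * sqrt K \<le> \<bar>D \<omega> - (\<integral>\<omega>. D \<omega> \<partial>M)\<bar>} \<le> 2 * exp (3 - l)"
proof -
  let ?E = "\<integral>\<omega>. D \<omega> \<partial>M"
  have [measurable]: "D \<in> borel_measurable M" unfolding D_def by measurable
  \<comment> \<open>Weakens the Gaussian lower tail to the exponential form of the upper one: the
    square gives \<open>- l\<^sup>2 / 4 \<le> 1 - l\<close>.\<close>
  have "0 \<le> (l / 2 - 1)\<^sup>2" by simp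
  then have "- l\<^sup>2 / 4 \<le> 3 - l" by (simp add: power2_eq_square algebra_simps)
  then have low: "prob {\<omega> \<in> space M. l * sqrt K \<le> ?E - D \<omega>} \<le> exp (3 - l)"
    using lower_tail[OF h r l] unfolding D_def K_def by (meson exp_le_cancel_iff order_trans)
  have "{\<omega> \<in> space M. l * sqrt K \<le> \<bar>D \<omega> - ?E\<bar>} \<subseteq>
      {\<omega> \<in> space M. l * sqrt K \<le> D \<omega> - ?E} \<union> {\<omega> \<in> space M. l * sqrt K \<le> ?E - D \<omega>}" by auto
  then have "prob {\<omega> \<in> space M. l * sqrt K \<le> \<bar>D \<omega> - ?E\<bar>} \<le>
      prob ({\<omega> \<in> space M. l * sqrt K \<le> D \<omega> - ?E} \<union> {\<omega> \<in> space M. l * sqrt K \<le> ?E - D \<omega>})"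
    by (intro finite_measure_mono) auto
  also have "\<dots> \<le> prob {\<omega> \<in> space M. l * sqrt K \<le> D \<omega> - ?E} + prob {\<omega> \<in> space M. l * sqrt K \<le> ?E - D \<omega>}"
    by (intro measure_Un_le) auto
  also have "\<dots> \<le> 2 * exp (3 - l)" using upper_tail[OF h r l] low unfolding D_def K_def by linarith
  finally show ?thesis .
qed

end

subsection \<open>Almost sure convergence\<close>

context fpp
begin

lemma AE_convergence:
  assumes \<sigma>: "((\<lambda>s. f s / s) \<longlongrightarrow> \<sigma>) at_top"
  shows "AE \<omega> in M. ((\<lambda>s. h_dist (h s) (X \<omega>) 0 (s *\<^sub>R axis j 1) / ennreal s) \<longlongrightarrow> ennreal \<sigma>) at_top"
proof -
  obtain S0 where S0: "2 \<le> S0" "\<And>s. S0 \<le> s \<Longrightarrow> h s \<le> s" using ex_large by blast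
  define N0 where "N0 = nat \<lceil>S0\<rceil>"
  have N0: "2 \<le> real n" "S0 \<le> real n" "1 < real n" "h n \<le> n" if "N0 \<le> n" for n
  proof -
    show "S0 \<le> real n" using that unfolding N0_def by linarith
    then show "2 \<le> real n" "1 < real n" "h n \<le> n" using S0 by auto
  qed
  define e :: "real ^ 'n" where "e = axis j 1"
  have ne: "norm e = 1" by (simp add: e_def)
  let ?c = "\<lambda>n. corner (side (real n)) :: int ^ 'n \<Rightarrow> real ^ 'n"
  have PG: "poisson_grid (side (real n)) 0 M X (?c n)" if "N0 \<le> n" for n
    by (rule grid_corner[OF N0(3)[OF that]])
  have cin: "?c n v \<in> grid_cube (side (real n)) 0 v" if "N0 \<le> n" for n v
    using side_ge[OF N0(3)[OF that]] by (intro corner_in_cube) auto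
  define D where "D n = poisson_grid.dist_e (side (real n)) 0 X (?c n) (h n) 0 (real n *\<^sub>R e)" for n :: nat
  define E where "E n = (\<integral>\<omega>. D n \<omega> \<partial>M)" for n
  \<comment> \<open>At \<open>l = 3 + 2 * ln n\<close> the tail bound \<open>2 * exp (3 - l)\<close>
    is \<open>2 * real n powr (-2)\<close>, which is summable.\<close>
  define q where "q n = (3 + 2 * ln n) * sqrt (kap * (\<delta>s n)\<^sup>2 * n / h n)" for n :: nat
  define A where "A n = (if N0 \<le> n then poisson_grid.bad (side (real n)) 0 M X (rad n) \<union>
    {\<omega> \<in> space M. q n \<le> \<bar>D n \<omega> - E n\<bar>} else {})" for n
  have nn: "norm (0 - real n *\<^sub>R e) = n" for n using ne by simp
  have props: "A n \<in> events \<and> prob (A n) \<le> bad_const * real n powr (real CARD('n) - k) + 2 * real n powr (-2)"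
    if n: "N0 \<le> n" for n
  proof -
    interpret G: poisson_grid "side (real n)" 0 M X "?c n" by (rule PG[OF n])
    have GC: "G.C = Cd" by (simp add: G.C_def Cd_def dim_const_def)
    have G\<delta>: "G.\<delta> = \<delta>s n" by (simp add: G.\<delta>_def GC \<delta>s_eq)
    have vf: "G.vf (h n) (norm (0 - real n *\<^sub>R e)) = kap * (\<delta>s n)\<^sup>2 * n / h n"
      unfolding nn by (simp add: G.vf_def kap_def GC G\<delta>)
    have r0: "0 \<le> rad n" using Cd_ge by (simp add: rad_def)
    have Dm[measurable]: "D n \<in> borel_measurable M" unfolding D_def by (rule G.dist_e_measurable)
    have B: "G.bad (rad n) \<in> events" by (rule G.bad_events[OF r0])
    have ev: "{\<omega> \<in> space M. q n \<le> \<bar>D n \<omega> - E n\<bar>} \<in> events" by measurable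
    have An: "A n = G.bad (rad n) \<union> {\<omega> \<in> space M. q n \<le> \<bar>D n \<omega> - E n\<bar>}" using n by (simp add: A_def)
    have "prob {\<omega> \<in> space M. q n \<le> \<bar>D n \<omega> - E n\<bar>} \<le> 2 * exp (3 - (3 + 2 * ln n))"
      unfolding q_def E_def D_def vf[symmetric] using N0[OF n] h_ge[OF N0(3)[OF n]] ne
      by (intro G.two_sided_tail) (auto simp: G\<delta>)
    also have "exp (3 - (3 + 2 * ln n)) = real n powr (-2)" using N0[OF n] by (simp add: powr_def)
    finally have p2: "prob {\<omega> \<in> space M. q n \<le> \<bar>D n \<omega> - E n\<bar>} \<le> 2 * real n powr (-2)" .
    have "prob (A n) \<le> prob (G.bad (rad n)) + prob {\<omega> \<in> space M. q n \<le> \<bar>D n \<omega> - E n\<bar>}"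
      unfolding An using B ev by (rule measure_Un_le)
    then show ?thesis using p2 prob_bad_rad[OF N0(3)[OF n] cin[OF n]] An B ev by auto
  qed
  have Am: "A n \<in> events" for n using props[of n] by (cases "N0 \<le> n") (auto simp: A_def)
  \<comment> \<open>The exponent \<open>real CARD('n) - k\<close> is below -1 because
    \<open>k > d + 1\<close>.\<close>
  have sum: "summable (\<lambda>n. prob (A n))"
  proof (rule summable_comparison_test')
    show "summable (\<lambda>n. bad_const * real n powr (real CARD('n) - k) + 2 * real n powr (-2))"
      using k by (intro summable_add summable_mult) (auto simp: summable_real_powr_iff)
    show "norm (prob (A n)) \<le> bad_const * real n powr (real CARD('n) - k) + 2 * real n powr (-2)" if "N0 \<le> n" for n
      using props[OF that] by simp
  qed
  have BC: "AE \<omega> in M. \<forall>\<^sub>F n in sequentially. \<omega> \<in> space M - A n"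
    by (rule borel_cantelli_AE1[OF Am _ sum]) (simp add: emeasure_eq_measure)
  \<comment> \<open>The total error at \<open>n\<close>: the fluctuation plus the cost of moving the
    end point by at most one.\<close>
  define w where "w n = q n + Cd + (Cd + 1) * \<delta>s n" for n :: nat
  have lim_w: "(\<lambda>n. w n / real n) \<longlonglongrightarrow> 0"
  proof (rule Lim_null_comparison)
    let ?b = "\<lambda>n :: nat. (3 + 2 * ln n) * (sqrt (kap * Bsqrt) * real n powr (3 / 4)) / n + Cd / n + (Cd + 1) * (Bsqrt * sqrt n) / n"
    show "\<forall>\<^sub>F n in sequentially. norm (w n / real n) \<le> ?b n"
      using eventually_ge_at_top[of N0]
    proof eventually_elim
      case (elim n)
      note n = N0[OF elim]
      have h0: "0 < h n" using h_ge_2[OF n(3)] by simp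
      have \<delta>0: "0 \<le> \<delta>s n" "\<delta>s n \<le> h n" "\<delta>s n \<le> Bsqrt * sqrt n"
        using \<delta>s_ge[OF n(3)] h_ge[OF n(3)] \<delta>s_le_sqrt[OF n(3)] by auto
      \<comment> \<open>As \<open>\<delta>s n \<le> h n\<close>, one factor cancels and the other is
        at most of order \<open>sqrt n\<close>. The fluctuation is then at most of order
        \<open>ln n * real n powr (3 / 4)\<close>, whatever the growth of \<open>h\<close>.\<close>
      have "(\<delta>s n)\<^sup>2 / h n \<le> \<delta>s n * h n / h n"
        unfolding power2_eq_square using \<delta>0 h0 by (intro divide_right_mono mult_left_mono) auto
      then have "(\<delta>s n)\<^sup>2 / h n \<le> Bsqrt * sqrt n" using \<delta>0 h0 by simp
      then have "kap * n * ((\<delta>s n)\<^sup>2 / h n) \<le> kap * n * (Bsqrt * sqrt n)"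
        using kap_pos by (intro mult_left_mono) auto
      then have "sqrt (kap * (\<delta>s n)\<^sup>2 * n / h n) \<le> sqrt (kap * n * (Bsqrt * sqrt n))"
        by (intro real_sqrt_le_mono) (simp add: mult_ac)
      also have "kap * n * (Bsqrt * sqrt n) = (kap * Bsqrt) * (real n powr (3 / 2))"
      proof -
        have "real n * sqrt n = real n powr 1 * real n powr (1 / 2)" using n by (simp add: powr_half_sqrt)
        also have "\<dots> = real n powr (1 + 1 / 2)" by (rule powr_add[symmetric])
        finally have "real n * sqrt n = real n powr (3 / 2)" by simp
        then show ?thesis by (simp add: mult_ac)
      qed
      also have "sqrt \<dots> = sqrt (kap * Bsqrt) * real n powr (3 / 4)"
        unfolding real_sqrt_mult using n by (simp add: powr_powr flip: powr_half_sqrt)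
      finally have sq: "sqrt (kap * (\<delta>s n)\<^sup>2 * n / h n) \<le> sqrt (kap * Bsqrt) * real n powr (3 / 4)" .
      have l0: "0 \<le> 3 + 2 * ln n" using n by simp
      have q0: "0 \<le> q n" "q n \<le> (3 + 2 * ln n) * (sqrt (kap * Bsqrt) * real n powr (3 / 4))"
        unfolding q_def using l0 sq kap_pos \<delta>0 h0 by (auto intro: mult_left_mono)
      have dd: "(Cd + 1) * \<delta>s n \<le> (Cd + 1) * (Bsqrt * sqrt n)" "0 \<le> (Cd + 1) * \<delta>s n"
        using \<delta>0 Cd_ge by (auto intro: mult_left_mono)
      have "0 \<le> w n" "w n \<le> (3 + 2 * ln n) * (sqrt (kap * Bsqrt) * real n powr (3 / 4)) + Cd + (Cd + 1) * (Bsqrt * sqrt n)"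
        unfolding w_def using q0 dd Cd_ge by linarith+
      then show ?case using n by (simp add: divide_right_mono flip: add_divide_distrib)
    qed
    show "?b \<longlonglongrightarrow> 0" by real_asymp
  qed
  have lim_E: "(\<lambda>n. E n / real n) \<longlonglongrightarrow> \<sigma>"
  proof -
    have "(\<lambda>n. E n / real n - f (real n) / real n) \<longlonglongrightarrow> 0"
    proof (rule Lim_null_comparison)
      show "\<forall>\<^sub>F n in sequentially. norm (E n / real n - f (real n) / real n) \<le> c0 / n"
        using eventually_ge_at_top[of N0]
      proof eventually_elim
        case (elim n)
        note n = N0[OF elim]
        have "\<bar>E n - f n\<bar> \<le> c0"
          unfolding E_def D_def f_def using mean_dist_tau[OF n(3,4) cin[OF elim], of 0 "real n *\<^sub>R e"] n unfolding nn by simp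
        then show ?case using n by (simp add: divide_right_mono flip: diff_divide_distrib)
      qed
      show "(\<lambda>n. c0 / real n) \<longlonglongrightarrow> 0" by real_asymp
    qed
    moreover have "(\<lambda>n. f (real n) / real n) \<longlonglongrightarrow> \<sigma>"
      using filterlim_compose[OF \<sigma> filterlim_real_sequentially] .
    ultimately show ?thesis using tendsto_add by fastforce
  qed
  have lim_u: "(\<lambda>n. (E n + w n) / real n) \<longlonglongrightarrow> \<sigma>" and lim_l: "(\<lambda>n. (E n - w n) / real n) \<longlonglongrightarrow> \<sigma>"
    using tendsto_add[OF lim_E lim_w] tendsto_diff[OF lim_E lim_w] by (simp_all add: add_divide_distrib diff_divide_distrib)
  have fl1: "filterlim (\<lambda>s :: real. nat \<lfloor>s\<rfloor>) sequentially at_top"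
    by (rule filterlim_compose[OF filterlim_nat_sequentially filterlim_floor_sequentially])
  have fl2: "filterlim (\<lambda>s :: real. Suc (nat \<lfloor>s\<rfloor>)) sequentially at_top"
    by (rule filterlim_compose[OF filterlim_Suc fl1])
  from BC show ?thesis
  proof eventually_elim
    case (elim \<omega>)
    then obtain N1 where N1: "\<And>n. N1 \<le> n \<Longrightarrow> \<omega> \<in> space M - A n" unfolding eventually_sequentially by blast
    define N where "N = max N0 N1"
    have good: "\<omega> \<in> space M \<and> \<omega> \<notin> poisson_grid.bad (side (real n)) 0 M X (rad n) \<and> \<bar>D n \<omega> - E n\<bar> < q n" if "N \<le> n" for n
      using N1[of n] that by (auto simp: A_def N_def)
    \<comment> \<open>Used from \<open>n\<close> up to \<open>s\<close> and from \<open>s\<close> up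
      to \<open>n + 1\<close>: in both cases the step size on the left is the larger one, as
      monotonicity in \<open>h\<close> requires.\<close>
    have shift: "h_dist h' (X \<omega>) 0 (t' *\<^sub>R e) \<le> h_dist h'' (X \<omega>) 0 (t *\<^sub>R e) + ennreal (Cd + (Cd + 1) * \<delta>s n)"
      if n: "N \<le> n" and t: "0 \<le> t" "0 \<le> t'" "t \<le> real n + 1" "t' \<le> real n + 1" "\<bar>t - t'\<bar> \<le> 1"
        and hh: "\<delta>s n \<le> h'" "h'' \<le> h'" for n t t' h' h''
    proof -
      have n0: "N0 \<le> n" using n by (simp add: N_def)
      note nb = N0[OF n0]
      interpret G: poisson_grid "side (real n)" 0 M X "?c n" by (rule PG[OF n0])
      have GC: "G.C = Cd" by (simp add: G.C_def Cd_def dim_const_def)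
      have G\<delta>: "G.\<delta> = \<delta>s n" by (simp add: G.\<delta>_def GC \<delta>s_eq)
      have \<delta>n: "\<delta>s n \<le> n" using h_ge[OF nb(3)] nb(4) by simp
      have cb: "cball (r *\<^sub>R e) (G.\<delta> / 2) \<subseteq> cball 0 (rad n)" if "0 \<le> r" "r \<le> real n + 1" for r
      proof
        fix u assume "u \<in> cball (r *\<^sub>R e) (G.\<delta> / 2)"
        then have "norm (r *\<^sub>R e - u) \<le> \<delta>s n / 2" by (simp add: dist_norm G\<delta>)
        then have "norm u \<le> r + \<delta>s n / 2"
          using norm_triangle_ineq4[of "r *\<^sub>R e" "r *\<^sub>R e - u"] ne that by simp
        also have "\<dots> \<le> 7 * (2 * n)" using that \<delta>n nb by linarith
        also have "\<dots> \<le> rad n" using Cd_ge by (simp add: rad_def mult_right_mono)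
        finally show "u \<in> cball 0 (rad n)" by simp
      qed
      have "h_dist h' (X \<omega>) 0 (t' *\<^sub>R e) \<le> h_dist h'' (X \<omega>) 0 (t *\<^sub>R e) +
          ennreal (G.C * norm (t *\<^sub>R e - t' *\<^sub>R e) + (G.C + 1) * G.\<delta>)"
        using good[OF n] t hh
        by (intro G.h_dist_shift_end[where U = "cball 0 (rad n)"] lfin_X G.good_hits cb) (auto simp: G\<delta>)
      also have "\<dots> \<le> h_dist h'' (X \<omega>) 0 (t *\<^sub>R e) + ennreal (Cd + (Cd + 1) * \<delta>s n)"
      proof -
        have "norm (t *\<^sub>R e - t' *\<^sub>R e) = \<bar>t - t'\<bar>" using ne by (simp flip: scaleR_diff_left)
        then have "Cd * norm (t *\<^sub>R e - t' *\<^sub>R e) \<le> Cd * 1" using t Cd_ge by (intro mult_left_mono) auto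
        then show ?thesis by (intro add_left_mono ennreal_leI) (simp add: GC G\<delta>)
      qed
      finally show ?thesis .
    qed
    have HD: "h_dist (h n) (X \<omega>) 0 (real n *\<^sub>R e) = ennreal (D n \<omega>)" "0 \<le> D n \<omega>" if n: "N \<le> n" for n
    proof -
      have n0: "N0 \<le> n" using n by (simp add: N_def)
      note nb = N0[OF n0]
      interpret G: poisson_grid "side (real n)" 0 M X "?c n" by (rule PG[OF n0])
      have GC: "G.C = Cd" by (simp add: G.C_def Cd_def dim_const_def)
      have G\<delta>: "G.\<delta> = \<delta>s n" by (simp add: G.\<delta>_def GC \<delta>s_eq)
      have "(Cd + 1) * \<delta>s n \<le> (Cd + 1) * n" using h_ge[OF nb(3)] nb(4) Cd_ge by (intro mult_left_mono) auto
      moreover have "(2 * Cd + 3) * n \<le> (7 * Cd) * n" using Cd_ge by (intro mult_right_mono) auto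
      moreover have "(Cd + 1) * real n = Cd * n + n" "(2 * Cd + 3) * real n = 2 * (Cd * n) + 3 * n"
        "(7 * Cd) * real n = 7 * (Cd * n)" by (simp_all add: algebra_simps)
      ultimately have "G.ell (norm (0 - real n *\<^sub>R e)) + h n + norm (0 - real n *\<^sub>R e) + norm (0 :: real ^ 'n) \<le> rad n"
        unfolding nn G.ell_def GC G\<delta> rad_def norm_zero using nb by linarith
      then show "h_dist (h n) (X \<omega>) 0 (real n *\<^sub>R e) = ennreal (D n \<omega>)"
        unfolding D_def using good[OF n] h_ge[OF nb(3)] by (intro G.good_dist(2)) (auto simp: G\<delta>)
      show "0 \<le> D n \<omega>" unfolding D_def by (rule G.dist_e_nonneg)
    qed
    define H where "H s = h_dist (h s) (X \<omega>) 0 (s *\<^sub>R e)" for s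
    define Hr where "Hr s = enn2real (H s)" for s
    have bounds: "H s = ennreal (Hr s) \<and> (E (Suc (nat \<lfloor>s\<rfloor>)) - w (Suc (nat \<lfloor>s\<rfloor>))) / real (Suc (nat \<lfloor>s\<rfloor>)) \<le> Hr s / s \<and>
        Hr s / s \<le> (E (nat \<lfloor>s\<rfloor>) + w (nat \<lfloor>s\<rfloor>)) / real (nat \<lfloor>s\<rfloor>)"
      if s: "real N \<le> s" "2 \<le> s" for s
    proof -
      define n where "n = nat \<lfloor>s\<rfloor>"
      have n: "N \<le> n" "real n \<le> s" "s \<le> real n + 1" "0 < real n"
        using s unfolding n_def by (linarith | simp add: le_nat_floor)+
      have n0: "N0 \<le> n" "N0 \<le> Suc n" using n(1) by (auto simp: N_def)
      note nb = N0[OF n0(1)] and nb' = N0[OF n0(2)]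
      have \<delta>0: "0 \<le> \<delta>s n" "0 \<le> \<delta>s (Suc n)" using \<delta>s_ge nb(3) nb'(3) by (meson order_trans zero_le_numeral)+
      have hh: "h n \<le> h s" "h s \<le> h (Suc n)" using h_le[OF nb(3) n(2)] h_le[of s "Suc n"] n s by auto
      have "H s \<le> h_dist (h n) (X \<omega>) 0 (real n *\<^sub>R e) + ennreal (Cd + (Cd + 1) * \<delta>s n)"
        unfolding H_def using n h_ge[OF nb(3)] hh s by (intro shift) auto
      also have "\<dots> = ennreal (D n \<omega> + (Cd + (Cd + 1) * \<delta>s n))"
        using HD[OF n(1)] \<delta>0 Cd_ge by (simp add: ennreal_plus)
      also have "\<dots> \<le> ennreal (E n + w n)" using good[OF n(1)] by (intro ennreal_leI) (auto simp: w_def)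
      finally have up: "H s \<le> ennreal (E n + w n)" .
      then have Hs: "H s = ennreal (Hr s)" unfolding Hr_def
        using le_less_trans[OF up ennreal_less_top] by simp
      have Hr0: "0 \<le> Hr s" by (simp add: Hr_def)
      have Ew: "0 \<le> E n + w n"
      proof -
        have "D n \<omega> \<le> E n + w n" using good[OF n(1)] \<delta>0 Cd_ge by (auto simp: w_def intro: order_trans[of _ "E n + q n"])
        then show ?thesis using HD(2)[OF n(1)] by simp
      qed
      have u: "Hr s \<le> E n + w n" using up Hs Ew by simp
      have n1: "N \<le> Suc n" using n by simp
      have "ennreal (D (Suc n) \<omega>) \<le> H s + ennreal (Cd + (Cd + 1) * \<delta>s (Suc n))"
        unfolding HD(1)[OF n1, symmetric] H_def using n h_ge[OF nb'(3)] hh s by (intro shift n1) auto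
      also have "\<dots> = ennreal (Hr s + (Cd + (Cd + 1) * \<delta>s (Suc n)))"
        using Hs Hr0 \<delta>0 Cd_ge by (simp add: ennreal_plus)
      finally have "D (Suc n) \<omega> \<le> Hr s + (Cd + (Cd + 1) * \<delta>s (Suc n))"
        using Hr0 \<delta>0 Cd_ge by (subst (asm) ennreal_le_iff) auto
      then have l: "E (Suc n) - w (Suc n) \<le> Hr s" using good[OF n1] by (auto simp: w_def)
      \<comment> \<open>Dividing by the neighbouring integer instead of \<open>s\<close> errs in the
        right direction on both sides, since \<open>Hr s\<close> is nonnegative.\<close>
      have "Hr s / s \<le> Hr s / n" using Hr0 n by (intro divide_left_mono) auto
      also have "\<dots> \<le> (E n + w n) / n" using u by (intro divide_right_mono) auto
      finally have A: "Hr s / s \<le> (E n + w n) / n" .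
      have "(E (Suc n) - w (Suc n)) / real (Suc n) \<le> Hr s / real (Suc n)" using l by (intro divide_right_mono) auto
      also have "\<dots> \<le> Hr s / s" using Hr0 n s by (intro divide_left_mono) auto
      finally show ?thesis using A Hs unfolding n_def by blast
    qed
    have ev: "\<forall>\<^sub>F s in at_top. real N \<le> s \<and> 2 \<le> (s :: real)"
      by (intro eventually_conj eventually_ge_at_top)
    have "((\<lambda>s. Hr s / s) \<longlongrightarrow> \<sigma>) at_top"
    proof (rule tendsto_sandwich)
      show "\<forall>\<^sub>F s in at_top. (E (Suc (nat \<lfloor>s\<rfloor>)) - w (Suc (nat \<lfloor>s\<rfloor>))) / real (Suc (nat \<lfloor>s\<rfloor>)) \<le> Hr s / s"
        using ev by eventually_elim (use bounds in blast)
      show "\<forall>\<^sub>F s in at_top. Hr s / s \<le> (E (nat \<lfloor>s\<rfloor>) + w (nat \<lfloor>s\<rfloor>)) / real (nat \<lfloor>s\<rfloor>)"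
        using ev by eventually_elim (use bounds in blast)
      show "((\<lambda>s :: real. (E (Suc (nat \<lfloor>s\<rfloor>)) - w (Suc (nat \<lfloor>s\<rfloor>))) / real (Suc (nat \<lfloor>s\<rfloor>))) \<longlongrightarrow> \<sigma>) at_top"
        using filterlim_compose[OF lim_l fl2] by blast
      show "((\<lambda>s :: real. (E (nat \<lfloor>s\<rfloor>) + w (nat \<lfloor>s\<rfloor>)) / real (nat \<lfloor>s\<rfloor>)) \<longlongrightarrow> \<sigma>) at_top"
        using filterlim_compose[OF lim_u fl1] by blast
    qed
    then have "((\<lambda>s. ennreal (Hr s / s)) \<longlongrightarrow> ennreal \<sigma>) at_top" by (rule tendsto_ennrealI)
    moreover have "\<forall>\<^sub>F s in at_top. ennreal (Hr s / s) = h_dist (h s) (X \<omega>) 0 (s *\<^sub>R axis j 1) / ennreal s"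
      using ev
    proof eventually_elim
      case (elim s)
      then have "H s = ennreal (Hr s)" "0 < s" using bounds[of s] by auto
      then show ?case by (simp add: divide_ennreal[symmetric] Hr_def H_def[symmetric] e_def[symmetric])
    qed
    ultimately show ?case by (rule Lim_transform_eventually)
  qed
qed

end

subsection \<open>Crossing two tangent spheres\<close>

context cube_grid
begin

text \<open>The first vertex \<open>b\<close> outside is projected radially to \<open>x\<close>,
  which is within \<open>2 * h\<close> of the last vertex inside. The end point stays flexible up to
  \<open>\<delta> / 2\<close> so that a net point can be used; the point of \<open>P\<close> closest
  to it is within \<open>3 * h\<close> of that vertex.\<close>

lemma prefix_to_sphere:
  assumes P: "hits UNIV P" "lfin P" and h: "\<delta> \<le> h" and pre: "pre \<noteq> []" "set pre \<subseteq> P" "short_steps h pre"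
    and hd: "hd pre \<in> closest_points P o'" "norm (o' - hd pre) \<le> h / 2"
    and s: "0 < s" "norm (last pre - o') < s" "s \<le> norm (b - o')" "norm (last pre - b) \<le> h"
  obtains x where "norm (x - o') = s"
    "\<And>x'. norm (x - x') \<le> \<delta> / 2 \<Longrightarrow> h_dist h P o' x' \<le> ennreal (path_length pre + (3 * C + 1) * h)"
proof -
  define r where "r = norm (b - o')"
  have r: "s \<le> r" "0 < r" "r \<le> s + h"
    using s norm_diff_via[of b o' "last pre"] norm_minus_commute[of b "last pre"] unfolding r_def by linarith+
  define x where "x = o' + (s / r) *\<^sub>R (b - o')"
  have x: "norm (x - o') = s" using r s by (simp add: x_def r_def)
  have "b - x = (1 - s / r) *\<^sub>R (b - o')" by (simp add: x_def algebra_simps)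
  then have "norm (b - x) = \<bar>1 - s / r\<bar> * r" by (simp add: r_def)
  also have "\<dots> = r - s" using r by (simp add: abs_if field_simps)
  finally have bx: "norm (b - x) \<le> h" using r by simp
  have lx: "norm (last pre - x) \<le> 2 * h" using norm_diff_via[of "last pre" x b] s bx by simp
  have "h_dist h P o' x' \<le> ennreal (path_length pre + (3 * C + 1) * h)" if x': "norm (x - x') \<le> \<delta> / 2" for x'
  proof -
    obtain u where u: "u \<in> closest_points P x'" "u \<in> P" "norm (x' - u) \<le> \<delta> / 2"
      using hits_ex_closest[OF P(2,1) UNIV_I] .
    have lp: "last pre \<in> P" using pre by auto
    have "norm (last pre - u) \<le> 3 * h"
      using norm_diff_via[of "last pre" u x] norm_diff_via[of x u x'] lx x' u h by simp
    then have "C * norm (last pre - u) \<le> C * (3 * h)" using C_ge by (intro mult_left_mono) auto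
    then have "conn h P (last pre) u ((3 * C + 1) * h)"
      using h by (intro conn_mono[OF conn_segment[OF P(1) convex_UNIV lp u(2)]]) (auto simp: algebra_simps)
    moreover have "conn h P (hd pre) (last pre) (path_length pre)" using pre by (intro connI) auto
    ultimately have "conn h P (hd pre) u (path_length pre + (3 * C + 1) * h)"
      using h \<delta>_pos by (intro conn_trans) auto
    then show ?thesis using hd u h by (intro h_dist_leI[OF hd(1) u(1)]) auto
  qed
  then show ?thesis using that x by blast
qed

text \<open>The path is cut before its first vertex outside the open ball around \<open>x0\<close>
  and after its last vertex outside the open ball around \<open>w0\<close>. These balls are
  disjoint, so the two pieces share no vertex and their lengths add up to at most that of the
  path.\<close>

lemma crossing:
  assumes P: "hits UNIV P" "lfin P" and h: "\<delta> \<le> h" "h \<le> s" and d: "norm (x0 - w0) = 2 * s"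
    and p: "p \<in> h_paths h P x0 w0"
  obtains x y \<alpha> \<beta> where "norm (x - x0) = s" "norm (y - w0) = s"
    "\<And>x'. norm (x - x') \<le> \<delta> / 2 \<Longrightarrow> h_dist h P x0 x' \<le> ennreal \<alpha>"
    "\<And>y'. norm (y - y') \<le> \<delta> / 2 \<Longrightarrow> h_dist h P w0 y' \<le> ennreal \<beta>"
    "\<alpha> + \<beta> \<le> path_length p + 2 * (3 * C + 1) * h" "0 \<le> \<alpha>" "0 \<le> \<beta>"
proof -
  have h0: "0 < h" "0 < s" using h \<delta>_pos by auto
  have pp: "p \<noteq> []" "set p \<subseteq> P" "short_steps h p" "hd p \<in> closest_points P x0" "last p \<in> closest_points P w0"
    "norm (x0 - hd p) \<le> h / 2" "norm (w0 - last p) \<le> h / 2"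
    using p by (auto simp: h_paths_iff)
  have far: "s < norm (u - w0)" if "norm (u - x0) < s" for u
    using norm_diff_via[of x0 w0 u] d that by (simp add: norm_minus_commute)
  have far': "s < norm (u - x0)" if "norm (u - w0) < s" for u
    using norm_diff_via[of x0 w0 u] d that by (simp add: norm_minus_commute)
  have hdl: "norm (hd p - x0) < s" "norm (last p - w0) < s" using pp h h0 by (simp_all add: norm_minus_commute)
  have "\<exists>u\<in>set p. s \<le> norm (u - x0)"
    using less_imp_le[OF far'[OF hdl(2)]] last_in_set[OF pp(1)] by (rule bexI)
  then obtain pre b post where p1: "p = pre @ b # post" "s \<le> norm (b - x0)" "\<forall>u\<in>set pre. \<not> s \<le> norm (u - x0)"
    by (rule split_list_first_propE)
  have "\<exists>u\<in>set p. s \<le> norm (u - w0)"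
    using less_imp_le[OF far[OF hdl(1)]] hd_in_set[OF pp(1)] by (rule bexI)
  then obtain pre2 b2 suf where p2: "p = pre2 @ b2 # suf" "s \<le> norm (b2 - w0)" "\<forall>u\<in>set suf. \<not> s \<le> norm (u - w0)"
    by (rule split_list_last_propE)
  have pre: "pre \<noteq> []"
  proof
    assume "pre = []"
    then have "hd p = b" using p1(1) by simp
    then show False using p1(2) hdl(1) by simp
  qed
  have suf: "suf \<noteq> []"
  proof
    assume "suf = []"
    then have "last p = b2" using p2(1) by simp
    then show False using p2(2) hdl(2) by simp
  qed
  have eq: "pre @ (b # post) = (pre2 @ [b2]) @ suf" using p1(1) p2(1) by simp
  have disj: "u \<notin> set pre \<or> u \<notin> set suf" for u
    using bspec[OF p1(3), of u] bspec[OF p2(3), of u] far[of u] by linarith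
  \<comment> \<open>Locates the suffix behind the prefix: in the other possible arrangement of the
    two decompositions, a nonempty overlap would contain a common vertex.\<close>
  obtain us where us: "b # post = us @ suf"
  proof -
    from iffD1[OF append_eq_append_conv2 eq] obtain us where
      "pre = (pre2 @ [b2]) @ us \<and> us @ (b # post) = suf \<or> pre @ us = pre2 @ [b2] \<and> b # post = us @ suf" by blast
    then show ?thesis
    proof
      assume a: "pre = (pre2 @ [b2]) @ us \<and> us @ (b # post) = suf"
      have "us = []"
      proof (rule ccontr)
        assume "us \<noteq> []"
        then have "hd us \<in> set pre" "hd us \<in> set suf" using a by auto
        then show False using disj by blast
      qed
      then show ?thesis using a that[of "[]"] by simp
    qed (use that in blast)
  qed
  have ss: "short_steps h pre" "norm (last pre - b) \<le> h" "short_steps h suf" "norm (b2 - hd suf) \<le> h"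
  proof -
    have "short_steps h (pre @ b # post)" using pp(3) unfolding p1(1) .
    then show "short_steps h pre" "norm (last pre - b) \<le> h"
      using pre by (simp_all add: successively_append_iff)
    have "short_steps h ((pre2 @ [b2]) @ suf)" using pp(3) unfolding p2(1) by simp
    then show "short_steps h suf" "norm (b2 - hd suf) \<le> h"
      using suf unfolding successively_append_iff by simp_all
  qed
  have sub: "set pre \<subseteq> P" "set suf \<subseteq> P"
  proof -
    show "set pre \<subseteq> P" using pp(2) unfolding p1(1) by simp
    show "set suf \<subseteq> P" using pp(2) unfolding p2(1) by simp
  qed
  have hl: "hd pre = hd p" unfolding p1(1) using pre by simp
  have hl2: "last suf = last p" unfolding p2(1) using suf by simp
  have lens: "path_length pre + path_length suf \<le> path_length p"
  proof -
    have "path_length p = path_length pre + norm (b - last pre) + path_length (us @ suf)"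
      unfolding p1(1) us[symmetric] using pre by (simp add: path_length_append)
    moreover have "path_length suf \<le> path_length (us @ suf)"
      using suf by (cases "us = []") (auto simp: path_length_append)
    ultimately show ?thesis using norm_ge_zero[of "b - last pre"] by linarith
  qed
  obtain x where x: "norm (x - x0) = s"
    "\<And>x'. norm (x - x') \<le> \<delta> / 2 \<Longrightarrow> h_dist h P x0 x' \<le> ennreal (path_length pre + (3 * C + 1) * h)"
  proof (rule prefix_to_sphere[OF P h(1) pre sub(1) ss(1) _ _ h0(2) _ p1(2) ss(2)])
    show "hd pre \<in> closest_points P x0" "norm (x0 - hd pre) \<le> h / 2" unfolding hl using pp by blast+
    show "norm (last pre - x0) < s" using p1(3) last_in_set[OF pre] by (simp add: not_le)
  qed blast
  have rs: "rev suf \<noteq> []" "set (rev suf) \<subseteq> P" "short_steps h (rev suf)"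
    using suf sub ss(3) by (simp_all add: norm_minus_commute)
  obtain y where y: "norm (y - w0) = s"
    "\<And>y'. norm (y - y') \<le> \<delta> / 2 \<Longrightarrow> h_dist h P w0 y' \<le> ennreal (path_length (rev suf) + (3 * C + 1) * h)"
  proof (rule prefix_to_sphere[OF P h(1) rs _ _ h0(2) _ p2(2)])
    show "hd (rev suf) \<in> closest_points P w0" "norm (w0 - hd (rev suf)) \<le> h / 2"
      using pp by (simp_all add: hd_rev hl2)
    show "norm (last (rev suf) - w0) < s" using p2(3) hd_in_set[OF suf] by (simp add: last_rev not_le)
    show "norm (last (rev suf) - b2) \<le> h" using ss(4) by (simp add: last_rev norm_minus_commute)
  qed blast
  have C0: "0 \<le> (3 * C + 1) * h" using C_ge h0 by simp
  show ?thesis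
    by (rule that[OF x(1) y(1) x(2) y(2)])
      (use lens add_nonneg_nonneg[OF path_length_nonneg C0, of pre] add_nonneg_nonneg[OF path_length_nonneg C0, of suf]
        in \<open>auto simp: path_length_rev algebra_simps\<close>)
qed

end

context poisson_grid
begin

text \<open>The point where a path crosses the sphere is random, so the lower tail is needed for all
  points of the sphere at once. One point per cube meeting the sphere is enough, and
  \<open>1 \<le> a\<close> limits the number of cubes.\<close>

lemma prob_low_on_net:
  assumes h: "\<delta> \<le> h" "h \<le> s" and l: "0 \<le> l" and a1: "1 \<le> a" and s1: "1 \<le> s" and x0: "norm x0 \<le> 2 * s"
  obtains B where "B \<in> events" "prob B \<le> (10 * s) ^ CARD('n) * exp (- l\<^sup>2 / 4)"
    "\<And>\<omega> x. \<omega> \<in> space M - B \<Longrightarrow> norm (x - x0) = s \<Longrightarrow> \<exists>x'. norm (x - x') \<le> \<delta> / 2 \<and> norm (x' - x0) = s \<and>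
      (\<integral>\<omega>. dist_e h x0 x' \<omega> \<partial>M) - l * sqrt (vf h s) < dist_e h x0 x' \<omega>"
proof -
  define V where "V = {v. cube v \<inter> cball 0 (4 * s) \<noteq> {}}"
  have R0: "0 \<le> 4 * s" using s1 by simp
  have V: "finite V" "real (card V) \<le> (2 * (4 * s) / a + 2) ^ CARD('n)"
    unfolding V_def by (rule cubes_meeting_ball[OF R0])+
  define W where "W = {v \<in> V. \<exists>x\<in>cube v. norm (x - x0) = s}"
  \<comment> \<open>Chosen on the sphere itself, so that its distance to \<open>x0\<close> is
    exactly \<open>s\<close> and the same variance factor and mean bound apply to every net
    point.\<close>
  define nx where "nx v = (SOME x. x \<in> cube v \<and> norm (x - x0) = s)" for v
  have nx: "nx v \<in> cube v" "norm (nx v - x0) = s" if "v \<in> W" for v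
    using someI_ex[of "\<lambda>x. x \<in> cube v \<and> norm (x - x0) = s"] that unfolding W_def nx_def by blast+
  define L where "L v = {\<omega> \<in> space M. l * sqrt (vf h s) \<le> (\<integral>\<omega>. dist_e h x0 (nx v) \<omega> \<partial>M) - dist_e h x0 (nx v) \<omega>}" for v
  have Lev: "L v \<in> events" for v unfolding L_def by measurable
  have W: "finite W" "card W \<le> card V" using V(1) unfolding W_def by (auto intro: card_mono)
  have Lp: "prob (L v) \<le> exp (- l\<^sup>2 / 4)" if "v \<in> W" for v
    unfolding L_def using lower_tail[OF h(1) _ l, of x0 "nx v"] nx(2)[OF that] h(2) by (simp add: norm_minus_commute)
  show ?thesis
  proof (rule that[of "\<Union>v\<in>W. L v"])
    show "(\<Union>v\<in>W. L v) \<in> events" using W Lev by auto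
    have "prob (\<Union>v\<in>W. L v) \<le> (\<Sum>v\<in>W. prob (L v))" using W Lev by (intro finite_measure_subadditive_finite) auto
    also have "\<dots> \<le> (\<Sum>v\<in>W. exp (- l\<^sup>2 / 4))" by (intro sum_mono Lp)
    also have "\<dots> = real (card W) * exp (- l\<^sup>2 / 4)" by simp
    also have "\<dots> \<le> (10 * s) ^ CARD('n) * exp (- l\<^sup>2 / 4)"
    proof (rule mult_right_mono)
      have "real (card W) \<le> (2 * (4 * s) / a + 2) ^ CARD('n)" using W V(2) by linarith
      also have "\<dots> \<le> (10 * s) ^ CARD('n)"
      proof (rule power_mono)
        have "2 * (4 * s) / a \<le> 2 * (4 * s) / 1" using a1 s1 by (intro divide_left_mono) auto
        then show "2 * (4 * s) / a + 2 \<le> 10 * s" using s1 by simp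
      qed (use a_pos s1 in auto)
      finally show "real (card W) \<le> (10 * s) ^ CARD('n)" .
    qed simp
    finally show "prob (\<Union>v\<in>W. L v) \<le> (10 * s) ^ CARD('n) * exp (- l\<^sup>2 / 4)" .
    fix \<omega> x assume \<omega>: "\<omega> \<in> space M - (\<Union>v\<in>W. L v)" and x: "norm (x - x0) = s"
    have "norm x \<le> 4 * s" using norm_triangle_sub[of x x0] x x0 s1 by simp
    then have "idx x \<in> V" unfolding V_def using mem_cube_idx[of x] by auto
    then have v: "idx x \<in> W" unfolding W_def using mem_cube_idx[of x] x by blast
    show "\<exists>x'. norm (x - x') \<le> \<delta> / 2 \<and> norm (x' - x0) = s \<and>
      (\<integral>\<omega>. dist_e h x0 x' \<omega> \<partial>M) - l * sqrt (vf h s) < dist_e h x0 x' \<omega>"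
    proof (intro exI[of _ "nx (idx x)"] conjI)
      show "norm (x - nx (idx x)) \<le> \<delta> / 2" by (rule cube_diam[OF mem_cube_idx nx(1)[OF v]])
      show "norm (nx (idx x) - x0) = s" by (rule nx(2)[OF v])
      have "\<omega> \<notin> L (idx x)" using \<omega> v by blast
      then show "(\<integral>\<omega>. dist_e h x0 (nx (idx x)) \<omega> \<partial>M) - l * sqrt (vf h s) < dist_e h x0 (nx (idx x)) \<omega>"
        using \<omega> unfolding L_def by auto
    qed
  qed
qed

text \<open>Off two small events each piece of a path from \<open>0\<close> to \<open>w0\<close> has
  length at least \<open>m - l * sqrt (vf h s)\<close>, up to the cost of reaching the net. On those
  events the distance is only known to be nonnegative, which loses at most \<open>2 * m\<close>
  times their probability.\<close>

lemma dist_e_superadditive: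
  assumes h: "\<delta> \<le> h" "h \<le> s" and l: "0 \<le> l" and a1: "1 \<le> a" and s1: "1 \<le> s" and w0: "norm w0 = 2 * s"
    and m: "\<And>x. norm x = s \<Longrightarrow> m \<le> (\<integral>\<omega>. dist_e h 0 x \<omega> \<partial>M)"
      "\<And>y. norm (y - w0) = s \<Longrightarrow> m \<le> (\<integral>\<omega>. dist_e h w0 y \<omega> \<partial>M)" and m0: "0 \<le> m"
  shows "2 * m - 2 * l * sqrt (vf h s) - 2 * (3 * C + 1) * h - 2 * m * (2 * (10 * s) ^ CARD('n) * exp (- l\<^sup>2 / 4))
    \<le> (\<integral>\<omega>. dist_e h 0 w0 \<omega> \<partial>M)"
proof -
  obtain B1 where B1: "B1 \<in> events" "prob B1 \<le> (10 * s) ^ CARD('n) * exp (- l\<^sup>2 / 4)"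
    "\<And>\<omega> x. \<omega> \<in> space M - B1 \<Longrightarrow> norm (x - 0) = s \<Longrightarrow> \<exists>x'. norm (x - x') \<le> \<delta> / 2 \<and> norm (x' - 0) = s \<and>
      (\<integral>\<omega>. dist_e h 0 x' \<omega> \<partial>M) - l * sqrt (vf h s) < dist_e h 0 x' \<omega>"
    by (rule prob_low_on_net[OF h l a1 s1, of 0]) (use s1 in auto)
  obtain B2 where B2: "B2 \<in> events" "prob B2 \<le> (10 * s) ^ CARD('n) * exp (- l\<^sup>2 / 4)"
    "\<And>\<omega> x. \<omega> \<in> space M - B2 \<Longrightarrow> norm (x - w0) = s \<Longrightarrow> \<exists>x'. norm (x - x') \<le> \<delta> / 2 \<and> norm (x' - w0) = s \<and>
      (\<integral>\<omega>. dist_e h w0 x' \<omega> \<partial>M) - l * sqrt (vf h s) < dist_e h w0 x' \<omega>"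
    by (rule prob_low_on_net[OF h l a1 s1, of w0]) (use w0 in auto)
  define q where "q = l * sqrt (vf h s)"
  have vf0: "0 \<le> vf h s"
    using vf_ge_jump[OF h] by (meson order_trans zero_le_power2)
  have q0: "0 \<le> q" using l vf0 by (simp add: q_def)
  have C0: "0 \<le> 2 * (3 * C + 1) * h" using C_ge h \<delta>_pos by simp
  define m' where "m' = 2 * m - 2 * q - 2 * (3 * C + 1) * h"
  have good: "m' \<le> dist_e h 0 w0 \<omega>" if \<omega>: "\<omega> \<in> space M - (B1 \<union> B2)" for \<omega>
  proof (rule ccontr)
    assume "\<not> ?thesis"
    then have "h_dist h (Xe \<omega>) 0 w0 < ennreal m'"
      using h_dist_Xe[of \<omega> h 0 w0] \<omega> h dist_e_nonneg[of h 0 w0 \<omega>] by (simp add: ennreal_less_iff)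
    then obtain p where p: "p \<in> h_paths h (Xe \<omega>) 0 w0" "path_length p < m'" by (rule h_dist_lessE)
    have n: "norm (0 - w0) = 2 * s" using w0 by simp
    have sp: "\<omega> \<in> space M" using \<omega> by blast
    obtain x y \<alpha> \<beta> where c: "norm (x - 0) = s" "norm (y - w0) = s"
      "\<And>x'. norm (x - x') \<le> \<delta> / 2 \<Longrightarrow> h_dist h (Xe \<omega>) 0 x' \<le> ennreal \<alpha>"
      "\<And>y'. norm (y - y') \<le> \<delta> / 2 \<Longrightarrow> h_dist h (Xe \<omega>) w0 y' \<le> ennreal \<beta>"
      "\<alpha> + \<beta> \<le> path_length p + 2 * (3 * C + 1) * h" "0 \<le> \<alpha>" "0 \<le> \<beta>"
      using crossing[OF Xe_hits Xe_lfin[OF sp] h n p(1)] by metis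
    obtain x' where x': "norm (x - x') \<le> \<delta> / 2" "norm (x' - 0) = s"
      "(\<integral>\<omega>. dist_e h 0 x' \<omega> \<partial>M) - q < dist_e h 0 x' \<omega>"
      using B1(3)[of \<omega> x] c(1) \<omega> unfolding q_def by blast
    obtain y' where y': "norm (y - y') \<le> \<delta> / 2" "norm (y' - w0) = s"
      "(\<integral>\<omega>. dist_e h w0 y' \<omega> \<partial>M) - q < dist_e h w0 y' \<omega>"
      using B2(3)[of \<omega> y] c(2) \<omega> unfolding q_def by blast
    have "dist_e h 0 x' \<omega> \<le> \<alpha>" using c(3)[OF x'(1)] c(6) unfolding h_dist_Xe[OF sp h(1)] by simp
    moreover have "dist_e h w0 y' \<omega> \<le> \<beta>" using c(4)[OF y'(1)] c(7) unfolding h_dist_Xe[OF sp h(1)] by simp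
    moreover have "m \<le> (\<integral>\<omega>. dist_e h 0 x' \<omega> \<partial>M)" "m \<le> (\<integral>\<omega>. dist_e h w0 y' \<omega> \<partial>M)"
      using m x'(2) y'(2) by auto
    ultimately show False using x'(3) y'(3) c(5) p(2) unfolding m'_def by linarith
  qed
  have B: "B1 \<union> B2 \<in> events" using B1 B2 by auto
  have "(\<integral>\<omega>. m' - 2 * m * indicator (B1 \<union> B2) \<omega> \<partial>M) \<le> (\<integral>\<omega>. dist_e h 0 w0 \<omega> \<partial>M)"
  proof (rule integral_mono)
    show "integrable M (\<lambda>\<omega>. m' - 2 * m * indicator (B1 \<union> B2) \<omega>)"
      using B by (intro Bochner_Integration.integrable_diff integrable_mult_right integrable_real_indicator) (auto simp: emeasure_eq_measure)
    show "integrable M (dist_e h 0 w0)" by (rule bdd_mble_integrable[OF bdd_dist_e[OF h(1)]])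
    fix \<omega> assume "\<omega> \<in> space M"
    then show "m' - 2 * m * indicator (B1 \<union> B2) \<omega> \<le> dist_e h 0 w0 \<omega>"
    proof (cases "\<omega> \<in> B1 \<union> B2")
      case True
      then have "m' - 2 * m * indicator (B1 \<union> B2) \<omega> \<le> 0" using q0 C0 by (simp add: m'_def)
      then show ?thesis using dist_e_nonneg[of h 0 w0 \<omega>] by linarith
    qed (use good in auto)
  qed
  also have "(\<integral>\<omega>. m' - 2 * m * indicator (B1 \<union> B2) \<omega> \<partial>M) = m' - 2 * m * prob (B1 \<union> B2)"
    using B by (subst Bochner_Integration.integral_diff) (auto simp: prob_space emeasure_eq_measure)
  finally have le: "m' - 2 * m * prob (B1 \<union> B2) \<le> (\<integral>\<omega>. dist_e h 0 w0 \<omega> \<partial>M)" .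
  have "prob (B1 \<union> B2) \<le> prob B1 + prob B2" using B1 B2 by (intro measure_Un_le) auto
  then have "prob (B1 \<union> B2) \<le> 2 * (10 * s) ^ CARD('n) * exp (- l\<^sup>2 / 4)" using B1(2) B2(2) by linarith
  then have "2 * m * prob (B1 \<union> B2) \<le> 2 * m * (2 * (10 * s) ^ CARD('n) * exp (- l\<^sup>2 / 4))"
    using m0 by (intro mult_left_mono) auto
  then show ?thesis using le unfolding m'_def q_def by linarith
qed

end

subsection \<open>The ratio\<close>

context fpp
begin

text \<open>The value of \<open>l\<close> makes \<open>exp (- l\<^sup>2 / 4)\<close> beat the size
  of the net by a factor \<open>10 * s\<close>. As the means are at most of order \<open>s\<close>,
  the loss on the exceptional events is then bounded by a constant.\<close>

lemma ratio_bound: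
  fixes j :: 'n
  assumes s: "1 < s" "h s \<le> s" and c: "\<And>v. c v \<in> grid_cube (side s) z v"
  defines "D \<equiv> poisson_grid.dist_e (side s) z X c (h s)"
  defines "F \<equiv> (\<integral>\<omega>. D 0 (s *\<^sub>R axis j 1) \<omega> \<partial>M)" and "G \<equiv> (\<integral>\<omega>. D 0 ((2 * s) *\<^sub>R axis j 1) \<omega> \<partial>M)"
    and "l \<equiv> 2 * sqrt ((real CARD('n) + 1) * ln (10 * s))"
  shows "\<bar>2 * F - G\<bar> \<le> c3 * h s + 2 * l * sqrt (kap * (\<delta>s s)\<^sup>2 * s / h s)" "s \<le> G"
proof -
  interpret G: poisson_grid "side s" z M X c by (rule grid[OF s(1) c])
  have GC: "G.C = Cd" by (simp add: G.C_def Cd_def dim_const_def)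
  have G\<delta>: "G.\<delta> = \<delta>s s" by (simp add: G.\<delta>_def GC \<delta>s_eq)
  have \<delta>h: "G.\<delta> \<le> h s" using h_ge[OF s(1)] by (simp add: G\<delta>)
  have h2: "2 \<le> h s" by (rule h_ge_2[OF s(1)])
  define e :: "real ^ 'n" where "e = axis j 1"
  have ne: "norm e = 1" by (simp add: e_def)
  define w where "w = (2 * s) *\<^sub>R e"
  have nw: "norm w = 2 * s" using ne s by (simp add: w_def)
  note mt = mean_dist_tau[OF s c, folded D_def]
  have F: "\<bar>F - f s\<bar> \<le> c0"
    using mt[of 0 "s *\<^sub>R e"] ne s by (simp add: F_def f_def e_def)
  have Gl: "s \<le> G"
  proof -
    have "(\<integral>\<omega>. 2 * s - h s \<partial>M) \<le> G" unfolding G_def D_def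
      using G.dist_e_lower[OF _ \<delta>h, of _ 0 w] nw
      by (intro integral_mono bdd_mble_integrable bdd_mble_const G.bdd_dist_e[OF \<delta>h]) (auto simp: w_def e_def)
    then show ?thesis using s by (simp add: prob_space)
  qed
  then show "s \<le> G" .
  have f0: "0 \<le> f s" "f s \<le> (2 * Cd + 1) * s"
  proof -
    show "0 \<le> f s" by (rule f_bounds(1)[OF s(1)])
    have "(Cd + 1) * \<delta>s s \<le> (Cd + 1) * s" using h_ge[OF s(1)] s(2) Cd_ge by (intro mult_left_mono) auto
    then show "f s \<le> (2 * Cd + 1) * s" using f_bounds(2)[OF s(1)] by (simp add: ells_def algebra_simps)
  qed
  have up: "G \<le> 2 * F + c3 * h s"
  proof -
    have "norm (s *\<^sub>R e - w) = s"
    proof -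
      have "s *\<^sub>R e - w = (s - 2 * s) *\<^sub>R e" unfolding w_def scaleR_diff_left ..
      then have "norm (s *\<^sub>R e - w) = \<bar>s - 2 * s\<bar> * norm e" by (simp only: norm_scaleR)
      then show ?thesis using ne s by simp
    qed
    then have A: "\<bar>(\<integral>\<omega>. D (s *\<^sub>R e) w \<omega> \<partial>M) - f s\<bar> \<le> c0"
      using mt[of "s *\<^sub>R e" w] ne s by (simp add: f_def)
    note int = G.bdd_dist_e[OF \<delta>h]
    have "G \<le> (\<integral>\<omega>. D 0 (s *\<^sub>R e) \<omega> + D (s *\<^sub>R e) w \<omega> + \<delta>s s \<partial>M)"
      unfolding G_def e_def[symmetric] w_def[symmetric] D_def
      by (intro integral_mono bdd_mble_integrable bdd_mble_add bdd_mble_const int G.dist_e_triangle[OF _ \<delta>h, unfolded G\<delta>])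
    also have "\<dots> = F + (\<integral>\<omega>. D (s *\<^sub>R e) w \<omega> \<partial>M) + \<delta>s s"
      using bdd_mble_integrable[OF int] by (simp add: prob_space F_def D_def e_def)
    finally have "G \<le> 2 * F + (2 * c0 + h s)" using A F h_ge[OF s(1)] by linarith
    also have "2 * c0 + h s \<le> c3 * h s"
    proof -
      have "2 * c0 * 1 \<le> 2 * c0 * h s" using c0_pos h2 by (intro mult_left_mono) auto
      moreover have "(2 * c0 + 1) * h s \<le> c3 * h s" using c0_pos Cd_ge h2 by (intro mult_right_mono) (auto simp: c3_def)
      ultimately show ?thesis by (simp add: algebra_simps)
    qed
    finally show ?thesis by simp
  qed
  have low: "2 * F - G \<le> c3 * h s + 2 * l * sqrt (kap * (\<delta>s s)\<^sup>2 * s / h s)"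
  proof (cases "c0 \<le> f s")
    \<comment> \<open>Superadditivity needs a nonnegative lower mean \<open>f s - c0\<close>.
      Otherwise \<open>F\<close> is at most \<open>2 * c0\<close>, and a constant bound is
      enough.\<close>
    case False
    have "2 * F - G \<le> 4 * c0" using F False Gl s c0_pos by linarith
    also have "\<dots> \<le> c3 * h s"
    proof -
      have "4 * c0 \<le> c3" using c0_pos Cd_ge by (simp add: c3_def)
      also have "c3 * 1 \<le> c3 * h s" using c3_pos h2 by (intro mult_left_mono) auto
      finally show ?thesis by simp
    qed
    also have "\<dots> \<le> c3 * h s + 2 * l * sqrt (kap * (\<delta>s s)\<^sup>2 * s / h s)"
      using s kap_pos h2 by (simp add: l_def)
    finally show ?thesis .
  next
    case True
    have ln0: "0 \<le> ln (10 * s)" using s by simp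
    have l0: "0 \<le> l" using ln0 by (simp add: l_def)
    have m1: "f s - c0 \<le> (\<integral>\<omega>. D 0 x \<omega> \<partial>M)" if "norm x = s" for x
      using mt[of 0 x] that s by (simp add: f_def abs_le_iff)
    have m2: "f s - c0 \<le> (\<integral>\<omega>. D w y \<omega> \<partial>M)" if "norm (y - w) = s" for y
      using mt[of w y] that nw s by (simp add: f_def abs_le_iff norm_minus_commute)
    have vf: "G.vf (h s) s = kap * (\<delta>s s)\<^sup>2 * s / h s" by (simp add: G.vf_def kap_def GC G\<delta>)
    have E: "2 * (10 * s) ^ CARD('n) * exp (- l\<^sup>2 / 4) = 1 / (5 * s)"
    proof -
      have "l\<^sup>2 / 4 = (real CARD('n) + 1) * ln (10 * s)" using ln0 by (simp add: l_def power_mult_distrib)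
      then have "- l\<^sup>2 / 4 = - (real CARD('n) + 1) * ln (10 * s)" by linarith
      then have "exp (- l\<^sup>2 / 4) = (10 * s) powr (- (real CARD('n) + 1))"
        using s by (simp only: powr_def) simp
      moreover have "(10 * s) ^ CARD('n) = (10 * s) powr real CARD('n)" using s by (simp add: powr_realpow)
      ultimately have "(10 * s) ^ CARD('n) * exp (- l\<^sup>2 / 4) = (10 * s) powr (real CARD('n) + - (real CARD('n) + 1))"
        by (simp only: powr_add)
      also have "real CARD('n) + - (real CARD('n) + 1) = - 1" by simp
      also have "(10 * s) powr - 1 = 1 / (10 * s)" using s powr_minus_divide[of "10 * s" 1] by simp
      finally have "2 * ((10 * s) ^ CARD('n) * exp (- l\<^sup>2 / 4)) = 2 * (1 / (10 * s))" by (rule arg_cong)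
      also have "\<dots> = 1 / (5 * s)" using s by (simp add: field_simps)
      finally show ?thesis by (simp only: mult.assoc)
    qed
    have "2 * (f s - c0) - 2 * l * sqrt (kap * (\<delta>s s)\<^sup>2 * s / h s) - 2 * (3 * Cd + 1) * h s - 2 * (f s - c0) * (1 / (5 * s)) \<le> G"
      using G.dist_e_superadditive[OF \<delta>h s(2) l0 side_ge[OF s(1)] less_imp_le[OF s(1)] nw, of "f s - c0"]
        m1 m2 True
      unfolding E vf GC G_def D_def w_def e_def by simp
    moreover have "2 * (f s - c0) * (1 / (5 * s)) \<le> 2 * (2 * Cd + 1)"
    proof -
      have "2 * (f s - c0) * (1 / (5 * s)) \<le> 2 * ((2 * Cd + 1) * s) * (1 / (5 * s))"
        using f0(2) c0_pos s by (intro mult_right_mono) auto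
      also have "\<dots> = 2 * (2 * Cd + 1) / 5" using s by simp
      also have "\<dots> \<le> 2 * (2 * Cd + 1)" using Cd_ge by simp
      finally show ?thesis .
    qed
    ultimately have "2 * F - G \<le> (4 * c0 + 2 * (2 * Cd + 1)) + 2 * (3 * Cd + 1) * h s + 2 * l * sqrt (kap * (\<delta>s s)\<^sup>2 * s / h s)"
      using abs_le_D1[OF F] by argo
    also have "(4 * c0 + 2 * (2 * Cd + 1)) + 2 * (3 * Cd + 1) * h s \<le> c3 * h s"
    proof -
      have "(4 * c0 + 2 * (2 * Cd + 1)) * 1 \<le> (4 * c0 + 2 * (2 * Cd + 1)) * h s"
        using c0_pos Cd_ge h2 by (intro mult_left_mono) auto
      moreover have "((4 * c0 + 2 * (2 * Cd + 1)) + 2 * (3 * Cd + 1)) * h s \<le> c3 * h s"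
        using c0_pos Cd_ge h2 by (intro mult_right_mono) (auto simp: c3_def)
      ultimately show ?thesis by (simp add: algebra_simps)
    qed
    finally show ?thesis by simp
  qed
  have "0 \<le> 2 * l * sqrt (kap * (\<delta>s s)\<^sup>2 * s / h s)" using s kap_pos h2 by (simp add: l_def)
  then show "\<bar>2 * F - G\<bar> \<le> c3 * h s + 2 * l * sqrt (kap * (\<delta>s s)\<^sup>2 * s / h s)"
    using up low by linarith
qed

end

subsection \<open>Constants uniform in the scale\<close>

context scales
begin

text \<open>Bounds the ratio of \<open>sqrt vf\<close> to the fluctuation scale
  \<open>sqrt (ln s powr (2 / real d) / h s * t)\<close> of the theorem, uniformly for
  \<open>s \<ge> s0\<close>.\<close>

definition gam :: "real \<Rightarrow> real" where "gam s0 = sqrt (kap * Blog s0)"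

lemma gam_pos: "1 < s0 \<Longrightarrow> 0 < gam s0"
  using kap_pos Blog_pos[of s0] by (simp add: gam_def)

lemma sqrt_variance_le:
  assumes s: "1 < s0" "s0 \<le> s" and H: "0 < H" and r: "0 \<le> r"
  shows "sqrt (kap * (\<delta>s s)\<^sup>2 * r / H) \<le> gam s0 * sqrt (ln s powr (2 / real d) / H * r)"
proof -
  have "kap * (\<delta>s s)\<^sup>2 * (r / H) \<le> kap * (Blog s0 * ln s powr (2 / real d)) * (r / H)"
    using \<delta>s_square_le[OF s] kap_pos H r by (intro mult_right_mono mult_left_mono) auto
  then have "kap * (\<delta>s s)\<^sup>2 * r / H \<le> kap * Blog s0 * (ln s powr (2 / real d) / H * r)"
    by (simp add: mult.assoc)
  then have "sqrt (kap * (\<delta>s s)\<^sup>2 * r / H) \<le> sqrt (kap * Blog s0 * (ln s powr (2 / real d) / H * r))"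
    by (rule real_sqrt_le_mono)
  then show ?thesis unfolding gam_def real_sqrt_mult .
qed

text \<open>The net costs only the root of a logarithm, so the constant \<open>1 / gam s0\<close>,
  dictated by the exponent of the concentration bound, also suffices as a factor of
  \<open>ln s\<close> in the ratio bound for large \<open>s\<close>.\<close>

lemma eventually_log_dominates:
  assumes "1 < s0"
  shows "\<forall>\<^sub>F s in at_top. 2 * sqrt ((real d + 1) * ln (10 * s)) * gam s0 \<le> 1 / gam s0 * ln s"
proof -
  define A where "A = real d + 1"
  have "((\<lambda>s. sqrt (ln (10 * s)) / ln s) \<longlongrightarrow> 0) at_top" by real_asymp
  then have "((\<lambda>s. sqrt A * (sqrt (ln (10 * s)) / ln s)) \<longlongrightarrow> sqrt A * 0) at_top" by (intro tendsto_intros)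
  moreover have "sqrt A * 0 < 1 / (2 * (gam s0)\<^sup>2)" using gam_pos[OF assms] by simp
  ultimately have "\<forall>\<^sub>F s in at_top. sqrt A * (sqrt (ln (10 * s)) / ln s) < 1 / (2 * (gam s0)\<^sup>2)"
    by (rule order_tendstoD(2))
  then show ?thesis using eventually_gt_at_top[of 1]
  proof eventually_elim
    case (elim s)
    have "sqrt (A * ln (10 * s)) / ln s < 1 / (2 * (gam s0)\<^sup>2)" using elim by (simp add: real_sqrt_mult)
    then have "sqrt (A * ln (10 * s)) * (2 * (gam s0)\<^sup>2) < ln s"
      using elim gam_pos[OF assms] by (simp add: divide_simps)
    then show ?case using gam_pos[OF assms] by (simp add: A_def field_simps power2_eq_square)
  qed
qed

end

context fpp
begin

definition enriched_dist :: "real ^ 'n \<Rightarrow> (int ^ 'n \<Rightarrow> real ^ 'n) \<Rightarrow> real \<Rightarrow> real ^ 'n \<Rightarrow> 'a \<Rightarrow> ennreal" where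
  "enriched_dist z c s x \<omega> = h_dist (h s) (enrich (side s) z c (X \<omega>)) 0 x"

definition mean_e :: "real ^ 'n \<Rightarrow> (int ^ 'n \<Rightarrow> real ^ 'n) \<Rightarrow> real \<Rightarrow> real ^ 'n \<Rightarrow> real" where
  "mean_e z c s x = (\<integral>\<omega>. poisson_grid.dist_e (side s) z X c (h s) 0 x \<omega> \<partial>M)"

lemma enriched_dist_eq:
  assumes s: "1 < s" and c: "\<And>v. c v \<in> grid_cube (side s) z v" and \<omega>: "\<omega> \<in> space M"
  shows "enriched_dist z c s x \<omega> = ennreal (poisson_grid.dist_e (side s) z X c (h s) 0 x \<omega>)"
proof -
  interpret G: poisson_grid "side s" z M X c by (rule grid[OF s c])
  have "G.\<delta> \<le> h s" using h_ge[OF s] by (simp add: G.\<delta>_def G.C_def \<delta>s_eq Cd_def dim_const_def)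
  then show ?thesis unfolding enriched_dist_def by (rule G.h_dist_Xe[OF \<omega>])
qed

lemma mean_enriched_dist:
  assumes s: "1 < s" and c: "\<And>v. c v \<in> grid_cube (side s) z v"
  shows "(\<integral>\<^sup>+\<omega>. enriched_dist z c s x \<omega> \<partial>M) = ennreal (mean_e z c s x)"
proof -
  interpret G: poisson_grid "side s" z M X c by (rule grid[OF s c])
  have \<delta>h: "G.\<delta> \<le> h s" using h_ge[OF s] by (simp add: G.\<delta>_def G.C_def \<delta>s_eq Cd_def dim_const_def)
  have "(\<integral>\<^sup>+\<omega>. enriched_dist z c s x \<omega> \<partial>M) = (\<integral>\<^sup>+\<omega>. ennreal (G.dist_e (h s) 0 x \<omega>) \<partial>M)"
    by (rule nn_integral_cong) (rule enriched_dist_eq[OF s c])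
  also have "\<dots> = ennreal (mean_e z c s x)" unfolding mean_e_def
    by (rule nn_integral_eq_integral[OF bdd_mble_integrable[OF G.bdd_dist_e[OF \<delta>h]]]) (auto simp: G.dist_e_nonneg)
  finally show ?thesis .
qed

lemma mean_convergence:
  assumes \<sigma>: "((\<lambda>s. f s / s) \<longlongrightarrow> \<sigma>) at_top" and c: "\<And>s v. 1 < s \<Longrightarrow> c s v \<in> grid_cube (side s) (z s) v"
  shows "((\<lambda>s. (\<integral>\<^sup>+\<omega>. enriched_dist (z s) (c s) s (s *\<^sub>R axis j 1) \<omega> \<partial>M) / ennreal s) \<longlongrightarrow> ennreal \<sigma>) at_top"
proof -
  obtain S where S: "2 \<le> S" "\<And>s. S \<le> s \<Longrightarrow> h s \<le> s" using ex_large by blast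
  let ?F = "\<lambda>s. mean_e (z s) (c s) s (s *\<^sub>R axis j 1)"
  have "((\<lambda>s. ?F s / s - f s / s) \<longlongrightarrow> 0) at_top"
  proof (rule Lim_null_comparison)
    show "((\<lambda>s. c0 / s) \<longlongrightarrow> 0) at_top" by real_asymp
    show "\<forall>\<^sub>F s in at_top. norm (?F s / s - f s / s) \<le> c0 / s"
      using eventually_ge_at_top[of S]
    proof eventually_elim
      case (elim s)
      have s: "1 < s" "h s \<le> s" using elim S by auto
      have "\<bar>?F s - f s\<bar> \<le> c0"
        using mean_dist_tau[OF s c[OF s(1)], of 0 "s *\<^sub>R axis j 1"] s by (simp add: mean_e_def f_def)
      then have "\<bar>?F s - f s\<bar> / s \<le> c0 / s" using s by (intro divide_right_mono) auto
      then show ?case using s by (simp flip: diff_divide_distrib)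
    qed
  qed
  from tendsto_add[OF this \<sigma>] have "((\<lambda>s. ?F s / s) \<longlongrightarrow> \<sigma>) at_top" by simp
  then have "((\<lambda>s. ennreal (?F s / s)) \<longlongrightarrow> ennreal \<sigma>) at_top" by (rule tendsto_ennrealI)
  then show ?thesis
  proof (rule Lim_transform_eventually)
    show "\<forall>\<^sub>F s in at_top. ennreal (?F s / s) =
        (\<integral>\<^sup>+\<omega>. enriched_dist (z s) (c s) s (s *\<^sub>R axis j 1) \<omega> \<partial>M) / ennreal s"
      using eventually_gt_at_top[of 1]
    proof eventually_elim
      case (elim s)
      interpret G: poisson_grid "side s" "z s" M X "c s" by (rule grid[OF elim c[OF elim]])
      have "0 \<le> ?F s" unfolding mean_e_def by (rule integral_nonneg_AE) (auto simp: G.dist_e_nonneg)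
      then show ?case using elim mean_enriched_dist[of s "c s" "z s"] c by (simp add: divide_ennreal)
    qed
  qed
qed

lemma concentration:
  assumes s: "1 < s0" "s0 \<le> s" and c: "\<And>v. c v \<in> grid_cube (side s) z v" and t: "h s \<le> t" and l: "0 \<le> l"
  shows "measure M {\<omega> \<in> space M.
      ereal (l * sqrt (ln s powr (2 / real CARD('n)) / h s * t))
      < \<bar>enn2ereal (enriched_dist z c s (t *\<^sub>R axis j 1) \<omega>) -
         enn2ereal (\<integral>\<^sup>+\<omega>. enriched_dist z c s (t *\<^sub>R axis j 1) \<omega> \<partial>M)\<bar>}
    \<le> 2 * exp 3 * exp (- (1 / gam s0) * l)"
proof -
  have s1: "1 < s" using s by simp
  interpret G: poisson_grid "side s" z M X c by (rule grid[OF s1 c])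
  have GC: "G.C = Cd" by (simp add: G.C_def Cd_def dim_const_def)
  have G\<delta>: "G.\<delta> = \<delta>s s" by (simp add: G.\<delta>_def GC \<delta>s_eq)
  have \<delta>h: "G.\<delta> \<le> h s" using h_ge[OF s1] by (simp add: G\<delta>)
  have h2: "2 \<le> h s" by (rule h_ge_2[OF s1])
  let ?x = "t *\<^sub>R axis j 1 :: real ^ 'n"
  let ?D = "G.dist_e (h s) 0 ?x"
  let ?Q = "sqrt (ln s powr (2 / real CARD('n)) / h s * t)"
  have n: "norm (0 - ?x) = t" using t h2 by simp
  define l' where "l' = l / gam s0"
  have l': "0 \<le> l'" "l = l' * gam s0" using l gam_pos[OF s(1)] by (auto simp: l'_def)
  have vf: "G.vf (h s) t = kap * (\<delta>s s)\<^sup>2 * t / h s" by (simp add: G.vf_def kap_def GC G\<delta>)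
  have "sqrt (G.vf (h s) t) \<le> gam s0 * ?Q"
    unfolding vf using t h2 by (intro sqrt_variance_le[OF s]) auto
  then have le: "l' * sqrt (G.vf (h s) t) \<le> l * ?Q"
    using l' mult_left_mono[of "sqrt (G.vf (h s) t)" "gam s0 * ?Q" l'] by (simp add: mult.assoc)
  have F0: "0 \<le> mean_e z c s ?x" unfolding mean_e_def by (rule integral_nonneg_AE) (auto simp: G.dist_e_nonneg)
  have "measure M {\<omega> \<in> space M. ereal (l * ?Q) < \<bar>enn2ereal (enriched_dist z c s ?x \<omega>) -
      enn2ereal (\<integral>\<^sup>+\<omega>. enriched_dist z c s ?x \<omega> \<partial>M)\<bar>}
    = measure M {\<omega> \<in> space M. l * ?Q < \<bar>?D \<omega> - mean_e z c s ?x\<bar>}"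
    using F0 G.dist_e_nonneg[of "h s" 0 ?x]
    by (intro arg_cong[where f = "measure M"] Collect_cong conj_cong refl)
      (simp add: enriched_dist_eq[OF s1 c] mean_enriched_dist[OF s1 c] enn2ereal_ennreal)
  also have "\<dots> \<le> measure M {\<omega> \<in> space M. l' * sqrt (G.vf (h s) t) \<le> \<bar>?D \<omega> - mean_e z c s ?x\<bar>}"
    using le by (intro finite_measure_mono) auto
  also have "\<dots> \<le> 2 * exp (3 - l')"
    using G.two_sided_tail[OF \<delta>h, of 0 ?x l'] t l' unfolding n mean_e_def by simp
  also have "\<dots> = 2 * exp 3 * exp (- (1 / gam s0) * l)" by (simp add: l'_def exp_diff exp_minus divide_inverse)
  finally show ?thesis .
qed

lemma ratio_convergence:
  fixes j :: 'n
  assumes s: "1 < s0" "s0 \<le> s" "h s \<le> s" and c: "\<And>v. c v \<in> grid_cube (side s) z v"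
    and l: "2 * sqrt ((real CARD('n) + 1) * ln (10 * s)) * gam s0 \<le> C * ln s" and C1: "c3 \<le> C1"
  shows "\<bar>enn2ereal ((\<integral>\<^sup>+\<omega>. enriched_dist z c s (s *\<^sub>R axis j 1) \<omega> \<partial>M) /
      (\<integral>\<^sup>+\<omega>. enriched_dist z c s ((2 * s) *\<^sub>R axis j 1) \<omega> \<partial>M)) - ereal (1 / 2)\<bar>
    \<le> ereal (C1 * (h s / s) + C * (sqrt (ln s powr (2 / real CARD('n)) / h s) * (ln s / sqrt s)))"
proof -
  have s1: "1 < s" using s by simp
  interpret G: poisson_grid "side s" z M X c by (rule grid[OF s1 c])
  have h2: "2 \<le> h s" by (rule h_ge_2[OF s1])
  define F where "F = mean_e z c s (s *\<^sub>R axis j 1)"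
  define G where "G = mean_e z c s ((2 * s) *\<^sub>R axis j 1)"
  define L where "L = 2 * sqrt ((real CARD('n) + 1) * ln (10 * s))"
  let ?q = "sqrt (ln s powr (2 / real CARD('n)) / h s)"
  have L0: "0 \<le> L" using s1 by (simp add: L_def)
  have b: "\<bar>2 * F - G\<bar> \<le> c3 * h s + 2 * L * sqrt (kap * (\<delta>s s)\<^sup>2 * s / h s)" and Gs: "s \<le> G"
    unfolding F_def G_def L_def mean_e_def by (rule ratio_bound[OF s1 s(3) c])+
  have G0: "0 < G" using Gs s1 by simp
  have F0: "0 \<le> F" unfolding F_def mean_e_def by (rule integral_nonneg_AE) (auto simp: G.dist_e_nonneg)
  have "2 * L * sqrt (kap * (\<delta>s s)\<^sup>2 * s / h s) \<le> 2 * L * (gam s0 * (?q * sqrt s))"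
  proof (rule mult_left_mono)
    show "sqrt (kap * (\<delta>s s)\<^sup>2 * s / h s) \<le> gam s0 * (?q * sqrt s)"
      using sqrt_variance_le[OF s(1,2), of "h s" s] h2 s1 by (simp only: real_sqrt_mult[symmetric])
  qed (use L0 in simp)
  also have "\<dots> = 2 * (L * gam s0) * (?q * sqrt s)" by simp
  also have "\<dots> \<le> 2 * (C * ln s) * (?q * sqrt s)"
    using l h2 s1 unfolding L_def by (intro mult_right_mono mult_left_mono) auto
  finally have b2: "\<bar>2 * F - G\<bar> \<le> c3 * h s + 2 * (C * ln s) * (?q * sqrt s)" using b by linarith
  have "\<bar>F / G - 1 / 2\<bar> = \<bar>2 * F - G\<bar> / (2 * G)"
  proof -
    have "F / G - 1 / 2 = (2 * F - G) / (2 * G)" using G0 by (simp add: field_simps)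
    then show ?thesis using G0 by (simp add: abs_divide)
  qed
  also have "\<dots> \<le> \<bar>2 * F - G\<bar> / (2 * s)" using Gs s1 by (intro divide_left_mono) auto
  also have "\<dots> \<le> (c3 * h s + 2 * (C * ln s) * (?q * sqrt s)) / (2 * s)"
    using b2 s1 by (intro divide_right_mono) auto
  also have "\<dots> = c3 / 2 * (h s / s) + C * (?q * (ln s * (sqrt s / s)))"
    using s1 by (simp add: field_simps)
  also have "sqrt s / s = 1 / sqrt s" using s1 by (simp add: real_div_sqrt field_simps)
  also have "c3 / 2 * (h s / s) \<le> C1 * (h s / s)"
    using C1 c3_pos h2 s1 by (intro mult_right_mono) auto
  finally have main: "\<bar>F / G - 1 / 2\<bar> \<le> C1 * (h s / s) + C * (?q * (ln s / sqrt s))" by simp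
  have "enn2ereal (ennreal F / ennreal G) = ereal (F / G)"
    using F0 G0 by (simp add: divide_ennreal enn2ereal_ennreal)
  then show ?thesis
    using main unfolding mean_enriched_dist[OF s1 c] F_def[symmetric] G_def[symmetric] by simp
qed

end

theorem theorem2p1:
  fixes C' k s0 :: real
  defines "d \<equiv> CARD('n::finite)"
  defines "\<delta> \<equiv> delta_scale d C' k"
  assumes "C' \<ge> dim_const d + 3 / 2" and "k > real d + 1" and "s0 > 1"
  shows "\<exists>C1>0. \<exists>C2>0. \<forall>h :: real \<Rightarrow> real.
    mono_on {1<..} h \<and> (\<forall>s>1. \<delta> s \<le> h s) \<and> ((\<lambda>s. h s / s) \<longlongrightarrow> 0) at_top \<longrightarrow>
    (\<exists>\<sigma> s1. 1 \<le> \<sigma> \<and> \<sigma> \<le> dim_const d \<and> 1 < s1 \<and>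
      (\<forall>(M :: 'a measure) (X :: 'a \<Rightarrow> (real ^ 'n) set) (j :: 'n)
        (z :: real \<Rightarrow> real ^ 'n) (c :: real \<Rightarrow> int ^ 'n \<Rightarrow> real ^ 'n).
        poisson_point_process M X \<and>
        (\<forall>s>1. \<forall>v. c s v \<in> grid_cube (\<delta> s / dim_const d) (z s) v) \<longrightarrow>
        (let e1 = axis j 1 :: real ^ 'n;
             Xs = (\<lambda>s \<omega>. enrich (\<delta> s / dim_const d) (z s) (c s) (X \<omega>));
             D = (\<lambda>s t \<omega>. h_dist (h s) (Xs s \<omega>) 0 (t *\<^sub>R e1));
             E = (\<lambda>s t. \<integral>\<^sup>+ \<omega>. D s t \<omega> \<partial>M)
         in
          ((\<lambda>s. E s s / ennreal s) \<longlongrightarrow> ennreal \<sigma>) at_top \<and>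
          (AE \<omega> in M. ((\<lambda>s. h_dist (h s) (X \<omega>) 0 (s *\<^sub>R e1) / ennreal s) \<longlongrightarrow> ennreal \<sigma>) at_top) \<and>
          (\<forall>s\<ge>s0. \<forall>t\<ge>h s. \<forall>l\<ge>0.
            measure M {\<omega> \<in> space M.
              \<bar>enn2ereal (D s t \<omega>) - enn2ereal (E s t)\<bar>
                > ereal (l * sqrt (ln s powr (2 / real d) / h s * t))}
            \<le> C1 * exp (- C2 * l)) \<and>
          (\<forall>s\<ge>s1.
            \<bar>enn2ereal (E s s / E s (2 * s)) - ereal (1 / 2)\<bar>
            \<le> ereal (C1 * (h s / s)
                + C2 * (sqrt (ln s powr (2 / real d) / h s) * (ln s / sqrt s)))))))"
proof -
  interpret S: scales C' k "CARD('n)"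
    using assms by unfold_locales (auto simp: d_def Suc_le_eq)
  have side: "\<delta> s / dim_const d = S.side s" for s
    by (simp add: \<delta>_def d_def S.side_def S.\<delta>s_def S.Cd_def)
  \<comment> \<open>\<open>C1\<close> has to serve both the tail bound and the ratio, while
    \<open>C2\<close> is the rate from the concentration bound.\<close>
  define C1 where "C1 = max (2 * exp 3) S.c3"
  define C2 where "C2 = 1 / S.gam s0"
  have C: "0 < C1" "0 < C2" using S.gam_pos[OF assms(5)] by (auto simp: C1_def C2_def less_max_iff_disj)
  show ?thesis
  proof (rule exI[of _ C1], rule conjI[OF C(1)], rule exI[of _ C2], rule conjI[OF C(2)], intro allI impI)
    fix h :: "real \<Rightarrow> real"
    assume "mono_on {1<..} h \<and> (\<forall>s>1. \<delta> s \<le> h s) \<and> ((\<lambda>s. h s / s) \<longlongrightarrow> 0) at_top"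
    then have h: "mono_on {1<..} h" "\<And>s. 1 < s \<Longrightarrow> S.\<delta>s s \<le> h s" "((\<lambda>s. h s / s) \<longlongrightarrow> 0) at_top"
      by (auto simp: \<delta>_def d_def S.\<delta>s_def)
    have fpp: "fpp C' k M X h" if "poisson M X" for M :: "'a measure" and X :: "'a \<Rightarrow> (real ^ 'n) set"
    proof -
      interpret poisson M X by fact
      show ?thesis using h by unfold_locales
    qed
    \<comment> \<open>The function \<open>f\<close> of the locale \<open>fpp\<close> with the
      process as an argument, because \<open>\<sigma>\<close> has to be chosen before the
      process.\<close>
    define \<phi> where "\<phi> M X s = (\<integral>\<omega>. trunc_dist (h s) (S.ells s s) (X \<omega>) 0 (s *\<^sub>R axis undefined 1) \<partial>M)"
      for M :: "'a measure" and X :: "'a \<Rightarrow> (real ^ 'n) set" and s :: real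
    have "\<exists>\<sigma>. 1 \<le> \<sigma> \<and> \<sigma> \<le> S.Cd \<and> (\<forall>M X. poisson M X \<longrightarrow> ((\<lambda>s. \<phi> M X s / s) \<longlongrightarrow> \<sigma>) at_top)"
    \<comment> \<open>By uniqueness of the law, one process on the type \<open>'a\<close> determines
      the limit for all of them. If there is none, the value 1 serves.\<close>
    proof (cases "\<exists>(M :: 'a measure) (X :: 'a \<Rightarrow> (real ^ 'n) set). poisson M X")
      case True
      then obtain M0 :: "'a measure" and X0 :: "'a \<Rightarrow> (real ^ 'n) set" where P0: "poisson M0 X0" by blast
      interpret F: fpp C' k M0 X0 h by (rule fpp[OF P0])
      have "\<phi> M X s = F.f s" if "poisson M X" for M X s
        unfolding \<phi>_def F.f_def F.tau_def by (rule mean_trunc_dist_unique[OF that P0]) simp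
      then show ?thesis using F.time_constant by auto
    next
      case False
      then show ?thesis using S.Cd_ge by (intro exI[of _ 1]) auto
    qed
    then obtain \<sigma> where \<sigma>: "1 \<le> \<sigma>" "\<sigma> \<le> S.Cd"
      "\<And>M X. poisson M X \<Longrightarrow> ((\<lambda>s. \<phi> M X s / s) \<longlongrightarrow> \<sigma>) at_top" by blast
    have "\<forall>\<^sub>F s in at_top. h s / s < 1" using h(3) by (rule order_tendstoD(2)) simp
    then have "\<forall>\<^sub>F s in at_top. s0 \<le> s \<and> h s \<le> s \<and>
        2 * sqrt ((real CARD('n) + 1) * ln (10 * s)) * S.gam s0 \<le> C2 * ln s"
      using S.eventually_log_dominates[OF assms(5)] eventually_ge_at_top[of s0] eventually_gt_at_top[of 0]
      unfolding C2_def by eventually_elim (auto simp: divide_less_eq)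
    \<comment> \<open>This threshold depends on \<open>h\<close> and the constants, but not on the
      process or the grids.\<close>
    then obtain S where S: "\<And>s. S \<le> s \<Longrightarrow> s0 \<le> s \<and> h s \<le> s \<and>
        2 * sqrt ((real CARD('n) + 1) * ln (10 * s)) * S.gam s0 \<le> C2 * ln s"
      unfolding eventually_at_top_linorder by blast
    show "\<exists>\<sigma> s1. 1 \<le> \<sigma> \<and> \<sigma> \<le> dim_const d \<and> 1 < s1 \<and>
      (\<forall>(M :: 'a measure) (X :: 'a \<Rightarrow> (real ^ 'n) set) (j :: 'n)
        (z :: real \<Rightarrow> real ^ 'n) (c :: real \<Rightarrow> int ^ 'n \<Rightarrow> real ^ 'n).
        poisson_point_process M X \<and>
        (\<forall>s>1. \<forall>v. c s v \<in> grid_cube (\<delta> s / dim_const d) (z s) v) \<longrightarrow>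
        (let e1 = axis j 1 :: real ^ 'n;
             Xs = (\<lambda>s \<omega>. enrich (\<delta> s / dim_const d) (z s) (c s) (X \<omega>));
             D = (\<lambda>s t \<omega>. h_dist (h s) (Xs s \<omega>) 0 (t *\<^sub>R e1));
             E = (\<lambda>s t. \<integral>\<^sup>+ \<omega>. D s t \<omega> \<partial>M)
         in
          ((\<lambda>s. E s s / ennreal s) \<longlongrightarrow> ennreal \<sigma>) at_top \<and>
          (AE \<omega> in M. ((\<lambda>s. h_dist (h s) (X \<omega>) 0 (s *\<^sub>R e1) / ennreal s) \<longlongrightarrow> ennreal \<sigma>) at_top) \<and>
          (\<forall>s\<ge>s0. \<forall>t\<ge>h s. \<forall>l\<ge>0.
            measure M {\<omega> \<in> space M.
              \<bar>enn2ereal (D s t \<omega>) - enn2ereal (E s t)\<bar>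
                > ereal (l * sqrt (ln s powr (2 / real d) / h s * t))}
            \<le> C1 * exp (- C2 * l)) \<and>
          (\<forall>s\<ge>s1.
            \<bar>enn2ereal (E s s / E s (2 * s)) - ereal (1 / 2)\<bar>
            \<le> ereal (C1 * (h s / s)
                + C2 * (sqrt (ln s powr (2 / real d) / h s) * (ln s / sqrt s))))))"
      unfolding side unfolding Let_def d_def
    proof (rule exI[of _ \<sigma>], rule exI[of _ "max 2 S"], intro allI impI conjI; (elim conjE)?)
      fix M :: "'a measure" and X :: "'a \<Rightarrow> (real ^ 'n) set" and j :: 'n
        and z :: "real \<Rightarrow> real ^ 'n" and c :: "real \<Rightarrow> int ^ 'n \<Rightarrow> real ^ 'n"
      assume ppp: "poisson_point_process M X" and "\<forall>s>1. \<forall>v. c s v \<in> grid_cube (S.side s) (z s) v"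
      then have c: "\<And>s v. 1 < s \<Longrightarrow> c s v \<in> grid_cube (S.side s) (z s) v" by blast
      have P: "poisson M X" using ppp by unfold_locales
      interpret F: fpp C' k M X h by (rule fpp[OF P])
      have f: "((\<lambda>s. F.f s / s) \<longlongrightarrow> \<sigma>) at_top" using \<sigma>(3)[OF P] unfolding \<phi>_def F.f_def F.tau_def .
      note e = F.enriched_dist_def
      show "((\<lambda>s. (\<integral>\<^sup>+ \<omega>. h_dist (h s) (enrich (S.side s) (z s) (c s) (X \<omega>)) 0 (s *\<^sub>R axis j 1) \<partial>M) / ennreal s)
          \<longlongrightarrow> ennreal \<sigma>) at_top"
        by (rule F.mean_convergence[OF f, unfolded e]) (rule c)
      show "AE \<omega> in M. ((\<lambda>s. h_dist (h s) (X \<omega>) 0 (s *\<^sub>R axis j 1) / ennreal s) \<longlongrightarrow> ennreal \<sigma>) at_top"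
        by (rule F.AE_convergence[OF f])
      show "measure M {\<omega> \<in> space M.
          ereal (l * sqrt (ln s powr (2 / real CARD('n)) / h s * t))
          < \<bar>enn2ereal (h_dist (h s) (enrich (S.side s) (z s) (c s) (X \<omega>)) 0 (t *\<^sub>R axis j 1)) -
             enn2ereal (\<integral>\<^sup>+ \<omega>. h_dist (h s) (enrich (S.side s) (z s) (c s) (X \<omega>)) 0 (t *\<^sub>R axis j 1) \<partial>M)\<bar>}
        \<le> C1 * exp (- C2 * l)" if s: "s0 \<le> s" and t: "h s \<le> t" and l: "0 \<le> l" for s t l
      proof -
        have "1 < s" using s assms(5) by simp
        note F.concentration[where j = j, OF assms(5) s c[OF this] t l, unfolded e]
        also have "2 * exp 3 * exp (- (1 / S.gam s0) * l) \<le> C1 * exp (- C2 * l)"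
          unfolding C2_def by (intro mult_right_mono) (auto simp: C1_def)
        finally show ?thesis .
      qed
      show "\<bar>enn2ereal ((\<integral>\<^sup>+ \<omega>. h_dist (h s) (enrich (S.side s) (z s) (c s) (X \<omega>)) 0 (s *\<^sub>R axis j 1) \<partial>M) /
            (\<integral>\<^sup>+ \<omega>. h_dist (h s) (enrich (S.side s) (z s) (c s) (X \<omega>)) 0 ((2 * s) *\<^sub>R axis j 1) \<partial>M)) - ereal (1 / 2)\<bar>
        \<le> ereal (C1 * (h s / s) + C2 * (sqrt (ln s powr (2 / real CARD('n)) / h s) * (ln s / sqrt s)))"
        if "max 2 S \<le> s" for s
      proof -
        have s: "s0 \<le> s" "h s \<le> s" "2 * sqrt ((real CARD('n) + 1) * ln (10 * s)) * S.gam s0 \<le> C2 * ln s" "1 < s"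
          using S[of s] that by auto
        show ?thesis
          using F.ratio_convergence[where j = j, OF assms(5) s(1,2) c[OF s(4)] s(3), of C1]
          unfolding e by (simp add: C1_def)
      qed
    qed (use \<sigma> in \<open>auto simp: S.Cd_def\<close>)
  qed
qed

end
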